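(* Let $\mathcal{A}$ be an additive category. Under the isomorphism of categories $\Psi\colon G(\mathcal{A})\to C(\mathbb{Z}_+\mathcal{A})$, the exact structure $\mathcal{E}_\eta$ on $C(\mathbb{Z}_+\mathcal{A})$ gives a Frobenius exact structure on $G(\mathcal{A})$, and the corresponding stable category is a triangulated category.
   Context: The category $G(\mathcal{A})$ (Rickard): objects are systems $\{X^{**},d_n\colon n=0,1,\dots\}$, where $X^{**}$ is a bigraded object of $\mathcal{A}$ and $d_n$ is a graded endomorphism of $X^{**}$ of degree $(1-n,n)$, with $d_0d_n+d_1d_{n-1}+\cdots+d_nd_0=0$ for all $n\ge0$. A morphism $\{X^{**},d_{X,n}\}\to\{Y^{**},d_{Y,n}\}$ is a collection $\alpha=\{\alpha_n\colon n\ge0\}$ of graded maps with $\alpha_n$ of degree $(-n,n)$ and $\sum_{p+q=n}\alpha_pd_{X,q}=\sum_{p+q=n}d_{Y,p}\alpha_q$ for each $n$. Composition is $(\alpha\beta)_n=\sum_{p+q=n}\alpha_p\beta_q$. The category $\mathbb{Z}_+\mathcal{A}$: objects are $\mathbb{Z}$-graded objects $X^\bullet=(X^j)_{j\in\mathbb{Z}}$ of $\mathcal{A}$; a morphism $f\colon X^\bullet\to Y^\bullet$ is a collection $f=\{f_0,f_1,\dots\}$ with $f_n=(f_n^j\colon X^j\to Y^{j+n})_{j}$; composition is $(gf)_n^j=\sum_{k=0}^ng_{n-k}^{j+k}f_k^j$. The automorphism $(1)$ is $(X^\bullet(1))^j=X^{j+1}$, $(f(1))_n^j=f_n^{j+1}$,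 and $\eta\colon(1)\to\mathrm{Id}$ is $\eta_{X^\bullet}=\{0,\mathrm{Id},0,0,\dots\}\colon X^\bullet(1)\to X^\bullet$, where $\mathrm{Id}\colon(X^\bullet(1))^j\to X^{j+1}$ is the identity in $\mathcal{A}$. $C(\mathbb{Z}_+\mathcal{A})$ is the category of complexes in $\mathbb{Z}_+\mathcal{A}$; such a complex is a bigraded object $X^{\bullet\bullet}$ with maps $d_n^{ij}\colon X^{ij}\to X^{i+1,j+n}$ ($n\ge0$) satisfying $\sum_{p+q=n}d_pd_q=0$, and a morphism is a collection $f_n^{ij}\colon X^{ij}\to Y^{i,j+n}$ with $\sum_{p+q=n}f_pd_{X,q}=\sum_{p+q=n}d_{Y,p}f_q$. The isomorphism $\Psi$ is $(\Psi(X))^{ij}=X^{i-j,j}$, $d_{\Psi(X),n}^{ij}=d_n^{i-j,j}$, $(\Psi(\alpha))_n^{ij}=\alpha_n^{i-j,j}$. The functor $(1)$ and the transformation $\eta$ extend termwise to $C(\mathbb{Z}_+\mathcal{A})$. $\mathcal{E}_\eta$ is the class of kernel-cokernel pairs in $C(\mathbb{Z}_+\mathcal{A})$ isomorphic to $Y\xrightarrow{\binom01}\mathrm{Con}(f)\xrightarrow{(1\ 0)}X[1]$ for some chain map $f\colon X\to Y$ factoring through $\eta_Y\colon Y(1)\to Y$, where $(X[1])^n=X^{n+1}$, $d_{X[1]}^n=-d_X^{n+1}$, and $\mathrm{Con}(f)$ has terms $X^{n+1}\oplus Y^n$ and differential $\begin{pmatrix}-d_X^{n+1}&0\\ f^{n+1}&d_Y^n\end{pmatrix}$.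 A Frobenius exact structure on an additive category is an exact structure (Quillen/Keller) with enough projectives and enough injectives, for which projectives and injectives coincide; the stable category has the same objects, and morphisms modulo those factoring through an injective object. *)

theory Defs
  imports "HOL-Algebra.Coset" "HOL-Algebra.FiniteProduct"
begin

section \<open>Additive categories\<close>

text \<open>
  Each hom-group is a commutative group of \<open>HOL-Algebra\<close>. That library writes such groups
  multiplicatively, so in a hom-group \<open>\<otimes>\<close> is the addition of morphisms, \<open>\<one>\<close> is the zero morphism,
  \<open>inv\<close> is negation and \<open>finprod\<close> is a finite sum. Hom-groups need not be disjoint (a family of maps
  does not determine the complexes between which it is a chain map), so composition and the morphism
  part of a functor take the objects as arguments: \<open>Comp C X Y Z g f\<close> is the composite of
  \<open>f : X \<rightarrow> Y\<close> and \<open>g : Y \<rightarrow> Z\<close>.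
\<close>

record ('o, 'm) cat =
  Ob :: "'o set"
  Hom :: "'o \<Rightarrow> 'o \<Rightarrow> 'm monoid"
  Comp :: "'o \<Rightarrow> 'o \<Rightarrow> 'o \<Rightarrow> 'm \<Rightarrow> 'm \<Rightarrow> 'm"
  Idn :: "'o \<Rightarrow> 'm"

abbreviation mor :: "('o, 'm) cat \<Rightarrow> 'o \<Rightarrow> 'o \<Rightarrow> 'm set"
  where "mor C X Y \<equiv> carrier (Hom C X Y)"

abbreviation zmor :: "('o, 'm) cat \<Rightarrow> 'o \<Rightarrow> 'o \<Rightarrow> 'm"
  where "zmor C X Y \<equiv> \<one>\<^bsub>Hom C X Y\<^esub>"

abbreviation madd :: "('o, 'm) cat \<Rightarrow> 'o \<Rightarrow> 'o \<Rightarrow> 'm \<Rightarrow> 'm \<Rightarrow> 'm"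
  where "madd C X Y f g \<equiv> f \<otimes>\<^bsub>Hom C X Y\<^esub> g"

abbreviation mneg :: "('o, 'm) cat \<Rightarrow> 'o \<Rightarrow> 'o \<Rightarrow> 'm \<Rightarrow> 'm"
  where "mneg C X Y f \<equiv> inv\<^bsub>Hom C X Y\<^esub> f"

abbreviation msum :: "('o, 'm) cat \<Rightarrow> 'o \<Rightarrow> 'o \<Rightarrow> (nat \<Rightarrow> 'm) \<Rightarrow> nat set \<Rightarrow> 'm"
  where "msum C X Y f K \<equiv> finprod (Hom C X Y) f K"

locale preadditive_category =
  fixes C :: "('o, 'm) cat"
  assumes hom_group: "\<lbrakk>X \<in> Ob C; Y \<in> Ob C\<rbrakk> \<Longrightarrow> comm_group (Hom C X Y)"
    and id_mor: "X \<in> Ob C \<Longrightarrow> Idn C X \<in> mor C X X"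
    and comp_mor: "\<lbrakk>X \<in> Ob C; Y \<in> Ob C; Z \<in> Ob C; f \<in> mor C X Y; g \<in> mor C Y Z\<rbrakk>
      \<Longrightarrow> Comp C X Y Z g f \<in> mor C X Z"
    and comp_id_right: "\<lbrakk>X \<in> Ob C; Y \<in> Ob C; f \<in> mor C X Y\<rbrakk> \<Longrightarrow> Comp C X X Y f (Idn C X) = f"
    and comp_id_left: "\<lbrakk>X \<in> Ob C; Y \<in> Ob C; f \<in> mor C X Y\<rbrakk> \<Longrightarrow> Comp C X Y Y (Idn C Y) f = f"
    and comp_assoc: "\<lbrakk>W \<in> Ob C; X \<in> Ob C; Y \<in> Ob C; Z \<in> Ob C;
        f \<in> mor C W X; g \<in> mor C X Y; h \<in> mor C Y Z\<rbrakk>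
      \<Longrightarrow> Comp C W Y Z h (Comp C W X Y g f) = Comp C W X Z (Comp C X Y Z h g) f"
    and comp_add_right: "\<lbrakk>X \<in> Ob C; Y \<in> Ob C; Z \<in> Ob C; f \<in> mor C X Y; f' \<in> mor C X Y; g \<in> mor C Y Z\<rbrakk>
      \<Longrightarrow> Comp C X Y Z g (madd C X Y f f') = madd C X Z (Comp C X Y Z g f) (Comp C X Y Z g f')"
    and comp_add_left: "\<lbrakk>X \<in> Ob C; Y \<in> Ob C; Z \<in> Ob C; f \<in> mor C X Y; g \<in> mor C Y Z; g' \<in> mor C Y Z\<rbrakk>
      \<Longrightarrow> Comp C X Y Z (madd C Y Z g g') f = madd C X Z (Comp C X Y Z g f) (Comp C X Y Z g' f)"

definition is_zero_object :: "('o, 'm) cat \<Rightarrow> 'o \<Rightarrow> bool" where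
  "is_zero_object C N \<longleftrightarrow> N \<in> Ob C \<and>
     (\<forall>X\<in>Ob C. (\<exists>!f. f \<in> mor C X N) \<and> (\<exists>!f. f \<in> mor C N X))"

definition is_biproduct :: "('o, 'm) cat \<Rightarrow> 'o \<Rightarrow> 'o \<Rightarrow> 'o \<Rightarrow> 'm \<Rightarrow> 'm \<Rightarrow> 'm \<Rightarrow> 'm \<Rightarrow> bool" where
  "is_biproduct C X Y B i1 i2 p1 p2 \<longleftrightarrow>
     X \<in> Ob C \<and> Y \<in> Ob C \<and> B \<in> Ob C \<and>
     i1 \<in> mor C X B \<and> i2 \<in> mor C Y B \<and> p1 \<in> mor C B X \<and> p2 \<in> mor C B Y \<and>
     Comp C X B X p1 i1 = Idn C X \<and> Comp C Y B Y p2 i2 = Idn C Y \<and>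
     Comp C Y B X p1 i2 = zmor C Y X \<and> Comp C X B Y p2 i1 = zmor C X Y \<and>
     madd C B B (Comp C B X B i1 p1) (Comp C B Y B i2 p2) = Idn C B"

locale additive_category = preadditive_category C for C :: "('o, 'm) cat" +
  assumes ex_zero_object: "\<exists>N. is_zero_object C N"
    and ex_biproduct: "\<lbrakk>X \<in> Ob C; Y \<in> Ob C\<rbrakk> \<Longrightarrow> \<exists>B i1 i2 p1 p2. is_biproduct C X Y B i1 i2 p1 p2"

definition is_iso :: "('o, 'm) cat \<Rightarrow> 'o \<Rightarrow> 'o \<Rightarrow> 'm \<Rightarrow> bool" where
  "is_iso C X Y f \<longleftrightarrow> X \<in> Ob C \<and> Y \<in> Ob C \<and> f \<in> mor C X Y \<and>
     (\<exists>g\<in>mor C Y X. Comp C X Y X g f = Idn C X \<and> Comp C Y X Y f g = Idn C Y)"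


section \<open>Functors\<close>

locale category_functor =
  fixes C :: "('o, 'm) cat" and D :: "('p, 'n) cat"
    and Fo :: "'o \<Rightarrow> 'p" and Fm :: "'o \<Rightarrow> 'o \<Rightarrow> 'm \<Rightarrow> 'n"
  assumes functor_ob: "X \<in> Ob C \<Longrightarrow> Fo X \<in> Ob D"
    and functor_mor: "\<lbrakk>X \<in> Ob C; Y \<in> Ob C; f \<in> mor C X Y\<rbrakk> \<Longrightarrow> Fm X Y f \<in> mor D (Fo X) (Fo Y)"
    and functor_id: "X \<in> Ob C \<Longrightarrow> Fm X X (Idn C X) = Idn D (Fo X)"
    and functor_comp: "\<lbrakk>X \<in> Ob C; Y \<in> Ob C; Z \<in> Ob C; f \<in> mor C X Y; g \<in> mor C Y Z\<rbrakk>
      \<Longrightarrow> Fm X Z (Comp C X Y Z g f) = Comp D (Fo X) (Fo Y) (Fo Z) (Fm Y Z g) (Fm X Y f)"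

locale additive_functor = category_functor C D Fo Fm
  for C :: "('o, 'm) cat" and D :: "('p, 'n) cat" and Fo Fm +
  assumes functor_add: "\<lbrakk>X \<in> Ob C; Y \<in> Ob C; f \<in> mor C X Y; g \<in> mor C X Y\<rbrakk>
      \<Longrightarrow> Fm X Y (madd C X Y f g) = madd D (Fo X) (Fo Y) (Fm X Y f) (Fm X Y g)"

definition category_isomorphism ::
    "('o, 'm) cat \<Rightarrow> ('p, 'n) cat \<Rightarrow> ('o \<Rightarrow> 'p) \<Rightarrow> ('o \<Rightarrow> 'o \<Rightarrow> 'm \<Rightarrow> 'n) \<Rightarrow> bool" where
  "category_isomorphism C D Fo Fm \<longleftrightarrow> additive_functor C D Fo Fm \<and>
     (\<exists>Go Gm. additive_functor D C Go Gm \<and>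
        (\<forall>X\<in>Ob C. Go (Fo X) = X) \<and> (\<forall>X\<in>Ob D. Fo (Go X) = X) \<and>
        (\<forall>X\<in>Ob C. \<forall>Y\<in>Ob C. \<forall>f\<in>mor C X Y. Gm (Fo X) (Fo Y) (Fm X Y f) = f) \<and>
        (\<forall>X\<in>Ob D. \<forall>Y\<in>Ob D. \<forall>f\<in>mor D X Y. Fm (Go X) (Go Y) (Gm X Y f) = f))"

definition iso_to_identity ::
    "('o, 'm) cat \<Rightarrow> ('o \<Rightarrow> 'o) \<Rightarrow> ('o \<Rightarrow> 'o \<Rightarrow> 'm \<Rightarrow> 'm) \<Rightarrow> bool" where
  "iso_to_identity C Ho Hm \<longleftrightarrow>
     (\<exists>\<tau>. (\<forall>X\<in>Ob C. is_iso C (Ho X) X (\<tau> X)) \<and>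
        (\<forall>X\<in>Ob C. \<forall>Y\<in>Ob C. \<forall>f\<in>mor C X Y.
           Comp C (Ho X) X Y f (\<tau> X) = Comp C (Ho X) (Ho Y) Y (\<tau> Y) (Hm X Y f)))"

definition additive_autoequivalence ::
    "('o, 'm) cat \<Rightarrow> ('o \<Rightarrow> 'o) \<Rightarrow> ('o \<Rightarrow> 'o \<Rightarrow> 'm \<Rightarrow> 'm) \<Rightarrow> bool" where
  "additive_autoequivalence C Fo Fm \<longleftrightarrow> additive_functor C C Fo Fm \<and>
     (\<exists>Go Gm. category_functor C C Go Gm \<and>
        iso_to_identity C (\<lambda>X. Go (Fo X)) (\<lambda>X Y f. Gm (Fo X) (Fo Y) (Fm X Y f)) \<and>
        iso_to_identity C (\<lambda>X. Fo (Go X)) (\<lambda>X Y f. Fm (Go X) (Go Y) (Gm X Y f)))"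


section \<open>Exact and Frobenius structures\<close>

text \<open>A tuple \<open>(X, i, Y, p, Z)\<close> stands for the pair of morphisms \<open>i : X \<rightarrow> Y\<close>, \<open>p : Y \<rightarrow> Z\<close>.\<close>

type_synonym ('o, 'm) seq = "'o \<times> 'm \<times> 'o \<times> 'm \<times> 'o"

definition is_kernel :: "('o, 'm) cat \<Rightarrow> 'o \<Rightarrow> 'o \<Rightarrow> 'o \<Rightarrow> 'm \<Rightarrow> 'm \<Rightarrow> bool" where
  "is_kernel C X Y Z i p \<longleftrightarrow> Comp C X Y Z p i = zmor C X Z \<and>
     (\<forall>W\<in>Ob C. \<forall>h\<in>mor C W Y. Comp C W Y Z p h = zmor C W Z \<longrightarrow>
        (\<exists>!u. u \<in> mor C W X \<and> Comp C W X Y i u = h))"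

definition is_cokernel :: "('o, 'm) cat \<Rightarrow> 'o \<Rightarrow> 'o \<Rightarrow> 'o \<Rightarrow> 'm \<Rightarrow> 'm \<Rightarrow> bool" where
  "is_cokernel C X Y Z i p \<longleftrightarrow> Comp C X Y Z p i = zmor C X Z \<and>
     (\<forall>W\<in>Ob C. \<forall>h\<in>mor C Y W. Comp C X Y W h i = zmor C X W \<longrightarrow>
        (\<exists>!u. u \<in> mor C Z W \<and> Comp C Y Z W u p = h))"

definition kernel_cokernel_pairs :: "('o, 'm) cat \<Rightarrow> ('o, 'm) seq set" where
  "kernel_cokernel_pairs C = {(X, i, Y, p, Z).
     X \<in> Ob C \<and> Y \<in> Ob C \<and> Z \<in> Ob C \<and> i \<in> mor C X Y \<and> p \<in> mor C Y Z \<and>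
     is_kernel C X Y Z i p \<and> is_cokernel C X Y Z i p}"

definition seq_iso :: "('o, 'm) cat \<Rightarrow> ('o, 'm) seq \<Rightarrow> ('o, 'm) seq \<Rightarrow> bool" where
  "seq_iso C = (\<lambda>(X, i, Y, p, Z) (X', i', Y', p', Z').
     \<exists>a b c. is_iso C X X' a \<and> is_iso C Y Y' b \<and> is_iso C Z Z' c \<and>
       Comp C X Y Y' b i = Comp C X X' Y' i' a \<and>
       Comp C Y Z Z' c p = Comp C Y Y' Z' p' b)"

definition inflation :: "('o, 'm) seq set \<Rightarrow> 'o \<Rightarrow> 'o \<Rightarrow> 'm \<Rightarrow> bool" where
  "inflation E X Y i \<longleftrightarrow> (\<exists>p Z. (X, i, Y, p, Z) \<in> E)"

definition deflation :: "('o, 'm) seq set \<Rightarrow> 'o \<Rightarrow> 'o \<Rightarrow> 'm \<Rightarrow> bool" where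
  "deflation E Y Z p \<longleftrightarrow> (\<exists>i X. (X, i, Y, p, Z) \<in> E)"

text \<open>The pushout square on \<open>i : X \<rightarrow> Y\<close> and \<open>f : X \<rightarrow> X'\<close> has corner \<open>P\<close> and legs \<open>f' : Y \<rightarrow> P\<close>,
  \<open>i' : X' \<rightarrow> P\<close>. The pullback square on \<open>p : Y \<rightarrow> Z\<close> and \<open>f : Z' \<rightarrow> Z\<close> has corner \<open>P\<close> and legs
  \<open>f' : P \<rightarrow> Y\<close>, \<open>p' : P \<rightarrow> Z'\<close>.\<close>

definition is_pushout ::
    "('o, 'm) cat \<Rightarrow> 'o \<Rightarrow> 'o \<Rightarrow> 'o \<Rightarrow> 'o \<Rightarrow> 'm \<Rightarrow> 'm \<Rightarrow> 'm \<Rightarrow> 'm \<Rightarrow> bool" where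
  "is_pushout C X Y X' P i f f' i' \<longleftrightarrow>
     P \<in> Ob C \<and> f' \<in> mor C Y P \<and> i' \<in> mor C X' P \<and> Comp C X Y P f' i = Comp C X X' P i' f \<and>
     (\<forall>W\<in>Ob C. \<forall>a\<in>mor C Y W. \<forall>b\<in>mor C X' W. Comp C X Y W a i = Comp C X X' W b f \<longrightarrow>
        (\<exists>!u. u \<in> mor C P W \<and> Comp C Y P W u f' = a \<and> Comp C X' P W u i' = b))"

definition is_pullback ::
    "('o, 'm) cat \<Rightarrow> 'o \<Rightarrow> 'o \<Rightarrow> 'o \<Rightarrow> 'o \<Rightarrow> 'm \<Rightarrow> 'm \<Rightarrow> 'm \<Rightarrow> 'm \<Rightarrow> bool" where
  "is_pullback C Y Z Z' P p f f' p' \<longleftrightarrow>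
     P \<in> Ob C \<and> f' \<in> mor C P Y \<and> p' \<in> mor C P Z' \<and> Comp C P Y Z p f' = Comp C P Z' Z f p' \<and>
     (\<forall>W\<in>Ob C. \<forall>a\<in>mor C W Y. \<forall>b\<in>mor C W Z'. Comp C W Y Z p a = Comp C W Z' Z f b \<longrightarrow>
        (\<exists>!u. u \<in> mor C W P \<and> Comp C W P Y f' u = a \<and> Comp C W P Z' p' u = b))"

locale exact_structure = additive_category C
  for C :: "('o, 'm) cat" and E :: "('o, 'm) seq set" +
  assumes conflation_kernel_cokernel: "E \<subseteq> kernel_cokernel_pairs C"
    and conflation_iso: "\<lbrakk>s \<in> E; t \<in> kernel_cokernel_pairs C; seq_iso C s t\<rbrakk> \<Longrightarrow> t \<in> E"
    and inflation_id: "X \<in> Ob C \<Longrightarrow> inflation E X X (Idn C X)"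
    and deflation_id: "X \<in> Ob C \<Longrightarrow> deflation E X X (Idn C X)"
    and inflation_comp: "\<lbrakk>inflation E X Y i; inflation E Y Z j\<rbrakk> \<Longrightarrow> inflation E X Z (Comp C X Y Z j i)"
    and deflation_comp: "\<lbrakk>deflation E X Y p; deflation E Y Z q\<rbrakk> \<Longrightarrow> deflation E X Z (Comp C X Y Z q p)"
    and inflation_pushout: "\<lbrakk>inflation E X Y i; X' \<in> Ob C; f \<in> mor C X X'\<rbrakk>
      \<Longrightarrow> \<exists>P f' i'. is_pushout C X Y X' P i f f' i' \<and> inflation E X' P i'"
    and deflation_pullback: "\<lbrakk>deflation E Y Z p; Z' \<in> Ob C; f \<in> mor C Z' Z\<rbrakk>
      \<Longrightarrow> \<exists>P f' p'. is_pullback C Y Z Z' P p f f' p' \<and> deflation E P Z' p'"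

definition injective_object :: "('o, 'm) cat \<Rightarrow> ('o, 'm) seq set \<Rightarrow> 'o \<Rightarrow> bool" where
  "injective_object C E J \<longleftrightarrow> J \<in> Ob C \<and>
     (\<forall>X Y i. inflation E X Y i \<longrightarrow> (\<forall>f\<in>mor C X J. \<exists>g\<in>mor C Y J. Comp C X Y J g i = f))"

definition projective_object :: "('o, 'm) cat \<Rightarrow> ('o, 'm) seq set \<Rightarrow> 'o \<Rightarrow> bool" where
  "projective_object C E P \<longleftrightarrow> P \<in> Ob C \<and>
     (\<forall>Y Z p. deflation E Y Z p \<longrightarrow> (\<forall>f\<in>mor C P Z. \<exists>g\<in>mor C P Y. Comp C P Y Z p g = f))"

locale frobenius_exact_structure = exact_structure C E
  for C :: "('o, 'm) cat" and E :: "('o, 'm) seq set" +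
  assumes enough_injectives: "X \<in> Ob C \<Longrightarrow> \<exists>J i. injective_object C E J \<and> inflation E X J i"
    and enough_projectives: "X \<in> Ob C \<Longrightarrow> \<exists>P p. projective_object C E P \<and> deflation E P X p"
    and projective_iff_injective: "projective_object C E X \<longleftrightarrow> injective_object C E X"


section \<open>Triangulated categories\<close>

text \<open>A tuple \<open>(X, Y, Z, u, v, w)\<close> stands for the triangle
  \<open>u : X \<rightarrow> Y\<close>, \<open>v : Y \<rightarrow> Z\<close>, \<open>w : Z \<rightarrow> So X\<close>, where \<open>(So, Sm)\<close> is the shift functor.\<close>

type_synonym ('o, 'm) triangle = "'o \<times> 'o \<times> 'o \<times> 'm \<times> 'm \<times> 'm"

definition triangles :: "('o, 'm) cat \<Rightarrow> ('o \<Rightarrow> 'o) \<Rightarrow> ('o, 'm) triangle set" where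
  "triangles T So = {(X, Y, Z, u, v, w). X \<in> Ob T \<and> Y \<in> Ob T \<and> Z \<in> Ob T \<and>
     u \<in> mor T X Y \<and> v \<in> mor T Y Z \<and> w \<in> mor T Z (So X)}"

definition triangle_mor :: "('o, 'm) cat \<Rightarrow> ('o \<Rightarrow> 'o) \<Rightarrow> ('o \<Rightarrow> 'o \<Rightarrow> 'm \<Rightarrow> 'm) \<Rightarrow>
    ('o, 'm) triangle \<Rightarrow> ('o, 'm) triangle \<Rightarrow> 'm \<Rightarrow> 'm \<Rightarrow> 'm \<Rightarrow> bool" where
  "triangle_mor T So Sm = (\<lambda>(X, Y, Z, u, v, w) (X', Y', Z', u', v', w') f g h.
     f \<in> mor T X X' \<and> g \<in> mor T Y Y' \<and> h \<in> mor T Z Z' \<and>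
     Comp T X Y Y' g u = Comp T X X' Y' u' f \<and>
     Comp T Y Z Z' h v = Comp T Y Y' Z' v' g \<and>
     Comp T Z (So X) (So X') (Sm X X' f) w = Comp T Z Z' (So X') w' h)"

definition triangle_iso :: "('o, 'm) cat \<Rightarrow> ('o \<Rightarrow> 'o) \<Rightarrow> ('o \<Rightarrow> 'o \<Rightarrow> 'm \<Rightarrow> 'm) \<Rightarrow>
    ('o, 'm) triangle \<Rightarrow> ('o, 'm) triangle \<Rightarrow> bool" where
  "triangle_iso T So Sm = (\<lambda>(X, Y, Z, u, v, w) (X', Y', Z', u', v', w').
     \<exists>f g h. is_iso T X X' f \<and> is_iso T Y Y' g \<and> is_iso T Z Z' h \<and>
       triangle_mor T So Sm (X, Y, Z, u, v, w) (X', Y', Z', u', v', w') f g h)"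

locale triangulated_category = additive_category T
  for T :: "('o, 'm) cat" and So :: "'o \<Rightarrow> 'o" and Sm :: "'o \<Rightarrow> 'o \<Rightarrow> 'm \<Rightarrow> 'm"
    and \<Delta> :: "('o, 'm) triangle set" +
  assumes shift_autoequivalence: "additive_autoequivalence T So Sm"
    and dist_triangles: "\<Delta> \<subseteq> triangles T So"
    and TR1_iso: "\<lbrakk>s \<in> \<Delta>; t \<in> triangles T So; triangle_iso T So Sm s t\<rbrakk> \<Longrightarrow> t \<in> \<Delta>"
    and TR1_id: "\<lbrakk>X \<in> Ob T; is_zero_object T N\<rbrakk>
      \<Longrightarrow> (X, X, N, Idn T X, zmor T X N, zmor T N (So X)) \<in> \<Delta>"
    and TR1_ex: "\<lbrakk>X \<in> Ob T; Y \<in> Ob T; u \<in> mor T X Y\<rbrakk> \<Longrightarrow> \<exists>Z v w. (X, Y, Z, u, v, w) \<in> \<Delta>"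
    and TR2: "(X, Y, Z, u, v, w) \<in> triangles T So
      \<Longrightarrow> (X, Y, Z, u, v, w) \<in> \<Delta> \<longleftrightarrow> (Y, Z, So X, v, w, mneg T (So X) (So Y) (Sm X Y u)) \<in> \<Delta>"
    and TR3: "\<lbrakk>(X, Y, Z, u, v, w) \<in> \<Delta>; (X', Y', Z', u', v', w') \<in> \<Delta>;
        f \<in> mor T X X'; g \<in> mor T Y Y'; Comp T X Y Y' g u = Comp T X X' Y' u' f\<rbrakk>
      \<Longrightarrow> \<exists>h. triangle_mor T So Sm (X, Y, Z, u, v, w) (X', Y', Z', u', v', w') f g h"
    and TR4: "\<lbrakk>(X, Y, Z', u, i, i') \<in> \<Delta>; (Y, Z, X', v, j, j') \<in> \<Delta>;
        (X, Z, Y', Comp T X Y Z v u, k, k') \<in> \<Delta>\<rbrakk>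
      \<Longrightarrow> \<exists>f g. (Z', Y', X', f, g, Comp T X' (So Y) (So Z') (Sm Y Z' i) j') \<in> \<Delta> \<and>
            Comp T Y Z' Y' f i = Comp T Y Z Y' k v \<and>
            Comp T Z' Y' (So X) k' f = i' \<and>
            Comp T Z Y' X' g k = j \<and>
            Comp T Y' X' (So Y) j' g = Comp T Y' (So X) (So Y) (Sm X Y u) k'"


section \<open>The stable category and its triangles\<close>

definition stably_zero :: "('o, 'm) cat \<Rightarrow> ('o, 'm) seq set \<Rightarrow> 'o \<Rightarrow> 'o \<Rightarrow> 'm set" where
  "stably_zero C E X Y = {h. \<exists>J a b. injective_object C E J \<and> a \<in> mor C X J \<and> b \<in> mor C J Y \<and>
     h = Comp C X J Y b a}"

definition stable_class :: "('o, 'm) cat \<Rightarrow> ('o, 'm) seq set \<Rightarrow> 'o \<Rightarrow> 'o \<Rightarrow> 'm \<Rightarrow> 'm set" where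
  "stable_class C E X Y f = stably_zero C E X Y #>\<^bsub>Hom C X Y\<^esub> f"

text \<open>Operations on stable morphisms are given as unions over all representatives; in a Frobenius
  category all members of such a union are equal.\<close>

definition stable_category :: "('o, 'm) cat \<Rightarrow> ('o, 'm) seq set \<Rightarrow> ('o, 'm set) cat" where
  "stable_category C E = \<lparr>
     Ob = Ob C,
     Hom = (\<lambda>X Y. Hom C X Y Mod stably_zero C E X Y),
     Comp = (\<lambda>X Y Z G F. \<Union>g\<in>G. \<Union>f\<in>F. stable_class C E X Z (Comp C X Y Z g f)),
     Idn = (\<lambda>X. stable_class C E X X (Idn C X))\<rparr>"

text \<open>Happel's triangulated structure depends on a choice, for each object \<open>X\<close>, of a conflation
  \<open>X \<rightarrow> J X \<rightarrow> S X\<close> with \<open>J X\<close> injective; such a choice exists when there are enough injectives.\<close>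

definition cosyzygy_choice :: "('o, 'm) cat \<Rightarrow> ('o, 'm) seq set \<Rightarrow>
    ('o \<Rightarrow> 'm) \<Rightarrow> ('o \<Rightarrow> 'o) \<Rightarrow> ('o \<Rightarrow> 'm) \<Rightarrow> ('o \<Rightarrow> 'o) \<Rightarrow> bool" where
  "cosyzygy_choice C E \<iota> J \<pi> S \<longleftrightarrow>
     (\<forall>X\<in>Ob C. injective_object C E (J X) \<and> (X, \<iota> X, J X, \<pi> X, S X) \<in> E)"

definition stable_shift :: "('o, 'm) cat \<Rightarrow> ('o, 'm) seq set \<Rightarrow>
    ('o \<Rightarrow> 'm) \<Rightarrow> ('o \<Rightarrow> 'o) \<Rightarrow> ('o \<Rightarrow> 'm) \<Rightarrow> ('o \<Rightarrow> 'o) \<Rightarrow> 'o \<Rightarrow> 'o \<Rightarrow> 'm set \<Rightarrow> 'm set" where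
  "stable_shift C E \<iota> J \<pi> S X Y F =
     \<Union>{stable_class C E (S X) (S Y) s | s f a.
         f \<in> F \<and> a \<in> mor C (J X) (J Y) \<and> s \<in> mor C (S X) (S Y) \<and>
         Comp C X (J X) (J Y) a (\<iota> X) = Comp C X Y (J Y) (\<iota> Y) f \<and>
         Comp C (J X) (S X) (S Y) s (\<pi> X) = Comp C (J X) (J Y) (S Y) (\<pi> Y) a}"

text \<open>The standard triangle of \<open>u : X \<rightarrow> Y\<close> comes from the pushout \<open>Z\<close> of \<open>\<iota> X\<close> along \<open>u\<close>, with
  \<open>w : Z \<rightarrow> S X\<close> the map induced by \<open>\<pi> X\<close> and \<open>0 : Y \<rightarrow> S X\<close>.\<close>

definition standard_triangles :: "('o, 'm) cat \<Rightarrow> ('o, 'm) seq set \<Rightarrow>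
    ('o \<Rightarrow> 'm) \<Rightarrow> ('o \<Rightarrow> 'o) \<Rightarrow> ('o \<Rightarrow> 'm) \<Rightarrow> ('o \<Rightarrow> 'o) \<Rightarrow> ('o, 'm set) triangle set" where
  "standard_triangles C E \<iota> J \<pi> S =
     {(X, Y, Z, stable_class C E X Y u, stable_class C E Y Z v, stable_class C E Z (S X) w)
      | X Y Z u u' v w. X \<in> Ob C \<and> Y \<in> Ob C \<and> u \<in> mor C X Y \<and>
          is_pushout C X (J X) Y Z (\<iota> X) u u' v \<and>
          w \<in> mor C Z (S X) \<and>
          Comp C (J X) Z (S X) w u' = \<pi> X \<and>
          Comp C Y Z (S X) w v = zmor C Y (S X)}"

definition stable_triangles :: "('o, 'm) cat \<Rightarrow> ('o, 'm) seq set \<Rightarrow>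
    ('o \<Rightarrow> 'm) \<Rightarrow> ('o \<Rightarrow> 'o) \<Rightarrow> ('o \<Rightarrow> 'm) \<Rightarrow> ('o \<Rightarrow> 'o) \<Rightarrow> ('o, 'm set) triangle set" where
  "stable_triangles C E \<iota> J \<pi> S =
     {t \<in> triangles (stable_category C E) S. \<exists>s\<in>standard_triangles C E \<iota> J \<pi> S.
        triangle_iso (stable_category C E) S (stable_shift C E \<iota> J \<pi> S) s t}"


section \<open>Complexes and mapping cones\<close>

type_synonym ('o, 'm) cpx = "(int \<Rightarrow> 'o) \<times> (int \<Rightarrow> 'm)"

definition complex_category :: "('o, 'm) cat \<Rightarrow> (('o, 'm) cpx, int \<Rightarrow> 'm) cat" where
  "complex_category T = \<lparr>
     Ob = {(X, d). (\<forall>i. X i \<in> Ob T) \<and> (\<forall>i. d i \<in> mor T (X i) (X (i + 1))) \<and>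
        (\<forall>i. Comp T (X i) (X (i + 1)) (X (i + 2)) (d (i + 1)) (d i) = zmor T (X i) (X (i + 2)))},
     Hom = (\<lambda>(X, dX) (Y, dY). \<lparr>
        carrier = {f. (\<forall>i. f i \<in> mor T (X i) (Y i)) \<and>
          (\<forall>i. Comp T (X i) (X (i + 1)) (Y (i + 1)) (f (i + 1)) (dX i)
             = Comp T (X i) (Y i) (Y (i + 1)) (dY i) (f i))},
        mult = (\<lambda>f g i. madd T (X i) (Y i) (f i) (g i)),
        one = (\<lambda>i. zmor T (X i) (Y i))\<rparr>),
     Comp = (\<lambda>(X, dX) (Y, dY) (Z, dZ) g f. (\<lambda>i. Comp T (X i) (Y i) (Z i) (g i) (f i))),
     Idn = (\<lambda>(X, d) i. Idn T (X i))\<rparr>"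

definition complex_shift :: "('o, 'm) cat \<Rightarrow> ('o, 'm) cpx \<Rightarrow> ('o, 'm) cpx" where
  "complex_shift T = (\<lambda>(X, d).
     (\<lambda>n. X (n + 1), \<lambda>n. mneg T (X (n + 1)) (X (n + 2)) (d (n + 1))))"

text \<open>All sequences \<open>Y \<rightarrow> Con(f) \<rightarrow> X[1]\<close>, for all choices of the biproducts
  \<open>X\<^sup>n\<^sup>+\<^sup>1 \<oplus> Y\<^sup>n\<close>. The differential is the sum of the three nonzero matrix entries.\<close>

definition cone_sequences ::
    "('o, 'm) cat \<Rightarrow> ('o, 'm) cpx \<Rightarrow> ('o, 'm) cpx \<Rightarrow> (int \<Rightarrow> 'm) \<Rightarrow> (('o, 'm) cpx, int \<Rightarrow> 'm) seq set" where
  "cone_sequences T = (\<lambda>(X, dX) (Y, dY) f.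
     {((Y, dY), i2, (K, dK), p1, complex_shift T (X, dX)) | K dK i1 i2 p1 p2.
        (\<forall>n. is_biproduct T (X (n + 1)) (Y n) (K n) (i1 n) (i2 n) (p1 n) (p2 n)) \<and>
        (\<forall>n. dK n = madd T (K n) (K (n + 1))
           (Comp T (K n) (X (n + 2)) (K (n + 1)) (i1 (n + 1))
              (Comp T (K n) (X (n + 1)) (X (n + 2))
                 (mneg T (X (n + 1)) (X (n + 2)) (dX (n + 1))) (p1 n)))
           (Comp T (K n) (Y (n + 1)) (K (n + 1)) (i2 (n + 1))
              (madd T (K n) (Y (n + 1))
                 (Comp T (K n) (X (n + 1)) (Y (n + 1)) (f (n + 1)) (p1 n))
                 (Comp T (K n) (Y n) (Y (n + 1)) (dY n) (p2 n)))))})"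


section \<open>The category of graded objects with maps of nonnegative degree\<close>

definition zplus :: "('o, 'm) cat \<Rightarrow> (int \<Rightarrow> 'o, nat \<Rightarrow> int \<Rightarrow> 'm) cat" where
  "zplus A = \<lparr>
     Ob = {X. \<forall>j. X j \<in> Ob A},
     Hom = (\<lambda>X Y. \<lparr>
        carrier = {f. \<forall>n j. f n j \<in> mor A (X j) (Y (j + int n))},
        mult = (\<lambda>f g n j. madd A (X j) (Y (j + int n)) (f n j) (g n j)),
        one = (\<lambda>n j. zmor A (X j) (Y (j + int n)))\<rparr>),
     Comp = (\<lambda>X Y Z g f n j. msum A (X j) (Z (j + int n))
        (\<lambda>k. Comp A (X j) (Y (j + int k)) (Z (j + int n)) (g (n - k) (j + int k)) (f k j)) {..n}),
     Idn = (\<lambda>X n j. if n = 0 then Idn A (X j) else zmor A (X j) (X (j + int n)))\<rparr>"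

definition zplus_twist :: "(int \<Rightarrow> 'o) \<Rightarrow> int \<Rightarrow> 'o" where
  "zplus_twist X = (\<lambda>j. X (j + 1))"

definition zplus_twist_mor :: "(nat \<Rightarrow> int \<Rightarrow> 'm) \<Rightarrow> nat \<Rightarrow> int \<Rightarrow> 'm" where
  "zplus_twist_mor f = (\<lambda>n j. f n (j + 1))"

definition zplus_eta :: "('o, 'm) cat \<Rightarrow> (int \<Rightarrow> 'o) \<Rightarrow> nat \<Rightarrow> int \<Rightarrow> 'm" where
  "zplus_eta A X = (\<lambda>n j. if n = 1 then Idn A (X (j + 1)) else zmor A (X (j + 1)) (X (j + int n)))"

type_synonym ('o, 'm) zcpx = "(int \<Rightarrow> 'o, nat \<Rightarrow> int \<Rightarrow> 'm) cpx"

definition cpx_twist :: "('o, 'm) zcpx \<Rightarrow> ('o, 'm) zcpx" where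
  "cpx_twist = (\<lambda>(X, d). (\<lambda>i. zplus_twist (X i), \<lambda>i. zplus_twist_mor (d i)))"

definition cpx_eta :: "('o, 'm) cat \<Rightarrow> ('o, 'm) zcpx \<Rightarrow> int \<Rightarrow> nat \<Rightarrow> int \<Rightarrow> 'm" where
  "cpx_eta A = (\<lambda>(X, d) i. zplus_eta A (X i))"

definition E_eta :: "('o, 'm) cat \<Rightarrow> (('o, 'm) zcpx, int \<Rightarrow> nat \<Rightarrow> int \<Rightarrow> 'm) seq set" where
  "E_eta A = (let CZ = complex_category (zplus A) in
     {s \<in> kernel_cokernel_pairs CZ. \<exists>X\<in>Ob CZ. \<exists>Y\<in>Ob CZ. \<exists>f\<in>mor CZ X Y.
        (\<exists>g\<in>mor CZ X (cpx_twist Y). f = Comp CZ X (cpx_twist Y) Y (cpx_eta A Y) g) \<and>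
        (\<exists>t\<in>cone_sequences (zplus A) X Y f. seq_iso CZ s t)})"


section \<open>Rickard's category and its comparison with complexes\<close>

type_synonym ('o, 'm) gobj = "(int \<Rightarrow> int \<Rightarrow> 'o) \<times> (nat \<Rightarrow> int \<Rightarrow> int \<Rightarrow> 'm)"

definition G_category :: "('o, 'm) cat \<Rightarrow> (('o, 'm) gobj, nat \<Rightarrow> int \<Rightarrow> int \<Rightarrow> 'm) cat" where
  "G_category A = \<lparr>
     Ob = {(X, d). (\<forall>i j. X i j \<in> Ob A) \<and>
        (\<forall>n i j. d n i j \<in> mor A (X i j) (X (i + 1 - int n) (j + int n))) \<and>
        (\<forall>n i j. msum A (X i j) (X (i + 2 - int n) (j + int n))
           (\<lambda>q. Comp A (X i j) (X (i + 1 - int q) (j + int q)) (X (i + 2 - int n) (j + int n))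
              (d (n - q) (i + 1 - int q) (j + int q)) (d q i j)) {..n}
           = zmor A (X i j) (X (i + 2 - int n) (j + int n)))},
     Hom = (\<lambda>(X, dX) (Y, dY). \<lparr>
        carrier = {\<alpha>. (\<forall>n i j. \<alpha> n i j \<in> mor A (X i j) (Y (i - int n) (j + int n))) \<and>
          (\<forall>n i j.
             msum A (X i j) (Y (i + 1 - int n) (j + int n))
               (\<lambda>q. Comp A (X i j) (X (i + 1 - int q) (j + int q)) (Y (i + 1 - int n) (j + int n))
                  (\<alpha> (n - q) (i + 1 - int q) (j + int q)) (dX q i j)) {..n}
           = msum A (X i j) (Y (i + 1 - int n) (j + int n))
               (\<lambda>q. Comp A (X i j) (Y (i - int q) (j + int q)) (Y (i + 1 - int n) (j + int n))
                  (dY (n - q) (i - int q) (j + int q)) (\<alpha> q i j)) {..n})},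
        mult = (\<lambda>\<alpha> \<beta> n i j. madd A (X i j) (Y (i - int n) (j + int n)) (\<alpha> n i j) (\<beta> n i j)),
        one = (\<lambda>n i j. zmor A (X i j) (Y (i - int n) (j + int n)))\<rparr>),
     Comp = (\<lambda>(X, dX) (Y, dY) (Z, dZ) \<alpha> \<beta>. (\<lambda>n i j.
        msum A (X i j) (Z (i - int n) (j + int n))
          (\<lambda>q. Comp A (X i j) (Y (i - int q) (j + int q)) (Z (i - int n) (j + int n))
             (\<alpha> (n - q) (i - int q) (j + int q)) (\<beta> q i j)) {..n})),
     Idn = (\<lambda>(X, d) n i j. if n = 0 then Idn A (X i j)
        else zmor A (X i j) (X (i - int n) (j + int n)))\<rparr>"

definition Psi_ob :: "('o, 'm) gobj \<Rightarrow> ('o, 'm) zcpx" where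
  "Psi_ob = (\<lambda>(X, d). (\<lambda>i j. X (i - j) j, \<lambda>i n j. d n (i - j) j))"

definition Psi_mor :: "(nat \<Rightarrow> int \<Rightarrow> int \<Rightarrow> 'm) \<Rightarrow> int \<Rightarrow> nat \<Rightarrow> int \<Rightarrow> 'm" where
  "Psi_mor \<alpha> = (\<lambda>i n j. \<alpha> n (i - j) j)"

text \<open>The sequences in \<open>G(A)\<close> whose image under \<open>\<Psi>\<close> belongs to \<open>E_eta\<close>.\<close>

definition G_conflations :: "('o, 'm) cat \<Rightarrow> (('o, 'm) gobj, nat \<Rightarrow> int \<Rightarrow> int \<Rightarrow> 'm) seq set" where
  "G_conflations A = {(X, i, Y, p, Z).
     X \<in> Ob (G_category A) \<and> Y \<in> Ob (G_category A) \<and> Z \<in> Ob (G_category A) \<and>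
     i \<in> mor (G_category A) X Y \<and> p \<in> mor (G_category A) Y Z \<and>
     (Psi_ob X, Psi_mor i, Psi_ob Y, Psi_mor p, Psi_ob Z) \<in> E_eta A}"

end

theory Submission
  imports Defs
begin

text \<open>The conflations in complexes are the degreewise split sequences whose class, the
  off-diagonal part of the middle differential, factors through \<open>\<eta>\<close>; this description makes closure
  under compositions, pushouts and pullbacks a computation with such splittings. The cone of \<open>\<eta>\<close>
  on \<open>Y\<close> is an object on which \<open>\<eta>\<close> is null-homotopic, and \<open>Y\<close> is both a sub- and a quotient of such
  an object. A null-homotopy of \<open>\<eta>\<close> on \<open>P\<close> turns the factorization of a class through \<open>\<eta>\<close> into a
  splitting, so the injectives and the projectives are both the objects on which \<open>\<eta>\<close> is
  null-homotopic. The stable category of any Frobenius category is triangulated (Happel): the basic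
  triangles are the pushouts of the chosen sequences \<open>X \<rightarrow> J X \<rightarrow> S X\<close>, and for the octahedral axiom
  the two composable maps may be taken to be inflations, where the cones are quotients and Noether's
  isomorphism gives the octahedron. All of this is transported along \<open>\<Psi>\<close>, which is a bijection on
  objects and morphisms compatible with the whole structure.\<close>

section \<open>Calculus in preadditive categories\<close>

text \<open>The class of a degreewise split sequence takes values in \<open>X\<close>, whereas its
  factorization lives in the twist \<open>X(1)\<close>. Since \<open>\<eta>\<close> is monic, the
  factor \<open>g\<close> is unique and inherits the cocycle relation, so splittings can carry
  \<open>g\<close> itself and each closure property becomes a formula for a new \<open>g\<close>.
  Injectives and projectives are not quite dual here: an extension is built directly from a
  null-homotopy of \<open>\<eta>\<close>, while a lift is obtained only after twisting once, and
  invertibility of \<open>(1)\<close> is what removes that twist again. On the triangulated side the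
  shift depends on choices and is an equivalence only up to isomorphism, so rotation cannot be
  undone on standard triangles. It is undone by rotating further and descending along the fully
  faithful shift, which requires a five lemma; weak cokernels suffice for that. The strictness of
  \<open>\<Psi>\<close>, by contrast, lets whole notions be transported by rewriting their
  quantifiers.\<close>

context preadditive_category
begin

lemma madd_mor [simp]:
  "\<lbrakk>X \<in> Ob C; Y \<in> Ob C; f \<in> mor C X Y; g \<in> mor C X Y\<rbrakk> \<Longrightarrow> madd C X Y f g \<in> mor C X Y"
  using hom_group[of X Y] by (simp add: comm_group_def comm_monoid_def monoid.m_closed)

lemma zmor_mor [simp]: "\<lbrakk>X \<in> Ob C; Y \<in> Ob C\<rbrakk> \<Longrightarrow> zmor C X Y \<in> mor C X Y"
  using hom_group[of X Y] by (simp add: comm_group_def comm_monoid_def monoid.one_closed)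

lemma mneg_mor [simp]:
  "\<lbrakk>X \<in> Ob C; Y \<in> Ob C; f \<in> mor C X Y\<rbrakk> \<Longrightarrow> mneg C X Y f \<in> mor C X Y"
  using hom_group[of X Y] by (simp add: comm_group_def group.inv_closed)

declare id_mor [simp] comp_mor [simp] comp_id_left [simp] comp_id_right [simp]

text \<open>Associativity is oriented so that composites normalize to right-nested form. An equation
  \<open>gf = h\<close> then no longer matches inside a longer composite, which is what
  \<open>reassoc\<close> repairs.\<close>

lemma comp_assoc_right [simp]:
  "\<lbrakk>W \<in> Ob C; X \<in> Ob C; Y \<in> Ob C; Z \<in> Ob C; f \<in> mor C W X; g \<in> mor C X Y; h \<in> mor C Y Z\<rbrakk>
    \<Longrightarrow> Comp C W X Z (Comp C X Y Z h g) f = Comp C W Y Z h (Comp C W X Y g f)"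
  by (simp add: comp_assoc)

declare comp_add_left [simp] comp_add_right [simp]

lemma madd_assoc [simp]:
  "\<lbrakk>X \<in> Ob C; Y \<in> Ob C; f \<in> mor C X Y; g \<in> mor C X Y; h \<in> mor C X Y\<rbrakk>
    \<Longrightarrow> madd C X Y (madd C X Y f g) h = madd C X Y f (madd C X Y g h)"
  using hom_group[of X Y] by (simp add: comm_group_def comm_monoid_def monoid.m_assoc)

lemma madd_commute:
  "\<lbrakk>X \<in> Ob C; Y \<in> Ob C; f \<in> mor C X Y; g \<in> mor C X Y\<rbrakk> \<Longrightarrow> madd C X Y f g = madd C X Y g f"
  using hom_group[of X Y] by (simp add: comm_group_def comm_monoid.m_comm)

lemma madd_left_commute:
  "\<lbrakk>X \<in> Ob C; Y \<in> Ob C; f \<in> mor C X Y; g \<in> mor C X Y; h \<in> mor C X Y\<rbrakk>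
    \<Longrightarrow> madd C X Y f (madd C X Y g h) = madd C X Y g (madd C X Y f h)"
  using hom_group[of X Y] by (simp add: comm_group_def comm_monoid.m_lcomm)

lemmas madd_ac = madd_commute madd_left_commute

lemma madd_zero_left [simp]:
  "\<lbrakk>X \<in> Ob C; Y \<in> Ob C; f \<in> mor C X Y\<rbrakk> \<Longrightarrow> madd C X Y (zmor C X Y) f = f"
  using hom_group[of X Y] by (simp add: comm_group_def comm_monoid_def)

lemma madd_zero_right [simp]:
  "\<lbrakk>X \<in> Ob C; Y \<in> Ob C; f \<in> mor C X Y\<rbrakk> \<Longrightarrow> madd C X Y f (zmor C X Y) = f"
  using hom_group[of X Y] by (simp add: comm_group_def comm_monoid_def)

lemma madd_neg_left [simp]:
  "\<lbrakk>X \<in> Ob C; Y \<in> Ob C; f \<in> mor C X Y\<rbrakk> \<Longrightarrow> madd C X Y (mneg C X Y f) f = zmor C X Y"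
  using hom_group[of X Y] by (simp add: comm_group_def group.l_inv)

lemma madd_neg_right [simp]:
  "\<lbrakk>X \<in> Ob C; Y \<in> Ob C; f \<in> mor C X Y\<rbrakk> \<Longrightarrow> madd C X Y f (mneg C X Y f) = zmor C X Y"
  using hom_group[of X Y] by (simp add: comm_group_def group.r_inv)

lemma madd_neg_left' [simp]:
  "\<lbrakk>X \<in> Ob C; Y \<in> Ob C; f \<in> mor C X Y; g \<in> mor C X Y\<rbrakk>
    \<Longrightarrow> madd C X Y (mneg C X Y f) (madd C X Y f g) = g"
  by (simp del: madd_assoc flip: madd_assoc)

lemma madd_neg_right' [simp]:
  "\<lbrakk>X \<in> Ob C; Y \<in> Ob C; f \<in> mor C X Y; g \<in> mor C X Y\<rbrakk>
    \<Longrightarrow> madd C X Y f (madd C X Y (mneg C X Y f) g) = g"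
  by (simp del: madd_assoc flip: madd_assoc)

text \<open>The shape \<open>g + (f - g)\<close> that arises when a difference is substituted
  back.\<close>

lemma madd_neg_outer [simp]:
  "\<lbrakk>X \<in> Ob C; Y \<in> Ob C; f \<in> mor C X Y; g \<in> mor C X Y\<rbrakk>
    \<Longrightarrow> madd C X Y f (madd C X Y g (mneg C X Y f)) = g"
  by (metis madd_commute madd_neg_right' mneg_mor)

lemma madd_left_cancel:
  "\<lbrakk>X \<in> Ob C; Y \<in> Ob C; f \<in> mor C X Y; g \<in> mor C X Y; h \<in> mor C X Y\<rbrakk>
    \<Longrightarrow> madd C X Y f g = madd C X Y f h \<longleftrightarrow> g = h"
  by (metis madd_neg_left')

lemma mneg_eqI:
  "\<lbrakk>X \<in> Ob C; Y \<in> Ob C; f \<in> mor C X Y; g \<in> mor C X Y; madd C X Y f g = zmor C X Y\<rbrakk>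
    \<Longrightarrow> mneg C X Y f = g"
  by (metis madd_neg_left' madd_zero_right mneg_mor)

lemma mneg_neg [simp]:
  "\<lbrakk>X \<in> Ob C; Y \<in> Ob C; f \<in> mor C X Y\<rbrakk> \<Longrightarrow> mneg C X Y (mneg C X Y f) = f"
  by (rule mneg_eqI) simp_all

lemma mneg_zero [simp]: "\<lbrakk>X \<in> Ob C; Y \<in> Ob C\<rbrakk> \<Longrightarrow> mneg C X Y (zmor C X Y) = zmor C X Y"
  by (rule mneg_eqI) simp_all

lemma mneg_eq_zero_iff [simp]:
  "\<lbrakk>X \<in> Ob C; Y \<in> Ob C; f \<in> mor C X Y\<rbrakk> \<Longrightarrow> mneg C X Y f = zmor C X Y \<longleftrightarrow> f = zmor C X Y"
  by (metis mneg_neg mneg_zero)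

lemma mneg_eq_iff [simp]:
  "\<lbrakk>X \<in> Ob C; Y \<in> Ob C; f \<in> mor C X Y; g \<in> mor C X Y\<rbrakk> \<Longrightarrow> mneg C X Y f = mneg C X Y g \<longleftrightarrow> f = g"
  by (metis mneg_neg)

lemma comp_zero_right [simp]:
  assumes [simp]: "X \<in> Ob C" "Y \<in> Ob C" "Z \<in> Ob C" "g \<in> mor C Y Z"
  shows "Comp C X Y Z g (zmor C X Y) = zmor C X Z"
proof -
  let ?z = "Comp C X Y Z g (zmor C X Y)"
  have "madd C X Z ?z ?z = madd C X Z ?z (zmor C X Z)"
    by (simp flip: comp_add_right)
  then show ?thesis by (subst (asm) madd_left_cancel) simp_all
qed

lemma comp_zero_left [simp]:
  assumes [simp]: "X \<in> Ob C" "Y \<in> Ob C" "Z \<in> Ob C" "f \<in> mor C X Y"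
  shows "Comp C X Y Z (zmor C Y Z) f = zmor C X Z"
proof -
  let ?z = "Comp C X Y Z (zmor C Y Z) f"
  have "madd C X Z ?z ?z = madd C X Z ?z (zmor C X Z)"
    by (simp flip: comp_add_left)
  then show ?thesis by (subst (asm) madd_left_cancel) simp_all
qed

lemma comp_neg_right [simp]:
  "\<lbrakk>X \<in> Ob C; Y \<in> Ob C; Z \<in> Ob C; f \<in> mor C X Y; g \<in> mor C Y Z\<rbrakk>
    \<Longrightarrow> Comp C X Y Z g (mneg C X Y f) = mneg C X Z (Comp C X Y Z g f)"
  by (rule mneg_eqI[symmetric]) (simp_all flip: comp_add_right)

lemma comp_neg_left [simp]:
  "\<lbrakk>X \<in> Ob C; Y \<in> Ob C; Z \<in> Ob C; f \<in> mor C X Y; g \<in> mor C Y Z\<rbrakk>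
    \<Longrightarrow> Comp C X Y Z (mneg C Y Z g) f = mneg C X Z (Comp C X Y Z g f)"
  by (rule mneg_eqI[symmetric]) (simp_all flip: comp_add_left)

text \<open>Turns an equation \<open>gf = h\<close> into a rewrite rule for right-nested composites.\<close>

lemma reassoc:
  "\<lbrakk>Comp C X Y Z g f = h; X \<in> Ob C; Y \<in> Ob C; Z \<in> Ob C; f \<in> mor C X Y; g \<in> mor C Y Z;
    W \<in> Ob C; x \<in> mor C W X\<rbrakk>
    \<Longrightarrow> Comp C W Y Z g (Comp C W X Y f x) = Comp C W X Z h x"
  by (auto simp flip: comp_assoc_right simp del: comp_assoc_right)

lemma madd_eq_iff_neg:
  "\<lbrakk>X \<in> Ob C; Y \<in> Ob C; f \<in> mor C X Y; g \<in> mor C X Y; h \<in> mor C X Y\<rbrakk>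
    \<Longrightarrow> madd C X Y f (mneg C X Y g) = h \<longleftrightarrow> f = madd C X Y h g"
  by (metis madd_neg_left' madd_commute madd_mor mneg_mor)

lemma madd_neg_eq_zero_iff:
  "\<lbrakk>X \<in> Ob C; Y \<in> Ob C; f \<in> mor C X Y; g \<in> mor C X Y\<rbrakk>
    \<Longrightarrow> madd C X Y f (mneg C X Y g) = zmor C X Y \<longleftrightarrow> f = g"
  by (subst madd_eq_iff_neg) simp_all

lemma is_isoI:
  "\<lbrakk>X \<in> Ob C; Y \<in> Ob C; f \<in> mor C X Y; g \<in> mor C Y X;
    Comp C X Y X g f = Idn C X; Comp C Y X Y f g = Idn C Y\<rbrakk> \<Longrightarrow> is_iso C X Y f"
  by (auto simp: is_iso_def)

lemma is_isoE:
  assumes "is_iso C X Y f"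
  obtains g where "X \<in> Ob C" "Y \<in> Ob C" "f \<in> mor C X Y" "g \<in> mor C Y X" "is_iso C Y X g"
    "Comp C X Y X g f = Idn C X" "Comp C Y X Y f g = Idn C Y"
  using assms unfolding is_iso_def by metis

lemma is_iso_id: "X \<in> Ob C \<Longrightarrow> is_iso C X X (Idn C X)"
  by (rule is_isoI[of _ _ _ "Idn C X"]) simp_all

lemma is_iso_comp:
  assumes f: "is_iso C X Y f" and g: "is_iso C Y Z g"
  shows "is_iso C X Z (Comp C X Y Z g f)"
proof -
  obtain f' where f' [simp]: "X \<in> Ob C" "Y \<in> Ob C" "f \<in> mor C X Y" "f' \<in> mor C Y X"
    "is_iso C Y X f'" "Comp C X Y X f' f = Idn C X" "Comp C Y X Y f f' = Idn C Y"
    using f by (rule is_isoE)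
  obtain g' where g' [simp]: "Y \<in> Ob C" "Z \<in> Ob C" "g \<in> mor C Y Z" "g' \<in> mor C Z Y"
    "is_iso C Z Y g'" "Comp C Y Z Y g' g = Idn C Y" "Comp C Z Y Z g g' = Idn C Z"
    using g by (rule is_isoE)
  note [simp] = f'(6,7)[THEN reassoc] g'(6,7)[THEN reassoc]
  show ?thesis
    by (rule is_isoI[of _ _ _ "Comp C Z Y X f' g'"]) simp_all
qed

text \<open>An equational test: if the identity vanishes, so does every map composed with it. Zero
  objects among complexes and in the stable category are recognized this way.\<close>

lemma zero_object_Idn:
  "is_zero_object C N \<longleftrightarrow> N \<in> Ob C \<and> Idn C N = zmor C N N"
proof
  assume "is_zero_object C N"
  then show "N \<in> Ob C \<and> Idn C N = zmor C N N"
    unfolding is_zero_object_def using id_mor zmor_mor by metis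
next
  assume N: "N \<in> Ob C \<and> Idn C N = zmor C N N"
  then have [simp]: "N \<in> Ob C" by simp
  have "f = zmor C X N" if "X \<in> Ob C" "f \<in> mor C X N" for X f
    using that comp_id_left[of X N f] N by simp
  moreover have "f = zmor C N X" if "X \<in> Ob C" "f \<in> mor C N X" for X f
    using that comp_id_right[of N X f] N by simp
  ultimately show "is_zero_object C N"
    unfolding is_zero_object_def using zmor_mor \<open>N \<in> Ob C\<close> by metis
qed

lemma zero_object_mor_eq:
  assumes "is_zero_object C N" "X \<in> Ob C"
  shows "f \<in> mor C X N \<Longrightarrow> f = zmor C X N" and "f \<in> mor C N X \<Longrightarrow> f = zmor C N X"
  using assms unfolding is_zero_object_def using zmor_mor by (metis assms(1) is_zero_object_def)+

end

section \<open>Exact categories\<close>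

context preadditive_category
begin

lemma pushout_eqI:
  assumes po: "is_pushout C X Y X' P i f f' i'"
    and eq: "Comp C Y P W u f' = Comp C Y P W v f'" "Comp C X' P W u i' = Comp C X' P W v i'"
    and [simp]: "X \<in> Ob C" "Y \<in> Ob C" "X' \<in> Ob C" "W \<in> Ob C" "i \<in> mor C X Y" "f \<in> mor C X X'"
      "u \<in> mor C P W" "v \<in> mor C P W"
  shows "u = v"
proof -
  have [simp]: "P \<in> Ob C" "f' \<in> mor C Y P" "i' \<in> mor C X' P"
    and sq: "Comp C X Y P f' i = Comp C X X' P i' f"
    using po by (auto simp: is_pushout_def)
  have "\<exists>!w. w \<in> mor C P W \<and> Comp C Y P W w f' = Comp C Y P W v f' \<and>
      Comp C X' P W w i' = Comp C X' P W v i'"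
    using po unfolding is_pushout_def by (simp add: sq)
  then show ?thesis using eq by (metis assms(10,11))
qed

lemma pushout_ex:
  assumes "is_pushout C X Y X' P i f f' i'" "W \<in> Ob C" "a \<in> mor C Y W" "b \<in> mor C X' W"
    "Comp C X Y W a i = Comp C X X' W b f"
  obtains u where "u \<in> mor C P W" "Comp C Y P W u f' = a" "Comp C X' P W u i' = b"
  using assms unfolding is_pushout_def by metis

lemma pushoutD:
  assumes "is_pushout C X Y X' P i f f' i'"
  shows "P \<in> Ob C" "f' \<in> mor C Y P" "i' \<in> mor C X' P" "Comp C X Y P f' i = Comp C X X' P i' f"
  using assms by (auto simp: is_pushout_def)

text \<open>The exactness axioms supply some pushout whose leg is an inflation; this comparison
  carries the property to a prescribed pushout.\<close>

lemma pushout_unique: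
  assumes P: "is_pushout C X Y X' P i f f' i'" and Q: "is_pushout C X Y X' Q i f g' j'"
    and [simp]: "X \<in> Ob C" "Y \<in> Ob C" "X' \<in> Ob C" "i \<in> mor C X Y" "f \<in> mor C X X'"
  obtains t where "is_iso C P Q t" "Comp C Y P Q t f' = g'" "Comp C X' P Q t i' = j'"
proof -
  note [simp] = pushoutD(1-3)[OF P] pushoutD(1-3)[OF Q]
  obtain t where t [simp]: "t \<in> mor C P Q" "Comp C Y P Q t f' = g'" "Comp C X' P Q t i' = j'"
    by (rule pushout_ex[OF P _ _ _ pushoutD(4)[OF Q]]) simp_all
  obtain s where s [simp]: "s \<in> mor C Q P" "Comp C Y Q P s g' = f'" "Comp C X' Q P s j' = i'"
    by (rule pushout_ex[OF Q _ _ _ pushoutD(4)[OF P]]) simp_all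
  have "Comp C P Q P s t = Idn C P" by (rule pushout_eqI[OF P, where W = P]) simp_all
  moreover have "Comp C Q P Q t s = Idn C Q" by (rule pushout_eqI[OF Q, where W = Q]) simp_all
  ultimately have "is_iso C P Q t" by (intro is_isoI[of _ _ _ s]) simp_all
  then show ?thesis using t(2,3) by (rule that)
qed

lemma kernel_cokernelD:
  assumes "(X, i, Y, p, Z) \<in> kernel_cokernel_pairs C"
  shows "X \<in> Ob C" "Y \<in> Ob C" "Z \<in> Ob C" "i \<in> mor C X Y" "p \<in> mor C Y Z"
    "is_kernel C X Y Z i p" "is_cokernel C X Y Z i p" "Comp C X Y Z p i = zmor C X Z"
  using assms by (auto simp: kernel_cokernel_pairs_def is_kernel_def)

lemma kernel_ex:
  assumes "is_kernel C X Y Z i p" "W \<in> Ob C" "h \<in> mor C W Y" "Comp C W Y Z p h = zmor C W Z"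
  obtains u where "u \<in> mor C W X" "Comp C W X Y i u = h"
  using assms unfolding is_kernel_def by metis

lemma cokernel_ex:
  assumes "is_cokernel C X Y Z i p" "W \<in> Ob C" "h \<in> mor C Y W" "Comp C X Y W h i = zmor C X W"
  obtains u where "u \<in> mor C Z W" "Comp C Y Z W u p = h"
  using assms unfolding is_cokernel_def by metis

lemma kernel_mono:
  assumes k: "is_kernel C X Y Z i p"
    and eq: "Comp C W X Y i u = Comp C W X Y i v"
    and [simp]: "X \<in> Ob C" "Y \<in> Ob C" "Z \<in> Ob C" "W \<in> Ob C" "i \<in> mor C X Y" "p \<in> mor C Y Z"
      "u \<in> mor C W X" "v \<in> mor C W X"
  shows "u = v"
proof -
  have pi: "Comp C X Y Z p i = zmor C X Z" using k by (simp add: is_kernel_def)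
  have "Comp C W Y Z p (Comp C W X Y i v) = zmor C W Z" using pi by (simp add: pi[THEN reassoc])
  then have "\<exists>!w. w \<in> mor C W X \<and> Comp C W X Y i w = Comp C W X Y i v"
    using k unfolding is_kernel_def by simp
  then show ?thesis using eq assms(9,10) by metis
qed

lemma cokernel_epi:
  assumes k: "is_cokernel C X Y Z i p"
    and eq: "Comp C Y Z W u p = Comp C Y Z W v p"
    and [simp]: "X \<in> Ob C" "Y \<in> Ob C" "Z \<in> Ob C" "W \<in> Ob C" "i \<in> mor C X Y" "p \<in> mor C Y Z"
      "u \<in> mor C Z W" "v \<in> mor C Z W"
  shows "u = v"
proof -
  have pi: "Comp C X Y Z p i = zmor C X Z" using k by (simp add: is_cokernel_def)
  have "Comp C X Y W (Comp C Y Z W v p) i = zmor C X W" using pi by simp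
  then have "\<exists>!w. w \<in> mor C Z W \<and> Comp C Y Z W w p = Comp C Y Z W v p"
    using k unfolding is_cokernel_def by simp
  then show ?thesis using eq assms(9,10) by metis
qed

text \<open>Exact structures are closed under isomorphism only towards targets already known to be
  kernel-cokernel pairs; this discharges that proviso. Test maps are moved along the isomorphisms,
  factored there, and moved back.\<close>

lemma kernel_cokernel_iso:
  assumes s: "(X, i, Y, p, Z) \<in> kernel_cokernel_pairs C"
    and a: "is_iso C X X' a" and b: "is_iso C Y Y' b" and c: "is_iso C Z Z' c"
    and [simp]: "i' \<in> mor C X' Y'" "p' \<in> mor C Y' Z'"
    and bi: "Comp C X Y Y' b i = Comp C X X' Y' i' a"
    and cp: "Comp C Y Z Z' c p = Comp C Y Y' Z' p' b"
  shows "(X', i', Y', p', Z') \<in> kernel_cokernel_pairs C"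
proof -
  note [simp] = kernel_cokernelD(1-5)[OF s]
  have ker: "is_kernel C X Y Z i p" and cok: "is_cokernel C X Y Z i p"
    and pi: "Comp C X Y Z p i = zmor C X Z" using kernel_cokernelD(6-8)[OF s] by blast+
  obtain a' where a' [simp]: "X \<in> Ob C" "X' \<in> Ob C" "a \<in> mor C X X'" "a' \<in> mor C X' X"
    "is_iso C X' X a'" "Comp C X X' X a' a = Idn C X" "Comp C X' X X' a a' = Idn C X'"
    using a by (rule is_isoE)
  obtain b' where b' [simp]: "Y \<in> Ob C" "Y' \<in> Ob C" "b \<in> mor C Y Y'" "b' \<in> mor C Y' Y"
    "is_iso C Y' Y b'" "Comp C Y Y' Y b' b = Idn C Y" "Comp C Y' Y Y' b b' = Idn C Y'"
    using b by (rule is_isoE)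
  obtain c' where c' [simp]: "Z \<in> Ob C" "Z' \<in> Ob C" "c \<in> mor C Z Z'" "c' \<in> mor C Z' Z"
    "is_iso C Z' Z c'" "Comp C Z Z' Z c' c = Idn C Z" "Comp C Z' Z Z' c c' = Idn C Z'"
    using c by (rule is_isoE)
  note [simp] = a'(6,7)[THEN reassoc] b'(6,7)[THEN reassoc] c'(6,7)[THEN reassoc]
  have i': "i' = Comp C X' Y Y' b (Comp C X' X Y i a')"
    using bi[THEN reassoc, of X' a'] by simp
  have p': "p' = Comp C Y' Z Z' c (Comp C Y' Y Z p b')"
    using cp[THEN reassoc, of Y' b'] by simp
  have p'i': "Comp C X' Y' Z' p' i' = zmor C X' Z'"
    unfolding i' p' by (simp add: pi[THEN reassoc])
  have "\<exists>!u. u \<in> mor C W X' \<and> Comp C W X' Y' i' u = h"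
    if [simp]: "W \<in> Ob C" "h \<in> mor C W Y'" and "Comp C W Y' Z' p' h = zmor C W Z'" for W h
  proof -
    have "Comp C W Z' Z c' (Comp C W Y' Z' p' h) = zmor C W Z" using that(3) by simp
    then have "Comp C W Y Z p (Comp C W Y' Y b' h) = zmor C W Z" unfolding p' by simp
    then obtain u where [simp]: "u \<in> mor C W X" and u: "Comp C W X Y i u = Comp C W Y' Y b' h"
      by (rule kernel_ex[OF ker, of W, rotated 2]) simp_all
    show ?thesis
    proof (rule ex1I[of _ "Comp C W X X' a u"])
      show "Comp C W X X' a u \<in> mor C W X' \<and> Comp C W X' Y' i' (Comp C W X X' a u) = h"
        unfolding i' by (simp add: u)
    next
      fix v assume v: "v \<in> mor C W X' \<and> Comp C W X' Y' i' v = h"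
      then have [simp]: "v \<in> mor C W X'" and iv: "h = Comp C W X' Y' i' v" by auto
      have "Comp C W X Y i (Comp C W X' X a' v) = Comp C W X Y i u"
        unfolding u iv i' by simp
      then have "Comp C W X' X a' v = u" by (rule kernel_mono[OF ker]) simp_all
      then have "Comp C W X X' a (Comp C W X' X a' v) = Comp C W X X' a u" by simp
      then show "v = Comp C W X X' a u" by simp
    qed
  qed
  moreover have "\<exists>!u. u \<in> mor C Z' W \<and> Comp C Y' Z' W u p' = h"
    if [simp]: "W \<in> Ob C" "h \<in> mor C Y' W" and "Comp C X' Y' W h i' = zmor C X' W" for W h
  proof -
    have "Comp C X X' W (Comp C X' Y' W h i') a = zmor C X W" using that(3) by simp
    then have "Comp C X Y W (Comp C Y Y' W h b) i = zmor C X W" unfolding i' by simp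
    then obtain u where [simp]: "u \<in> mor C Z W" and u: "Comp C Y Z W u p = Comp C Y Y' W h b"
      by (rule cokernel_ex[OF cok, of W, rotated 2]) simp_all
    show ?thesis
    proof (rule ex1I[of _ "Comp C Z' Z W u c'"])
      show "Comp C Z' Z W u c' \<in> mor C Z' W \<and> Comp C Y' Z' W (Comp C Z' Z W u c') p' = h"
        unfolding p' by (simp add: u[THEN reassoc])
    next
      fix v assume v: "v \<in> mor C Z' W \<and> Comp C Y' Z' W v p' = h"
      then have [simp]: "v \<in> mor C Z' W" and iv: "h = Comp C Y' Z' W v p'" by auto
      have "Comp C Y Z W (Comp C Z Z' W v c) p = Comp C Y Z W u p"
        unfolding u iv p' by simp
      then have "Comp C Z Z' W v c = u" by (rule cokernel_epi[OF cok]) simp_all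
      then have "Comp C Z' Z W (Comp C Z Z' W v c) c' = Comp C Z' Z W u c'" by simp
      then show "v = Comp C Z' Z W u c'" by simp
    qed
  qed
  ultimately show ?thesis
    unfolding kernel_cokernel_pairs_def is_kernel_def is_cokernel_def using p'i' by simp
qed

lemma seq_iso_sym:
  assumes "seq_iso C (X, i, Y, p, Z) (X', i', Y', p', Z')"
    and [simp]: "i \<in> mor C X Y" "p \<in> mor C Y Z" "i' \<in> mor C X' Y'" "p' \<in> mor C Y' Z'"
  shows "seq_iso C (X', i', Y', p', Z') (X, i, Y, p, Z)"
proof -
  obtain a b c where a: "is_iso C X X' a" and b: "is_iso C Y Y' b" and c: "is_iso C Z Z' c"
    and bi: "Comp C X Y Y' b i = Comp C X X' Y' i' a"
    and cp: "Comp C Y Z Z' c p = Comp C Y Y' Z' p' b"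
    using assms(1) by (auto simp: seq_iso_def)
  obtain a' where a' [simp]: "X \<in> Ob C" "X' \<in> Ob C" "a \<in> mor C X X'" "a' \<in> mor C X' X"
    "is_iso C X' X a'" "Comp C X X' X a' a = Idn C X" "Comp C X' X X' a a' = Idn C X'"
    using a by (rule is_isoE)
  obtain b' where b' [simp]: "Y \<in> Ob C" "Y' \<in> Ob C" "b \<in> mor C Y Y'" "b' \<in> mor C Y' Y"
    "is_iso C Y' Y b'" "Comp C Y Y' Y b' b = Idn C Y" "Comp C Y' Y Y' b b' = Idn C Y'"
    using b by (rule is_isoE)
  obtain c' where c' [simp]: "Z \<in> Ob C" "Z' \<in> Ob C" "c \<in> mor C Z Z'" "c' \<in> mor C Z' Z"
    "is_iso C Z' Z c'" "Comp C Z Z' Z c' c = Idn C Z" "Comp C Z' Z Z' c c' = Idn C Z'"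
    using c by (rule is_isoE)
  note [simp] = a'(6,7)[THEN reassoc] b'(6,7)[THEN reassoc] c'(6,7)[THEN reassoc]
  have i': "i' = Comp C X' Y Y' b (Comp C X' X Y i a')"
    using bi[THEN reassoc, of X' a'] by simp
  have p': "p' = Comp C Y' Z Z' c (Comp C Y' Y Z p b')"
    using cp[THEN reassoc, of Y' b'] by simp
  have "Comp C X' Y' Y b' i' = Comp C X' X Y i a'" "Comp C Y' Z' Z c' p' = Comp C Y' Y Z p b'"
    unfolding i' p' by simp_all
  then show ?thesis unfolding seq_iso_def split using a'(5) b'(5) c'(5) by metis
qed

lemma biproductD:
  assumes "is_biproduct C X Y B i1 i2 p1 p2"
  shows "X \<in> Ob C" "Y \<in> Ob C" "B \<in> Ob C" "i1 \<in> mor C X B" "i2 \<in> mor C Y B"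
     "p1 \<in> mor C B X" "p2 \<in> mor C B Y"
     "Comp C X B X p1 i1 = Idn C X" "Comp C Y B Y p2 i2 = Idn C Y"
     "Comp C Y B X p1 i2 = zmor C Y X" "Comp C X B Y p2 i1 = zmor C X Y"
     "madd C B B (Comp C B X B i1 p1) (Comp C B Y B i2 p2) = Idn C B"
  using assms by (auto simp: is_biproduct_def)

lemma biproduct_expand:
  assumes b: "is_biproduct C X Y B i1 i2 p1 p2" and [simp]: "W \<in> Ob C" "f \<in> mor C W B"
  shows "madd C W B (Comp C W X B i1 (Comp C W B X p1 f)) (Comp C W Y B i2 (Comp C W B Y p2 f)) = f"
proof -
  note [simp] = biproductD(1-7)[OF b]
  have "Comp C W B B (madd C B B (Comp C B X B i1 p1) (Comp C B Y B i2 p2)) f = f"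
    using biproductD(12)[OF b] by simp
  then show ?thesis by simp
qed

text \<open>Equality of matrices column by column; with \<open>biproduct_eq_toI\<close>, row by row,
  it is the standard way to verify formulas on split middle terms.\<close>

lemma biproduct_eq_fromI:
  assumes b: "is_biproduct C X Y B i1 i2 p1 p2"
    and eq: "Comp C X B W u i1 = Comp C X B W v i1" "Comp C Y B W u i2 = Comp C Y B W v i2"
    and [simp]: "W \<in> Ob C" "u \<in> mor C B W" "v \<in> mor C B W"
  shows "u = v"
proof -
  note [simp] = biproductD(1-7)[OF b]
  have e: "w = madd C B W (Comp C B X W (Comp C X B W w i1) p1) (Comp C B Y W (Comp C Y B W w i2) p2)"
    if [simp]: "w \<in> mor C B W" for w
    using comp_id_right[of B W w] unfolding biproductD(12)[OF b, symmetric] by simp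
  show ?thesis using e[of u] e[of v] eq by simp
qed

lemma biproduct_eq_toI:
  assumes b: "is_biproduct C X Y B i1 i2 p1 p2"
    and eq: "Comp C W B X p1 u = Comp C W B X p1 v" "Comp C W B Y p2 u = Comp C W B Y p2 v"
    and [simp]: "W \<in> Ob C" "u \<in> mor C W B" "v \<in> mor C W B"
  shows "u = v"
  using biproduct_expand[OF b, of W u] biproduct_expand[OF b, of W v] unfolding eq by simp

end

section \<open>Conflations: cokernels, pushouts, biproducts and Noether's isomorphism\<close>

context exact_structure
begin

lemma conflationD:
  assumes "(X, i, Y, p, Z) \<in> E"
  shows "X \<in> Ob C" "Y \<in> Ob C" "Z \<in> Ob C" "i \<in> mor C X Y" "p \<in> mor C Y Z"
    "is_kernel C X Y Z i p" "is_cokernel C X Y Z i p" "Comp C X Y Z p i = zmor C X Z"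
  by (rule kernel_cokernelD[OF subsetD[OF conflation_kernel_cokernel assms]])+

lemma inflationD:
  assumes "inflation E X Y i"
  shows "X \<in> Ob C" "Y \<in> Ob C" "i \<in> mor C X Y"
  using assms conflationD by (auto simp: inflation_def)

lemma conflation_kernel:
  assumes "(X, i, Y, p, Z) \<in> E" "W \<in> Ob C" "h \<in> mor C W Y" "Comp C W Y Z p h = zmor C W Z"
  obtains u where "u \<in> mor C W X" "Comp C W X Y i u = h"
  using conflationD(6)[OF assms(1)] assms(2-) unfolding is_kernel_def by metis

lemma conflation_cokernel:
  assumes "(X, i, Y, p, Z) \<in> E" "W \<in> Ob C" "h \<in> mor C Y W" "Comp C X Y W h i = zmor C X W"
  obtains u where "u \<in> mor C Z W" "Comp C Y Z W u p = h"
  using conflationD(7)[OF assms(1)] assms(2-) unfolding is_cokernel_def by metis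

lemma inflation_mono:
  assumes "(X, i, Y, p, Z) \<in> E" "Comp C W X Y i u = Comp C W X Y i v"
    "W \<in> Ob C" "u \<in> mor C W X" "v \<in> mor C W X"
  shows "u = v"
  using kernel_mono[OF conflationD(6)[OF assms(1)]] conflationD(1-5)[OF assms(1)] assms(2-) by blast

lemma deflation_epi:
  assumes "(X, i, Y, p, Z) \<in> E" "Comp C Y Z W u p = Comp C Y Z W v p"
    "W \<in> Ob C" "u \<in> mor C Z W" "v \<in> mor C Z W"
  shows "u = v"
  using cokernel_epi[OF conflationD(7)[OF assms(1)]] conflationD(1-5)[OF assms(1)] assms(2-) by blast

lemma conflation_isoI:
  assumes s: "(X, i, Y, p, Z) \<in> E"
    and abc: "is_iso C X X' a" "is_iso C Y Y' b" "is_iso C Z Z' c"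
      "i' \<in> mor C X' Y'" "p' \<in> mor C Y' Z'"
      "Comp C X Y Y' b i = Comp C X X' Y' i' a" "Comp C Y Z Z' c p = Comp C Y Y' Z' p' b"
  shows "(X', i', Y', p', Z') \<in> E"
proof (rule conflation_iso[OF s])
  show "(X', i', Y', p', Z') \<in> kernel_cokernel_pairs C"
    using s conflation_kernel_cokernel by (intro kernel_cokernel_iso[OF _ abc]) auto
  show "seq_iso C (X, i, Y, p, Z) (X', i', Y', p', Z')"
    unfolding seq_iso_def using abc by blast
qed

text \<open>Cokernels are unique up to isomorphism, so the given one may replace the one that
  witnesses the inflation.\<close>

lemma conflation_cokernelI:
  assumes "inflation E X Y i" and cok: "is_cokernel C X Y Z i p" and [simp]: "Z \<in> Ob C" "p \<in> mor C Y Z"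
  shows "(X, i, Y, p, Z) \<in> E"
proof -
  obtain q Q where q: "(X, i, Y, q, Q) \<in> E" using assms(1) by (auto simp: inflation_def)
  note [simp] = conflationD(1-5)[OF q]
  have pi: "Comp C X Y Z p i = zmor C X Z" using cok by (simp add: is_cokernel_def)
  obtain t where t [simp]: "t \<in> mor C Q Z" "Comp C Y Q Z t q = p"
    by (rule conflation_cokernel[OF q _ _ pi]) simp_all
  obtain s where s [simp]: "s \<in> mor C Z Q" "Comp C Y Z Q s p = q"
    by (rule cokernel_ex[OF cok, of Q q]) (simp_all add: conflationD(8)[OF q])
  have "Comp C Q Z Q s t = Idn C Q" by (rule deflation_epi[OF q, where W = Q]) simp_all
  moreover have "Comp C Z Q Z t s = Idn C Z" by (rule cokernel_epi[OF cok, where W = Z]) simp_all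
  ultimately have t_iso: "is_iso C Q Z t" by (intro is_isoI[of _ _ _ s]) simp_all
  show ?thesis
    by (rule conflation_isoI[OF q is_iso_id is_iso_id t_iso]) simp_all
qed

lemma pushout_inflation:
  assumes i: "inflation E X Y i" and f: "X' \<in> Ob C" "f \<in> mor C X X'"
    and po: "is_pushout C X Y X' P i f f' i'"
  shows "inflation E X' P i'"
proof -
  note [simp] = f inflationD[OF i] pushoutD(1-3)[OF po]
  obtain Q g' j' where Q: "is_pushout C X Y X' Q i f g' j'" and "inflation E X' Q j'"
    using inflation_pushout[OF i f] by blast
  then obtain q Z where q: "(X', j', Q, q, Z) \<in> E" by (auto simp: inflation_def)
  note [simp] = conflationD(1-5)[OF q]
  obtain t where t: "is_iso C Q P t" "Comp C Y Q P t g' = f'" "Comp C X' Q P t j' = i'"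
    by (rule pushout_unique[OF Q po]) simp_all
  then obtain t' where t' [simp]: "t \<in> mor C Q P" "t' \<in> mor C P Q" "Comp C Q P Q t' t = Idn C Q"
    using is_isoE by metis
  have "(X', i', P, Comp C P Q Z q t', Z) \<in> E"
    by (rule conflation_isoI[OF q is_iso_id t(1) is_iso_id]) (simp_all add: t(3))
  then show ?thesis by (auto simp: inflation_def)
qed

text \<open>A pushout keeps the cokernel: a map on \<open>P\<close> that kills \<open>i'\<close> is
  determined by its restriction to \<open>Y\<close>, which kills \<open>i\<close> and therefore
  descends to \<open>Z\<close>.\<close>

lemma pushout_conflation:
  assumes i: "(X, i, Y, p, Z) \<in> E" and f [simp]: "X' \<in> Ob C" "f \<in> mor C X X'"
    and po: "is_pushout C X Y X' P i f f' i'"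
    and q [simp]: "q \<in> mor C P Z" "Comp C Y P Z q f' = p" "Comp C X' P Z q i' = zmor C X' Z"
  shows "(X', i', P, q, Z) \<in> E"
proof (rule conflation_cokernelI)
  note [simp] = conflationD(1-5)[OF i] pushoutD(1-3)[OF po]
  have "inflation E X Y i" using i by (auto simp: inflation_def)
  then show "inflation E X' P i'" by (rule pushout_inflation[OF _ f po])
  have "\<exists>!u. u \<in> mor C Z W \<and> Comp C P Z W u q = h"
    if [simp]: "W \<in> Ob C" "h \<in> mor C P W" and h: "Comp C X' P W h i' = zmor C X' W" for W h
  proof -
    have "Comp C X Y W (Comp C Y P W h f') i = zmor C X W"
      using h[THEN reassoc, of X f] by (simp add: pushoutD(4)[OF po])
    then obtain u where u [simp]: "u \<in> mor C Z W" "Comp C Y Z W u p = Comp C Y P W h f'"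
      by (rule conflation_cokernel[OF i, of W, rotated 2]) simp_all
    have "Comp C P Z W u q = h"
      by (rule pushout_eqI[OF po, where W = W]) (simp_all add: h)
    moreover have "v = u" if v: "v \<in> mor C Z W" "Comp C P Z W v q = h" for v
    proof (rule deflation_epi[OF i, where W = W])
      have "Comp C Y P W (Comp C P Z W v q) f' = Comp C Y Z W v p" using v(1) by simp
      then show "Comp C Y Z W v p = Comp C Y Z W u p" by (simp add: v(2))
    qed (use v in simp_all)
    ultimately show ?thesis using u(1) by blast
  qed
  then show "is_cokernel C X' P Z i' q" by (simp add: is_cokernel_def)
  show "Z \<in> Ob C" by simp
qed simp

text \<open>A biproduct is the pushout of two maps out of a zero object, and a conflation that ends
  in an identity provides such an object as its first term.\<close>

lemma biproduct_inflation:
  assumes b: "is_biproduct C X Y B i1 i2 p1 p2"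
  shows "inflation E X B i1"
proof -
  note [simp] = biproductD(1-11)[OF b] biproductD(8-11)[OF b, THEN reassoc]
  obtain k K where k: "(K, k, Y, Idn C Y, Y) \<in> E"
    using deflation_id[of Y] by (auto simp: deflation_def)
  note [simp] = conflationD(1-5)[OF k]
  \<comment> \<open>The kernel map of an identity is both zero and monic, so its source is a zero
    object.\<close>
  have k0: "k = zmor C K Y" using conflationD(8)[OF k] by simp
  have "Idn C K = zmor C K K" by (rule inflation_mono[OF k, where W = K]) (simp_all add: k0)
  then have "is_zero_object C K" by (simp add: zero_object_Idn)
  have "is_pushout C K Y X B k (zmor C K X) i2 i1"
    unfolding is_pushout_def
  proof (intro conjI ballI impI)
    fix W g h assume [simp]: "W \<in> Ob C" "g \<in> mor C Y W" "h \<in> mor C X W"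
    show "\<exists>!u. u \<in> mor C B W \<and> Comp C Y B W u i2 = g \<and> Comp C X B W u i1 = h"
    proof (rule ex1I[of _ "madd C B W (Comp C B X W h p1) (Comp C B Y W g p2)"])
      fix u assume "u \<in> mor C B W \<and> Comp C Y B W u i2 = g \<and> Comp C X B W u i1 = h"
      then show "u = madd C B W (Comp C B X W h p1) (Comp C B Y W g p2)"
        by (intro biproduct_eq_fromI[OF b, where W = W and u = u]) simp_all
    qed simp
  qed (simp_all add: k0)
  then show ?thesis
    by (rule pushout_inflation[rotated 3]) (use k in \<open>auto simp: inflation_def\<close>)
qed

text \<open>The map with components \<open>i\<close> and \<open>u\<close> is the graph of
  \<open>u\<close>, into the sum of \<open>X\<close> and \<open>Z\<close>, followed by the sum of
  \<open>i\<close> and an identity, which is a pushout of \<open>i\<close>.\<close>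

lemma inflation_into_biproduct:
  assumes i: "inflation E X Y i" and [simp]: "u \<in> mor C X Z" and b: "is_biproduct C Y Z B i1 i2 p1 p2"
  shows "inflation E X B (madd C X B (Comp C X Y B i1 i) (Comp C X Z B i2 u))"
proof -
  note [simp] = inflationD[OF i] biproductD(1-11)[OF b] biproductD(8-11)[OF b, THEN reassoc]
  obtain D j1 j2 q1 q2 where d: "is_biproduct C X Z D j1 j2 q1 q2"
    using ex_biproduct[of X Z] by auto
  note [simp] = biproductD(1-11)[OF d] biproductD(8-11)[OF d, THEN reassoc]
  let ?e = "madd C X D j1 (Comp C X Z D j2 u)"
  let ?j = "madd C D B (Comp C D Y B i1 (Comp C D X Y i q1)) (Comp C D Z B i2 q2)"
  \<comment> \<open>Shearing the biproduct by \<open>u\<close> turns the graph into a coordinate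
    inclusion.\<close>
  have "is_biproduct C X Z D ?e j2 q1 (madd C D Z q2 (mneg C D Z (Comp C D X Z u q1)))"
    unfolding is_biproduct_def using biproductD(12)[OF d] by (simp add: madd_ac)
  then have e: "inflation E X D ?e" by (rule biproduct_inflation)
  have "is_pushout C X Y D B i j1 i1 ?j"
    unfolding is_pushout_def
  proof (intro conjI ballI impI)
    fix W g h assume [simp]: "W \<in> Ob C" "g \<in> mor C Y W" "h \<in> mor C D W"
      and eq: "Comp C X Y W g i = Comp C X D W h j1"
    show "\<exists>!v. v \<in> mor C B W \<and> Comp C Y B W v i1 = g \<and> Comp C D B W v ?j = h"
    proof (rule ex1I[of _ "madd C B W (Comp C B Y W g p1) (Comp C B D W h (Comp C B Z D j2 p2))"])
      let ?v = "madd C B W (Comp C B Y W g p1) (Comp C B D W h (Comp C B Z D j2 p2))"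
      have "Comp C D B W ?v ?j = h"
        by (rule biproduct_eq_fromI[OF d, where W = W]) (simp_all add: eq eq[THEN reassoc])
      then show "?v \<in> mor C B W \<and> Comp C Y B W ?v i1 = g \<and> Comp C D B W ?v ?j = h" by simp
    next
      fix v assume v: "v \<in> mor C B W \<and> Comp C Y B W v i1 = g \<and> Comp C D B W v ?j = h"
      then have [simp]: "v \<in> mor C B W" "Comp C Y B W v i1 = g" by auto
      have "Comp C Z D W (Comp C D B W v ?j) j2 = Comp C Z D W h j2" using v by simp
      then show "v = madd C B W (Comp C B Y W g p1) (Comp C B D W h (Comp C B Z D j2 p2))"
        by (intro biproduct_eq_fromI[OF b, where W = W and u = v]) simp_all
    qed
  qed simp_all
  then have "inflation E D B ?j" by (rule pushout_inflation[rotated 3]) (use i in simp_all)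
  from inflation_comp[OF e this] show ?thesis by (simp add: madd_ac)
qed

text \<open>\<open>P\<close> is the pushout of \<open>v\<close> along \<open>i\<close> and plays the
  role of Z / X. A map on \<open>Z\<close> that kills \<open>X\<close> induces on \<open>Y\<close> a
  map through Z' = Y / X, and the two glue on \<open>P\<close>; hence \<open>P\<close> is also the
  cokernel of the composite.\<close>

lemma noether:
  assumes u: "(X, u, Y, i, Z') \<in> E" and v: "(Y, v, Z, j, X') \<in> E"
  obtains P f k g where "(X, Comp C X Y Z v u, Z, k, P) \<in> E" "(Z', f, P, g, X') \<in> E"
    "Comp C Y Z' P f i = Comp C Y Z P k v" "Comp C Z P X' g k = j"
proof -
  note [simp] = conflationD(1-5)[OF u] conflationD(1-5)[OF v]
  have iu: "inflation E X Y u" and iv: "inflation E Y Z v" using u v by (auto simp: inflation_def)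
  obtain P k f where po: "is_pushout C Y Z Z' P v i k f"
    using inflation_pushout[OF iv, of Z' i] by auto
  note [simp] = pushoutD(1-3)[OF po]
  obtain g where g [simp]: "g \<in> mor C P X'" "Comp C Z P X' g k = j" "Comp C Z' P X' g f = zmor C Z' X'"
    by (rule pushout_ex[OF po, of X' j "zmor C Z' X'"]) (simp_all add: conflationD(8)[OF v])
  have 1: "(Z', f, P, g, X') \<in> E"
    by (rule pushout_conflation[OF v _ _ po]) simp_all
  have 2: "(X, Comp C X Y Z v u, Z, k, P) \<in> E"
  proof (rule conflation_cokernelI)
    show "inflation E X Z (Comp C X Y Z v u)" using iu iv by (rule inflation_comp)
    have "\<exists>!w. w \<in> mor C P W \<and> Comp C Z P W w k = h"
      if [simp]: "W \<in> Ob C" "h \<in> mor C Z W" and h: "Comp C X Z W h (Comp C X Y Z v u) = zmor C X W" for W h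
    proof -
      have "Comp C X Y W (Comp C Y Z W h v) u = zmor C X W" using h by simp
      then obtain t where t [simp]: "t \<in> mor C Z' W" "Comp C Y Z' W t i = Comp C Y Z W h v"
        by (rule conflation_cokernel[OF u, of W, rotated 2]) simp_all
      obtain w where w: "w \<in> mor C P W" "Comp C Z P W w k = h" "Comp C Z' P W w f = t"
        by (rule pushout_ex[OF po, of W h t]) simp_all
      have "w' = w" if w': "w' \<in> mor C P W" "Comp C Z P W w' k = h" for w'
      proof (rule pushout_eqI[OF po, where W = W])
        have "Comp C Y Z' W (Comp C Z' P W w' f) i = Comp C Y Z' W t i"
          using w' pushoutD(4)[OF po, symmetric] w'(2)[THEN reassoc, of Y v] by simp
        then have "Comp C Z' P W w' f = t" by (rule deflation_epi[OF u]) (simp_all add: w')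
        then show "Comp C Z' P W w' f = Comp C Z' P W w f" by (simp add: w)
      qed (use w w' in simp_all)
      then show ?thesis using w by blast
    qed
    moreover have "Comp C X Z P k (Comp C X Y Z v u) = zmor C X P"
      using pushoutD(4)[OF po] by (simp add: pushoutD(4)[OF po, THEN reassoc] conflationD(8)[OF u])
    ultimately show "is_cokernel C X Z P (Comp C X Y Z v u) k" by (simp add: is_cokernel_def)
  qed simp_all
  show ?thesis by (rule that[OF 2 1]) (simp_all add: pushoutD(4)[OF po])
qed

lemma injective_extend:
  assumes "injective_object C E J" "(X, i, Y, p, Z) \<in> E" "f \<in> mor C X J"
  obtains g where "g \<in> mor C Y J" "Comp C X Y J g i = f"
  using assms unfolding injective_object_def inflation_def by metis

lemma projective_lift:
  assumes "projective_object C E P" "(X, i, Y, p, Z) \<in> E" "f \<in> mor C P Z"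
  obtains g where "g \<in> mor C P Y" "Comp C P Y Z p g = f"
  using assms unfolding projective_object_def deflation_def by metis

lemma injective_biproduct:
  assumes J: "injective_object C E J" "injective_object C E J'" and b: "is_biproduct C J J' B i1 i2 p1 p2"
  shows "injective_object C E B"
proof -
  note [simp] = biproductD(1-11)[OF b]
  have "\<exists>g\<in>mor C Y B. Comp C X Y B g i = f"
    if i: "inflation E X Y i" and f [simp]: "f \<in> mor C X B" for X Y i f
  proof -
    note [simp] = inflationD[OF i]
    obtain g where [simp]: "g \<in> mor C Y J" "Comp C X Y J g i = Comp C X B J p1 f"
      using J(1) i unfolding injective_object_def by (metis biproductD(1,3,6)[OF b] comp_mor inflationD(1)[OF i] f)
    obtain g' where [simp]: "g' \<in> mor C Y J'" "Comp C X Y J' g' i = Comp C X B J' p2 f"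
      using J(2) i unfolding injective_object_def by (metis biproductD(2,3,7)[OF b] comp_mor inflationD(1)[OF i] f)
    show ?thesis
      by (rule bexI[of _ "madd C Y B (Comp C Y J B i1 g) (Comp C Y J' B i2 g')"])
        (simp_all add: biproduct_expand[OF b])
  qed
  then show ?thesis by (simp add: injective_object_def)
qed

end

section \<open>Triangulations generated by basic triangles\<close>

context preadditive_category
begin

text \<open>Inverts the vertical arrows of a commutative square; a left inverse on one side and a
  right inverse on the other are enough.\<close>

lemma iso_square_inverse:
  assumes "Comp C X Y Y' g u = Comp C X X' Y' u' f" "Comp C Y Y' Y g' g = Idn C Y"
    "Comp C X' X X' f f' = Idn C X'"
    and [simp]: "X \<in> Ob C" "Y \<in> Ob C" "X' \<in> Ob C" "Y' \<in> Ob C" "u \<in> mor C X Y" "u' \<in> mor C X' Y'"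
      "f \<in> mor C X X'" "g \<in> mor C Y Y'" "f' \<in> mor C X' X" "g' \<in> mor C Y' Y"
  shows "Comp C X' Y' Y g' u' = Comp C X' X Y u f'"
proof -
  have "Comp C X' Y' Y g' u' = Comp C X' Y' Y g' (Comp C X' X' Y' u' (Comp C X' X X' f f'))"
    by (simp add: assms(3))
  also have "\<dots> = Comp C X' X Y (Comp C X Y' Y g' (Comp C X X' Y' u' f)) f'"
    by simp
  also have "\<dots> = Comp C X' X Y u f'"
    unfolding assms(1)[symmetric] by (simp add: assms(2)[THEN reassoc])
  finally show ?thesis .
qed

end

lemma triangles_iff [simp]:
  "(X, Y, Z, u, v, w) \<in> triangles T So \<longleftrightarrow> X \<in> Ob T \<and> Y \<in> Ob T \<and> Z \<in> Ob T \<and>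
     u \<in> mor T X Y \<and> v \<in> mor T Y Z \<and> w \<in> mor T Z (So X)"
  by (simp add: triangles_def)

definition triangle_closure ::
    "('o, 'm) cat \<Rightarrow> ('o \<Rightarrow> 'o) \<Rightarrow> ('o \<Rightarrow> 'o \<Rightarrow> 'm \<Rightarrow> 'm) \<Rightarrow> ('o, 'm) triangle set \<Rightarrow> ('o, 'm) triangle set"
  where "triangle_closure T So Sm D = {t \<in> triangles T So. \<exists>s\<in>D. triangle_iso T So Sm s t}"

text \<open>The conclusion of the octahedral axiom for given cones, kept separate so that it can be
  moved along isomorphisms of the composable pair.\<close>

definition octahedron ::
    "('o, 'm) cat \<Rightarrow> ('o \<Rightarrow> 'o) \<Rightarrow> ('o \<Rightarrow> 'o \<Rightarrow> 'm \<Rightarrow> 'm) \<Rightarrow> ('o, 'm) triangle set \<Rightarrow>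
     'o \<Rightarrow> 'o \<Rightarrow> 'o \<Rightarrow> 'm \<Rightarrow> 'm \<Rightarrow> 'o \<Rightarrow> 'm \<Rightarrow> 'm \<Rightarrow> 'o \<Rightarrow> 'm \<Rightarrow> 'm \<Rightarrow> 'o \<Rightarrow> 'm \<Rightarrow> 'm \<Rightarrow> 'm \<Rightarrow> 'm \<Rightarrow> bool"
  where "octahedron T So Sm \<Delta> X Y Z u v Z' i i' X' j j' Y' k k' f g \<longleftrightarrow>
     (Z', Y', X', f, g, Comp T X' (So Y) (So Z') (Sm Y Z' i) j') \<in> \<Delta> \<and>
     Comp T Y Z' Y' f i = Comp T Y Z Y' k v \<and>
     Comp T Z' Y' (So X) k' f = i' \<and>
     Comp T Z Y' X' g k = j \<and>
     Comp T Y' X' (So Y) j' g = Comp T Y' (So X) (So Y) (Sm X Y u) k'"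

text \<open>The axioms are those that can be checked on representatives of stable maps. Rotation is
  required in one direction, the weak cokernel property replaces exactness of Hom, and the
  octahedron is demanded only for some pair isomorphic to the given one, which leaves room to
  replace both maps by inflations.\<close>

locale pretriangulation = additive_category T + additive_functor T T So Sm
  for T :: "('o, 'm) cat" and So :: "'o \<Rightarrow> 'o" and Sm :: "'o \<Rightarrow> 'o \<Rightarrow> 'm \<Rightarrow> 'm" +
  fixes D :: "('o, 'm) triangle set"
  assumes shift_full: "\<lbrakk>X \<in> Ob T; Y \<in> Ob T; g \<in> mor T (So X) (So Y)\<rbrakk> \<Longrightarrow> \<exists>f\<in>mor T X Y. Sm X Y f = g"
    and shift_faithful: "\<lbrakk>X \<in> Ob T; Y \<in> Ob T; f \<in> mor T X Y; f' \<in> mor T X Y; Sm X Y f = Sm X Y f'\<rbrakk> \<Longrightarrow> f = f'"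
    and shift_surj: "Y \<in> Ob T \<Longrightarrow> \<exists>X\<in>Ob T. \<exists>e. is_iso T (So X) Y e"
    and basic_triangles: "D \<subseteq> triangles T So"
    and basic_ex: "\<lbrakk>X \<in> Ob T; Y \<in> Ob T; u \<in> mor T X Y\<rbrakk> \<Longrightarrow> \<exists>Z v w. (X, Y, Z, u, v, w) \<in> D"
    and basic_id: "X \<in> Ob T \<Longrightarrow> \<exists>Z v w. is_zero_object T Z \<and> (X, X, Z, Idn T X, v, w) \<in> D"
    and basic_zero: "(X, Y, Z, u, v, w) \<in> D \<Longrightarrow> Comp T X Y Z v u = zmor T X Z"
    and basic_weak_cokernel: "\<lbrakk>(X, Y, Z, u, v, w) \<in> D; W \<in> Ob T; k \<in> mor T Y W; Comp T X Y W k u = zmor T X W\<rbrakk>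
      \<Longrightarrow> \<exists>l\<in>mor T Z W. Comp T Y Z W l v = k"
    and basic_rotate: "(X, Y, Z, u, v, w) \<in> D
      \<Longrightarrow> (Y, Z, So X, v, w, mneg T (So X) (So Y) (Sm X Y u)) \<in> triangle_closure T So Sm D"
    and basic_morphism: "\<lbrakk>(X, Y, Z, u, v, w) \<in> D; (X', Y', Z', u', v', w') \<in> D;
        f \<in> mor T X X'; g \<in> mor T Y Y'; Comp T X Y Y' g u = Comp T X X' Y' u' f\<rbrakk>
      \<Longrightarrow> \<exists>h. triangle_mor T So Sm (X, Y, Z, u, v, w) (X', Y', Z', u', v', w') f g h"
    and basic_octahedron: "\<lbrakk>X \<in> Ob T; Y \<in> Ob T; Z \<in> Ob T; u \<in> mor T X Y; v \<in> mor T Y Z\<rbrakk>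
      \<Longrightarrow> \<exists>Y1 Z1 a b u1 v1 Z' i i' X' j j' Y' k k' f g. is_iso T Y Y1 a \<and> is_iso T Z Z1 b \<and>
        u1 = Comp T X Y Y1 a u \<and> Comp T Y Y1 Z1 v1 a = Comp T Y Z Z1 b v \<and>
        (X, Y1, Z', u1, i, i') \<in> triangle_closure T So Sm D \<and>
        (Y1, Z1, X', v1, j, j') \<in> triangle_closure T So Sm D \<and>
        (X, Z1, Y', Comp T X Y1 Z1 v1 u1, k, k') \<in> triangle_closure T So Sm D \<and>
        octahedron T So Sm (triangle_closure T So Sm D) X Y1 Z1 u1 v1 Z' i i' X' j j' Y' k k' f g"
begin

abbreviation "\<Delta> \<equiv> triangle_closure T So Sm D"

declare functor_ob [simp] functor_mor [simp] functor_id [simp] functor_comp [simp] functor_add [simp]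

lemma is_iso_shift:
  assumes "is_iso T X Y f" shows "is_iso T (So X) (So Y) (Sm X Y f)"
proof -
  obtain g where [simp]: "X \<in> Ob T" "Y \<in> Ob T" "f \<in> mor T X Y" "g \<in> mor T Y X" "is_iso T Y X g"
    and "Comp T X Y X g f = Idn T X" "Comp T Y X Y f g = Idn T Y"
    using assms by (rule is_isoE)
  then show ?thesis
    by (intro is_isoI[of _ _ _ "Sm Y X g"]) (simp_all flip: functor_comp)
qed

lemma is_iso_shiftD:
  assumes iso: "is_iso T (So X) (So Y) (Sm X Y f)" and [simp]: "X \<in> Ob T" "Y \<in> Ob T" "f \<in> mor T X Y"
  shows "is_iso T X Y f"
proof -
  obtain g where g: "g \<in> mor T (So Y) (So X)"
    "Comp T (So X) (So Y) (So X) g (Sm X Y f) = Idn T (So X)"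
    "Comp T (So Y) (So X) (So Y) (Sm X Y f) g = Idn T (So Y)"
    using is_isoE[OF iso] by metis
  obtain g' where [simp]: "g' \<in> mor T Y X" and g': "Sm Y X g' = g"
    using shift_full[OF _ _ g(1)] by auto
  have "Comp T X Y X g' f = Idn T X" by (rule shift_faithful[of X X]) (simp_all add: g g')
  moreover have "Comp T Y X Y f g' = Idn T Y" by (rule shift_faithful[of Y Y]) (simp_all add: g g')
  ultimately show ?thesis by (intro is_isoI[of _ _ _ g']) simp_all
qed

lemma triangle_isoE:
  assumes "triangle_iso T So Sm (X, Y, Z, u, v, w) (X', Y', Z', u', v', w')"
    and [simp]: "(X, Y, Z, u, v, w) \<in> triangles T So" "(X', Y', Z', u', v', w') \<in> triangles T So"
  obtains f g h f' g' h' where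
    "f \<in> mor T X X'" "g \<in> mor T Y Y'" "h \<in> mor T Z Z'" "f' \<in> mor T X' X" "g' \<in> mor T Y' Y" "h' \<in> mor T Z' Z"
    "is_iso T X X' f" "is_iso T Y Y' g" "is_iso T Z Z' h"
    "is_iso T X' X f'" "is_iso T Y' Y g'" "is_iso T Z' Z h'"
    "Comp T X X' X f' f = Idn T X" "Comp T X' X X' f f' = Idn T X'"
    "Comp T Y Y' Y g' g = Idn T Y" "Comp T Y' Y Y' g g' = Idn T Y'"
    "Comp T Z Z' Z h' h = Idn T Z" "Comp T Z' Z Z' h h' = Idn T Z'"
    "Comp T X Y Y' g u = Comp T X X' Y' u' f" "Comp T Y Z Z' h v = Comp T Y Y' Z' v' g"
    "Comp T Z (So X) (So X') (Sm X X' f) w = Comp T Z Z' (So X') w' h"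
    "Comp T X' Y' Y g' u' = Comp T X' X Y u f'" "Comp T Y' Z' Z h' v' = Comp T Y' Y Z v g'"
    "Comp T Z' (So X') (So X) (Sm X' X f') w' = Comp T Z' Z (So X) w h'"
proof -
  obtain f g h where f: "is_iso T X X' f" and g: "is_iso T Y Y' g" and h: "is_iso T Z Z' h"
    and tm: "triangle_mor T So Sm (X, Y, Z, u, v, w) (X', Y', Z', u', v', w') f g h"
    using assms(1) by (auto simp: triangle_iso_def)
  note eqs = tm[unfolded triangle_mor_def split]
  obtain f' where f' [simp]: "X \<in> Ob T" "X' \<in> Ob T" "f \<in> mor T X X'" "f' \<in> mor T X' X"
    "is_iso T X' X f'" "Comp T X X' X f' f = Idn T X" "Comp T X' X X' f f' = Idn T X'"
    using f by (rule is_isoE)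
  obtain g' where g' [simp]: "Y \<in> Ob T" "Y' \<in> Ob T" "g \<in> mor T Y Y'" "g' \<in> mor T Y' Y"
    "is_iso T Y' Y g'" "Comp T Y Y' Y g' g = Idn T Y" "Comp T Y' Y Y' g g' = Idn T Y'"
    using g by (rule is_isoE)
  obtain h' where h' [simp]: "Z \<in> Ob T" "Z' \<in> Ob T" "h \<in> mor T Z Z'" "h' \<in> mor T Z' Z"
    "is_iso T Z' Z h'" "Comp T Z Z' Z h' h = Idn T Z" "Comp T Z' Z Z' h h' = Idn T Z'"
    using h by (rule is_isoE)
  have [simp]: "u \<in> mor T X Y" "v \<in> mor T Y Z" "w \<in> mor T Z (So X)"
     "u' \<in> mor T X' Y'" "v' \<in> mor T Y' Z'" "w' \<in> mor T Z' (So X')"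
    using assms(2,3) by simp_all
  have 1: "Comp T X' Y' Y g' u' = Comp T X' X Y u f'"
    by (rule iso_square_inverse[of _ _ _ g _ _ _ f]) (use eqs in simp_all)
  have 2: "Comp T Y' Z' Z h' v' = Comp T Y' Y Z v g'"
    by (rule iso_square_inverse[of _ _ _ h _ _ _ g]) (use eqs in simp_all)
  have 3: "Comp T Z' (So X') (So X) (Sm X' X f') w' = Comp T Z' Z (So X) w h'"
    by (rule iso_square_inverse[of _ _ _ "Sm X X' f" _ _ _ h]) (use eqs in \<open>simp_all flip: functor_comp\<close>)
  show ?thesis
    by (rule that[of f g h f' g' h']) (use eqs 1 2 3 f g h in simp_all)
qed

lemma triangle_isoI:
  assumes "is_iso T X X' f" "is_iso T Y Y' g" "is_iso T Z Z' h"
    "Comp T X Y Y' g u = Comp T X X' Y' u' f" "Comp T Y Z Z' h v = Comp T Y Y' Z' v' g"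
    "Comp T Z (So X) (So X') (Sm X X' f) w = Comp T Z Z' (So X') w' h"
  shows "triangle_iso T So Sm (X, Y, Z, u, v, w) (X', Y', Z', u', v', w')"
  unfolding triangle_iso_def triangle_mor_def using assms by (auto simp: is_iso_def)

lemma triangle_iso_sym:
  assumes "triangle_iso T So Sm (X, Y, Z, u, v, w) (X', Y', Z', u', v', w')"
    and "(X, Y, Z, u, v, w) \<in> triangles T So" "(X', Y', Z', u', v', w') \<in> triangles T So"
  shows "triangle_iso T So Sm (X', Y', Z', u', v', w') (X, Y, Z, u, v, w)"
  using triangle_isoE[OF assms] triangle_isoI by metis

lemma triangle_iso_trans:
  assumes 1: "triangle_iso T So Sm (X, Y, Z, u, v, w) (X', Y', Z', u', v', w')"
    and 2: "triangle_iso T So Sm (X', Y', Z', u', v', w') (X'', Y'', Z'', u'', v'', w'')"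
    and t: "(X, Y, Z, u, v, w) \<in> triangles T So" "(X', Y', Z', u', v', w') \<in> triangles T So"
      "(X'', Y'', Z'', u'', v'', w'') \<in> triangles T So"
  shows "triangle_iso T So Sm (X, Y, Z, u, v, w) (X'', Y'', Z'', u'', v'', w'')"
proof -
  obtain f g h where fgh: "f \<in> mor T X X'" "g \<in> mor T Y Y'" "h \<in> mor T Z Z'"
    "is_iso T X X' f" "is_iso T Y Y' g" "is_iso T Z Z' h"
    "Comp T X Y Y' g u = Comp T X X' Y' u' f" "Comp T Y Z Z' h v = Comp T Y Y' Z' v' g"
    "Comp T Z (So X) (So X') (Sm X X' f) w = Comp T Z Z' (So X') w' h"
    by (rule triangle_isoE[OF 1 t(1,2)])
  obtain f' g' h' where fgh': "f' \<in> mor T X' X''" "g' \<in> mor T Y' Y''" "h' \<in> mor T Z' Z''"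
    "is_iso T X' X'' f'" "is_iso T Y' Y'' g'" "is_iso T Z' Z'' h'"
    "Comp T X' Y' Y'' g' u' = Comp T X' X'' Y'' u'' f'" "Comp T Y' Z' Z'' h' v' = Comp T Y' Y'' Z'' v'' g'"
    "Comp T Z' (So X') (So X'') (Sm X' X'' f') w' = Comp T Z' Z'' (So X'') w'' h'"
    by (rule triangle_isoE[OF 2 t(2,3)])
  note [simp] = t[unfolded triangles_iff]
  show ?thesis
    by (rule triangle_isoI[OF is_iso_comp[OF fgh(4) fgh'(4)] is_iso_comp[OF fgh(5) fgh'(5)]
          is_iso_comp[OF fgh(6) fgh'(6)]])
      (simp_all add: fgh fgh' fgh'(7-9)[THEN reassoc])
qed

lemma DeltaD:
  assumes "(X, Y, Z, u, v, w) \<in> \<Delta>"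
  shows "X \<in> Ob T" "Y \<in> Ob T" "Z \<in> Ob T" "u \<in> mor T X Y" "v \<in> mor T Y Z" "w \<in> mor T Z (So X)"
    "(X, Y, Z, u, v, w) \<in> triangles T So"
  using assms by (auto simp: triangle_closure_def)

lemma DeltaE:
  assumes "(X, Y, Z, u, v, w) \<in> \<Delta>"
  obtains X0 Y0 Z0 u0 v0 w0 where "(X0, Y0, Z0, u0, v0, w0) \<in> D" "(X0, Y0, Z0, u0, v0, w0) \<in> triangles T So"
    "triangle_iso T So Sm (X0, Y0, Z0, u0, v0, w0) (X, Y, Z, u, v, w)"
proof -
  obtain s where s: "s \<in> D" "triangle_iso T So Sm s (X, Y, Z, u, v, w)"
    using assms by (auto simp: triangle_closure_def)
  obtain X0 Y0 Z0 u0 v0 w0 where "s = (X0, Y0, Z0, u0, v0, w0)" by (cases s) auto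
  then show ?thesis using s basic_triangles by (intro that[of X0 Y0 Z0 u0 v0 w0]) auto
qed

lemma basic_Delta: "(X, Y, Z, u, v, w) \<in> D \<Longrightarrow> (X, Y, Z, u, v, w) \<in> \<Delta>"
proof -
  assume D: "(X, Y, Z, u, v, w) \<in> D"
  then have t: "(X, Y, Z, u, v, w) \<in> triangles T So" using basic_triangles by blast
  then have "triangle_iso T So Sm (X, Y, Z, u, v, w) (X, Y, Z, u, v, w)"
    by (intro triangle_isoI[of _ _ "Idn T X" _ _ "Idn T Y" _ _ "Idn T Z"] is_iso_id) simp_all
  then show ?thesis using D t by (auto simp: triangle_closure_def)
qed

lemma Delta_iso:
  assumes 1: "(X, Y, Z, u, v, w) \<in> \<Delta>"
    and 2: "triangle_iso T So Sm (X, Y, Z, u, v, w) (X', Y', Z', u', v', w')"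
    and 3: "(X', Y', Z', u', v', w') \<in> triangles T So"
  shows "(X', Y', Z', u', v', w') \<in> \<Delta>"
proof -
  obtain X0 Y0 Z0 u0 v0 w0 where 0: "(X0, Y0, Z0, u0, v0, w0) \<in> D" "(X0, Y0, Z0, u0, v0, w0) \<in> triangles T So"
    "triangle_iso T So Sm (X0, Y0, Z0, u0, v0, w0) (X, Y, Z, u, v, w)"
    by (rule DeltaE[OF 1])
  have "triangle_iso T So Sm (X0, Y0, Z0, u0, v0, w0) (X', Y', Z', u', v', w')"
    by (rule triangle_iso_trans[OF 0(3) 2 0(2) DeltaD(7)[OF 1] 3])
  then show ?thesis using 0 3 by (auto simp: triangle_closure_def)
qed

lemma Delta_zero:
  assumes 1: "(X, Y, Z, u, v, w) \<in> \<Delta>"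
  shows "Comp T X Y Z v u = zmor T X Z"
proof -
  obtain X0 Y0 Z0 u0 v0 w0 where 0: "(X0, Y0, Z0, u0, v0, w0) \<in> D" "(X0, Y0, Z0, u0, v0, w0) \<in> triangles T So"
    "triangle_iso T So Sm (X0, Y0, Z0, u0, v0, w0) (X, Y, Z, u, v, w)"
    by (rule DeltaE[OF 1])
  note [simp] = 0(2)[unfolded triangles_iff] DeltaD(1-6)[OF 1]
  obtain f g h f' g' h' where [simp]: "f \<in> mor T X0 X" "g \<in> mor T Y0 Y" "h \<in> mor T Z0 Z"
    "f' \<in> mor T X X0" "g' \<in> mor T Y Y0" "h' \<in> mor T Z Z0" and
    e: "Comp T Y0 Y Y0 g' g = Idn T Y0" "Comp T Y Y0 Y g g' = Idn T Y"
    "Comp T X Y Y0 g' u = Comp T X X0 Y0 u0 f'" "Comp T Y0 Z0 Z h v0 = Comp T Y0 Y Z v g"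
    by (rule triangle_isoE[OF 0(3,2) DeltaD(7)[OF 1]])
  have "Comp T X Y Z v u = Comp T X Y Z v (Comp T X Y0 Y g (Comp T X Y Y0 g' u))"
    by (simp add: e(2)[THEN reassoc])
  also have "\<dots> = Comp T X X0 Z (Comp T X0 Z0 Z h (Comp T X0 Y0 Z0 v0 u0)) f'"
    by (simp add: e e[THEN reassoc])
  finally show ?thesis by (simp add: basic_zero[OF 0(1)])
qed

text \<open>Together with rotation this stands in for the long exact sequence: on successive
  rotations it factors any map that vanishes on the preceding arrow.\<close>

lemma Delta_weak_cokernel:
  assumes 1: "(X, Y, Z, u, v, w) \<in> \<Delta>" and k: "Comp T X Y W k u = zmor T X W"
    and [simp]: "W \<in> Ob T" "k \<in> mor T Y W"
  obtains l where "l \<in> mor T Z W" "Comp T Y Z W l v = k"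
proof -
  obtain X0 Y0 Z0 u0 v0 w0 where 0: "(X0, Y0, Z0, u0, v0, w0) \<in> D" "(X0, Y0, Z0, u0, v0, w0) \<in> triangles T So"
    "triangle_iso T So Sm (X0, Y0, Z0, u0, v0, w0) (X, Y, Z, u, v, w)"
    by (rule DeltaE[OF 1])
  note [simp] = 0(2)[unfolded triangles_iff] DeltaD(1-6)[OF 1]
  obtain f g h f' g' h' where [simp]: "f \<in> mor T X0 X" "g \<in> mor T Y0 Y" "h \<in> mor T Z0 Z"
    "f' \<in> mor T X X0" "g' \<in> mor T Y Y0" "h' \<in> mor T Z Z0" and
    e: "Comp T Y0 Y Y0 g' g = Idn T Y0" "Comp T Y Y0 Y g g' = Idn T Y"
    "Comp T X0 Y0 Y g u0 = Comp T X0 X Y u f" "Comp T Y Z Z0 h' v = Comp T Y Y0 Z0 v0 g'"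
    by (rule triangle_isoE[OF 0(3,2) DeltaD(7)[OF 1]])
  have "Comp T X0 Y0 W (Comp T Y0 Y W k g) u0 = zmor T X0 W"
    by (simp add: e k[THEN reassoc])
  then obtain l where [simp]: "l \<in> mor T Z0 W" and l: "Comp T Y0 Z0 W l v0 = Comp T Y0 Y W k g"
    using basic_weak_cokernel[OF 0(1), of W "Comp T Y0 Y W k g"] by auto
  show ?thesis
    by (rule that[of "Comp T Z Z0 W l h'"]) (simp_all add: e l[THEN reassoc])
qed

lemma Delta_rotate:
  assumes 1: "(X, Y, Z, u, v, w) \<in> \<Delta>"
  shows "(Y, Z, So X, v, w, mneg T (So X) (So Y) (Sm X Y u)) \<in> \<Delta>"
proof -
  obtain X0 Y0 Z0 u0 v0 w0 where 0: "(X0, Y0, Z0, u0, v0, w0) \<in> D" "(X0, Y0, Z0, u0, v0, w0) \<in> triangles T So"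
    "triangle_iso T So Sm (X0, Y0, Z0, u0, v0, w0) (X, Y, Z, u, v, w)"
    by (rule DeltaE[OF 1])
  note [simp] = 0(2)[unfolded triangles_iff] DeltaD(1-6)[OF 1]
  obtain f g h where [simp]: "f \<in> mor T X0 X" "g \<in> mor T Y0 Y" "h \<in> mor T Z0 Z" and
    i: "is_iso T X0 X f" "is_iso T Y0 Y g" "is_iso T Z0 Z h" and
    e: "Comp T X0 Y0 Y g u0 = Comp T X0 X Y u f" "Comp T Y0 Z0 Z h v0 = Comp T Y0 Y Z v g"
      "Comp T Z0 (So X0) (So X) (Sm X0 X f) w0 = Comp T Z0 Z (So X) w h"
    by (rule triangle_isoE[OF 0(3,2) DeltaD(7)[OF 1]])
  have "Comp T (So X0) (So Y0) (So Y) (Sm Y0 Y g) (Sm X0 Y0 u0) = Comp T (So X0) (So X) (So Y) (Sm X Y u) (Sm X0 X f)"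
    using e(1) by (simp flip: functor_comp)
  then show ?thesis
    by (intro Delta_iso[OF basic_rotate[OF 0(1)]] triangle_isoI[OF i(2,3) is_iso_shift[OF i(1)]])
      (simp_all add: e)
qed

lemma Delta_morphism:
  assumes s: "(X, Y, Z, u, v, w) \<in> \<Delta>" and t: "(X', Y', Z', u', v', w') \<in> \<Delta>"
    and [simp]: "f \<in> mor T X X'" "g \<in> mor T Y Y'" and fg: "Comp T X Y Y' g u = Comp T X X' Y' u' f"
  obtains h where "h \<in> mor T Z Z'" "Comp T Y Z Z' h v = Comp T Y Y' Z' v' g"
     "Comp T Z (So X) (So X') (Sm X X' f) w = Comp T Z Z' (So X') w' h"
proof -
  obtain X0 Y0 Z0 u0 v0 w0 where s0: "(X0, Y0, Z0, u0, v0, w0) \<in> D" "(X0, Y0, Z0, u0, v0, w0) \<in> triangles T So"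
    "triangle_iso T So Sm (X0, Y0, Z0, u0, v0, w0) (X, Y, Z, u, v, w)"
    by (rule DeltaE[OF s])
  obtain X0' Y0' Z0' u0' v0' w0' where t0: "(X0', Y0', Z0', u0', v0', w0') \<in> D"
    "(X0', Y0', Z0', u0', v0', w0') \<in> triangles T So"
    "triangle_iso T So Sm (X0', Y0', Z0', u0', v0', w0') (X', Y', Z', u', v', w')"
    by (rule DeltaE[OF t])
  note [simp] = s0(2)[unfolded triangles_iff] DeltaD(1-6)[OF s] t0(2)[unfolded triangles_iff] DeltaD(1-6)[OF t]
  obtain a b c a1 b1 c1 where [simp]: "a \<in> mor T X0 X" "b \<in> mor T Y0 Y" "c \<in> mor T Z0 Z"
      "a1 \<in> mor T X X0" "b1 \<in> mor T Y Y0" "c1 \<in> mor T Z Z0"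
    and e: "Comp T Y Y0 Y b b1 = Idn T Y" "Comp T Z Z0 Z c c1 = Idn T Z"
      "Comp T X0 Y0 Y b u0 = Comp T X0 X Y u a"
      "Comp T Z0 (So X0) (So X) (Sm X0 X a) w0 = Comp T Z0 Z (So X) w c"
      "Comp T Y Z Z0 c1 v = Comp T Y Y0 Z0 v0 b1"
    by (rule triangle_isoE[OF s0(3,2) DeltaD(7)[OF s]])
  obtain a' b' c' a1' b1' c1' where [simp]: "a' \<in> mor T X0' X'" "b' \<in> mor T Y0' Y'" "c' \<in> mor T Z0' Z'"
      "a1' \<in> mor T X' X0'" "b1' \<in> mor T Y' Y0'" "c1' \<in> mor T Z' Z0'"
    and e': "Comp T X' X0' X' a' a1' = Idn T X'" "Comp T Y' Y0' Y' b' b1' = Idn T Y'"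
      "Comp T Y0' Z0' Z' c' v0' = Comp T Y0' Y' Z' v' b'"
      "Comp T Z0' (So X0') (So X') (Sm X0' X' a') w0' = Comp T Z0' Z' (So X') w' c'"
      "Comp T X' Y' Y0' b1' u' = Comp T X' X0' Y0' u0' a1'"
    by (rule triangle_isoE[OF t0(3,2) DeltaD(7)[OF t]])
  \<comment> \<open>Conjugated by the comparison isomorphisms, the square becomes one between basic
    triangles.\<close>
  let ?f = "Comp T X0 X' X0' a1' (Comp T X0 X X' f a)" and ?g = "Comp T Y0 Y' Y0' b1' (Comp T Y0 Y Y' g b)"
  have "Comp T X0 Y0 Y0' ?g u0 = Comp T X0 X0' Y0' u0' ?f"
    by (simp add: e fg[THEN reassoc] e'[THEN reassoc])
  then have "\<exists>h. triangle_mor T So Sm (X0, Y0, Z0, u0, v0, w0) (X0', Y0', Z0', u0', v0', w0') ?f ?g h"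
    by (intro basic_morphism[OF s0(1) t0(1)]) simp_all
  then obtain h where [simp]: "h \<in> mor T Z0 Z0'"
    and h: "Comp T Y0 Z0 Z0' h v0 = Comp T Y0 Y0' Z0' v0' ?g"
      "Comp T Z0 (So X0) (So X0') (Sm X0 X0' ?f) w0 = Comp T Z0 Z0' (So X0') w0' h"
    by (auto simp: triangle_mor_def)
  let ?h = "Comp T Z Z0 Z' (Comp T Z0 Z0' Z' c' h) c1"
  have 1: "Comp T Y Z Z' ?h v = Comp T Y Y' Z' v' g"
    by (simp add: e h[THEN reassoc] e'(3)[THEN reassoc] e'(2)[THEN reassoc])
  have "Comp T X0 X0' X' a' ?f = Comp T X0 X X' f a"
    by (simp add: e'(1)[THEN reassoc])
  then have "Comp T Z0 (So X) (So X') (Sm X X' f) (Comp T Z0 (So X0) (So X) (Sm X0 X a) w0) =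
      Comp T Z0 (So X0') (So X') (Sm X0' X' a') (Comp T Z0 (So X0) (So X0') (Sm X0 X0' ?f) w0)"
    by (simp flip: comp_assoc_right functor_comp del: comp_assoc_right functor_comp)
  then have "Comp T Z0 Z (So X') (Comp T Z (So X) (So X') (Sm X X' f) w) c
    = Comp T Z0 Z' (So X') w' (Comp T Z0 Z0' Z' c' h)"
    unfolding e h(2) by (simp add: e'(4)[THEN reassoc])
  then have "Comp T Z Z0 (So X') (Comp T Z0 Z (So X') (Comp T Z (So X) (So X') (Sm X X' f) w) c) c1
    = Comp T Z Z0 (So X') (Comp T Z0 Z' (So X') w' (Comp T Z0 Z0' Z' c' h)) c1" by simp
  then have 2: "Comp T Z (So X) (So X') (Sm X X' f) w = Comp T Z Z' (So X') w' ?h"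
    by (simp add: e)
  show ?thesis by (rule that[of ?h, OF _ 1 2]) simp
qed

text \<open>A left inverse \<open>l\<close> of \<open>h\<close> comes from correcting a
  weak-cokernel factorization. Then \<open>(h l - 1) h = 0\<close>, and cancellation of
  \<open>h\<close> on the right makes the inverse two-sided.\<close>

lemma five:
  assumes s: "(X, Y, Z, u, v, w) \<in> \<Delta>" and t: "(X', Y', Z', u', v', w') \<in> \<Delta>"
    and f: "is_iso T X X' f" and g: "is_iso T Y Y' g" and [simp]: "h \<in> mor T Z Z'"
    and gu: "Comp T X Y Y' g u = Comp T X X' Y' u' f" and hv: "Comp T Y Z Z' h v = Comp T Y Y' Z' v' g"
    and fw: "Comp T Z (So X) (So X') (Sm X X' f) w = Comp T Z Z' (So X') w' h"
  shows "is_iso T Z Z' h"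
proof -
  note [simp] = DeltaD(1-6)[OF s] DeltaD(1-6)[OF t]
  obtain f' where f' [simp]: "X \<in> Ob T" "X' \<in> Ob T" "f \<in> mor T X X'" "f' \<in> mor T X' X"
    "is_iso T X' X f'" "Comp T X X' X f' f = Idn T X" "Comp T X' X X' f f' = Idn T X'"
    using f by (rule is_isoE)
  obtain g' where g' [simp]: "Y \<in> Ob T" "Y' \<in> Ob T" "g \<in> mor T Y Y'" "g' \<in> mor T Y' Y"
    "is_iso T Y' Y g'" "Comp T Y Y' Y g' g = Idn T Y" "Comp T Y' Y Y' g g' = Idn T Y'"
    using g by (rule is_isoE)
  have gu': "Comp T X' Y' Y g' u' = Comp T X' X Y u f'"
    by (rule iso_square_inverse[OF gu]) simp_all
  have Sf [simp]: "Comp T (So X) (So X') (So X) (Sm X' X f') (Sm X X' f) = Idn T (So X)"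
     "Comp T (So X') (So X) (So X') (Sm X X' f) (Sm X' X f') = Idn T (So X')"
    by (simp_all flip: functor_comp)
  note [simp] = Sf[THEN reassoc] g'(6,7)[THEN reassoc]
  have "Comp T X' Y' Z (Comp T Y' Y Z v g') u' = zmor T X' Z"
    by (simp add: gu' Delta_zero[OF s, THEN reassoc])
  then obtain m where [simp]: "m \<in> mor T Z' Z" and m: "Comp T Y' Z' Z m v' = Comp T Y' Y Z v g'"
    by (rule Delta_weak_cokernel[OF t]) simp_all
  \<comment> \<open>\<open>m h\<close> agrees with the identity on \<open>v\<close>, so the defect
    factors as \<open>n w\<close>. Carrying \<open>n\<close> over to \<open>Z'\<close> along the
    shift of \<open>f'\<close> corrects \<open>m\<close> to the left inverse
    \<open>?l\<close>.\<close>
  have "Comp T Y Z Z (madd T Z Z (Idn T Z) (mneg T Z Z (Comp T Z Z' Z m h))) v = zmor T Y Z"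
    by (simp add: hv m[THEN reassoc])
  then obtain n where [simp]: "n \<in> mor T (So X) Z"
    and n: "Comp T Z (So X) Z n w = madd T Z Z (Idn T Z) (mneg T Z Z (Comp T Z Z' Z m h))"
    by (rule Delta_weak_cokernel[OF Delta_rotate[OF s]]) simp_all
  let ?l = "madd T Z' Z m (Comp T Z' (So X) Z n (Comp T Z' (So X') (So X) (Sm X' X f') w'))"
  have lh: "Comp T Z Z' Z ?l h = Idn T Z"
    using n by (simp flip: fw)
  \<comment> \<open>Right cancellation: \<open>q\<close> kills \<open>v'\<close>, so it is
    \<open>n2 w'\<close>. On the first triangle \<open>n2\<close> factors through the shift of
    \<open>u\<close>, and \<open>w'\<close> followed by the shift of \<open>u'\<close>
    vanishes.\<close>
  have zero: "q = zmor T Z' Z'" if [simp]: "q \<in> mor T Z' Z'" and q: "Comp T Z Z' Z' q h = zmor T Z Z'" for q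
  proof -
    have "Comp T Y' Z' Z' q v' = Comp T Y' Y Z' (Comp T Y Z' Z' q (Comp T Y Y' Z' v' g)) g'" by simp
    also have "\<dots> = zmor T Y' Z'" by (simp flip: hv) (simp add: q[THEN reassoc])
    finally obtain n2 where [simp]: "n2 \<in> mor T (So X') Z'" and n2: "Comp T Z' (So X') Z' n2 w' = q"
      by (rule Delta_weak_cokernel[OF Delta_rotate[OF t]]) simp_all
    have "Comp T Z (So X) Z' (Comp T (So X) (So X') Z' n2 (Sm X X' f)) w = zmor T Z Z'"
      by (simp add: fw n2[THEN reassoc] q)
    then obtain n3 where [simp]: "n3 \<in> mor T (So Y) Z'"
      and n3: "Comp T (So X) (So Y) Z' n3 (mneg T (So X) (So Y) (Sm X Y u)) = Comp T (So X) (So X') Z' n2 (Sm X X' f)"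
      by (rule Delta_weak_cokernel[OF Delta_rotate[OF Delta_rotate[OF s]]]) simp_all
    have Su'w': "Comp T Z' (So X') (So Y') (Sm X' Y' u') w' = zmor T Z' (So Y')"
      using Delta_zero[OF Delta_rotate[OF Delta_rotate[OF t]]] by simp
    have Sgu: "Comp T (So X') (So X) (So Y) (Sm X Y u) (Sm X' X f') = Comp T (So X') (So Y') (So Y) (Sm Y' Y g') (Sm X' Y' u')"
      using gu' by (simp flip: functor_comp)
    have "q = Comp T Z' (So X) Z' (Comp T (So X) (So X') Z' n2 (Sm X X' f)) (Comp T Z' (So X') (So X) (Sm X' X f') w')"
      by (simp add: n2)
    also have "\<dots> = zmor T Z' Z'"
      by (simp flip: n3) (simp add: Sgu[THEN reassoc] Su'w')
    finally show ?thesis .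
  qed
  have "madd T Z' Z' (Comp T Z' Z Z' h ?l) (mneg T Z' Z' (Idn T Z')) = zmor T Z' Z'"
  proof (rule zero)
    have "Comp T Z Z' Z' (madd T Z' Z' (Comp T Z' Z Z' h ?l) (mneg T Z' Z' (Idn T Z'))) h =
      madd T Z Z' (Comp T Z Z Z' h (Comp T Z Z' Z ?l h)) (mneg T Z Z' h)"
      by simp
    then show "Comp T Z Z' Z' (madd T Z' Z' (Comp T Z' Z Z' h ?l) (mneg T Z' Z' (Idn T Z'))) h = zmor T Z Z'"
      unfolding lh by simp
  qed simp
  then have "Comp T Z' Z Z' h ?l = Idn T Z'" by (subst (asm) madd_neg_eq_zero_iff) simp_all
  with lh show ?thesis by (intro is_isoI[of _ _ _ ?l]) simp_all
qed

text \<open>Complete \<open>u\<close> to a triangle with third vertex \<open>Z1\<close> and rotate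
  until both triangles begin with the negated shift of \<open>u\<close>. Their comparison is then a
  map between the shifts of \<open>Z\<close> and \<open>Z1\<close>, and full faithfulness of the
  shift brings it down to an isomorphism of \<open>Z\<close> with \<open>Z1\<close>.\<close>

lemma Delta_unrotate:
  assumes t: "(X, Y, Z, u, v, w) \<in> triangles T So"
    and rot: "(Y, Z, So X, v, w, mneg T (So X) (So Y) (Sm X Y u)) \<in> \<Delta>"
  shows "(X, Y, Z, u, v, w) \<in> \<Delta>"
proof -
  note [simp] = t[unfolded triangles_iff]
  obtain Z1 v1 w1 where s: "(X, Y, Z1, u, v1, w1) \<in> \<Delta>"
    using basic_ex[of X Y u] by (auto dest: basic_Delta)
  note [simp] = DeltaD(1-6)[OF s]
  obtain h where [simp]: "h \<in> mor T (So Z) (So Z1)"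
    and h: "Comp T (So Y) (So Z) (So Z1) h (mneg T (So Y) (So Z) (Sm Y Z v)) =
          Comp T (So Y) (So Y) (So Z1) (mneg T (So Y) (So Z1) (Sm Y Z1 v1)) (Idn T (So Y))"
      "Comp T (So Z) (So (So X)) (So (So X)) (Sm (So X) (So X) (Idn T (So X))) (mneg T (So Z) (So (So X)) (Sm Z (So X) w))
        = Comp T (So Z) (So Z1) (So (So X)) (mneg T (So Z1) (So (So X)) (Sm Z1 (So X) w1)) h"
    by (rule Delta_morphism[OF Delta_rotate[OF Delta_rotate[OF rot]]
          Delta_rotate[OF Delta_rotate[OF Delta_rotate[OF s]]], of "Idn T (So X)" "Idn T (So Y)"]) simp_all
  have iso: "is_iso T (So Z) (So Z1) h"
    by (rule five[OF Delta_rotate[OF Delta_rotate[OF rot]] Delta_rotate[OF Delta_rotate[OF Delta_rotate[OF s]]]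
          is_iso_id[of "So X"] is_iso_id[of "So Y"] _ _ h]) simp_all
  obtain k where [simp]: "k \<in> mor T Z Z1" and k: "Sm Z Z1 k = h"
    using shift_full[of Z Z1 h] by auto
  have iso: "is_iso T Z Z1 k" by (rule is_iso_shiftD) (simp_all add: k iso)
  have v: "Comp T Y Z Z1 k v = v1"
    by (rule shift_faithful[of Y Z1]) (use h(1) in \<open>simp_all add: k\<close>)
  have w: "Comp T Z Z1 (So X) w1 k = w"
    by (rule shift_faithful[of Z "So X"]) (use h(2) in \<open>simp_all add: k\<close>)
  have "triangle_iso T So Sm (X, Y, Z, u, v, w) (X, Y, Z1, u, v1, w1)"
    using v w by (intro triangle_isoI[OF is_iso_id is_iso_id iso]) simp_all
  then show ?thesis
    by (rule Delta_iso[OF s triangle_iso_sym]) (use t in simp_all)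
qed

text \<open>The prescribed cones are matched with those of the available octahedron by the five
  lemma, and its maps \<open>f1\<close> and \<open>g1\<close> are conjugated by the resulting
  isomorphisms.\<close>

lemma Delta_octahedron:
  assumes t1: "(X, Y, Z', u, i, i') \<in> \<Delta>" and t2: "(Y, Z, X', v, j, j') \<in> \<Delta>"
    and t3: "(X, Z, Y', Comp T X Y Z v u, k, k') \<in> \<Delta>"
  shows "\<exists>f g. octahedron T So Sm \<Delta> X Y Z u v Z' i i' X' j j' Y' k k' f g"
proof -
  note [simp] = DeltaD(1-6)[OF t1] DeltaD(1-6)[OF t2] DeltaD(1-6)[OF t3]
  obtain Y1 Z1 a b u1 v1 Z1' i1 i1' X1' j1 j1' Y1' k1 k1' f1 g1 where
    a: "is_iso T Y Y1 a" and b: "is_iso T Z Z1 b" and u1: "u1 = Comp T X Y Y1 a u"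
    and v1: "Comp T Y Y1 Z1 v1 a = Comp T Y Z Z1 b v"
    and s1: "(X, Y1, Z1', u1, i1, i1') \<in> \<Delta>" and s2: "(Y1, Z1, X1', v1, j1, j1') \<in> \<Delta>"
    and s3: "(X, Z1, Y1', Comp T X Y1 Z1 v1 u1, k1, k1') \<in> \<Delta>"
    and oct: "octahedron T So Sm \<Delta> X Y1 Z1 u1 v1 Z1' i1 i1' X1' j1 j1' Y1' k1 k1' f1 g1"
    using basic_octahedron[of X Y Z u v] by auto
  note [simp] = DeltaD(1-6)[OF s1] DeltaD(1-6)[OF s2] DeltaD(1-6)[OF s3]
  obtain a' where a' [simp]: "Y \<in> Ob T" "Y1 \<in> Ob T" "a \<in> mor T Y Y1" "a' \<in> mor T Y1 Y"
    "is_iso T Y1 Y a'" "Comp T Y Y1 Y a' a = Idn T Y" "Comp T Y1 Y Y1 a a' = Idn T Y1"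
    using a by (rule is_isoE)
  obtain b' where b' [simp]: "Z \<in> Ob T" "Z1 \<in> Ob T" "b \<in> mor T Z Z1" "b' \<in> mor T Z1 Z"
    "is_iso T Z1 Z b'" "Comp T Z Z1 Z b' b = Idn T Z" "Comp T Z1 Z Z1 b b' = Idn T Z1"
    using b by (rule is_isoE)
  note oc = oct[unfolded octahedron_def]
  have t4: "(Z1', Y1', X1', f1, g1, Comp T X1' (So Y1) (So Z1') (Sm Y1 Z1' i1) j1') \<in> \<Delta>"
    using oc by blast
  note [simp] = DeltaD(4,5)[OF t4]
  obtain z where [simp]: "z \<in> mor T Z' Z1'" and z: "Comp T Y Z' Z1' z i = Comp T Y Y1 Z1' i1 a"
     and z2: "Comp T Z' (So X) (So X) (Sm X X (Idn T X)) i' = Comp T Z' Z1' (So X) i1' z"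
    by (rule Delta_morphism[OF t1 s1, of "Idn T X" a]) (simp_all add: u1)
  have zi: "is_iso T Z' Z1' z"
    by (rule five[OF t1 s1 is_iso_id a _ _ z z2]) (simp_all add: u1)
  obtain y where [simp]: "y \<in> mor T Y' Y1'" and y: "Comp T Z Y' Y1' y k = Comp T Z Z1 Y1' k1 b"
     and y2: "Comp T Y' (So X) (So X) (Sm X X (Idn T X)) k' = Comp T Y' Y1' (So X) k1' y"
    by (rule Delta_morphism[OF t3 s3, of "Idn T X" b]) (simp_all add: u1 v1[THEN reassoc])
  have yi: "is_iso T Y' Y1' y"
    by (rule five[OF t3 s3 is_iso_id b _ _ y y2]) (simp_all add: u1 v1[THEN reassoc])
  obtain x where [simp]: "x \<in> mor T X' X1'" and x: "Comp T Z X' X1' x j = Comp T Z Z1 X1' j1 b"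
     and x2: "Comp T X' (So Y) (So Y1) (Sm Y Y1 a) j' = Comp T X' X1' (So Y1) j1' x"
    by (rule Delta_morphism[OF t2 s2, of a b]) (simp_all add: v1)
  have xi: "is_iso T X' X1' x"
    by (rule five[OF t2 s2 a b _ _ x x2]) (simp_all add: v1)
  obtain z' where z' [simp]: "Z' \<in> Ob T" "Z1' \<in> Ob T" "z \<in> mor T Z' Z1'" "z' \<in> mor T Z1' Z'"
    "is_iso T Z1' Z' z'" "Comp T Z' Z1' Z' z' z = Idn T Z'" "Comp T Z1' Z' Z1' z z' = Idn T Z1'"
    using zi by (rule is_isoE)
  obtain y' where y' [simp]: "Y' \<in> Ob T" "Y1' \<in> Ob T" "y \<in> mor T Y' Y1'" "y' \<in> mor T Y1' Y'"
    "is_iso T Y1' Y' y'" "Comp T Y' Y1' Y' y' y = Idn T Y'" "Comp T Y1' Y' Y1' y y' = Idn T Y1'"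
    using yi by (rule is_isoE)
  obtain x' where x' [simp]: "X' \<in> Ob T" "X1' \<in> Ob T" "x \<in> mor T X' X1'" "x' \<in> mor T X1' X'"
    "is_iso T X1' X' x'" "Comp T X' X1' X' x' x = Idn T X'" "Comp T X1' X' X1' x x' = Idn T X1'"
    using xi by (rule is_isoE)
  note [simp] = x'(6,7)[THEN reassoc] y'(6,7)[THEN reassoc] z'(6,7)[THEN reassoc]
    a'(6,7)[THEN reassoc] b'(6,7)[THEN reassoc]
  have i': "Comp T Z' Z1' (So X) i1' z = i'" and k': "Comp T Y' Y1' (So X) k1' y = k'"
    using z2 y2 by simp_all
  have yk1: "Comp T Z1 Y1' Y' y' k1 = Comp T Z1 Z Y' k b'"
    by (rule iso_square_inverse[OF y]) simp_all
  have xj1: "Comp T Z1 X1' X' x' j1 = Comp T Z1 Z X' j b'"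
    by (rule iso_square_inverse[OF x]) simp_all
  have zi1: "Comp T Y1 Z1' Z' z' i1 = Comp T Y1 Y Z' i a'"
    by (rule iso_square_inverse[OF z]) simp_all
  have Sa: "Comp T (So Y) (So Y1) (So Y) (Sm Y1 Y a') (Sm Y Y1 a) = Idn T (So Y)"
    "Comp T (So Y1) (So Y) (So Y1) (Sm Y Y1 a) (Sm Y1 Y a') = Idn T (So Y1)"
    by (simp_all flip: functor_comp)
  have aj1': "Comp T X1' (So Y1) (So Y) (Sm Y1 Y a') j1' = Comp T X1' X' (So Y) j' x'"
    by (rule iso_square_inverse[OF x2]) (simp_all add: Sa)
  have Szi1: "Comp T (So Y1) (So Z1') (So Z') (Sm Z1' Z' z') (Sm Y1 Z1' i1) = Comp T (So Y1) (So Y) (So Z') (Sm Y Z' i) (Sm Y1 Y a')"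
    using zi1 by (simp flip: functor_comp)
  let ?f = "Comp T Z' Y1' Y' y' (Comp T Z' Z1' Y1' f1 z)"
  let ?g = "Comp T Y' X1' X' x' (Comp T Y' Y1' X1' g1 y)"
  have fi1: "Comp T Y1 Z1' Y1' f1 i1 = Comp T Y1 Z1 Y1' k1 v1" and kf1: "Comp T Z1' Y1' (So X) k1' f1 = i1'"
    and gk1: "Comp T Z1 Y1' X1' g1 k1 = j1"
    and jg1: "Comp T Y1' X1' (So Y1) j1' g1 = Comp T Y1' (So X) (So Y1) (Sm X Y1 u1) k1'"
    using oc by blast+
  have 1: "Comp T Y Z' Y' ?f i = Comp T Y Z Y' k v"
    by (simp add: z fi1[THEN reassoc] v1 yk1[THEN reassoc])
  have 2: "Comp T Z' Y' (So X) k' ?f = i'"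
    by (simp add: k'[symmetric] kf1[THEN reassoc] i')
  have 3: "Comp T Z Y' X' ?g k = j"
    by (simp add: y gk1[THEN reassoc] xj1[THEN reassoc])
  have 4: "Comp T Y' X' (So Y) j' ?g = Comp T Y' (So X) (So Y) (Sm X Y u) k'"
  proof -
    have "Comp T Y' X' (So Y) j' ?g = Comp T Y' (So Y1) (So Y) (Sm Y1 Y a') (Comp T Y' X1' (So Y1) j1' (Comp T Y' Y1' X1' g1 y))"
      by (simp add: aj1'[symmetric, THEN reassoc])
    also have "\<dots> = Comp T Y' (So X) (So Y) (Sm X Y u) k'"
      by (simp add: jg1[THEN reassoc] u1 Sa[THEN reassoc] k')
    finally show ?thesis .
  qed
  have "triangle_iso T So Sm (Z1', Y1', X1', f1, g1, Comp T X1' (So Y1) (So Z1') (Sm Y1 Z1' i1) j1')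
     (Z', Y', X', ?f, ?g, Comp T X' (So Y) (So Z') (Sm Y Z' i) j')"
    by (rule triangle_isoI[OF z'(5) y'(5) x'(5)]) (simp_all add: Szi1[THEN reassoc] aj1')
  then have "(Z', Y', X', ?f, ?g, Comp T X' (So Y) (So Z') (Sm Y Z' i) j') \<in> \<Delta>"
    by (rule Delta_iso[OF t4]) simp
  with 1 2 3 4 show ?thesis unfolding octahedron_def by blast
qed

text \<open>The usual quasi-inverse of a fully faithful, essentially surjective functor: on
  morphisms it is the preimage of the conjugate by \<open>e\<close>, and functoriality is checked
  after applying the shift.\<close>

lemma shift_autoequivalence: "additive_autoequivalence T So Sm"
proof -
  have "\<forall>Y\<in>Ob T. \<exists>X e. X \<in> Ob T \<and> is_iso T (So X) Y e" using shift_surj by blast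
  then obtain Go e where Go: "\<forall>Y\<in>Ob T. Go Y \<in> Ob T \<and> is_iso T (So (Go Y)) Y (e Y)"
    by metis
  then have Go [simp]: "Go Y \<in> Ob T" and e: "is_iso T (So (Go Y)) Y (e Y)" if "Y \<in> Ob T" for Y
    using that by auto
  have "\<exists>g. g \<in> mor T Y (So (Go Y)) \<and> e Y \<in> mor T (So (Go Y)) Y \<and>
     Comp T (So (Go Y)) Y (So (Go Y)) g (e Y) = Idn T (So (Go Y)) \<and> Comp T Y (So (Go Y)) Y (e Y) g = Idn T Y"
    if "Y \<in> Ob T" for Y
    by (rule is_isoE[OF e[OF that]]) blast
  then obtain e' where "\<forall>Y\<in>Ob T. e' Y \<in> mor T Y (So (Go Y)) \<and> e Y \<in> mor T (So (Go Y)) Y \<and>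
     Comp T (So (Go Y)) Y (So (Go Y)) (e' Y) (e Y) = Idn T (So (Go Y)) \<and> Comp T Y (So (Go Y)) Y (e Y) (e' Y) = Idn T Y"
    by metis
  then have ee [simp]: "e Y \<in> mor T (So (Go Y)) Y" "e' Y \<in> mor T Y (So (Go Y))"
    "Comp T (So (Go Y)) Y (So (Go Y)) (e' Y) (e Y) = Idn T (So (Go Y))" "Comp T Y (So (Go Y)) Y (e Y) (e' Y) = Idn T Y"
    if "Y \<in> Ob T" for Y using that by auto
  note [simp] = ee(3,4)[THEN reassoc]
  \<comment> \<open>The implications make existence unconditional, so that one choice function in
    \<open>X\<close>, \<open>Y\<close> and \<open>g\<close> can be extracted.\<close>
  have "\<exists>f. X \<in> Ob T \<longrightarrow> Y \<in> Ob T \<longrightarrow> g \<in> mor T X Y \<longrightarrow> f \<in> mor T (Go X) (Go Y) \<and>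
     Sm (Go X) (Go Y) f = Comp T (So (Go X)) Y (So (Go Y)) (e' Y) (Comp T (So (Go X)) X Y g (e X))" for X Y g
  proof (cases "X \<in> Ob T \<and> Y \<in> Ob T \<and> g \<in> mor T X Y")
    case True
    then show ?thesis
      using shift_full[of "Go X" "Go Y" "Comp T (So (Go X)) Y (So (Go Y)) (e' Y) (Comp T (So (Go X)) X Y g (e X))"]
      by auto
  qed auto
  then obtain Gm where "\<forall>X Y g. X \<in> Ob T \<longrightarrow> Y \<in> Ob T \<longrightarrow> g \<in> mor T X Y \<longrightarrow> Gm X Y g \<in> mor T (Go X) (Go Y) \<and>
     Sm (Go X) (Go Y) (Gm X Y g) = Comp T (So (Go X)) Y (So (Go Y)) (e' Y) (Comp T (So (Go X)) X Y g (e X))"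
    by metis
  then have Gm [simp]: "Gm X Y g \<in> mor T (Go X) (Go Y)"
     "Sm (Go X) (Go Y) (Gm X Y g) = Comp T (So (Go X)) Y (So (Go Y)) (e' Y) (Comp T (So (Go X)) X Y g (e X))"
    if "X \<in> Ob T" "Y \<in> Ob T" "g \<in> mor T X Y" for X Y g using that by auto
  have G: "category_functor T T Go Gm"
  proof
    fix X assume [simp]: "X \<in> Ob T"
    show "Gm X X (Idn T X) = Idn T (Go X)"
      by (rule shift_faithful[of "Go X" "Go X"]) simp_all
  next
    fix X Y Z f g assume [simp]: "X \<in> Ob T" "Y \<in> Ob T" "Z \<in> Ob T" "f \<in> mor T X Y" "g \<in> mor T Y Z"
    show "Gm X Z (Comp T X Y Z g f) = Comp T (Go X) (Go Y) (Go Z) (Gm Y Z g) (Gm X Y f)"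
      by (rule shift_faithful[of "Go X" "Go Z"]) simp_all
  qed simp_all
  have 1: "iso_to_identity T (\<lambda>X. So (Go X)) (\<lambda>X Y f. Sm (Go X) (Go Y) (Gm X Y f))"
    unfolding iso_to_identity_def by (intro exI[of _ e]) (simp add: e)
  \<comment> \<open>The isomorphism for the other composite is the preimage of \<open>e\<close> at
    \<open>So X\<close> under the shift.\<close>
  have "\<exists>t\<in>mor T (Go (So X)) X. Sm (Go (So X)) X t = e (So X)" if "X \<in> Ob T" for X
    using that by (intro shift_full) simp_all
  then obtain t where "\<forall>X\<in>Ob T. t X \<in> mor T (Go (So X)) X \<and> Sm (Go (So X)) X (t X) = e (So X)"
    by metis
  then have t [simp]: "t X \<in> mor T (Go (So X)) X" "Sm (Go (So X)) X (t X) = e (So X)" if "X \<in> Ob T" for X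
    using that by auto
  have "is_iso T (Go (So X)) X (t X)" if "X \<in> Ob T" for X
    by (rule is_iso_shiftD) (use that in \<open>simp_all add: e\<close>)
  moreover have "Comp T (Go (So X)) X Y f (t X) = Comp T (Go (So X)) (Go (So Y)) Y (t Y) (Gm (So X) (So Y) (Sm X Y f))"
    if [simp]: "X \<in> Ob T" "Y \<in> Ob T" "f \<in> mor T X Y" for X Y f
    by (rule shift_faithful[of "Go (So X)" Y]) simp_all
  ultimately have 2: "iso_to_identity T (\<lambda>X. Go (So X)) (\<lambda>X Y f. Gm (So X) (So Y) (Sm X Y f))"
    unfolding iso_to_identity_def by (intro exI[of _ t]) simp
  show ?thesis
    unfolding additive_autoequivalence_def using additive_functor_axioms G 1 2 by blast
qed

theorem triangulated_category_closure: "triangulated_category T So Sm \<Delta>"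
proof
  show "additive_autoequivalence T So Sm" by (rule shift_autoequivalence)
  show "\<Delta> \<subseteq> triangles T So" by (auto simp: triangle_closure_def)
next
  fix s t assume "s \<in> \<Delta>" "t \<in> triangles T So" "triangle_iso T So Sm s t"
  then show "t \<in> \<Delta>" by (cases s; cases t) (blast intro: Delta_iso)
next
  fix X N assume [simp]: "X \<in> Ob T" and N: "is_zero_object T N"
  then have [simp]: "N \<in> Ob T" by (simp add: is_zero_object_def)
  obtain Z v w where Z: "is_zero_object T Z" and s: "(X, X, Z, Idn T X, v, w) \<in> \<Delta>"
    using basic_id[of X] by (auto dest: basic_Delta)
  note [simp] = DeltaD(1-6)[OF s]
  have v: "v = zmor T X Z" "w = zmor T Z (So X)" using zero_object_mor_eq[OF Z] by simp_all
  \<comment> \<open>Zero objects are isomorphic by the zero map, which moves the basic identity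
    triangle to the prescribed \<open>N\<close>.\<close>
  have iso: "is_iso T Z N (zmor T Z N)"
    using N Z by (intro is_isoI[of _ _ _ "zmor T N Z"]) (simp_all add: zero_object_Idn)
  have "triangle_iso T So Sm (X, X, Z, Idn T X, v, w) (X, X, N, Idn T X, zmor T X N, zmor T N (So X))"
    by (rule triangle_isoI[OF is_iso_id is_iso_id iso]) (simp_all add: v)
  then show "(X, X, N, Idn T X, zmor T X N, zmor T N (So X)) \<in> \<Delta>"
    by (rule Delta_iso[OF s]) simp
next
  fix X Y u assume "X \<in> Ob T" "Y \<in> Ob T" "u \<in> mor T X Y"
  then show "\<exists>Z v w. (X, Y, Z, u, v, w) \<in> \<Delta>" using basic_ex basic_Delta by meson
next
  fix X Y Z u v w assume "(X, Y, Z, u, v, w) \<in> triangles T So"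
  then show "(X, Y, Z, u, v, w) \<in> \<Delta> \<longleftrightarrow> (Y, Z, So X, v, w, mneg T (So X) (So Y) (Sm X Y u)) \<in> \<Delta>"
    using Delta_rotate Delta_unrotate by blast
next
  fix X Y Z u v w X' Y' Z' u' v' w' f g
  assume a: "(X, Y, Z, u, v, w) \<in> \<Delta>" "(X', Y', Z', u', v', w') \<in> \<Delta>" "f \<in> mor T X X'" "g \<in> mor T Y Y'"
    "Comp T X Y Y' g u = Comp T X X' Y' u' f"
  show "\<exists>h. triangle_mor T So Sm (X, Y, Z, u, v, w) (X', Y', Z', u', v', w') f g h"
    unfolding triangle_mor_def split using a Delta_morphism[OF a] by metis
next
  fix X Y Z' u i i' Z X' v j j' Y' k k'
  assume "(X, Y, Z', u, i, i') \<in> \<Delta>" "(Y, Z, X', v, j, j') \<in> \<Delta>" "(X, Z, Y', Comp T X Y Z v u, k, k') \<in> \<Delta>"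
  then show "\<exists>f g. (Z', Y', X', f, g, Comp T X' (So Y) (So Z') (Sm Y Z' i) j') \<in> \<Delta> \<and>
      Comp T Y Z' Y' f i = Comp T Y Z Y' k v \<and> Comp T Z' Y' (So X) k' f = i' \<and>
      Comp T Z Y' X' g k = j \<and> Comp T Y' X' (So Y) j' g = Comp T Y' (So X) (So Y) (Sm X Y u) k'"
    using Delta_octahedron unfolding octahedron_def by blast
qed

end

section \<open>The stable category of a Frobenius category\<close>

context exact_structure
begin

text \<open>Maps that agree on the subobject differ by a map from the quotient. The additive form is
  the one from which stable comparisons below are read off.\<close>

lemma conflation_cokernel_diff:
  assumes c: "(X, i, Y, p, Z) \<in> E" and eq: "Comp C X Y W f i = Comp C X Y W g i"
    and [simp]: "W \<in> Ob C" "f \<in> mor C Y W" "g \<in> mor C Y W"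
  obtains t where "t \<in> mor C Z W" "f = madd C Y W g (Comp C Y Z W t p)"
proof -
  note [simp] = conflationD(1-5)[OF c]
  have "Comp C X Y W (madd C Y W f (mneg C Y W g)) i = zmor C X W" by (simp add: eq)
  then obtain t where [simp]: "t \<in> mor C Z W" and t: "Comp C Y Z W t p = madd C Y W f (mneg C Y W g)"
    by (rule conflation_cokernel[OF c, of W, rotated 2]) simp_all
  show ?thesis by (rule that[of t]) (simp_all add: t madd_ac)
qed

lemma conflation_kernel_diff:
  assumes c: "(X, i, Y, p, Z) \<in> E" and eq: "Comp C W Y Z p f = Comp C W Y Z p g"
    and [simp]: "W \<in> Ob C" "f \<in> mor C W Y" "g \<in> mor C W Y"
  obtains t where "t \<in> mor C W X" "f = madd C W Y g (Comp C W X Y i t)"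
proof -
  note [simp] = conflationD(1-5)[OF c]
  have "Comp C W Y Z p (madd C W Y f (mneg C W Y g)) = zmor C W Z" by (simp add: eq)
  then obtain t where [simp]: "t \<in> mor C W X" and t: "Comp C W X Y i t = madd C W Y f (mneg C W Y g)"
    by (rule conflation_kernel[OF c, of W, rotated 2]) simp_all
  show ?thesis by (rule that[of t]) (simp_all add: t madd_ac)
qed

end

section \<open>The stable category as an additive category\<close>

context frobenius_exact_structure
begin

abbreviation "ST \<equiv> stable_category C E"
abbreviation "cls \<equiv> stable_class C E"
abbreviation "SZ \<equiv> stably_zero C E"

lemma injective_Ob: "injective_object C E J \<Longrightarrow> J \<in> Ob C"
  by (simp add: injective_object_def)

lemma stably_zeroI:
  "\<lbrakk>injective_object C E J; a \<in> mor C X J; b \<in> mor C J Y\<rbrakk> \<Longrightarrow> Comp C X J Y b a \<in> SZ X Y"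
  unfolding stably_zero_def by blast

lemma stably_zeroE:
  assumes "h \<in> SZ X Y"
  obtains J a b where "injective_object C E J" "J \<in> Ob C" "a \<in> mor C X J" "b \<in> mor C J Y" "h = Comp C X J Y b a"
  using assms injective_Ob unfolding stably_zero_def by blast

lemma stably_zero_mor: "\<lbrakk>X \<in> Ob C; Y \<in> Ob C; h \<in> SZ X Y\<rbrakk> \<Longrightarrow> h \<in> mor C X Y"
  by (auto elim!: stably_zeroE)

lemma stably_zero_zero:
  assumes [simp]: "X \<in> Ob C" "Y \<in> Ob C" shows "zmor C X Y \<in> SZ X Y"
proof -
  obtain J i where J: "injective_object C E J" using enough_injectives[of X] by auto
  then have [simp]: "J \<in> Ob C" by (rule injective_Ob)
  show ?thesis using stably_zeroI[OF J, of "zmor C X J" X "zmor C J Y" Y] by simp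
qed

lemma stably_zero_add:
  assumes [simp]: "X \<in> Ob C" "Y \<in> Ob C" and f: "f \<in> SZ X Y" and g: "g \<in> SZ X Y"
  shows "madd C X Y f g \<in> SZ X Y"
proof -
  obtain J a b where J: "injective_object C E J" and [simp]: "J \<in> Ob C" "a \<in> mor C X J" "b \<in> mor C J Y"
    and f': "f = Comp C X J Y b a" using f by (rule stably_zeroE)
  obtain J' a' b' where J': "injective_object C E J'" and [simp]: "J' \<in> Ob C" "a' \<in> mor C X J'" "b' \<in> mor C J' Y"
    and g': "g = Comp C X J' Y b' a'" using g by (rule stably_zeroE)
  obtain B i1 i2 p1 p2 where b: "is_biproduct C J J' B i1 i2 p1 p2" using ex_biproduct[of J J'] by auto
  note [simp] = biproductD(1-11)[OF b] biproductD(8-11)[OF b, THEN reassoc]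
  \<comment> \<open>A sum of two maps through injectives factors through the biproduct of the
    injectives.\<close>
  have "madd C X Y f g = Comp C X B Y (madd C B Y (Comp C B J Y b p1) (Comp C B J' Y b' p2))
     (madd C X B (Comp C X J B i1 a) (Comp C X J' B i2 a'))"
    by (simp add: f' g')
  also have "\<dots> \<in> SZ X Y" by (rule stably_zeroI[OF injective_biproduct[OF J J' b]]) simp_all
  finally show ?thesis .
qed

lemma stably_zero_neg:
  assumes [simp]: "X \<in> Ob C" "Y \<in> Ob C" and f: "f \<in> SZ X Y"
  shows "mneg C X Y f \<in> SZ X Y"
proof -
  obtain J a b where J: "injective_object C E J" and [simp]: "J \<in> Ob C" "a \<in> mor C X J" "b \<in> mor C J Y"
    and f': "f = Comp C X J Y b a" using f by (rule stably_zeroE)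
  show ?thesis using stably_zeroI[OF J, of "mneg C X J a" X b Y] by (simp add: f')
qed

lemma stably_zero_comp_left:
  assumes [simp]: "X \<in> Ob C" "Y \<in> Ob C" "Z \<in> Ob C" and f: "f \<in> SZ X Y" and [simp]: "g \<in> mor C Y Z"
  shows "Comp C X Y Z g f \<in> SZ X Z"
proof -
  obtain J a b where J: "injective_object C E J" and [simp]: "J \<in> Ob C" "a \<in> mor C X J" "b \<in> mor C J Y"
    and f': "f = Comp C X J Y b a" using f by (rule stably_zeroE)
  show ?thesis using stably_zeroI[OF J, of a X "Comp C J Y Z g b" Z] by (simp add: f')
qed

lemma stably_zero_comp_right:
  assumes [simp]: "X \<in> Ob C" "Y \<in> Ob C" "Z \<in> Ob C" and g: "g \<in> SZ Y Z" and [simp]: "f \<in> mor C X Y"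
  shows "Comp C X Y Z g f \<in> SZ X Z"
proof -
  obtain J a b where J: "injective_object C E J" and [simp]: "J \<in> Ob C" "a \<in> mor C Y J" "b \<in> mor C J Z"
    and g': "g = Comp C Y J Z b a" using g by (rule stably_zeroE)
  show ?thesis using stably_zeroI[OF J, of "Comp C X Y J a f" X b Z] by (simp add: g')
qed

lemma stably_zero_subgroup:
  assumes [simp]: "X \<in> Ob C" "Y \<in> Ob C" shows "subgroup (SZ X Y) (Hom C X Y)"
  by (rule subgroup.intro) (auto intro: stably_zero_mor stably_zero_add stably_zero_zero stably_zero_neg)

lemma stably_zero_normal:
  assumes [simp]: "X \<in> Ob C" "Y \<in> Ob C" shows "normal (SZ X Y) (Hom C X Y)"
  using comm_group.normal_iff_subgroup[OF hom_group[of X Y]] stably_zero_subgroup[of X Y] by simp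

lemma mem_cls: "g \<in> cls X Y f \<longleftrightarrow> (\<exists>h\<in>SZ X Y. g = madd C X Y h f)"
  unfolding stable_class_def r_coset_def by auto

lemma cls_self: "\<lbrakk>X \<in> Ob C; Y \<in> Ob C; f \<in> mor C X Y\<rbrakk> \<Longrightarrow> f \<in> cls X Y f"
  unfolding mem_cls by (rule bexI[OF _ stably_zero_zero]) simp_all

lemma cls_mor: "\<lbrakk>X \<in> Ob C; Y \<in> Ob C; f \<in> mor C X Y; g \<in> cls X Y f\<rbrakk> \<Longrightarrow> g \<in> mor C X Y"
  unfolding mem_cls using stably_zero_mor by auto

lemma cls_eqI:
  assumes [simp]: "X \<in> Ob C" "Y \<in> Ob C" "g \<in> mor C X Y" and h: "h \<in> SZ X Y" and f: "f = madd C X Y g h"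
  shows "cls X Y f = cls X Y g"
proof -
  have [simp]: "h \<in> mor C X Y" using h by (simp add: stably_zero_mor)
  have "madd C X Y n f \<in> cls X Y g" if n: "n \<in> SZ X Y" for n
    unfolding mem_cls using n h stably_zero_mor[OF _ _ n]
    by (intro bexI[OF _ stably_zero_add[OF _ _ n h]]) (simp_all add: f madd_ac)
  moreover have "madd C X Y n g \<in> cls X Y f" if n: "n \<in> SZ X Y" for n
    unfolding mem_cls using n h stably_zero_mor[OF _ _ n]
    by (intro bexI[OF _ stably_zero_add[OF _ _ n stably_zero_neg[OF _ _ h]]]) (simp_all add: f madd_ac)
  ultimately show ?thesis unfolding set_eq_iff mem_cls by (metis mem_cls)
qed

text \<open>The form in which stable equalities are proved: an honest identity with an error term
  through an injective.\<close>

lemma cls_eqI_factor: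
  assumes "injective_object C E J" "f = madd C X Y g (Comp C X J Y b a)"
    and "X \<in> Ob C" "Y \<in> Ob C" "g \<in> mor C X Y" "a \<in> mor C X J" "b \<in> mor C J Y"
  shows "cls X Y f = cls X Y g"
  using assms by (intro cls_eqI[where h = "Comp C X J Y b a"] stably_zeroI) simp_all

lemma cls_eqE:
  assumes "cls X Y f = cls X Y g" and [simp]: "X \<in> Ob C" "Y \<in> Ob C" "f \<in> mor C X Y" "g \<in> mor C X Y"
  obtains h where "h \<in> SZ X Y" "h \<in> mor C X Y" "f = madd C X Y h g"
  using cls_self[of X Y f] unfolding assms(1) mem_cls using stably_zero_mor by auto

lemma Ob_ST [simp]: "Ob ST = Ob C" by (simp add: stable_category_def)

lemma mor_ST: "mor ST X Y = cls X Y ` mor C X Y"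
  by (simp add: stable_category_def carrier_FactGroup stable_class_def)

lemma cls_in_mor_ST [simp]: "f \<in> mor C X Y \<Longrightarrow> cls X Y f \<in> mor ST X Y"
  by (simp add: mor_ST)

lemma mor_STE:
  assumes "F \<in> mor ST X Y" obtains f where "f \<in> mor C X Y" "F = cls X Y f"
  using assms by (auto simp: mor_ST)

lemma Idn_ST [simp]: "Idn ST X = cls X X (Idn C X)" by (simp add: stable_category_def)

lemma zmor_ST:
  assumes [simp]: "X \<in> Ob C" "Y \<in> Ob C" shows "zmor ST X Y = cls X Y (zmor C X Y)"
proof -
  have "madd C X Y h (zmor C X Y) = h" if "h \<in> SZ X Y" for h
    using stably_zero_mor[OF _ _ that] by simp
  then have "cls X Y (zmor C X Y) = SZ X Y" unfolding set_eq_iff mem_cls by metis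
  then show ?thesis by (simp add: stable_category_def)
qed

lemma madd_ST [simp]:
  assumes [simp]: "X \<in> Ob C" "Y \<in> Ob C" "f \<in> mor C X Y" "g \<in> mor C X Y"
  shows "madd ST X Y (cls X Y f) (cls X Y g) = cls X Y (madd C X Y f g)"
  using normal.rcos_sum[OF stably_zero_normal[of X Y]]
  by (simp add: stable_category_def stable_class_def)

lemma Comp_ST [simp]:
  assumes [simp]: "X \<in> Ob C" "Y \<in> Ob C" "Z \<in> Ob C" "f \<in> mor C X Y" "g \<in> mor C Y Z"
  shows "Comp ST X Y Z (cls Y Z g) (cls X Y f) = cls X Z (Comp C X Y Z g f)"
proof -
  \<comment> \<open>Changing \<open>g\<close> by \<open>m\<close> and \<open>f\<close> by
    \<open>n\<close> changes the composite by \<open>m f' + g n\<close>, which is stably zero. The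
    union defining the composite therefore runs over a constant, nonempty family.\<close>
  have "cls X Z (Comp C X Y Z g' f') = cls X Z (Comp C X Y Z g f)"
    if gf: "g' \<in> cls Y Z g" "f' \<in> cls X Y f" for g' f'
  proof -
    obtain m where m: "m \<in> SZ Y Z" and g': "g' = madd C Y Z m g" using gf by (auto simp: mem_cls)
    obtain n where n: "n \<in> SZ X Y" and f': "f' = madd C X Y n f" using gf by (auto simp: mem_cls)
    have [simp]: "m \<in> mor C Y Z" "n \<in> mor C X Y" using m n by (simp_all add: stably_zero_mor)
    have "madd C X Z (Comp C X Y Z m f') (Comp C X Y Z g n) \<in> SZ X Z"
      by (intro stably_zero_add stably_zero_comp_right stably_zero_comp_left m n) (simp_all add: f')
    then show ?thesis
      by (rule cls_eqI[rotated 3]) (simp_all add: f' g' madd_ac)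
  qed
  then have "(\<Union>g'\<in>cls Y Z g. \<Union>f'\<in>cls X Y f. cls X Z (Comp C X Y Z g' f'))
      = (\<Union>g'\<in>cls Y Z g. \<Union>f'\<in>cls X Y f. cls X Z (Comp C X Y Z g f))"
    by (intro SUP_cong refl)
  moreover have "cls Y Z g \<noteq> {}" "cls X Y f \<noteq> {}" using cls_self[of Y Z g] cls_self[of X Y f] by auto
  ultimately show ?thesis by (simp add: stable_category_def)
qed

lemma additive_category_ST: "additive_category ST"
proof (intro additive_category.intro preadditive_category.intro additive_category_axioms.intro)
  fix X Y assume "X \<in> Ob ST" "Y \<in> Ob ST"
  then have "comm_group (Hom C X Y Mod SZ X Y)"
    by (intro comm_group.abelian_FactGroup[OF hom_group stably_zero_subgroup]) simp_all
  then show "comm_group (Hom ST X Y)" by (simp add: stable_category_def)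
next
  fix X Y assume "X \<in> Ob ST" "Y \<in> Ob ST"
  then have [simp]: "X \<in> Ob C" "Y \<in> Ob C" by simp_all
  obtain B i1 i2 p1 p2 where b: "is_biproduct C X Y B i1 i2 p1 p2" using ex_biproduct[of X Y] by auto
  note [simp] = biproductD[OF b]
  have "is_biproduct ST X Y B (cls X B i1) (cls Y B i2) (cls B X p1) (cls B Y p2)"
    unfolding is_biproduct_def by (simp add: zmor_ST)
  then show "\<exists>B i1 i2 p1 p2. is_biproduct ST X Y B i1 i2 p1 p2" by blast
next
  obtain N where N: "is_zero_object C N" using ex_zero_object by auto
  then have [simp]: "N \<in> Ob C" by (simp add: is_zero_object_def)
  have z: "f = zmor C X N" "g = zmor C N X" if "X \<in> Ob C" "f \<in> mor C X N" "g \<in> mor C N X" for X f g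
    using zero_object_mor_eq[OF N] that by blast+
  have "(\<exists>!f. f \<in> mor ST X N) \<and> (\<exists>!f. f \<in> mor ST N X)" if [simp]: "X \<in> Ob C" for X
  proof -
    have "mor C X N = {zmor C X N}" "mor C N X = {zmor C N X}"
      using zero_object_mor_eq[OF N \<open>X \<in> Ob C\<close>] by auto
    then show ?thesis by (simp add: mor_ST)
  qed
  then show "\<exists>N. is_zero_object ST N" by (intro exI[of _ N]) (simp add: is_zero_object_def)
qed (auto elim!: mor_STE)

end

sublocale frobenius_exact_structure \<subseteq> ST: additive_category "stable_category C E"
  by (rule additive_category_ST)

context frobenius_exact_structure
begin

lemma mneg_ST [simp]:
  "\<lbrakk>X \<in> Ob C; Y \<in> Ob C; f \<in> mor C X Y\<rbrakk> \<Longrightarrow> mneg ST X Y (cls X Y f) = cls X Y (mneg C X Y f)"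
  by (rule ST.mneg_eqI) (simp_all add: zmor_ST)

lemma cls_zeroD:
  assumes "cls X Y f = cls X Y (zmor C X Y)" and [simp]: "X \<in> Ob C" "Y \<in> Ob C" "f \<in> mor C X Y"
  obtains J a b where "injective_object C E J" "J \<in> Ob C" "a \<in> mor C X J" "b \<in> mor C J Y" "f = Comp C X J Y b a"
proof -
  obtain h where "h \<in> SZ X Y" "h \<in> mor C X Y" "f = madd C X Y h (zmor C X Y)"
    using assms(1) by (rule cls_eqE) simp_all
  then show ?thesis using that by (auto elim: stably_zeroE)
qed

lemma stable_isoI:
  assumes [simp]: "X \<in> Ob C" "Y \<in> Ob C" "f \<in> mor C X Y" "g \<in> mor C Y X"
    and "cls X X (Comp C X Y X g f) = cls X X (Idn C X)" "cls Y Y (Comp C Y X Y f g) = cls Y Y (Idn C Y)"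
  shows "is_iso ST X Y (cls X Y f)"
  by (rule ST.is_isoI[of _ _ _ "cls Y X g"]) (simp_all add: assms)

text \<open>Comparison of injective resolutions: an endomorphism of a conflation with injective middle
  term that restricts to the identity on the left induces the stable identity on the right.\<close>

lemma stable_identity_right:
  assumes c: "(X, i, J, p, Z) \<in> E" and J: "injective_object C E J"
    and [simp]: "a \<in> mor C J J" "b \<in> mor C Z Z"
    and ai: "Comp C X J J a i = i" and bp: "Comp C J Z Z b p = Comp C J J Z p a"
  shows "cls Z Z b = cls Z Z (Idn C Z)"
proof -
  note [simp] = conflationD(1-5)[OF c]
  obtain t where [simp]: "t \<in> mor C Z J" and t: "a = madd C J J (Idn C J) (Comp C J Z J t p)"
    by (rule conflation_cokernel_diff[OF c, of J a "Idn C J"]) (simp_all add: ai)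
  have "Comp C J Z Z b p = Comp C J Z Z (madd C Z Z (Idn C Z) (Comp C Z J Z p t)) p"
    unfolding bp by (subst t) simp
  then have "b = madd C Z Z (Idn C Z) (Comp C Z J Z p t)"
    by (rule deflation_epi[OF c]) simp_all
  then show ?thesis by (rule cls_eqI_factor[OF J]) simp_all
qed

end

section \<open>The shift defined by a choice of cosyzygies\<close>

locale cosyzygy = frobenius_exact_structure C E
  for C :: "('o, 'm) cat" and E :: "('o, 'm) seq set" +
  fixes \<iota> :: "'o \<Rightarrow> 'm" and J :: "'o \<Rightarrow> 'o" and \<pi> :: "'o \<Rightarrow> 'm" and S :: "'o \<Rightarrow> 'o"
  assumes choice: "cosyzygy_choice C E \<iota> J \<pi> S"
begin

abbreviation "Sm \<equiv> stable_shift C E \<iota> J \<pi> S"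
abbreviation "D \<equiv> standard_triangles C E \<iota> J \<pi> S"
abbreviation "\<Delta> \<equiv> triangle_closure ST S Sm D"

lemma cosyzygy_conflation: "X \<in> Ob C \<Longrightarrow> (X, \<iota> X, J X, \<pi> X, S X) \<in> E"
  using choice by (simp add: cosyzygy_choice_def)

lemma J_injective: "X \<in> Ob C \<Longrightarrow> injective_object C E (J X)"
  using choice by (simp add: cosyzygy_choice_def)

lemma cosyzygyD [simp]:
  assumes "X \<in> Ob C"
  shows "J X \<in> Ob C" "S X \<in> Ob C" "\<iota> X \<in> mor C X (J X)" "\<pi> X \<in> mor C (J X) (S X)"
    "Comp C X (J X) (S X) (\<pi> X) (\<iota> X) = zmor C X (S X)"
  using conflationD[OF cosyzygy_conflation[OF assms]] by blast+

text \<open>A map of the chosen conflations over \<open>f\<close>. Keeping the middle component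
  makes lifts closed under differences and composites, so that comparing two lifts reduces to a
  statement about one.\<close>

definition shift_lift where
  "shift_lift X Y f a s \<longleftrightarrow> f \<in> mor C X Y \<and> a \<in> mor C (J X) (J Y) \<and> s \<in> mor C (S X) (S Y) \<and>
     Comp C X (J X) (J Y) a (\<iota> X) = Comp C X Y (J Y) (\<iota> Y) f \<and>
     Comp C (J X) (S X) (S Y) s (\<pi> X) = Comp C (J X) (J Y) (S Y) (\<pi> Y) a"

lemma shift_liftD:
  assumes "shift_lift X Y f a s"
  shows "f \<in> mor C X Y" "a \<in> mor C (J X) (J Y)" "s \<in> mor C (S X) (S Y)"
    "Comp C X (J X) (J Y) a (\<iota> X) = Comp C X Y (J Y) (\<iota> Y) f"
    "Comp C (J X) (S X) (S Y) s (\<pi> X) = Comp C (J X) (J Y) (S Y) (\<pi> Y) a"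
  using assms by (auto simp: shift_lift_def)

lemma shift_lift_ex:
  assumes [simp]: "X \<in> Ob C" "Y \<in> Ob C" "f \<in> mor C X Y"
  obtains a s where "shift_lift X Y f a s"
proof -
  obtain a where [simp]: "a \<in> mor C (J X) (J Y)"
    and a: "Comp C X (J X) (J Y) a (\<iota> X) = Comp C X Y (J Y) (\<iota> Y) f"
    by (rule injective_extend[OF J_injective[of Y] cosyzygy_conflation[of X], of "Comp C X Y (J Y) (\<iota> Y) f"]) simp_all
  have "Comp C X (J X) (S Y) (Comp C (J X) (J Y) (S Y) (\<pi> Y) a) (\<iota> X) = zmor C X (S Y)"
    by (simp add: a cosyzygyD(5)[THEN reassoc])
  then obtain s where s: "s \<in> mor C (S X) (S Y)"
    "Comp C (J X) (S X) (S Y) s (\<pi> X) = Comp C (J X) (J Y) (S Y) (\<pi> Y) a"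
    by (rule conflation_cokernel[OF cosyzygy_conflation[of X], of "S Y", rotated 3]) simp_all
  show ?thesis by (rule that[of a s]) (simp add: shift_lift_def a s)
qed

text \<open>Read forwards this makes the shift well defined, backwards it makes it faithful. The
  first direction extends along the inflation of \<open>X\<close>; the second lifts along the
  deflation of \<open>Y\<close>, using an injective as a projective.\<close>

lemma shift_lift_stably_zero:
  assumes l: "shift_lift X Y f a s" and [simp]: "X \<in> Ob C" "Y \<in> Ob C"
  shows "f \<in> SZ X Y \<longleftrightarrow> s \<in> SZ (S X) (S Y)"
proof
  note [simp] = shift_liftD(1-3)[OF l]
  assume "f \<in> SZ X Y"
  then obtain K b c where K: "injective_object C E K" and [simp]: "K \<in> Ob C" "b \<in> mor C X K" "c \<in> mor C K Y"
    and f: "f = Comp C X K Y c b" by (rule stably_zeroE)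
  obtain b' where [simp]: "b' \<in> mor C (J X) K" and b': "Comp C X (J X) K b' (\<iota> X) = b"
    by (rule injective_extend[OF K cosyzygy_conflation[of X], of b]) simp_all
  \<comment> \<open>Subtracting from \<open>a\<close> the part that comes through \<open>K\<close>
    leaves a map that kills \<open>X\<close> and so factors through \<open>\<pi> X\<close>; the
    subtracted part dies under \<open>\<pi> Y\<close>.\<close>
  obtain t where [simp]: "t \<in> mor C (S X) (J Y)"
    and t: "a = madd C (J X) (J Y) (Comp C (J X) K (J Y) (Comp C K Y (J Y) (\<iota> Y) c) b') (Comp C (J X) (S X) (J Y) t (\<pi> X))"
    by (rule conflation_cokernel_diff[OF cosyzygy_conflation[of X], of "J Y" a
          "Comp C (J X) K (J Y) (Comp C K Y (J Y) (\<iota> Y) c) b'"])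
      (simp_all add: shift_liftD(4)[OF l] f b')
  have "Comp C (J X) (S X) (S Y) s (\<pi> X) = Comp C (J X) (S X) (S Y) (Comp C (S X) (J Y) (S Y) (\<pi> Y) t) (\<pi> X)"
    unfolding shift_liftD(5)[OF l] by (subst t) (simp add: cosyzygyD(5)[THEN reassoc])
  then have "s = Comp C (S X) (J Y) (S Y) (\<pi> Y) t"
    by (rule deflation_epi[OF cosyzygy_conflation[of X], rotated]) simp_all
  then show "s \<in> SZ (S X) (S Y)" using stably_zeroI[OF J_injective[of Y]] by simp
next
  note [simp] = shift_liftD(1-3)[OF l]
  assume "s \<in> SZ (S X) (S Y)"
  then obtain K b c where K: "injective_object C E K" and [simp]: "K \<in> Ob C" "b \<in> mor C (S X) K" "c \<in> mor C K (S Y)"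
    and s: "s = Comp C (S X) K (S Y) c b" by (rule stably_zeroE)
  obtain c' where [simp]: "c' \<in> mor C K (J Y)" and c': "Comp C K (J Y) (S Y) (\<pi> Y) c' = c"
    by (rule projective_lift[OF projective_iff_injective[THEN iffD2, OF K] cosyzygy_conflation[of Y], of c]) simp_all
  \<comment> \<open>Dually, \<open>a\<close> minus the lifted part lands in the kernel
    \<open>Y\<close> of \<open>\<pi> Y\<close>, and restriction to \<open>X\<close> identifies
    \<open>f\<close> with \<open>t\<close> after \<open>\<iota> X\<close>.\<close>
  obtain t where [simp]: "t \<in> mor C (J X) Y"
    and t: "a = madd C (J X) (J Y) (Comp C (J X) (S X) (J Y) (Comp C (S X) K (J Y) c' b) (\<pi> X)) (Comp C (J X) Y (J Y) (\<iota> Y) t)"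
    by (rule conflation_kernel_diff[OF cosyzygy_conflation[of Y], of "J X" a
          "Comp C (J X) (S X) (J Y) (Comp C (S X) K (J Y) c' b) (\<pi> X)"])
      (simp_all add: shift_liftD(5)[OF l, symmetric] s c'[THEN reassoc])
  have "Comp C X Y (J Y) (\<iota> Y) f = Comp C X Y (J Y) (\<iota> Y) (Comp C X (J X) Y t (\<iota> X))"
    unfolding shift_liftD(4)[OF l, symmetric] by (subst t) simp
  then have "f = Comp C X (J X) Y t (\<iota> X)"
    by (rule inflation_mono[OF cosyzygy_conflation[of Y], rotated]) simp_all
  then show "f \<in> SZ X Y" using stably_zeroI[OF J_injective[of X]] by simp
qed

lemma shift_lift_diff:
  assumes l: "shift_lift X Y f a s" and l': "shift_lift X Y f' a' s'" and [simp]: "X \<in> Ob C" "Y \<in> Ob C"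
  shows "cls X Y f = cls X Y f' \<longleftrightarrow> cls (S X) (S Y) s = cls (S X) (S Y) s'"
proof -
  note [simp] = shift_liftD(1-3)[OF l] shift_liftD(1-3)[OF l']
  have d: "cls P Q g = cls P Q g' \<longleftrightarrow> madd C P Q g (mneg C P Q g') \<in> SZ P Q"
    if [simp]: "P \<in> Ob C" "Q \<in> Ob C" "g \<in> mor C P Q" "g' \<in> mor C P Q" for P Q g g'
  proof
    assume "cls P Q g = cls P Q g'"
    then obtain h where h: "h \<in> SZ P Q" "h \<in> mor C P Q" "g = madd C P Q h g'" by (rule cls_eqE) simp_all
    then show "madd C P Q g (mneg C P Q g') \<in> SZ P Q" by (simp add: h(3))
  next
    assume "madd C P Q g (mneg C P Q g') \<in> SZ P Q"
    then show "cls P Q g = cls P Q g'" by (rule cls_eqI[rotated 3]) simp_all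
  qed
  have "shift_lift X Y (madd C X Y f (mneg C X Y f')) (madd C (J X) (J Y) a (mneg C (J X) (J Y) a'))
     (madd C (S X) (S Y) s (mneg C (S X) (S Y) s'))"
    using l l' by (simp add: shift_lift_def)
  then show ?thesis by (simp add: d shift_lift_stably_zero)
qed

text \<open>\<open>stable_shift\<close> is a union over all lifts of all representatives; since
  these give one and the same class, it is the union of a single set.\<close>

lemma shift_cls:
  assumes l: "shift_lift X Y f a s" and [simp]: "X \<in> Ob C" "Y \<in> Ob C"
  shows "Sm X Y (cls X Y f) = cls (S X) (S Y) s"
proof -
  note [simp] = shift_liftD(1-3)[OF l]
  have 1: "cls (S X) (S Y) s' = cls (S X) (S Y) s" if "f' \<in> cls X Y f" "shift_lift X Y f' a' s'" for f' a' s'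
  proof -
    obtain h where h: "h \<in> SZ X Y" "f' = madd C X Y h f" using \<open>f' \<in> cls X Y f\<close> by (auto simp: mem_cls)
    then have "cls X Y f' = cls X Y f"
      using stably_zero_mor[OF _ _ h(1)] by (intro cls_eqI[OF _ _ _ h(1)]) (simp_all add: madd_ac)
    then show ?thesis using shift_lift_diff[OF that(2) l] by simp
  qed
  have "Sm X Y (cls X Y f) = \<Union>{cls (S X) (S Y) s' | s' f' a'. f' \<in> cls X Y f \<and> shift_lift X Y f' a' s'}"
    unfolding stable_shift_def shift_lift_def using cls_mor[of X Y f] by (intro arg_cong[of _ _ Union]) auto
  also have "{cls (S X) (S Y) s' | s' f' a'. f' \<in> cls X Y f \<and> shift_lift X Y f' a' s'} = {cls (S X) (S Y) s}"
  proof (intro equalityI subsetI)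
    fix K assume "K \<in> {cls (S X) (S Y) s}"
    then show "K \<in> {cls (S X) (S Y) s' | s' f' a'. f' \<in> cls X Y f \<and> shift_lift X Y f' a' s'}"
      using l cls_self[of X Y f] by auto
  qed (use 1 in blast)
  finally show ?thesis by simp
qed

lemma shift_functor: "additive_functor ST ST S Sm"
proof unfold_locales
  fix X assume "X \<in> Ob ST" then show "S X \<in> Ob ST" by simp
next
  fix X Y F assume "X \<in> Ob ST" "Y \<in> Ob ST" "F \<in> mor ST X Y"
  then obtain f where [simp]: "X \<in> Ob C" "Y \<in> Ob C" "f \<in> mor C X Y" and F: "F = cls X Y f" by (auto elim: mor_STE)
  obtain a s where l: "shift_lift X Y f a s" by (rule shift_lift_ex[of X Y f]) simp_all
  show "Sm X Y F \<in> mor ST (S X) (S Y)" using shift_liftD(3)[OF l] by (simp add: F shift_cls[OF l])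
next
  fix X assume "X \<in> Ob ST"
  then have [simp]: "X \<in> Ob C" by simp
  have "shift_lift X X (Idn C X) (Idn C (J X)) (Idn C (S X))" by (simp add: shift_lift_def)
  then show "Sm X X (Idn ST X) = Idn ST (S X)" by (simp add: shift_cls)
next
  fix X Y Z F G assume "X \<in> Ob ST" "Y \<in> Ob ST" "Z \<in> Ob ST" "F \<in> mor ST X Y" "G \<in> mor ST Y Z"
  then obtain f g where [simp]: "X \<in> Ob C" "Y \<in> Ob C" "Z \<in> Ob C" "f \<in> mor C X Y" "g \<in> mor C Y Z"
    and FG: "F = cls X Y f" "G = cls Y Z g" by (auto elim!: mor_STE)
  obtain a s where l: "shift_lift X Y f a s" by (rule shift_lift_ex[of X Y f]) simp_all
  obtain a' s' where l': "shift_lift Y Z g a' s'" by (rule shift_lift_ex[of Y Z g]) simp_all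
  note [simp] = shift_liftD(1-3)[OF l] shift_liftD(1-3)[OF l']
  have "shift_lift X Z (Comp C X Y Z g f) (Comp C (J X) (J Y) (J Z) a' a) (Comp C (S X) (S Y) (S Z) s' s)"
    by (simp add: shift_lift_def shift_liftD(4,5)[OF l] shift_liftD(4,5)[OF l', THEN reassoc])
  then show "Sm X Z (Comp ST X Y Z G F) = Comp ST (S X) (S Y) (S Z) (Sm Y Z G) (Sm X Y F)"
    by (simp add: FG shift_cls[OF l] shift_cls[OF l'] shift_cls)
next
  fix X Y F G assume "X \<in> Ob ST" "Y \<in> Ob ST" "F \<in> mor ST X Y" "G \<in> mor ST X Y"
  then obtain f g where [simp]: "X \<in> Ob C" "Y \<in> Ob C" "f \<in> mor C X Y" "g \<in> mor C X Y"
    and FG: "F = cls X Y f" "G = cls X Y g" by (auto elim!: mor_STE)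
  obtain a s where l: "shift_lift X Y f a s" by (rule shift_lift_ex[of X Y f]) simp_all
  obtain a' s' where l': "shift_lift X Y g a' s'" by (rule shift_lift_ex[of X Y g]) simp_all
  note [simp] = shift_liftD(1-3)[OF l] shift_liftD(1-3)[OF l']
  have "shift_lift X Y (madd C X Y f g) (madd C (J X) (J Y) a a') (madd C (S X) (S Y) s s')"
    by (simp add: shift_lift_def shift_liftD(4,5)[OF l] shift_liftD(4,5)[OF l'])
  then show "Sm X Y (madd ST X Y F G) = madd ST (S X) (S Y) (Sm X Y F) (Sm X Y G)"
    by (simp add: FG shift_cls[OF l] shift_cls[OF l'] shift_cls)
qed

text \<open>The construction of a lift run from right to left, which is possible because
  \<open>J X\<close> is also projective.\<close>

lemma cosyzygy_full:
  assumes [simp]: "X \<in> Ob C" "Y \<in> Ob C" "s \<in> mor C (S X) (S Y)"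
  obtains f a where "shift_lift X Y f a s"
proof -
  obtain a where [simp]: "a \<in> mor C (J X) (J Y)"
    and a: "Comp C (J X) (J Y) (S Y) (\<pi> Y) a = Comp C (J X) (S X) (S Y) s (\<pi> X)"
    by (rule projective_lift[OF projective_iff_injective[THEN iffD2, OF J_injective[of X]] cosyzygy_conflation[of Y],
          of "Comp C (J X) (S X) (S Y) s (\<pi> X)"]) simp_all
  have "Comp C X (J Y) (S Y) (\<pi> Y) (Comp C X (J X) (J Y) a (\<iota> X)) = zmor C X (S Y)"
    by (simp add: a[THEN reassoc])
  then obtain f where f: "f \<in> mor C X Y" "Comp C X Y (J Y) (\<iota> Y) f = Comp C X (J X) (J Y) a (\<iota> X)"
    by (rule conflation_kernel[OF cosyzygy_conflation[of Y], of X, rotated 3]) simp_all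
  show ?thesis by (rule that[of f a]) (simp add: shift_lift_def a f)
qed

text \<open>A projective \<open>P\<close> with a deflation onto \<open>Z\<close> is injective, so
  \<open>Z\<close> is a cosyzygy of the kernel \<open>K\<close>; any two cosyzygies of
  \<open>K\<close> are stably isomorphic.\<close>

lemma cosyzygy_surj:
  assumes [simp]: "Z \<in> Ob C"
  shows "\<exists>X\<in>Ob C. \<exists>e. is_iso ST (S X) Z e"
proof -
  obtain P p where P: "projective_object C E P" "deflation E P Z p" using enough_projectives[of Z] by auto
  then obtain K i where c: "(K, i, P, p, Z) \<in> E" by (auto simp: deflation_def)
  note [simp] = conflationD(1-5,8)[OF c]
  have Pi: "injective_object C E P" using P projective_iff_injective by simp
  obtain a where [simp]: "a \<in> mor C P (J K)" and a: "Comp C K P (J K) a i = \<iota> K"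
    by (rule injective_extend[OF J_injective[of K] c, of "\<iota> K"]) simp_all
  obtain b where [simp]: "b \<in> mor C Z (S K)" and b: "Comp C P Z (S K) b p = Comp C P (J K) (S K) (\<pi> K) a"
    by (rule conflation_cokernel[OF c, of "S K" "Comp C P (J K) (S K) (\<pi> K) a"]) (simp_all add: a)
  obtain a' where [simp]: "a' \<in> mor C (J K) P" and a': "Comp C K (J K) P a' (\<iota> K) = i"
    by (rule injective_extend[OF Pi cosyzygy_conflation[of K], of i]) simp_all
  obtain b' where [simp]: "b' \<in> mor C (S K) Z" and b': "Comp C (J K) (S K) Z b' (\<pi> K) = Comp C (J K) P Z p a'"
    by (rule conflation_cokernel[OF cosyzygy_conflation[of K], of Z "Comp C (J K) P Z p a'"]) (simp_all add: a')
  have "cls (S K) (S K) (Comp C (S K) Z (S K) b b') = cls (S K) (S K) (Idn C (S K))"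
    by (rule stable_identity_right[OF cosyzygy_conflation[of K] J_injective[of K], of "Comp C (J K) P (J K) a a'"])
      (simp_all add: a a' b' b[THEN reassoc])
  moreover have "cls Z Z (Comp C Z (S K) Z b' b) = cls Z Z (Idn C Z)"
    by (rule stable_identity_right[OF c Pi, of "Comp C P (J K) P a' a"])
      (simp_all add: a a' b b'[THEN reassoc])
  ultimately have "is_iso ST (S K) Z (cls (S K) Z b')" by (intro stable_isoI[of _ _ _ b]) simp_all
  then show ?thesis by (intro bexI[of _ K]) auto
qed

end

section \<open>Standard triangles and the axioms of a triangulation\<close>

context cosyzygy
begin

lemma shift_id [simp]: "X \<in> Ob C \<Longrightarrow> Sm X X (cls X X (Idn C X)) = cls (S X) (S X) (Idn C (S X))"
  by (rule shift_cls[where a = "Idn C (J X)"]) (simp_all add: shift_lift_def)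

lemma ST_comp_id [simp]:
  assumes "X \<in> Ob C" "Y \<in> Ob C" "F \<in> mor ST X Y"
  shows "Comp ST X Y Y (cls Y Y (Idn C Y)) F = F" "Comp ST X X Y F (cls X X (Idn C X)) = F"
  using ST.comp_id_left[of X Y F] ST.comp_id_right[of X Y F] assms by simp_all

lemma standardI:
  assumes "X \<in> Ob C" "Y \<in> Ob C" "u \<in> mor C X Y" "is_pushout C X (J X) Y Z (\<iota> X) u u' v"
    "w \<in> mor C Z (S X)" "Comp C (J X) Z (S X) w u' = \<pi> X" "Comp C Y Z (S X) w v = zmor C Y (S X)"
  shows "(X, Y, Z, cls X Y u, cls Y Z v, cls Z (S X) w) \<in> D"
  using assms unfolding standard_triangles_def by blast

lemma standardE:
  assumes "(X, Y, Z, U, V, W) \<in> D"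
  obtains u u' v w where "U = cls X Y u" "V = cls Y Z v" "W = cls Z (S X) w"
    "X \<in> Ob C" "Y \<in> Ob C" "Z \<in> Ob C" "u \<in> mor C X Y" "u' \<in> mor C (J X) Z" "v \<in> mor C Y Z" "w \<in> mor C Z (S X)"
    "is_pushout C X (J X) Y Z (\<iota> X) u u' v"
    "Comp C (J X) Z (S X) w u' = \<pi> X" "Comp C Y Z (S X) w v = zmor C Y (S X)"
    "Comp C X (J X) Z u' (\<iota> X) = Comp C X Y Z v u"
proof -
  obtain u u' v w where 1: "U = cls X Y u" "V = cls Y Z v" "W = cls Z (S X) w"
    "X \<in> Ob C" "Y \<in> Ob C" "u \<in> mor C X Y" "w \<in> mor C Z (S X)"
    "is_pushout C X (J X) Y Z (\<iota> X) u u' v"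
    "Comp C (J X) Z (S X) w u' = \<pi> X" "Comp C Y Z (S X) w v = zmor C Y (S X)"
    using assms unfolding standard_triangles_def by blast
  show ?thesis by (rule that[of u v w u']) (simp_all add: 1 pushoutD[OF 1(8)])
qed

lemma standard_ex:
  assumes [simp]: "X \<in> Ob C" "Y \<in> Ob C" "u \<in> mor C X Y"
  obtains Z u' v w where "Z \<in> Ob C" "u' \<in> mor C (J X) Z" "v \<in> mor C Y Z" "w \<in> mor C Z (S X)"
    "is_pushout C X (J X) Y Z (\<iota> X) u u' v"
    "Comp C (J X) Z (S X) w u' = \<pi> X" "Comp C Y Z (S X) w v = zmor C Y (S X)"
    "Comp C X (J X) Z u' (\<iota> X) = Comp C X Y Z v u"
proof -
  have "inflation E X (J X) (\<iota> X)" using cosyzygy_conflation[of X] by (auto simp: inflation_def)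
  then obtain Z u' v where po: "is_pushout C X (J X) Y Z (\<iota> X) u u' v"
    using inflation_pushout[of X "J X" "\<iota> X" Y u] by auto
  note [simp] = pushoutD(1-3)[OF po]
  obtain w where "w \<in> mor C Z (S X)" "Comp C (J X) Z (S X) w u' = \<pi> X" "Comp C Y Z (S X) w v = zmor C Y (S X)"
    by (rule pushout_ex[OF po, of "S X" "\<pi> X" "zmor C Y (S X)"]) simp_all
  then show ?thesis by (intro that[of Z u' v w]) (simp_all add: po pushoutD(4)[OF po])
qed

lemma standard_in_triangles: "D \<subseteq> triangles ST S"
  by (auto elim!: standardE)

lemma Delta_stableI:
  assumes "(X, Y, Z', U, V', W') \<in> D" "is_iso ST Z' Z H" "X \<in> Ob C" "Y \<in> Ob C"
    "V \<in> mor ST Y Z" "W \<in> mor ST Z (S X)"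
    and eq: "Comp ST Y Z' Z H V' = V" "Comp ST Z' Z (S X) W H = W'"
  shows "(X, Y, Z, U, V, W) \<in> \<Delta>"
proof -
  have t: "(X, Y, Z', U, V', W') \<in> triangles ST S" using assms(1) standard_in_triangles by blast
  have [simp]: "H \<in> mor ST Z' Z" "Z \<in> Ob C" using assms(2) by (auto simp: is_iso_def)
  have "triangle_iso ST S Sm (X, Y, Z', U, V', W') (X, Y, Z, U, V, W)"
    unfolding triangle_iso_def triangle_mor_def split
    using assms(2-6) t eq ST.is_iso_id[of X] ST.is_iso_id[of Y]
    by (intro exI[of _ "cls X X (Idn C X)"] exI[of _ "cls Y Y (Idn C Y)"] exI[of _ H]) simp
  then show ?thesis using assms t unfolding triangle_closure_def by auto
qed

text \<open>The standard cone \<open>Z'\<close> of \<open>u\<close> is the sum of \<open>Z\<close>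
  and the injective \<open>J X\<close>: \<open>h\<close> and \<open>l\<close> compare it with
  \<open>Z\<close>, and \<open>k\<close> projects to \<open>J X\<close>. Its connecting map is
  \<open>\<pi> k - b h\<close>, so up to a map through \<open>J X\<close> it is
  \<open>- b h\<close>; this is the origin of the sign.\<close>

lemma conflation_triangle:
  assumes c: "(X, u, Y, v, Z) \<in> E" and [simp]: "a \<in> mor C Y (J X)" "b \<in> mor C Z (S X)"
    and au: "Comp C X Y (J X) a u = \<iota> X" and bv: "Comp C Y Z (S X) b v = Comp C Y (J X) (S X) (\<pi> X) a"
  shows "(X, Y, Z, cls X Y u, cls Y Z v, cls Z (S X) (mneg C Z (S X) b)) \<in> \<Delta>"
proof -
  note [simp] = conflationD(1-5,8)[OF c]
  obtain Z' u' v' w' where [simp]: "Z' \<in> Ob C" "u' \<in> mor C (J X) Z'" "v' \<in> mor C Y Z'" "w' \<in> mor C Z' (S X)"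
    and po: "is_pushout C X (J X) Y Z' (\<iota> X) u u' v'"
    and w': "Comp C (J X) Z' (S X) w' u' = \<pi> X" "Comp C Y Z' (S X) w' v' = zmor C Y (S X)"
    and sq: "Comp C X (J X) Z' u' (\<iota> X) = Comp C X Y Z' v' u"
    by (rule standard_ex[of X Y u]) simp_all
  obtain h where [simp]: "h \<in> mor C Z' Z" and h: "Comp C (J X) Z' Z h u' = zmor C (J X) Z" "Comp C Y Z' Z h v' = v"
    by (rule pushout_ex[OF po, of Z "zmor C (J X) Z" v]) simp_all
  obtain k where [simp]: "k \<in> mor C Z' (J X)" and k: "Comp C (J X) Z' (J X) k u' = Idn C (J X)" "Comp C Y Z' (J X) k v' = a"
    by (rule pushout_ex[OF po, of "J X" "Idn C (J X)" a]) (simp_all add: au)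
  \<comment> \<open>\<open>v'\<close> and \<open>u' a\<close> agree on \<open>u\<close> by the
    pushout square, and their difference descends to a section of \<open>h\<close>.\<close>
  obtain l where [simp]: "l \<in> mor C Z Z'" and l: "v' = madd C Y Z' (Comp C Y (J X) Z' u' a) (Comp C Y Z Z' l v)"
    by (rule conflation_cokernel_diff[OF c, of Z' v' "Comp C Y (J X) Z' u' a"]) (simp_all add: au sq)
  have "Comp C Y Z Z (Comp C Z Z' Z h l) v = Comp C Y Z Z (Idn C Z) v"
    using arg_cong[OF l, of "Comp C Y Z' Z h"] by (simp add: h h[THEN reassoc])
  then have hl: "Comp C Z Z' Z h l = Idn C Z" by (rule deflation_epi[OF c]) simp_all
  have "Idn C Z' = madd C Z' Z' (Comp C Z' Z Z' l h) (Comp C Z' (J X) Z' u' k)"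
  proof (rule pushout_eqI[OF po, where W = Z'])
    have v': "v' = madd C Y Z' (Comp C Y Z Z' l v) (Comp C Y (J X) Z' u' a)"
      by (subst l) (simp add: madd_ac)
    show "Comp C Y Z' Z' (Idn C Z') v' = Comp C Y Z' Z' (madd C Z' Z' (Comp C Z' Z Z' l h) (Comp C Z' (J X) Z' u' k)) v'"
      by (simp add: h k v'[symmetric])
  qed (simp_all add: h k)
  then have "cls Z' Z' (Idn C Z') = cls Z' Z' (Comp C Z' Z Z' l h)"
    by (rule cls_eqI_factor[OF J_injective[of X], rotated]) simp_all
  then have iso: "is_iso ST Z' Z (cls Z' Z h)"
    by (intro stable_isoI[of _ _ _ l]) (simp_all add: hl)
  have "w' = madd C Z' (S X) (mneg C Z' (S X) (Comp C Z' Z (S X) b h)) (Comp C Z' (J X) (S X) (\<pi> X) k)"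
    by (rule pushout_eqI[OF po, where W = "S X"]) (simp_all add: h k w' bv)
  then have w'h: "cls Z' (S X) w' = cls Z' (S X) (mneg C Z' (S X) (Comp C Z' Z (S X) b h))"
    by (rule cls_eqI_factor[OF J_injective[of X], rotated]) simp_all
  have "(X, Y, Z', cls X Y u, cls Y Z' v', cls Z' (S X) w') \<in> D"
    by (rule standardI[OF _ _ _ po]) (simp_all add: w')
  then show ?thesis
    by (rule Delta_stableI[OF _ iso]) (simp_all add: h w'h)
qed

text \<open>The maps \<open>v\<close> and \<open>w\<close> form a conflation, because pushouts keep
  cokernels. Its connecting map can be taken to be the lift \<open>s\<close> of \<open>u\<close>,
  and the sign in \<open>conflation_triangle\<close> becomes the sign of the rotation.\<close>

lemma standard_rotate:
  assumes "(X, Y, Z, U, V, W) \<in> D"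
  shows "(Y, Z, S X, V, W, mneg ST (S X) (S Y) (Sm X Y U)) \<in> \<Delta>"
proof -
  obtain u u' v w where UVW: "U = cls X Y u" "V = cls Y Z v" "W = cls Z (S X) w" and
    [simp]: "X \<in> Ob C" "Y \<in> Ob C" "Z \<in> Ob C" "u \<in> mor C X Y" "u' \<in> mor C (J X) Z" "v \<in> mor C Y Z" "w \<in> mor C Z (S X)"
    and po: "is_pushout C X (J X) Y Z (\<iota> X) u u' v"
    and w: "Comp C (J X) Z (S X) w u' = \<pi> X" "Comp C Y Z (S X) w v = zmor C Y (S X)"
    and sq: "Comp C X (J X) Z u' (\<iota> X) = Comp C X Y Z v u"
    using assms by (rule standardE)
  obtain a s where l: "shift_lift X Y u a s" by (rule shift_lift_ex[of X Y u]) simp_all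
  note [simp] = shift_liftD(1-3)[OF l]
  obtain b where [simp]: "b \<in> mor C Z (J Y)" and b: "Comp C (J X) Z (J Y) b u' = a" "Comp C Y Z (J Y) b v = \<iota> Y"
    by (rule pushout_ex[OF po, of "J Y" a "\<iota> Y"]) (simp_all add: shift_liftD(4)[OF l])
  have c: "(Y, v, Z, w, S X) \<in> E"
    by (rule pushout_conflation[OF cosyzygy_conflation[of X] _ _ po]) (simp_all add: w)
  have "(Y, Z, S X, cls Y Z v, cls Z (S X) w, cls (S X) (S Y) (mneg C (S X) (S Y) s)) \<in> \<Delta>"
  proof (rule conflation_triangle[OF c, of b s])
    show "Comp C Z (S X) (S Y) s w = Comp C Z (J Y) (S Y) (\<pi> Y) b"
      by (rule pushout_eqI[OF po, where W = "S Y"]) (simp_all add: w b shift_liftD(5)[OF l])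
  qed (simp_all add: b)
  then show ?thesis by (simp add: UVW shift_cls[OF l])
qed

lemma standard_weak_cokernel:
  assumes D: "(X, Y, Z, U, V, W) \<in> D" and Q [simp]: "Q \<in> Ob C" and K: "K \<in> mor ST Y Q"
    and KU: "Comp ST X Y Q K U = zmor ST X Q"
  shows "\<exists>L\<in>mor ST Z Q. Comp ST Y Z Q L V = K"
proof -
  obtain u u' v w where UVW: "U = cls X Y u" "V = cls Y Z v" "W = cls Z (S X) w" and
    [simp]: "X \<in> Ob C" "Y \<in> Ob C" "Z \<in> Ob C" "u \<in> mor C X Y" "u' \<in> mor C (J X) Z" "v \<in> mor C Y Z" "w \<in> mor C Z (S X)"
    and po: "is_pushout C X (J X) Y Z (\<iota> X) u u' v"
    using D by (rule standardE)
  obtain k where [simp]: "k \<in> mor C Y Q" and k: "K = cls Y Q k" using K by (rule mor_STE)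
  have "cls X Q (Comp C X Y Q k u) = cls X Q (zmor C X Q)" using KU by (simp add: UVW k zmor_ST)
  then obtain I a b where I: "injective_object C E I" and [simp]: "I \<in> Ob C" "a \<in> mor C X I" "b \<in> mor C I Q"
    and ku: "Comp C X Y Q k u = Comp C X I Q b a"
    by (rule cls_zeroD) simp_all
  \<comment> \<open>The nullhomotopy extends over \<open>J X\<close>, which supplies the second leg
    of a strict cocone on the pushout.\<close>
  obtain a' where [simp]: "a' \<in> mor C (J X) I" and a': "Comp C X (J X) I a' (\<iota> X) = a"
    by (rule injective_extend[OF I cosyzygy_conflation[of X], of a]) simp_all
  obtain l where "l \<in> mor C Z Q" "Comp C Y Z Q l v = k"
    by (rule pushout_ex[OF po, of Q "Comp C (J X) I Q b a'" k]) (simp_all add: ku a')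
  then show ?thesis by (intro bexI[of _ "cls Z Q l"]) (simp_all add: UVW k)
qed

lemma standard_morphism:
  assumes s: "(X, Y, Z, U, V, W) \<in> D" and t: "(X', Y', Z', U', V', W') \<in> D"
    and F: "F \<in> mor ST X X'" and G: "G \<in> mor ST Y Y'" and GU: "Comp ST X Y Y' G U = Comp ST X X' Y' U' F"
  shows "\<exists>H. triangle_mor ST S Sm (X, Y, Z, U, V, W) (X', Y', Z', U', V', W') F G H"
proof -
  obtain u p v w where UVW: "U = cls X Y u" "V = cls Y Z v" "W = cls Z (S X) w" and
    [simp]: "X \<in> Ob C" "Y \<in> Ob C" "Z \<in> Ob C" "u \<in> mor C X Y" "p \<in> mor C (J X) Z" "v \<in> mor C Y Z" "w \<in> mor C Z (S X)"
    and po: "is_pushout C X (J X) Y Z (\<iota> X) u p v"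
    and w: "Comp C (J X) Z (S X) w p = \<pi> X" "Comp C Y Z (S X) w v = zmor C Y (S X)"
    and sq: "Comp C X (J X) Z p (\<iota> X) = Comp C X Y Z v u"
    using s by (rule standardE)
  obtain u' p' v' w' where UVW': "U' = cls X' Y' u'" "V' = cls Y' Z' v'" "W' = cls Z' (S X') w'" and
    [simp]: "X' \<in> Ob C" "Y' \<in> Ob C" "Z' \<in> Ob C" "u' \<in> mor C X' Y'" "p' \<in> mor C (J X') Z'" "v' \<in> mor C Y' Z'" "w' \<in> mor C Z' (S X')"
    and po': "is_pushout C X' (J X') Y' Z' (\<iota> X') u' p' v'"
    and w': "Comp C (J X') Z' (S X') w' p' = \<pi> X'" "Comp C Y' Z' (S X') w' v' = zmor C Y' (S X')"
    and sq': "Comp C X' (J X') Z' p' (\<iota> X') = Comp C X' Y' Z' v' u'"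
    using t by (rule standardE)
  obtain f where [simp]: "f \<in> mor C X X'" and f: "F = cls X X' f" using F by (rule mor_STE)
  obtain g where [simp]: "g \<in> mor C Y Y'" and g: "G = cls Y Y' g" using G by (rule mor_STE)
  have "cls X Y' (Comp C X Y Y' g u) = cls X Y' (Comp C X X' Y' u' f)"
    using GU by (simp add: UVW UVW' f g)
  then obtain n where n: "n \<in> SZ X Y'" "n \<in> mor C X Y'" "Comp C X Y Y' g u = madd C X Y' n (Comp C X X' Y' u' f)"
    by (rule cls_eqE) simp_all
  obtain I a b where I: "injective_object C E I" and [simp]: "I \<in> Ob C" "a \<in> mor C X I" "b \<in> mor C I Y'"
    and ba: "n = Comp C X I Y' b a" using n(1) by (rule stably_zeroE)
  obtain a' where [simp]: "a' \<in> mor C (J X) I" and a': "Comp C X (J X) I a' (\<iota> X) = a"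
    by (rule injective_extend[OF I cosyzygy_conflation[of X], of a]) simp_all
  obtain k q where l: "shift_lift X X' f k q" by (rule shift_lift_ex[of X X' f]) simp_all
  note [simp] = shift_liftD(1-3)[OF l]
  \<comment> \<open>The square commutes only up to \<open>b a\<close>. The second summand absorbs
    that error, and it does not disturb the connecting map because \<open>w' v'\<close>
    vanishes.\<close>
  let ?h = "madd C (J X) Z' (Comp C (J X) (J X') Z' p' k) (Comp C (J X) Y' Z' v' (Comp C (J X) I Y' b a'))"
  obtain h where [simp]: "h \<in> mor C Z Z'" and h: "Comp C (J X) Z Z' h p = ?h"
      "Comp C Y Z Z' h v = Comp C Y Y' Z' v' g"
    by (rule pushout_ex[OF po, of Z' ?h "Comp C Y Y' Z' v' g"])
      (simp_all add: shift_liftD(4)[OF l] sq'[THEN reassoc] a' n(3) ba madd_ac)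
  have "Comp C Z Z' (S X') w' h = Comp C Z (S X) (S X') q w"
    by (rule pushout_eqI[OF po, where W = "S X'"])
      (simp_all add: h w w' w'[THEN reassoc] shift_liftD(5)[OF l])
  then show ?thesis
    unfolding triangle_mor_def split using GU
    by (intro exI[of _ "cls Z Z' h"]) (simp add: UVW UVW' f g h shift_cls[OF l])
qed

text \<open>Noether's isomorphism supplies the fourth conflation and the identities that avoid
  connecting maps. Of the remaining ones, one holds strictly by the choice of extensions, the others
  up to maps through \<open>J Z'\<close> and \<open>J Y\<close>.\<close>

lemma octahedron_inflations:
  assumes u: "(X, u, Y, i, Z') \<in> E" and v: "(Y, v, Z, j, X') \<in> E"
  shows "\<exists>Z' i i' X' j j' Y' k k' f g. (X, Y, Z', cls X Y u, i, i') \<in> \<Delta> \<and> (Y, Z, X', cls Y Z v, j, j') \<in> \<Delta> \<and>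
     (X, Z, Y', Comp ST X Y Z (cls Y Z v) (cls X Y u), k, k') \<in> \<Delta> \<and>
     octahedron ST S Sm \<Delta> X Y Z (cls X Y u) (cls Y Z v) Z' i i' X' j j' Y' k k' f g"
proof -
  note [simp] = conflationD(1-5)[OF u] conflationD(1-5)[OF v]
  obtain P f k g where vu: "(X, Comp C X Y Z v u, Z, k, P) \<in> E" and fg: "(Z', f, P, g, X') \<in> E"
    and fi: "Comp C Y Z' P f i = Comp C Y Z P k v" and gk: "Comp C Z P X' g k = j"
    using u v by (rule noether)
  note [simp] = conflationD(1-5)[OF vu] conflationD(1-5)[OF fg]
  obtain a3 where [simp]: "a3 \<in> mor C Z (J X)" and a3: "Comp C X Z (J X) a3 (Comp C X Y Z v u) = \<iota> X"
    by (rule injective_extend[OF J_injective[of X] vu, of "\<iota> X"]) simp_all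
  obtain a2 where [simp]: "a2 \<in> mor C Z (J Y)" and a2: "Comp C Y Z (J Y) a2 v = \<iota> Y"
    by (rule injective_extend[OF J_injective[of Y] v, of "\<iota> Y"]) simp_all
  obtain a4 where [simp]: "a4 \<in> mor C P (J Z')" and a4: "Comp C Z' P (J Z') a4 f = \<iota> Z'"
    by (rule injective_extend[OF J_injective[of Z'] fg, of "\<iota> Z'"]) simp_all
  \<comment> \<open>The extension of \<open>\<iota> X\<close> over \<open>Y\<close> is taken to be
    the restriction of \<open>a3\<close> from \<open>Z\<close>; this is what makes
    \<open>b3 f = b1\<close> hold on the nose.\<close>
  obtain b1 where [simp]: "b1 \<in> mor C Z' (S X)"
    and b1: "Comp C Y Z' (S X) b1 i = Comp C Y (J X) (S X) (\<pi> X) (Comp C Y Z (J X) a3 v)"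
    by (rule conflation_cokernel[OF u, of "S X" "Comp C Y (J X) (S X) (\<pi> X) (Comp C Y Z (J X) a3 v)"]) (simp_all add: a3)
  obtain b2 where [simp]: "b2 \<in> mor C X' (S Y)"
    and b2: "Comp C Z X' (S Y) b2 j = Comp C Z (J Y) (S Y) (\<pi> Y) a2"
    by (rule conflation_cokernel[OF v, of "S Y" "Comp C Z (J Y) (S Y) (\<pi> Y) a2"]) (simp_all add: a2)
  obtain b3 where [simp]: "b3 \<in> mor C P (S X)"
    and b3: "Comp C Z P (S X) b3 k = Comp C Z (J X) (S X) (\<pi> X) a3"
    by (rule conflation_cokernel[OF vu, of "S X" "Comp C Z (J X) (S X) (\<pi> X) a3"]) (simp_all add: a3)
  obtain b4 where [simp]: "b4 \<in> mor C X' (S Z')"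
    and b4: "Comp C P X' (S Z') b4 g = Comp C P (J Z') (S Z') (\<pi> Z') a4"
    by (rule conflation_cokernel[OF fg, of "S Z'" "Comp C P (J Z') (S Z') (\<pi> Z') a4"]) (simp_all add: a4)
  have t1: "(X, Y, Z', cls X Y u, cls Y Z' i, cls Z' (S X) (mneg C Z' (S X) b1)) \<in> \<Delta>"
    by (rule conflation_triangle[OF u, of "Comp C Y Z (J X) a3 v"]) (simp_all add: a3 b1)
  have t2: "(Y, Z, X', cls Y Z v, cls Z X' j, cls X' (S Y) (mneg C X' (S Y) b2)) \<in> \<Delta>"
    by (rule conflation_triangle[OF v, of a2]) (simp_all add: a2 b2)
  have t3: "(X, Z, P, cls X Z (Comp C X Y Z v u), cls Z P k, cls P (S X) (mneg C P (S X) b3)) \<in> \<Delta>"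
    by (rule conflation_triangle[OF vu, of a3]) (simp_all add: a3 b3)
  have t4: "(Z', P, X', cls Z' P f, cls P X' g, cls X' (S Z') (mneg C X' (S Z') b4)) \<in> \<Delta>"
    by (rule conflation_triangle[OF fg, of a4]) (simp_all add: a4 b4)
  have "Comp C Y Z' (S X) (Comp C Z' P (S X) b3 f) i = Comp C Y Z' (S X) b1 i"
    by (simp add: fi b3[THEN reassoc] b1)
  then have b3f: "Comp C Z' P (S X) b3 f = b1" by (rule deflation_epi[OF u]) simp_all
  obtain ai si where li: "shift_lift Y Z' i ai si" by (rule shift_lift_ex[of Y Z' i]) simp_all
  note [simp] = shift_liftD(1-3)[OF li]
  obtain au su where lu: "shift_lift X Y u au su" by (rule shift_lift_ex[of X Y u]) simp_all
  note [simp] = shift_liftD(1-3)[OF lu]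
  \<comment> \<open>Both \<open>ai a2\<close> and \<open>a4 k\<close> restrict along
    \<open>v\<close> to \<open>\<iota> Z'\<close> after \<open>i\<close>, so they differ by
    \<open>t j\<close>; passing to quotients, \<open>si b2\<close> is \<open>b4\<close> up to a map
    through \<open>J Z'\<close>.\<close>
  obtain t where [simp]: "t \<in> mor C X' (J Z')"
    and t: "Comp C Z (J Y) (J Z') ai a2 = madd C Z (J Z') (Comp C Z P (J Z') a4 k) (Comp C Z X' (J Z') t j)"
    by (rule conflation_cokernel_diff[OF v, of "J Z'" "Comp C Z (J Y) (J Z') ai a2" "Comp C Z P (J Z') a4 k"])
      (simp_all add: a2 shift_liftD(4)[OF li] fi[symmetric] a4[THEN reassoc])
  have "Comp C Z X' (S Z') (Comp C X' (S Y) (S Z') si b2) j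
      = Comp C Z X' (S Z') (madd C X' (S Z') b4 (Comp C X' (J Z') (S Z') (\<pi> Z') t)) j"
    by (simp add: b2 shift_liftD(5)[OF li, THEN reassoc] t)
      (simp add: gk[symmetric] b4[THEN reassoc])
  then have "Comp C X' (S Y) (S Z') si b2 = madd C X' (S Z') b4 (Comp C X' (J Z') (S Z') (\<pi> Z') t)"
    by (rule deflation_epi[OF v]) simp_all
  then have "cls X' (S Z') (Comp C X' (S Y) (S Z') si b2) = cls X' (S Z') b4"
    by (rule cls_eqI_factor[OF J_injective[of Z'], rotated]) simp_all
  then have "mneg ST X' (S Z') (cls X' (S Z') (Comp C X' (S Y) (S Z') si b2)) = mneg ST X' (S Z') (cls X' (S Z') b4)"
    by (rule arg_cong)
  then have si: "cls X' (S Z') (mneg C X' (S Z') (Comp C X' (S Y) (S Z') si b2)) = cls X' (S Z') (mneg C X' (S Z') b4)"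
    by simp
  \<comment> \<open>Likewise \<open>a2\<close> and \<open>au a3\<close> have the same restriction
    along \<open>v u\<close>, and their difference through \<open>k\<close> yields the last square
    up to a map through \<open>J Y\<close>.\<close>
  obtain r where [simp]: "r \<in> mor C P (J Y)"
    and r: "a2 = madd C Z (J Y) (Comp C Z (J X) (J Y) au a3) (Comp C Z P (J Y) r k)"
    by (rule conflation_cokernel_diff[OF vu, of "J Y" a2 "Comp C Z (J X) (J Y) au a3"])
      (simp_all add: a3 a2[THEN reassoc] shift_liftD(4)[OF lu])
  have "Comp C Z P (S Y) (Comp C P X' (S Y) b2 g) k = Comp C Z P (S Y) (madd C P (S Y) (Comp C P (S X) (S Y) su b3) (Comp C P (J Y) (S Y) (\<pi> Y) r)) k"
    by (simp add: gk b2 b3 shift_liftD(5)[OF lu, THEN reassoc]) (subst r, simp)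
  then have "Comp C P X' (S Y) b2 g = madd C P (S Y) (Comp C P (S X) (S Y) su b3) (Comp C P (J Y) (S Y) (\<pi> Y) r)"
    by (rule deflation_epi[OF vu]) simp_all
  then have "cls P (S Y) (Comp C P X' (S Y) b2 g) = cls P (S Y) (Comp C P (S X) (S Y) su b3)"
    by (rule cls_eqI_factor[OF J_injective[of Y], rotated]) simp_all
  then have "mneg ST P (S Y) (cls P (S Y) (Comp C P X' (S Y) b2 g)) = mneg ST P (S Y) (cls P (S Y) (Comp C P (S X) (S Y) su b3))"
    by (rule arg_cong)
  then have su: "cls P (S Y) (mneg C P (S Y) (Comp C P X' (S Y) b2 g)) = cls P (S Y) (mneg C P (S Y) (Comp C P (S X) (S Y) su b3))"
    by simp
  have "octahedron ST S Sm \<Delta> X Y Z (cls X Y u) (cls Y Z v) Z' (cls Y Z' i) (cls Z' (S X) (mneg C Z' (S X) b1))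
     X' (cls Z X' j) (cls X' (S Y) (mneg C X' (S Y) b2)) P (cls Z P k) (cls P (S X) (mneg C P (S X) b3))
     (cls Z' P f) (cls P X' g)"
    unfolding octahedron_def using t4 si su by (simp add: fi gk b3f shift_cls[OF li] shift_cls[OF lu])
  with t1 t2 t3 show ?thesis by (metis (no_types, lifting) Comp_ST conflationD(1,2,3,4)[OF u] conflationD(2,3,4)[OF v])
qed

text \<open>Adding \<open>J X\<close> to the target turns \<open>u\<close> into the inflation with
  components \<open>\<iota> X\<close> and \<open>u\<close>. The inclusion of \<open>Y\<close> is a
  stable isomorphism, and the component through \<open>J X\<close> is stably zero.\<close>

lemma stable_inflation:
  assumes [simp]: "X \<in> Ob C" "Y \<in> Ob C" "u \<in> mor C X Y"
  obtains Y' a u' where "is_iso ST Y Y' (cls Y Y' a)" "a \<in> mor C Y Y'" "inflation E X Y' u'"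
    "cls X Y' u' = cls X Y' (Comp C X Y Y' a u)"
proof -
  obtain B i1 i2 p1 p2 where b: "is_biproduct C (J X) Y B i1 i2 p1 p2" using ex_biproduct[of "J X" Y] by auto
  note [simp] = biproductD(1-11)[OF b]
  have "inflation E X (J X) (\<iota> X)" using cosyzygy_conflation[of X] by (auto simp: inflation_def)
  then have 1: "inflation E X B (madd C X B (Comp C X (J X) B i1 (\<iota> X)) (Comp C X Y B i2 u))"
    by (rule inflation_into_biproduct[OF _ _ b]) simp
  have "madd C X B (Comp C X (J X) B i1 (\<iota> X)) (Comp C X Y B i2 u) = madd C X B (Comp C X Y B i2 u) (Comp C X (J X) B i1 (\<iota> X))"
    by (simp add: madd_ac)
  then have 2: "cls X B (madd C X B (Comp C X (J X) B i1 (\<iota> X)) (Comp C X Y B i2 u)) = cls X B (Comp C X Y B i2 u)"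
    by (rule cls_eqI_factor[OF J_injective[of X], rotated]) simp_all
  have "Idn C B = madd C B B (Comp C B Y B i2 p2) (Comp C B (J X) B i1 p1)"
    by (subst biproductD(12)[OF b, symmetric]) (simp add: madd_ac)
  then have "cls B B (Idn C B) = cls B B (Comp C B Y B i2 p2)"
    by (rule cls_eqI_factor[OF J_injective[of X], rotated]) simp_all
  then have "is_iso ST Y B (cls Y B i2)" by (intro stable_isoI[of _ _ _ p2]) simp_all
  then show ?thesis by (rule that[OF _ _ 1 2]) simp
qed

lemma stable_octahedron:
  assumes X: "X \<in> Ob C" "Y \<in> Ob C" "Z \<in> Ob C" and U: "U \<in> mor ST X Y" and V: "V \<in> mor ST Y Z"
  shows "\<exists>Y1 Z1 a b u1 v1 Z' i i' X' j j' Y' k k' f g. is_iso ST Y Y1 a \<and> is_iso ST Z Z1 b \<and>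
        u1 = Comp ST X Y Y1 a U \<and> Comp ST Y Y1 Z1 v1 a = Comp ST Y Z Z1 b V \<and>
        (X, Y1, Z', u1, i, i') \<in> \<Delta> \<and> (Y1, Z1, X', v1, j, j') \<in> \<Delta> \<and>
        (X, Z1, Y', Comp ST X Y1 Z1 v1 u1, k, k') \<in> \<Delta> \<and>
        octahedron ST S Sm \<Delta> X Y1 Z1 u1 v1 Z' i i' X' j j' Y' k k' f g"
proof -
  note [simp] = X
  obtain u where [simp]: "u \<in> mor C X Y" and u: "U = cls X Y u" using U by (rule mor_STE)
  obtain v where [simp]: "v \<in> mor C Y Z" and v: "V = cls Y Z v" using V by (rule mor_STE)
  obtain Y1 a u1 where a: "is_iso ST Y Y1 (cls Y Y1 a)" "a \<in> mor C Y Y1" and u1: "inflation E X Y1 u1"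
    "cls X Y1 u1 = cls X Y1 (Comp C X Y Y1 a u)"
    by (rule stable_inflation[of X Y u]) simp_all
  note [simp] = inflationD[OF u1(1)] a(2)
  obtain A' where A': "A' \<in> mor ST Y1 Y" "Comp ST Y Y1 Y A' (cls Y Y1 a) = Idn ST Y"
    using ST.is_isoE[OF a(1)] by metis
  then obtain a' where [simp]: "a' \<in> mor C Y1 Y" and a': "A' = cls Y1 Y a'" by (auto elim: mor_STE)
  have aa: "cls Y Y (Comp C Y Y1 Y a' a) = cls Y Y (Idn C Y)" using A' by (simp add: a')
  \<comment> \<open>The second inflation has to start at \<open>Y1\<close>, so \<open>v\<close> is
    first moved there along a stable inverse of \<open>a\<close>.\<close>
  obtain Z1 b v1 where b: "is_iso ST Z Z1 (cls Z Z1 b)" "b \<in> mor C Z Z1" and v1: "inflation E Y1 Z1 v1"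
    "cls Y1 Z1 v1 = cls Y1 Z1 (Comp C Y1 Z Z1 b (Comp C Y1 Y Z v a'))"
    by (rule stable_inflation[of Y1 Z "Comp C Y1 Y Z v a'"]) simp_all
  note [simp] = inflationD[OF v1(1)] b(2)
  have "Comp ST Y Y1 Z1 (cls Y1 Z1 v1) (cls Y Y1 a) = Comp ST Y Y Z1 (cls Y Z1 (Comp C Y Z Z1 b v)) (cls Y Y (Comp C Y Y1 Y a' a))"
    unfolding v1(2) by simp
  then have va: "Comp ST Y Y1 Z1 (cls Y1 Z1 v1) (cls Y Y1 a) = Comp ST Y Z Z1 (cls Z Z1 b) V"
    unfolding aa v by simp
  have ua: "cls X Y1 u1 = Comp ST X Y Y1 (cls Y Y1 a) U" by (simp add: u u1(2))
  obtain i Z' where c1: "(X, u1, Y1, i, Z') \<in> E" using u1 by (auto simp: inflation_def)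
  obtain j X' where c2: "(Y1, v1, Z1, j, X') \<in> E" using v1 by (auto simp: inflation_def)
  have "\<exists>U1 V1. U1 = Comp ST X Y Y1 (cls Y Y1 a) U \<and> Comp ST Y Y1 Z1 V1 (cls Y Y1 a) = Comp ST Y Z Z1 (cls Z Z1 b) V \<and>
     (\<exists>Z' i i' X' j j' Y' k k' f g. (X, Y1, Z', U1, i, i') \<in> \<Delta> \<and> (Y1, Z1, X', V1, j, j') \<in> \<Delta> \<and>
        (X, Z1, Y', Comp ST X Y1 Z1 V1 U1, k, k') \<in> \<Delta> \<and>
        octahedron ST S Sm \<Delta> X Y1 Z1 U1 V1 Z' i i' X' j j' Y' k k' f g)"
    by (intro exI[of _ "cls X Y1 u1"] exI[of _ "cls Y1 Z1 v1"] conjI ua va octahedron_inflations[OF c1 c2])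
  then show ?thesis using a(1) b(1) by blast
qed

lemma stable_pretriangulation: "pretriangulation ST S Sm D"
proof (intro pretriangulation.intro pretriangulation_axioms.intro)
  show "additive_category ST" by (rule additive_category_ST)
  show "additive_functor ST ST S Sm" by (rule shift_functor)
  show "D \<subseteq> triangles ST S" by (rule standard_in_triangles)
next
  fix X Y G assume "X \<in> Ob ST" "Y \<in> Ob ST" "G \<in> mor ST (S X) (S Y)"
  then obtain s where [simp]: "X \<in> Ob C" "Y \<in> Ob C" "s \<in> mor C (S X) (S Y)" and G: "G = cls (S X) (S Y) s"
    by (auto elim: mor_STE)
  obtain f a where l: "shift_lift X Y f a s" by (rule cosyzygy_full[of X Y s]) simp_all
  show "\<exists>F\<in>mor ST X Y. Sm X Y F = G"
    using shift_liftD(1)[OF l] by (intro bexI[of _ "cls X Y f"]) (simp_all add: G shift_cls[OF l])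
next
  fix X Y F F' assume a: "X \<in> Ob ST" "Y \<in> Ob ST" "F \<in> mor ST X Y" "F' \<in> mor ST X Y" "Sm X Y F = Sm X Y F'"
  then obtain f f' where [simp]: "X \<in> Ob C" "Y \<in> Ob C" "f \<in> mor C X Y" "f' \<in> mor C X Y"
    and F: "F = cls X Y f" "F' = cls X Y f'" by (auto elim!: mor_STE)
  obtain k s where l: "shift_lift X Y f k s" by (rule shift_lift_ex[of X Y f]) simp_all
  obtain k' s' where l': "shift_lift X Y f' k' s'" by (rule shift_lift_ex[of X Y f']) simp_all
  show "F = F'" using a(5) shift_lift_diff[OF l l'] by (simp add: F shift_cls[OF l] shift_cls[OF l'])
next
  fix Y assume "Y \<in> Ob ST" then show "\<exists>X\<in>Ob ST. \<exists>e. is_iso ST (S X) Y e" by (simp add: cosyzygy_surj)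
next
  fix X Y U assume "X \<in> Ob ST" "Y \<in> Ob ST" "U \<in> mor ST X Y"
  then obtain u where [simp]: "X \<in> Ob C" "Y \<in> Ob C" "u \<in> mor C X Y" and U: "U = cls X Y u" by (auto elim: mor_STE)
  obtain Z u' v w where "Z \<in> Ob C" "u' \<in> mor C (J X) Z" "v \<in> mor C Y Z" "w \<in> mor C Z (S X)"
    "is_pushout C X (J X) Y Z (\<iota> X) u u' v"
    "Comp C (J X) Z (S X) w u' = \<pi> X" "Comp C Y Z (S X) w v = zmor C Y (S X)"
    by (rule standard_ex[of X Y u]) simp_all
  then have "(X, Y, Z, cls X Y u, cls Y Z v, cls Z (S X) w) \<in> D"
    by (intro standardI) simp_all
  then show "\<exists>Z v w. (X, Y, Z, U, v, w) \<in> D" unfolding U by blast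
next
  fix X assume "X \<in> Ob ST"
  then have [simp]: "X \<in> Ob C" by simp
  \<comment> \<open>The standard cone of an identity is \<open>J X\<close>, which is stably
    zero.\<close>
  have po: "is_pushout C X (J X) X (J X) (\<iota> X) (Idn C X) (Idn C (J X)) (\<iota> X)"
    unfolding is_pushout_def
  proof (intro conjI ballI impI)
    fix W a b assume [simp]: "W \<in> Ob C" "a \<in> mor C (J X) W" "b \<in> mor C X W"
      and "Comp C X (J X) W a (\<iota> X) = Comp C X X W b (Idn C X)"
    then have b: "Comp C X (J X) W a (\<iota> X) = b" by simp
    show "\<exists>!u. u \<in> mor C (J X) W \<and> Comp C (J X) (J X) W u (Idn C (J X)) = a \<and> Comp C X (J X) W u (\<iota> X) = b"
    proof (rule ex1I[of _ a])
      fix u assume u: "u \<in> mor C (J X) W \<and> Comp C (J X) (J X) W u (Idn C (J X)) = a \<and> Comp C X (J X) W u (\<iota> X) = b"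
      then show "u = a" using comp_id_right[of "J X" W u] by simp
    qed (simp add: b)
  qed simp_all
  have "(X, X, J X, cls X X (Idn C X), cls X (J X) (\<iota> X), cls (J X) (S X) (\<pi> X)) \<in> D"
    by (rule standardI[OF _ _ _ po]) simp_all
  moreover have "Idn C (J X) = madd C (J X) (J X) (zmor C (J X) (J X)) (Comp C (J X) (J X) (J X) (Idn C (J X)) (Idn C (J X)))"
    by simp
  then have "cls (J X) (J X) (Idn C (J X)) = cls (J X) (J X) (zmor C (J X) (J X))"
    by (rule cls_eqI_factor[OF J_injective[of X], rotated]) simp_all
  then have "is_zero_object ST (J X)" by (simp add: ST.zero_object_Idn zmor_ST)
  ultimately show "\<exists>Z v w. is_zero_object ST Z \<and> (X, X, Z, Idn ST X, v, w) \<in> D" unfolding Idn_ST by blast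
next
  fix X Y Z U V W assume "(X, Y, Z, U, V, W) \<in> D"
  then obtain u u' v w where UVW: "U = cls X Y u" "V = cls Y Z v" "W = cls Z (S X) w" and
    [simp]: "X \<in> Ob C" "Y \<in> Ob C" "Z \<in> Ob C" "u \<in> mor C X Y" "u' \<in> mor C (J X) Z" "v \<in> mor C Y Z" "w \<in> mor C Z (S X)"
    and sq: "Comp C X (J X) Z u' (\<iota> X) = Comp C X Y Z v u"
    by (rule standardE)
  have "Comp C X Y Z v u = madd C X Z (zmor C X Z) (Comp C X (J X) Z u' (\<iota> X))" by (simp add: sq)
  then have "cls X Z (Comp C X Y Z v u) = cls X Z (zmor C X Z)"
    by (rule cls_eqI_factor[OF J_injective[of X], rotated]) simp_all
  then show "Comp ST X Y Z V U = zmor ST X Z" by (simp add: UVW zmor_ST)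
qed (use standard_weak_cokernel standard_rotate standard_morphism stable_octahedron in \<open>simp_all\<close>)

theorem stable_triangulated: "triangulated_category ST S Sm (stable_triangles C E \<iota> J \<pi> S)"
proof -
  have "stable_triangles C E \<iota> J \<pi> S = \<Delta>"
    unfolding stable_triangles_def triangle_closure_def by simp
  then show ?thesis
    using pretriangulation.triangulated_category_closure[OF stable_pretriangulation] by simp
qed

end

section \<open>Complexes in an additive category\<close>

text \<open>Composites name the objects between which they run, so \<open>X (n + 1 + 1)\<close> and
  \<open>X (n + 2)\<close> must be brought to one form before equations about differentials can
  match.\<close>

lemma int_succ_succ [simp]: "(n :: int) + 1 + 1 = n + 2" by simp

context preadditive_category
begin

lemma biproduct_expand_from:
  assumes b: "is_biproduct C X Y B i1 i2 p1 p2" and [simp]: "W \<in> Ob C" "f \<in> mor C B W"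
  shows "madd C B W (Comp C B X W (Comp C X B W f i1) p1) (Comp C B Y W (Comp C Y B W f i2) p2) = f"
proof -
  note [simp] = biproductD(1-7)[OF b]
  have "Comp C B B W f (madd C B B (Comp C B X B i1 p1) (Comp C B Y B i2 p2)) = f"
    using biproductD(12)[OF b] by simp
  then show ?thesis by simp
qed

abbreviation "CC \<equiv> complex_category C"

lemma cpx_iff:
  "(X, d) \<in> Ob CC \<longleftrightarrow> (\<forall>n. X n \<in> Ob C) \<and> (\<forall>n. d n \<in> mor C (X n) (X (n + 1))) \<and>
     (\<forall>n. Comp C (X n) (X (n + 1)) (X (n + 2)) (d (n + 1)) (d n) = zmor C (X n) (X (n + 2)))"
  by (simp add: complex_category_def)

lemma cpxD:
  assumes "(X, d) \<in> Ob CC"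
  shows "X n \<in> Ob C" "d n \<in> mor C (X n) (X (n + 1))" "d (n + 1) \<in> mor C (X (n + 1)) (X (n + 2))"
    "Comp C (X n) (X (n + 1)) (X (n + 2)) (d (n + 1)) (d n) = zmor C (X n) (X (n + 2))"
  using assms spec[of "\<lambda>n. d n \<in> mor C (X n) (X (n + 1))" "n + 1"] by (simp_all add: cpx_iff)

lemma chain_iff:
  "f \<in> mor CC (X, dX) (Y, dY) \<longleftrightarrow> (\<forall>n. f n \<in> mor C (X n) (Y n)) \<and>
     (\<forall>n. Comp C (X n) (X (n + 1)) (Y (n + 1)) (f (n + 1)) (dX n) = Comp C (X n) (Y n) (Y (n + 1)) (dY n) (f n))"
  by (simp add: complex_category_def)

text \<open>Oriented to move differentials to the right past a chain map; the last fact is the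
  instance at \<open>n + 1\<close> with its indices already normalized.\<close>

lemma chainD:
  assumes "f \<in> mor CC (X, dX) (Y, dY)"
  shows "f n \<in> mor C (X n) (Y n)"
    "Comp C (X n) (Y n) (Y (n + 1)) (dY n) (f n) = Comp C (X n) (X (n + 1)) (Y (n + 1)) (f (n + 1)) (dX n)"
    "Comp C (X (n + 1)) (Y (n + 1)) (Y (n + 2)) (dY (n + 1)) (f (n + 1))
      = Comp C (X (n + 1)) (X (n + 2)) (Y (n + 2)) (f (n + 2)) (dX (n + 1))"
  using assms spec[of "\<lambda>n. Comp C (X n) (X (n + 1)) (Y (n + 1)) (f (n + 1)) (dX n)
     = Comp C (X n) (Y n) (Y (n + 1)) (dY n) (f n)" "n + 1"] by (simp_all add: chain_iff)

lemma Comp_CC [simp]: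
  "Comp CC (X, dX) (Y, dY) (Z, dZ) g f = (\<lambda>n. Comp C (X n) (Y n) (Z n) (g n) (f n))"
  by (simp add: complex_category_def)

lemma Idn_CC [simp]: "Idn CC (X, d) = (\<lambda>n. Idn C (X n))"
  by (simp add: complex_category_def)

lemma madd_CC [simp]: "madd CC (X, dX) (Y, dY) f g = (\<lambda>n. madd C (X n) (Y n) (f n) (g n))"
  by (simp add: complex_category_def)

lemma zmor_CC [simp]: "zmor CC (X, dX) (Y, dY) = (\<lambda>n. zmor C (X n) (Y n))"
  by (simp add: complex_category_def)

lemma chain_comp:
  assumes X: "(X, dX) \<in> Ob CC" and Y: "(Y, dY) \<in> Ob CC" and Z: "(Z, dZ) \<in> Ob CC"
    and f: "f \<in> mor CC (X, dX) (Y, dY)" and g: "g \<in> mor CC (Y, dY) (Z, dZ)"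
  shows "(\<lambda>n. Comp C (X n) (Y n) (Z n) (g n) (f n)) \<in> mor CC (X, dX) (Z, dZ)"
proof -
  note [simp] = cpxD(1-3)[OF X] cpxD(1-3)[OF Y] cpxD(1-3)[OF Z] chainD(1)[OF f] chainD(1)[OF g]
  show ?thesis
    unfolding chain_iff by (simp add: chainD(2)[OF f] chainD(2)[OF g, THEN reassoc])
qed

lemma preadditive_CC: "preadditive_category CC"
proof (rule preadditive_category.intro)
  fix P Q assume "P \<in> Ob CC" "Q \<in> Ob CC"
  then obtain X dX Y dY where PQ: "P = (X, dX)" "Q = (Y, dY)" and X: "(X, dX) \<in> Ob CC" and Y: "(Y, dY) \<in> Ob CC"
    by (cases P; cases Q) auto
  note [simp] = cpxD[OF X] cpxD[OF Y]
  show "comm_group (Hom CC P Q)" unfolding PQ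
  proof (rule comm_groupI)
    fix f assume f: "f \<in> mor CC (X, dX) (Y, dY)"
    note [simp] = chainD(1)[OF f]
    have "(\<lambda>n. mneg C (X n) (Y n) (f n)) \<in> mor CC (X, dX) (Y, dY)"
      by (simp add: chain_iff chainD(2)[OF f])
    moreover have "madd CC (X, dX) (Y, dY) (\<lambda>n. mneg C (X n) (Y n) (f n)) f = zmor CC (X, dX) (Y, dY)"
      by simp
    ultimately show "\<exists>g\<in>mor CC (X, dX) (Y, dY). madd CC (X, dX) (Y, dY) g f = zmor CC (X, dX) (Y, dY)" by blast
  qed (auto simp: chain_iff madd_ac)
next
  fix P Q R f g assume "P \<in> Ob CC" "Q \<in> Ob CC" "R \<in> Ob CC" "f \<in> mor CC P Q" "g \<in> mor CC Q R"
  then show "Comp CC P Q R g f \<in> mor CC P R"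
    by (cases P; cases Q; cases R) (simp add: chain_comp)
qed (auto simp: chain_iff, auto simp: cpx_iff)

end

context additive_category
begin

lemma biproduct_family:
  assumes "\<And>n :: int. X n \<in> Ob C" "\<And>n. Y n \<in> Ob C"
  shows "\<exists>B i1 i2 p1 p2. \<forall>n. is_biproduct C (X n) (Y n) (B n) (i1 n) (i2 n) (p1 n) (p2 n)"
proof -
  have "\<forall>n. \<exists>B i1 i2 p1 p2. is_biproduct C (X n) (Y n) B i1 i2 p1 p2"
    using ex_biproduct assms by blast
  then show ?thesis by metis
qed

lemma additive_CC: "additive_category CC"
proof (intro additive_category.intro preadditive_CC additive_category_axioms.intro)
  interpret CC: preadditive_category CC by (rule preadditive_CC)
  obtain N where N: "is_zero_object C N" using ex_zero_object by auto
  then have [simp]: "N \<in> Ob C" "Idn C N = zmor C N N" by (simp_all add: zero_object_Idn)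
  have "is_zero_object CC (\<lambda>n. N, \<lambda>n. zmor C N N)"
    unfolding CC.zero_object_Idn by (simp add: cpx_iff)
  then show "\<exists>N. is_zero_object CC N" ..
next
  fix P Q assume "P \<in> Ob CC" "Q \<in> Ob CC"
  then obtain X dX Y dY where PQ: "P = (X, dX)" "Q = (Y, dY)" and X: "(X, dX) \<in> Ob CC" and Y: "(Y, dY) \<in> Ob CC"
    by (cases P; cases Q) auto
  note [simp] = cpxD[OF X] cpxD[OF Y] cpxD(4)[OF X, THEN reassoc] cpxD(4)[OF Y, THEN reassoc] X Y
  obtain B i1 i2 p1 p2 where "\<forall>n. is_biproduct C (X n) (Y n) (B n) (i1 n) (i2 n) (p1 n) (p2 n)"
    using biproduct_family[of X Y] by auto
  then have b: "\<And>n. is_biproduct C (X n) (Y n) (B n) (i1 n) (i2 n) (p1 n) (p2 n)" by blast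
  note [simp] = biproductD[OF b] biproductD(8-11)[OF b, THEN reassoc]
  define d where "d n = madd C (B n) (B (n + 1)) (Comp C (B n) (X (n + 1)) (B (n + 1)) (i1 (n + 1)) (Comp C (B n) (X n) (X (n + 1)) (dX n) (p1 n)))
     (Comp C (B n) (Y (n + 1)) (B (n + 1)) (i2 (n + 1)) (Comp C (B n) (Y n) (Y (n + 1)) (dY n) (p2 n)))" for n
  have [simp]: "(B, d) \<in> Ob CC"
    unfolding cpx_iff d_def by simp
  have "is_biproduct CC (X, dX) (Y, dY) (B, d) i1 i2 p1 p2"
    unfolding is_biproduct_def by (simp add: chain_iff) (simp add: d_def)
  then show "\<exists>B i1 i2 p1 p2. is_biproduct CC P Q B i1 i2 p1 p2" unfolding PQ by blast
qed

end

section \<open>The exact structure defined by a natural transformation\<close>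

text \<open>What the construction uses of \<open>(1)\<close> and \<open>\<eta>\<close>: a fully
  faithful twist under which every object has a preimage, a natural monic transformation, and its
  compatibility with the twist. Monicity lets relations between classes pass to their factors
  through \<open>eta\<close>.\<close>

locale twisted_category = additive_category C
  for C :: "('o, 'm) cat" +
  fixes tw :: "'o \<Rightarrow> 'o" and twm :: "'m \<Rightarrow> 'm" and itw :: "'o \<Rightarrow> 'o" and eta :: "'o \<Rightarrow> 'm"
  assumes tw_ob [simp]: "X \<in> Ob C \<Longrightarrow> tw X \<in> Ob C"
    and itw_ob [simp]: "X \<in> Ob C \<Longrightarrow> itw X \<in> Ob C"
    and tw_itw [simp]: "X \<in> Ob C \<Longrightarrow> tw (itw X) = X"
    and twm_mor [simp]: "\<lbrakk>X \<in> Ob C; Y \<in> Ob C; f \<in> mor C X Y\<rbrakk> \<Longrightarrow> twm f \<in> mor C (tw X) (tw Y)"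
    and twm_full: "\<lbrakk>X \<in> Ob C; Y \<in> Ob C; g \<in> mor C (tw X) (tw Y)\<rbrakk> \<Longrightarrow> \<exists>f\<in>mor C X Y. twm f = g"
    and twm_inj: "\<lbrakk>X \<in> Ob C; Y \<in> Ob C; f \<in> mor C X Y; f' \<in> mor C X Y; twm f = twm f'\<rbrakk> \<Longrightarrow> f = f'"
    and twm_comp [simp]: "\<lbrakk>X \<in> Ob C; Y \<in> Ob C; Z \<in> Ob C; f \<in> mor C X Y; g \<in> mor C Y Z\<rbrakk>
      \<Longrightarrow> twm (Comp C X Y Z g f) = Comp C (tw X) (tw Y) (tw Z) (twm g) (twm f)"
    and twm_id [simp]: "X \<in> Ob C \<Longrightarrow> twm (Idn C X) = Idn C (tw X)"
    and twm_add [simp]: "\<lbrakk>X \<in> Ob C; Y \<in> Ob C; f \<in> mor C X Y; g \<in> mor C X Y\<rbrakk>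
      \<Longrightarrow> twm (madd C X Y f g) = madd C (tw X) (tw Y) (twm f) (twm g)"
    and eta_mor [simp]: "X \<in> Ob C \<Longrightarrow> eta X \<in> mor C (tw X) X"
    and eta_natural: "\<lbrakk>X \<in> Ob C; Y \<in> Ob C; f \<in> mor C X Y\<rbrakk>
      \<Longrightarrow> Comp C (tw X) (tw Y) Y (eta Y) (twm f) = Comp C (tw X) X Y f (eta X)"
    and eta_tw: "X \<in> Ob C \<Longrightarrow> eta (tw X) = twm (eta X)"
    and eta_mono: "\<lbrakk>X \<in> Ob C; Y \<in> Ob C; g \<in> mor C X (tw Y); g' \<in> mor C X (tw Y);
        Comp C X (tw Y) Y (eta Y) g = Comp C X (tw Y) Y (eta Y) g'\<rbrakk> \<Longrightarrow> g = g'"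
begin

sublocale CC: additive_category CC by (rule additive_CC)

text \<open>\<open>(s, r)\<close> splits the sequence degreewise, and \<open>\<eta> g\<close> is its class, the off-diagonal part
  of the differential of the middle term.\<close>

definition eta_splitting where
  "eta_splitting X dX i Y dY p Z dZ r s g \<longleftrightarrow>
     (X, dX) \<in> Ob CC \<and> (Y, dY) \<in> Ob CC \<and> (Z, dZ) \<in> Ob CC \<and>
     i \<in> mor CC (X, dX) (Y, dY) \<and> p \<in> mor CC (Y, dY) (Z, dZ) \<and>
     (\<forall>n. is_biproduct C (X n) (Z n) (Y n) (i n) (s n) (r n) (p n)) \<and>
     (\<forall>n. g n \<in> mor C (Z n) (tw (X (n + 1)))) \<and>
     (\<forall>n. Comp C (Z n) (Y (n + 1)) (X (n + 1)) (r (n + 1)) (Comp C (Z n) (Y n) (Y (n + 1)) (dY n) (s n))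
        = Comp C (Z n) (tw (X (n + 1))) (X (n + 1)) (eta (X (n + 1))) (g n))"

definition eta_conflations where
  "eta_conflations = {((X, dX), i, (Y, dY), p, (Z, dZ)) | X dX i Y dY p Z dZ. \<exists>r s g. eta_splitting X dX i Y dY p Z dZ r s g}"

lemma splittingD:
  assumes "eta_splitting X dX i Y dY p Z dZ r s g"
  shows "(X, dX) \<in> Ob CC" "(Y, dY) \<in> Ob CC" "(Z, dZ) \<in> Ob CC"
    "i \<in> mor CC (X, dX) (Y, dY)" "p \<in> mor CC (Y, dY) (Z, dZ)"
    "is_biproduct C (X n) (Z n) (Y n) (i n) (s n) (r n) (p n)"
    "g n \<in> mor C (Z n) (tw (X (n + 1)))" "g (n + 1) \<in> mor C (Z (n + 1)) (tw (X (n + 2)))"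
    "Comp C (Z n) (Y (n + 1)) (X (n + 1)) (r (n + 1)) (Comp C (Z n) (Y n) (Y (n + 1)) (dY n) (s n))
        = Comp C (Z n) (tw (X (n + 1))) (X (n + 1)) (eta (X (n + 1))) (g n)"
  using assms spec[of "\<lambda>n. g n \<in> mor C (Z n) (tw (X (n + 1)))" "n + 1"] by (simp_all add: eta_splitting_def)

lemmas splitting_simps =
  splittingD(1-5,7,8)
  splittingD(1)[THEN cpxD(1)] splittingD(1)[THEN cpxD(2)] splittingD(1)[THEN cpxD(3)]
  splittingD(2)[THEN cpxD(1)] splittingD(2)[THEN cpxD(2)] splittingD(2)[THEN cpxD(3)]
  splittingD(3)[THEN cpxD(1)] splittingD(3)[THEN cpxD(2)] splittingD(3)[THEN cpxD(3)]
  splittingD(4)[THEN chainD(1)] splittingD(5)[THEN chainD(1)]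
  splittingD(6)[THEN biproductD(5)] splittingD(6)[THEN biproductD(6)]

lemmas splitting_eqs =
  splittingD(1)[THEN cpxD(4)] splittingD(2)[THEN cpxD(4)] splittingD(3)[THEN cpxD(4)]
  splittingD(4)[THEN chainD(2)] splittingD(4)[THEN chainD(3)]
  splittingD(5)[THEN chainD(2)] splittingD(5)[THEN chainD(3)]
  splittingD(6)[THEN biproductD(8)] splittingD(6)[THEN biproductD(9)]
  splittingD(6)[THEN biproductD(10)] splittingD(6)[THEN biproductD(11)]

text \<open>The column of \<open>dY\<close> at the quotient: the class in the component
  \<open>X\<close> and, because \<open>p\<close> is a chain map, \<open>dZ\<close> in the component
  \<open>Z\<close>.\<close>

lemma splitting_section:
  assumes h: "eta_splitting X dX i Y dY p Z dZ r s g"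
  shows "Comp C (Z n) (Y n) (Y (n + 1)) (dY n) (s n) =
     madd C (Z n) (Y (n + 1)) (Comp C (Z n) (X (n + 1)) (Y (n + 1)) (i (n + 1)) (Comp C (Z n) (tw (X (n + 1))) (X (n + 1)) (eta (X (n + 1))) (g n)))
       (Comp C (Z n) (Z (n + 1)) (Y (n + 1)) (s (n + 1)) (dZ n))"
proof -
  note [simp] = splitting_simps[OF h] splitting_eqs[OF h] splitting_eqs[OF h, THEN reassoc] splittingD(9)[OF h]
  have "Comp C (Z n) (Y (n + 1)) (Z (n + 1)) (p (n + 1)) (Comp C (Z n) (Y n) (Y (n + 1)) (dY n) (s n)) =
     Comp C (Z n) (Y n) (Z (n + 1)) (Comp C (Y n) (Z n) (Z (n + 1)) (dZ n) (p n)) (s n)" by simp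
  also have "\<dots> = Comp C (Z n) (Z n) (Z (n + 1)) (dZ n) (Comp C (Z n) (Y n) (Z n) (p n) (s n))"
    by (simp del: splitting_eqs(6)[OF h])
  also have "\<dots> = dZ n" by simp
  finally have [simp]: "Comp C (Z n) (Y (n + 1)) (Z (n + 1)) (p (n + 1)) (Comp C (Z n) (Y n) (Y (n + 1)) (dY n) (s n)) = dZ n" .
  show ?thesis
    by (rule biproduct_eq_toI[OF splittingD(6)[OF h, of "n + 1"], where W = "Z n"]) simp_all
qed

lemma splitting_retraction:
  assumes h: "eta_splitting X dX i Y dY p Z dZ r s g"
  shows "Comp C (Y n) (Y (n + 1)) (X (n + 1)) (r (n + 1)) (dY n) =
     madd C (Y n) (X (n + 1)) (Comp C (Y n) (X n) (X (n + 1)) (dX n) (r n))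
       (Comp C (Y n) (tw (X (n + 1))) (X (n + 1)) (eta (X (n + 1))) (Comp C (Y n) (Z n) (tw (X (n + 1))) (g n) (p n)))"
proof -
  note [simp] = splitting_simps[OF h] splitting_eqs[OF h] splitting_eqs[OF h, THEN reassoc] splittingD(9)[OF h]
  show ?thesis
    by (rule biproduct_eq_fromI[OF splittingD(6)[OF h, of "n"], where W = "X (n + 1)"]) simp_all
qed

text \<open>The off-diagonal entry of \<open>dY dY = 0\<close>, with \<open>eta\<close> cancelled.
  Up to the sign of the shifted differential it says that \<open>g\<close> is a chain map from the
  desuspension of \<open>Z\<close> to the twist of \<open>X\<close>.\<close>

lemma splitting_class:
  assumes h: "eta_splitting X dX i Y dY p Z dZ r s g"
  shows "madd C (Z n) (tw (X (n + 2)))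
     (Comp C (Z n) (tw (X (n + 1))) (tw (X (n + 2))) (twm (dX (n + 1))) (g n))
     (Comp C (Z n) (Z (n + 1)) (tw (X (n + 2))) (g (n + 1)) (dZ n)) = zmor C (Z n) (tw (X (n + 2)))"
proof -
  note [simp] = splitting_simps[OF h] splitting_eqs[OF h] splitting_eqs[OF h, THEN reassoc] splittingD(9)[OF h]
    splitting_section[OF h, of n] splitting_section[OF h, of "n + 1", unfolded int_succ_succ, THEN reassoc]
  have "Comp C (Z n) (Y (n + 2)) (X (n + 2)) (r (n + 2)) (Comp C (Z n) (Y (n + 1)) (Y (n + 2)) (dY (n + 1))
     (Comp C (Z n) (Y n) (Y (n + 1)) (dY n) (s n))) = zmor C (Z n) (X (n + 2))"
    by (simp del: splitting_section[OF h, of n])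
  then have "madd C (Z n) (X (n + 2))
     (Comp C (Z n) (X (n + 1)) (X (n + 2)) (dX (n + 1)) (Comp C (Z n) (tw (X (n + 1))) (X (n + 1)) (eta (X (n + 1))) (g n)))
     (Comp C (Z n) (tw (X (n + 2))) (X (n + 2)) (eta (X (n + 2))) (Comp C (Z n) (Z (n + 1)) (tw (X (n + 2))) (g (n + 1)) (dZ n)))
     = zmor C (Z n) (X (n + 2))"
    by simp
  then show ?thesis
    by - (rule eta_mono[of "Z n" "X (n + 2)"], simp_all add: eta_natural[THEN reassoc])
qed

end

section \<open>Conflations under composition, pushout, pullback and isomorphism\<close>

context preadditive_category
begin

lemma biproduct_sym:
  assumes b: "is_biproduct C X Y B i1 i2 p1 p2"
  shows "is_biproduct C Y X B i2 i1 p2 p1"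
proof -
  note [simp] = biproductD(1-11)[OF b]
  show ?thesis unfolding is_biproduct_def using biproductD(12)[OF b] by (simp add: madd_commute)
qed

text \<open>In a two-step split filtration the complement of the bottom layer is the sum of the two
  upper layers. Applied to swapped biproducts it also serves composites of deflations.\<close>

lemma biproduct_trans:
  assumes b1: "is_biproduct C X Z Y i s r p" and b2: "is_biproduct C Y V W j t q v"
    and b3: "is_biproduct C Z V Q a b a' b'"
  shows "is_biproduct C X Q W (Comp C X Y W j i)
     (madd C Q W (Comp C Q Y W j (Comp C Q Z Y s a')) (Comp C Q V W t b'))
     (Comp C W Y X r q) (madd C W Q (Comp C W Z Q a (Comp C W Y Z p q)) (Comp C W V Q b v))"
proof -
  note [simp] = biproductD(1-11)[OF b1] biproductD(8-11)[OF b1, THEN reassoc]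
    biproductD(1-11)[OF b2] biproductD(8-11)[OF b2, THEN reassoc]
    biproductD[OF b3] biproductD(8-11)[OF b3, THEN reassoc]
  have e: "madd C W W (Comp C W Y W j (Comp C W X Y i (Comp C W Y X r q))) (Comp C W Y W j (Comp C W Z Y s (Comp C W Y Z p q)))
      = Comp C W Y W j q"
    using arg_cong[OF biproduct_expand[OF b1, of W q], of "Comp C W Y W j"] by simp
  have "madd C W W (madd C W W (Comp C W Y W j (Comp C W X Y i (Comp C W Y X r q))) (Comp C W Y W j (Comp C W Z Y s (Comp C W Y Z p q))))
     (Comp C W V W t v) = Idn C W"
    unfolding e using biproductD(12)[OF b2] .
  then show ?thesis unfolding is_biproduct_def by simp
qed

end

context twisted_category
begin

lemma splitting_kernel_cokernel:
  assumes h: "eta_splitting X dX i Y dY p Z dZ r s g"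
  shows "((X, dX), i, (Y, dY), p, (Z, dZ)) \<in> kernel_cokernel_pairs CC"
proof -
  note [simp] = splitting_simps[OF h] splitting_eqs[OF h] splitting_eqs[OF h, THEN reassoc]
    splitting_section[OF h] splitting_retraction[OF h] splitting_retraction[OF h, THEN reassoc]
  have "\<exists>!u. u \<in> mor CC W (X, dX) \<and> Comp CC W (X, dX) (Y, dY) i u = f"
    if W: "W \<in> Ob CC" and f: "f \<in> mor CC W (Y, dY)" and pf: "Comp CC W (Y, dY) (Z, dZ) p f = zmor CC W (Z, dZ)" for W f
  proof -
    obtain V dV where W': "W = (V, dV)" by (cases W)
    note V = W[unfolded W'] and f = f[unfolded W'] and pf = pf[unfolded W', simplified, THEN fun_cong]
    note [simp] = cpxD[OF V] chainD[OF f] pf pf[THEN reassoc]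
    \<comment> \<open>\<open>r\<close> fails to be a chain map by a term that starts with
      \<open>p\<close>; as \<open>p f = 0\<close>, the composite \<open>r f\<close> is a chain
      map.\<close>
    let ?u = "\<lambda>n. Comp C (V n) (Y n) (X n) (r n) (f n)"
    show ?thesis unfolding W'
    proof (rule ex1I[of _ ?u])
      have 1: "Comp C (V n) (V (n + 1)) (X (n + 1)) (?u (n + 1)) (dV n) = Comp C (V n) (X n) (X (n + 1)) (dX n) (?u n)" for n
      proof -
        have "Comp C (V n) (V (n + 1)) (X (n + 1)) (?u (n + 1)) (dV n)
          = Comp C (V n) (Y (n + 1)) (X (n + 1)) (r (n + 1)) (Comp C (V n) (Y n) (Y (n + 1)) (dY n) (f n))" by simp
        also have "\<dots> = Comp C (V n) (Y n) (X (n + 1)) (Comp C (Y n) (Y (n + 1)) (X (n + 1)) (r (n + 1)) (dY n)) (f n)"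
          by (rule comp_assoc) simp_all
        also have "\<dots> = Comp C (V n) (X n) (X (n + 1)) (dX n) (?u n)"
          by simp
        finally show ?thesis .
      qed
      have "Comp C (V n) (X n) (Y n) (i n) (?u n) = f n" for n
        using biproduct_expand[OF splittingD(6)[OF h, of n], of "V n" "f n"] by simp
      then show "?u \<in> mor CC (V, dV) (X, dX) \<and> Comp CC (V, dV) (X, dX) (Y, dY) i ?u = f"
        using 1 by (simp add: chain_iff)
    next
      fix u assume u: "u \<in> mor CC (V, dV) (X, dX) \<and> Comp CC (V, dV) (X, dX) (Y, dY) i u = f"
      then have [simp]: "u n \<in> mor C (V n) (X n)" for n using chainD(1) by blast
      have "f n = Comp C (V n) (X n) (Y n) (i n) (u n)" for n using u by auto
      then show "u = ?u" by (intro ext) simp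
    qed
  qed
  moreover have "\<exists>!u. u \<in> mor CC (Z, dZ) W \<and> Comp CC (Y, dY) (Z, dZ) W u p = f"
    if W: "W \<in> Ob CC" and f: "f \<in> mor CC (Y, dY) W" and fi: "Comp CC (X, dX) (Y, dY) W f i = zmor CC (X, dX) W" for W f
  proof -
    obtain V dV where W': "W = (V, dV)" by (cases W)
    note V = W[unfolded W'] and f = f[unfolded W'] and fi = fi[unfolded W', simplified, THEN fun_cong]
    note [simp] = cpxD[OF V] chainD(1)[OF f] fi fi[THEN reassoc]
    \<comment> \<open>\<open>s\<close> fails to be a chain map by a term that ends with
      \<open>i\<close>, and \<open>f\<close> kills \<open>i\<close>.\<close>
    let ?u = "\<lambda>n. Comp C (Z n) (Y n) (V n) (f n) (s n)"
    show ?thesis unfolding W'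
    proof (rule ex1I[of _ ?u])
      have 1: "Comp C (Z n) (Z (n + 1)) (V (n + 1)) (?u (n + 1)) (dZ n) = Comp C (Z n) (V n) (V (n + 1)) (dV n) (?u n)" for n
        by (simp add: chainD(2)[OF f, THEN reassoc])
      have "Comp C (Y n) (Z n) (V n) (?u n) (p n) = f n" for n
        using biproduct_expand_from[OF splittingD(6)[OF h, of n], of "V n" "f n"] by simp
      then show "?u \<in> mor CC (Z, dZ) (V, dV) \<and> Comp CC (Y, dY) (Z, dZ) (V, dV) ?u p = f"
        using 1 by (simp add: chain_iff del: comp_assoc_right)
    next
      fix u assume u: "u \<in> mor CC (Z, dZ) (V, dV) \<and> Comp CC (Y, dY) (Z, dZ) (V, dV) u p = f"
      then have [simp]: "u n \<in> mor C (Z n) (V n)" for n using chainD(1) by blast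
      have "f n = Comp C (Y n) (Z n) (V n) (u n) (p n)" for n using u by auto
      then show "u = ?u" by (intro ext) simp
    qed
  qed
  ultimately show ?thesis
    unfolding kernel_cokernel_pairs_def is_kernel_def is_cokernel_def by simp
qed

text \<open>The differential of the quotient is forced to be \<open>p dY s\<close>, so it suffices
  to supply the inclusion, a degreewise complement and a factorization of the class.\<close>

lemma splitting_quotient:
  assumes X: "(X, dX) \<in> Ob CC" and Y: "(Y, dY) \<in> Ob CC" and i: "i \<in> mor CC (X, dX) (Y, dY)"
    and b: "\<And>n. is_biproduct C (X n) (Q n) (Y n) (i n) (s n) (r n) (p n)"
    and g: "\<And>n. g n \<in> mor C (Q n) (tw (X (n + 1)))"
    and c: "\<And>n. Comp C (Q n) (Y (n + 1)) (X (n + 1)) (r (n + 1)) (Comp C (Q n) (Y n) (Y (n + 1)) (dY n) (s n))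
        = Comp C (Q n) (tw (X (n + 1))) (X (n + 1)) (eta (X (n + 1))) (g n)"
  obtains dQ where "eta_splitting X dX i Y dY p Q dQ r s g"
proof -
  note [simp] = cpxD[OF X] cpxD[OF Y] cpxD(4)[OF X, THEN reassoc] cpxD(4)[OF Y, THEN reassoc]
    chainD[OF i] chainD(2,3)[OF i, THEN reassoc] biproductD(1-11)[OF b] biproductD(8-11)[OF b, THEN reassoc]
  define d where "d n = Comp C (Q n) (Y (n + 1)) (Q (n + 1)) (p (n + 1)) (Comp C (Q n) (Y n) (Y (n + 1)) (dY n) (s n))" for n
  have [simp]: "d n \<in> mor C (Q n) (Q (n + 1))" for n by (simp add: d_def)
  have [simp]: "d (n + 1) \<in> mor C (Q (n + 1)) (Q (n + 2))" for n by (simp add: d_def)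
  have pd: "Comp C (Y n) (Q n) (Q (n + 1)) (d n) (p n) = Comp C (Y n) (Y (n + 1)) (Q (n + 1)) (p (n + 1)) (dY n)" for n
    by (rule biproduct_eq_fromI[OF b[of n], where W = "Q (n + 1)"]) (simp_all add: d_def)
  have dd: "Comp C (Q n) (Q (n + 1)) (Q (n + 2)) (d (n + 1)) (d n) = zmor C (Q n) (Q (n + 2))" for n
    unfolding d_def[of n] by (simp add: pd[of "n + 1", unfolded int_succ_succ, THEN reassoc])
  show ?thesis
    by (rule that[of d]) (simp add: eta_splitting_def X Y i b g c cpx_iff[of Q] chain_iff[of p] dd pd)
qed

text \<open>Dually, the differential of the kernel is forced to be \<open>r dY i\<close>.\<close>

lemma splitting_subobject:
  assumes Y: "(Y, dY) \<in> Ob CC" and Z: "(Z, dZ) \<in> Ob CC" and p: "p \<in> mor CC (Y, dY) (Z, dZ)"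
    and b: "\<And>n. is_biproduct C (Q n) (Z n) (Y n) (i n) (s n) (r n) (p n)"
    and g: "\<And>n. g n \<in> mor C (Z n) (tw (Q (n + 1)))"
    and c: "\<And>n. Comp C (Z n) (Y (n + 1)) (Q (n + 1)) (r (n + 1)) (Comp C (Z n) (Y n) (Y (n + 1)) (dY n) (s n))
        = Comp C (Z n) (tw (Q (n + 1))) (Q (n + 1)) (eta (Q (n + 1))) (g n)"
  obtains dQ where "eta_splitting Q dQ i Y dY p Z dZ r s g"
proof -
  note [simp] = cpxD[OF Y] cpxD[OF Z] cpxD(4)[OF Y, THEN reassoc] cpxD(4)[OF Z, THEN reassoc]
    chainD(1)[OF p] biproductD(1-11)[OF b] biproductD(8-11)[OF b, THEN reassoc]
  define d where "d n = Comp C (Q n) (Y (n + 1)) (Q (n + 1)) (r (n + 1)) (Comp C (Q n) (Y n) (Y (n + 1)) (dY n) (i n))" for n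
  have [simp]: "d n \<in> mor C (Q n) (Q (n + 1))" for n by (simp add: d_def)
  have [simp]: "d (n + 1) \<in> mor C (Q (n + 1)) (Q (n + 2))" for n by (simp add: d_def)
  have id: "Comp C (Q n) (Q (n + 1)) (Y (n + 1)) (i (n + 1)) (d n) = Comp C (Q n) (Y n) (Y (n + 1)) (dY n) (i n)" for n
    by (rule biproduct_eq_toI[OF b[of "n + 1"], where W = "Q n"]) (simp_all add: d_def chainD(2)[OF p, symmetric, THEN reassoc])
  have dd: "Comp C (Q n) (Q (n + 1)) (Q (n + 2)) (d (n + 1)) (d n) = zmor C (Q n) (Q (n + 2))" for n
    unfolding d_def[of "n + 1", unfolded int_succ_succ] by (simp add: id)
  show ?thesis
    by (rule that[of d]) (simp add: eta_splitting_def Z Y p b g c cpx_iff[of Q] chain_iff[of i] dd id)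
qed

lemma eta_inflationE:
  assumes "inflation eta_conflations P Q i"
  obtains X dX Y dY p Z dZ r s g where "P = (X, dX)" "Q = (Y, dY)" "eta_splitting X dX i Y dY p Z dZ r s g"
  using assms unfolding inflation_def eta_conflations_def by blast

lemma eta_deflationE:
  assumes "deflation eta_conflations Q R p"
  obtains X dX i Y dY Z dZ r s g where "Q = (Y, dY)" "R = (Z, dZ)" "eta_splitting X dX i Y dY p Z dZ r s g"
  using assms unfolding deflation_def eta_conflations_def by blast

lemma eta_inflationI: "eta_splitting X dX i Y dY p Z dZ r s g \<Longrightarrow> inflation eta_conflations (X, dX) (Y, dY) i"
  unfolding inflation_def eta_conflations_def by blast

lemma eta_deflationI: "eta_splitting X dX i Y dY p Z dZ r s g \<Longrightarrow> deflation eta_conflations (Y, dY) (Z, dZ) p"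
  unfolding deflation_def eta_conflations_def by blast

lemma eta_inflation_comp:
  assumes "inflation eta_conflations P Q i" "inflation eta_conflations Q R j"
  shows "inflation eta_conflations P R (Comp CC P Q R j i)"
proof -
  obtain X dX Y dY p Z dZ r s g where PQ: "P = (X, dX)" "Q = (Y, dY)" and h: "eta_splitting X dX i Y dY p Z dZ r s g"
    using assms(1) by (rule eta_inflationE)
  obtain Y' dY' W dW q V dV r2 s2 g2 where QR: "Q = (Y', dY')" "R = (W, dW)" and h2': "eta_splitting Y' dY' j W dW q V dV r2 s2 g2"
    using assms(2) by (rule eta_inflationE)
  have h2: "eta_splitting Y dY j W dW q V dV r2 s2 g2" using h2' QR PQ by simp
  note [simp] = splitting_simps[OF h] splitting_eqs[OF h] splitting_eqs[OF h, THEN reassoc]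
    splitting_simps[OF h2] splitting_eqs[OF h2] splitting_eqs[OF h2, THEN reassoc]
    splitting_section[OF h2] splitting_section[OF h2, THEN reassoc] splitting_section[OF h] splitting_section[OF h, THEN reassoc]
  obtain Q' a b a' b' where "\<forall>n. is_biproduct C (Z n) (V n) (Q' n) (a n) (b n) (a' n) (b' n)"
    using biproduct_family[of Z V] by auto
  then have bQ: "\<And>n. is_biproduct C (Z n) (V n) (Q' n) (a n) (b n) (a' n) (b' n)" by blast
  note [simp] = biproductD[OF bQ] biproductD(8-11)[OF bQ, THEN reassoc]
  \<comment> \<open>One entry for each upper layer: \<open>g\<close> on \<open>Z\<close>, and on
    \<open>V\<close> the class \<open>g2\<close> projected from \<open>Y\<close> to
    \<open>X\<close>, where naturality of \<open>eta\<close> turns \<open>r\<close> into its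
    twist.\<close>
  let ?g = "\<lambda>n. madd C (Q' n) (tw (X (n + 1))) (Comp C (Q' n) (Z n) (tw (X (n + 1))) (g n) (a' n))
     (Comp C (Q' n) (tw (Y (n + 1))) (tw (X (n + 1))) (twm (r (n + 1))) (Comp C (Q' n) (V n) (tw (Y (n + 1))) (g2 n) (b' n)))"
  obtain dQ where "eta_splitting X dX (\<lambda>n. Comp C (X n) (Y n) (W n) (j n) (i n)) W dW
      (\<lambda>n. madd C (W n) (Q' n) (Comp C (W n) (Z n) (Q' n) (a n) (Comp C (W n) (Y n) (Z n) (p n) (r2 n))) (Comp C (W n) (V n) (Q' n) (b n) (q n)))
      Q' dQ
      (\<lambda>n. Comp C (W n) (Y n) (X n) (r n) (r2 n))
      (\<lambda>n. madd C (Q' n) (W n) (Comp C (Q' n) (Y n) (W n) (j n) (Comp C (Q' n) (Z n) (Y n) (s n) (a' n))) (Comp C (Q' n) (V n) (W n) (s2 n) (b' n)))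
      ?g"
  proof (rule splitting_quotient[of X dX W dW])
    show "(\<lambda>n. Comp C (X n) (Y n) (W n) (j n) (i n)) \<in> mor CC (X, dX) (W, dW)"
      by (rule chain_comp[of X dX Y dY W dW]) simp_all
  next
    fix n
    show "is_biproduct C (X n) (Q' n) (W n) (Comp C (X n) (Y n) (W n) (j n) (i n))
      (madd C (Q' n) (W n) (Comp C (Q' n) (Y n) (W n) (j n) (Comp C (Q' n) (Z n) (Y n) (s n) (a' n))) (Comp C (Q' n) (V n) (W n) (s2 n) (b' n)))
      (Comp C (W n) (Y n) (X n) (r n) (r2 n))
      (madd C (W n) (Q' n) (Comp C (W n) (Z n) (Q' n) (a n) (Comp C (W n) (Y n) (Z n) (p n) (r2 n))) (Comp C (W n) (V n) (Q' n) (b n) (q n)))"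
      by (rule biproduct_trans[OF splittingD(6)[OF h] splittingD(6)[OF h2] bQ])
  next
    fix n
    show "?g n \<in> mor C (Q' n) (tw (X (n + 1)))" by simp
    show "Comp C (Q' n) (W (n + 1)) (X (n + 1)) (Comp C (W (n + 1)) (Y (n + 1)) (X (n + 1)) (r (n + 1)) (r2 (n + 1)))
      (Comp C (Q' n) (W n) (W (n + 1)) (dW n)
        (madd C (Q' n) (W n) (Comp C (Q' n) (Y n) (W n) (j n) (Comp C (Q' n) (Z n) (Y n) (s n) (a' n))) (Comp C (Q' n) (V n) (W n) (s2 n) (b' n))))
      = Comp C (Q' n) (tw (X (n + 1))) (X (n + 1)) (eta (X (n + 1))) (?g n)"
      by (simp add: eta_natural[THEN reassoc])
  qed simp_all
  then show ?thesis unfolding PQ QR Comp_CC by (rule eta_inflationI)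
qed

end

context twisted_category
begin

lemma eta_deflation_comp:
  assumes "deflation eta_conflations P Q p" "deflation eta_conflations Q R q"
  shows "deflation eta_conflations P R (Comp CC P Q R q p)"
proof -
  obtain X dX i Y dY Z dZ r s g where PQ: "P = (Y, dY)" "Q = (Z, dZ)" and h: "eta_splitting X dX i Y dY p Z dZ r s g"
    using assms(1) by (rule eta_deflationE)
  obtain U dU i2 Z' dZ' V dV r2 s2 g2 where QR: "Q = (Z', dZ')" "R = (V, dV)" and h2': "eta_splitting U dU i2 Z' dZ' q V dV r2 s2 g2"
    using assms(2) by (rule eta_deflationE)
  have h2: "eta_splitting U dU i2 Z dZ q V dV r2 s2 g2" using h2' QR PQ by simp
  note [simp] = splitting_simps[OF h] splitting_eqs[OF h] splitting_eqs[OF h, THEN reassoc]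
    splitting_simps[OF h2] splitting_eqs[OF h2] splitting_eqs[OF h2, THEN reassoc]
    splitting_section[OF h2] splitting_section[OF h2, THEN reassoc] splitting_section[OF h] splitting_section[OF h, THEN reassoc]
  note [simp del] = splitting_eqs(6,7)[OF h] splitting_eqs(6,7)[OF h, THEN reassoc]
  obtain Q' a b a' b' where "\<forall>n. is_biproduct C (X n) (U n) (Q' n) (a n) (b n) (a' n) (b' n)"
    using biproduct_family[of X U] by auto
  then have bQ: "\<And>n. is_biproduct C (X n) (U n) (Q' n) (a n) (b n) (a' n) (b' n)" by blast
  note [simp] = biproductD[OF bQ] biproductD(8-11)[OF bQ, THEN reassoc]
  \<comment> \<open>One entry for each layer of the kernel: \<open>g2\<close> in \<open>U\<close>,
    and in \<open>X\<close> the class \<open>g\<close> restricted along the section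
    \<open>s2\<close>.\<close>
  let ?g = "\<lambda>n. madd C (V n) (tw (Q' (n + 1)))
     (Comp C (V n) (tw (U (n + 1))) (tw (Q' (n + 1))) (twm (b (n + 1))) (g2 n))
     (Comp C (V n) (tw (X (n + 1))) (tw (Q' (n + 1))) (twm (a (n + 1))) (Comp C (V n) (Z n) (tw (X (n + 1))) (g n) (s2 n)))"
  obtain dQ where "eta_splitting Q' dQ
      (\<lambda>n. madd C (Q' n) (Y n) (Comp C (Q' n) (Z n) (Y n) (s n) (Comp C (Q' n) (U n) (Z n) (i2 n) (b' n))) (Comp C (Q' n) (X n) (Y n) (i n) (a' n)))
      Y dY (\<lambda>n. Comp C (Y n) (Z n) (V n) (q n) (p n)) V dV
      (\<lambda>n. madd C (Y n) (Q' n) (Comp C (Y n) (U n) (Q' n) (b n) (Comp C (Y n) (Z n) (U n) (r2 n) (p n))) (Comp C (Y n) (X n) (Q' n) (a n) (r n)))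
      (\<lambda>n. Comp C (V n) (Z n) (Y n) (s n) (s2 n)) ?g"
  proof (rule splitting_subobject[of Y dY V dV])
    show "(\<lambda>n. Comp C (Y n) (Z n) (V n) (q n) (p n)) \<in> mor CC (Y, dY) (V, dV)"
      by (rule chain_comp[of Y dY Z dZ V dV]) simp_all
  next
    fix n
    show "is_biproduct C (Q' n) (V n) (Y n)
      (madd C (Q' n) (Y n) (Comp C (Q' n) (Z n) (Y n) (s n) (Comp C (Q' n) (U n) (Z n) (i2 n) (b' n))) (Comp C (Q' n) (X n) (Y n) (i n) (a' n)))
      (Comp C (V n) (Z n) (Y n) (s n) (s2 n))
      (madd C (Y n) (Q' n) (Comp C (Y n) (U n) (Q' n) (b n) (Comp C (Y n) (Z n) (U n) (r2 n) (p n))) (Comp C (Y n) (X n) (Q' n) (a n) (r n)))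
      (Comp C (Y n) (Z n) (V n) (q n) (p n))"
      by (rule biproduct_sym[OF biproduct_trans[OF biproduct_sym[OF splittingD(6)[OF h2]] biproduct_sym[OF splittingD(6)[OF h]]
            biproduct_sym[OF bQ]]])
  next
    fix n
    show "?g n \<in> mor C (V n) (tw (Q' (n + 1)))" by simp
    show "Comp C (V n) (Y (n + 1)) (Q' (n + 1))
       (madd C (Y (n + 1)) (Q' (n + 1)) (Comp C (Y (n + 1)) (U (n + 1)) (Q' (n + 1)) (b (n + 1)) (Comp C (Y (n + 1)) (Z (n + 1)) (U (n + 1)) (r2 (n + 1)) (p (n + 1))))
          (Comp C (Y (n + 1)) (X (n + 1)) (Q' (n + 1)) (a (n + 1)) (r (n + 1))))
       (Comp C (V n) (Y n) (Y (n + 1)) (dY n) (Comp C (V n) (Z n) (Y n) (s n) (s2 n)))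
      = Comp C (V n) (tw (Q' (n + 1))) (Q' (n + 1)) (eta (Q' (n + 1))) (?g n)"
      by (simp add: eta_natural[THEN reassoc] madd_ac)
  qed simp_all
  then show ?thesis unfolding PQ QR Comp_CC by (rule eta_deflationI)
qed

lemma eta_inflation_id:
  assumes "P \<in> Ob CC" shows "inflation eta_conflations P P (Idn CC P)"
proof -
  obtain X dX where P: "P = (X, dX)" by (cases P)
  note X = assms[unfolded P]
  note [simp] = cpxD(1-3)[OF X] X
  obtain N where "is_zero_object C N" using ex_zero_object by auto
  then have [simp]: "N \<in> Ob C" "Idn C N = zmor C N N" by (simp_all add: zero_object_Idn)
  have "eta_splitting X dX (\<lambda>n. Idn C (X n)) X dX (\<lambda>n. zmor C (X n) N) (\<lambda>n. N) (\<lambda>n. zmor C N N)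
     (\<lambda>n. Idn C (X n)) (\<lambda>n. zmor C N (X n)) (\<lambda>n. zmor C N (tw (X (n + 1))))"
    unfolding eta_splitting_def by (simp add: is_biproduct_def chain_iff) (simp add: cpx_iff)
  then show ?thesis unfolding P Idn_CC by (rule eta_inflationI)
qed

lemma eta_deflation_id:
  assumes "P \<in> Ob CC" shows "deflation eta_conflations P P (Idn CC P)"
proof -
  obtain X dX where P: "P = (X, dX)" by (cases P)
  note X = assms[unfolded P]
  note [simp] = cpxD(1-3)[OF X] X
  obtain N where "is_zero_object C N" using ex_zero_object by auto
  then have [simp]: "N \<in> Ob C" "Idn C N = zmor C N N" by (simp_all add: zero_object_Idn)
  have "eta_splitting (\<lambda>n. N) (\<lambda>n. zmor C N N) (\<lambda>n. zmor C N (X n)) X dX (\<lambda>n. Idn C (X n)) X dX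
     (\<lambda>n. zmor C (X n) N) (\<lambda>n. Idn C (X n)) (\<lambda>n. zmor C (X n) (tw N))"
    unfolding eta_splitting_def by (simp add: is_biproduct_def chain_iff) (simp add: cpx_iff)
  then show ?thesis unfolding P Idn_CC by (rule eta_deflationI)
qed

lemma eta_inflation_pushout:
  assumes i: "inflation eta_conflations P Q i" and P': "P' \<in> Ob CC" and f: "f \<in> mor CC P P'"
  shows "\<exists>R f' i'. is_pushout CC P Q P' R i f f' i' \<and> inflation eta_conflations P' R i'"
proof -
  obtain X dX Y dY p Z dZ r s g where PQ: "P = (X, dX)" "Q = (Y, dY)" and h: "eta_splitting X dX i Y dY p Z dZ r s g"
    using i by (rule eta_inflationE)
  obtain X' dX' where P'': "P' = (X', dX')" by (cases P')
  note X' = P'[unfolded P''] and f = f[unfolded PQ P'']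
  note [simp] = splitting_simps[OF h] splitting_eqs[OF h] splitting_eqs[OF h, THEN reassoc] X'
    splitting_section[OF h] splitting_section[OF h, THEN reassoc] splitting_retraction[OF h] splitting_retraction[OF h, THEN reassoc]
    cpxD[OF X'] cpxD(4)[OF X', THEN reassoc] chainD[OF f] chainD(2,3)[OF f, THEN reassoc]
  obtain R j \<sigma> \<rho> q where "\<forall>n. is_biproduct C (X' n) (Z n) (R n) (j n) (\<sigma> n) (\<rho> n) (q n)"
    using biproduct_family[of X' Z] by auto
  then have b: "\<And>n. is_biproduct C (X' n) (Z n) (R n) (j n) (\<sigma> n) (\<rho> n) (q n)" by blast
  note [simp] = biproductD(1-11)[OF b] biproductD(8-11)[OF b, THEN reassoc]
  let ?c = "\<lambda>n. Comp C (Z n) (tw (X (n + 1))) (X (n + 1)) (eta (X (n + 1))) (g n)"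
  \<comment> \<open>The pushout is split with the same quotient \<open>Z\<close>; its off-diagonal
    entry is the old class pushed forward along \<open>f\<close>.\<close>
  define d where "d n = madd C (R n) (R (n + 1))
     (Comp C (R n) (X' (n + 1)) (R (n + 1)) (j (n + 1)) (madd C (R n) (X' (n + 1)) (Comp C (R n) (X' n) (X' (n + 1)) (dX' n) (\<rho> n))
        (Comp C (R n) (X (n + 1)) (X' (n + 1)) (f (n + 1)) (Comp C (R n) (Z n) (X (n + 1)) (?c n) (q n)))))
     (Comp C (R n) (Z (n + 1)) (R (n + 1)) (\<sigma> (n + 1)) (Comp C (R n) (Z n) (Z (n + 1)) (dZ n) (q n)))" for n
  have [simp]: "d n \<in> mor C (R n) (R (n + 1))" for n by (simp add: d_def)
  have [simp]: "d (n + 1) \<in> mor C (R (n + 1)) (R (n + 2))" for n by (simp add: d_def)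
  have dj: "Comp C (X' n) (R n) (R (n + 1)) (d n) (j n) = Comp C (X' n) (X' (n + 1)) (R (n + 1)) (j (n + 1)) (dX' n)" for n
    by (simp add: d_def)
  have qd: "Comp C (R n) (Z n) (Z (n + 1)) (dZ n) (q n) = Comp C (R n) (R (n + 1)) (Z (n + 1)) (q (n + 1)) (d n)" for n
    by (simp add: d_def)
  define f' where "f' n = madd C (Y n) (R n) (Comp C (Y n) (X' n) (R n) (j n) (Comp C (Y n) (X n) (X' n) (f n) (r n)))
     (Comp C (Y n) (Z n) (R n) (\<sigma> n) (p n))" for n
  have [simp]: "f' n \<in> mor C (Y n) (R n)" for n by (simp add: f'_def)
  have df': "Comp C (Y n) (R n) (R (n + 1)) (d n) (f' n) = Comp C (Y n) (Y (n + 1)) (R (n + 1)) (f' (n + 1)) (dY n)" for n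
    by (rule biproduct_eq_fromI[OF splittingD(6)[OF h, of n], where W = "R (n + 1)"]) (simp_all add: d_def f'_def madd_ac)
  have f'i: "Comp C (X n) (Y n) (R n) (f' n) (i n) = Comp C (X n) (X' n) (R n) (j n) (f n)" for n
    by (simp add: f'_def)
  \<comment> \<open>The summand \<open>Z\<close> of \<open>R\<close> comes from \<open>Y\<close>
    through \<open>f'\<close>, so \<open>d d = 0\<close> on it is inherited from \<open>Y\<close>
    instead of being expanded.\<close>
  have sf': "\<sigma> n = Comp C (Z n) (Y n) (R n) (f' n) (s n)" for n by (simp add: f'_def)
  have dd: "Comp C (R n) (R (n + 1)) (R (n + 2)) (d (n + 1)) (d n) = zmor C (R n) (R (n + 2))" for n
  proof (rule biproduct_eq_fromI[OF b[of n], where W = "R (n + 2)"])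
    show "Comp C (X' n) (R n) (R (n + 2)) (Comp C (R n) (R (n + 1)) (R (n + 2)) (d (n + 1)) (d n)) (j n) = Comp C (X' n) (R n) (R (n + 2)) (zmor C (R n) (R (n + 2))) (j n)"
      by (simp add: dj dj[of "n + 1", unfolded int_succ_succ, THEN reassoc])
    have "Comp C (Z n) (R n) (R (n + 2)) (Comp C (R n) (R (n + 1)) (R (n + 2)) (d (n + 1)) (d n)) (\<sigma> n) =
      Comp C (Z n) (Y n) (R (n + 2)) (Comp C (Y n) (R (n + 1)) (R (n + 2)) (d (n + 1)) (Comp C (Y n) (R n) (R (n + 1)) (d n) (f' n))) (s n)"
      unfolding sf' by simp
    also have "\<dots> = Comp C (Z n) (Y n) (R (n + 2)) (Comp C (Y n) (Y (n + 1)) (R (n + 2)) (Comp C (Y (n + 1)) (Y (n + 2)) (R (n + 2)) (f' (n + 2)) (dY (n + 1))) (dY n)) (s n)"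
      unfolding df' by (simp add: df'[of "n + 1", unfolded int_succ_succ, THEN reassoc] del: splitting_section[OF h] splitting_section[OF h, THEN reassoc])
    also have "\<dots> = zmor C (Z n) (R (n + 2))"
      by (simp del: splitting_section[OF h] splitting_section[OF h, THEN reassoc])
    finally show "Comp C (Z n) (R n) (R (n + 2)) (Comp C (R n) (R (n + 1)) (R (n + 2)) (d (n + 1)) (d n)) (\<sigma> n) =
       Comp C (Z n) (R n) (R (n + 2)) (zmor C (R n) (R (n + 2))) (\<sigma> n)" by simp
  qed simp_all
  have R [simp]: "(R, d) \<in> Ob CC" by (simp add: cpx_iff dd)
  have jc: "j \<in> mor CC (X', dX') (R, d)" by (simp add: chain_iff dj)
  have qc: "q \<in> mor CC (R, d) (Z, dZ)" by (simp add: chain_iff qd)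
  have f'c: "f' \<in> mor CC (Y, dY) (R, d)" by (simp add: chain_iff df')
  have "eta_splitting X' dX' j R d q Z dZ \<rho> \<sigma> (\<lambda>n. Comp C (Z n) (tw (X (n + 1))) (tw (X' (n + 1))) (twm (f (n + 1))) (g n))"
    unfolding eta_splitting_def by (simp add: jc qc b) (simp add: d_def eta_natural[THEN reassoc])
  then have "inflation eta_conflations P' (R, d) j" unfolding P'' by (rule eta_inflationI)
  moreover have "is_pushout CC (X, dX) (Y, dY) (X', dX') (R, d) i f f' j"
    unfolding is_pushout_def
  proof (intro conjI ballI impI)
    show "Comp CC (X, dX) (Y, dY) (R, d) f' i = Comp CC (X, dX) (X', dX') (R, d) j f" by (simp add: f'i)
  next
    fix W a b' assume W: "W \<in> Ob CC" and a: "a \<in> mor CC (Y, dY) W" and b': "b' \<in> mor CC (X', dX') W"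
      and eq: "Comp CC (X, dX) (Y, dY) W a i = Comp CC (X, dX) (X', dX') W b' f"
    obtain V dV where W': "W = (V, dV)" by (cases W)
    note V = W[unfolded W'] and a = a[unfolded W'] and b' = b'[unfolded W'] and eq = eq[unfolded W', simplified, THEN fun_cong]
    note [simp] = cpxD[OF V] chainD(1)[OF a] chainD(1)[OF b'] eq eq[THEN reassoc]
    \<comment> \<open>Forced on both summands: \<open>b'\<close> on \<open>X'\<close>, and
      \<open>a s\<close> on \<open>Z\<close> because \<open>\<sigma>\<close> is
      \<open>f' s\<close>.\<close>
    define u where "u n = madd C (R n) (V n) (Comp C (R n) (X' n) (V n) (b' n) (\<rho> n))
       (Comp C (R n) (Y n) (V n) (a n) (Comp C (R n) (Z n) (Y n) (s n) (q n)))" for n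
    have [simp]: "u n \<in> mor C (R n) (V n)" for n by (simp add: u_def)
    have uf': "Comp C (Y n) (R n) (V n) (u n) (f' n) = a n" for n
      by (rule biproduct_eq_fromI[OF splittingD(6)[OF h, of n], where W = "V n"]) (simp_all add: u_def f'_def)
    have uj: "Comp C (X' n) (R n) (V n) (u n) (j n) = b' n" for n by (simp add: u_def)
    have uniq: "v n = u n" if [simp]: "v n \<in> mor C (R n) (V n)" and vj: "Comp C (X' n) (R n) (V n) (v n) (j n) = b' n"
      and vf': "Comp C (Y n) (R n) (V n) (v n) (f' n) = a n" for v n
    proof -
      have "Comp C (Z n) (R n) (V n) (v n) (\<sigma> n) = Comp C (Z n) (R n) (V n) (u n) (\<sigma> n)"
        unfolding sf' by (simp add: vf'[THEN reassoc] uf'[THEN reassoc])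
      then show ?thesis
        by - (rule biproduct_eq_fromI[OF b[of n], where W = "V n"], simp_all add: uj vj)
    qed
    have "Comp C (R n) (R (n + 1)) (V (n + 1)) (u (n + 1)) (d n) = Comp C (R n) (V n) (V (n + 1)) (dV n) (u n)" for n
    proof (rule biproduct_eq_fromI[OF b[of n], where W = "V (n + 1)"])
      show "Comp C (X' n) (R n) (V (n + 1)) (Comp C (R n) (R (n + 1)) (V (n + 1)) (u (n + 1)) (d n)) (j n) =
         Comp C (X' n) (R n) (V (n + 1)) (Comp C (R n) (V n) (V (n + 1)) (dV n) (u n)) (j n)"
        by (simp add: dj uj uj[THEN reassoc] chainD(2)[OF b'])
      show "Comp C (Z n) (R n) (V (n + 1)) (Comp C (R n) (R (n + 1)) (V (n + 1)) (u (n + 1)) (d n)) (\<sigma> n) =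
         Comp C (Z n) (R n) (V (n + 1)) (Comp C (R n) (V n) (V (n + 1)) (dV n) (u n)) (\<sigma> n)"
        unfolding sf'
        by (simp add: df'[THEN reassoc] uf'[THEN reassoc] chainD(2)[OF a, THEN reassoc]
            del: splitting_section[OF h] splitting_section[OF h, THEN reassoc])
    qed simp_all
    then have uc: "u \<in> mor CC (R, d) (V, dV)" by (simp add: chain_iff)
    show "\<exists>!u. u \<in> mor CC (R, d) W \<and> Comp CC (Y, dY) (R, d) W u f' = a \<and> Comp CC (X', dX') (R, d) W u j = b'"
      unfolding W'
    proof (rule ex1I[of _ u])
      show "u \<in> mor CC (R, d) (V, dV) \<and> Comp CC (Y, dY) (R, d) (V, dV) u f' = a \<and> Comp CC (X', dX') (R, d) (V, dV) u j = b'"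
        using uc uf' uj by simp
      fix v assume v: "v \<in> mor CC (R, d) (V, dV) \<and> Comp CC (Y, dY) (R, d) (V, dV) v f' = a \<and> Comp CC (X', dX') (R, d) (V, dV) v j = b'"
      show "v = u"
      proof
        fix n
        show "v n = u n" using v chainD(1)[of v] by (intro uniq) auto
      qed
    qed
  qed (simp_all add: jc f'c)
  ultimately show ?thesis unfolding PQ P'' by blast
qed

end

context twisted_category
begin

lemma eta_deflation_pullback:
  assumes i: "deflation eta_conflations P Q p" and Q': "Q' \<in> Ob CC" and f: "f \<in> mor CC Q' Q"
  shows "\<exists>R f' p'. is_pullback CC P Q Q' R p f f' p' \<and> deflation eta_conflations R Q' p'"
proof -
  obtain X dX i Y dY Z dZ r s g where PQ: "P = (Y, dY)" "Q = (Z, dZ)" and h: "eta_splitting X dX i Y dY p Z dZ r s g"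
    using i by (rule eta_deflationE)
  obtain Z' dZ' where Q'': "Q' = (Z', dZ')" by (cases Q')
  note Z' = Q'[unfolded Q''] and f = f[unfolded PQ Q'']
  note [simp] = splitting_simps[OF h] splitting_eqs[OF h] splitting_eqs[OF h, THEN reassoc] Z'
    splitting_section[OF h] splitting_section[OF h, THEN reassoc] splitting_retraction[OF h] splitting_retraction[OF h, THEN reassoc]
    cpxD[OF Z'] cpxD(4)[OF Z', THEN reassoc] chainD[OF f] chainD(2,3)[OF f, THEN reassoc]
  obtain R j \<sigma> \<rho> q where "\<forall>n. is_biproduct C (X n) (Z' n) (R n) (j n) (\<sigma> n) (\<rho> n) (q n)"
    using biproduct_family[of X Z'] by auto
  then have b: "\<And>n. is_biproduct C (X n) (Z' n) (R n) (j n) (\<sigma> n) (\<rho> n) (q n)" by blast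
  note [simp] = biproductD(1-11)[OF b] biproductD(8-11)[OF b, THEN reassoc]
  let ?c = "\<lambda>n. Comp C (Z n) (tw (X (n + 1))) (X (n + 1)) (eta (X (n + 1))) (g n)"
  \<comment> \<open>For the pullback the kernel \<open>X\<close> is kept and the class is restricted
    along \<open>f\<close>.\<close>
  define d where "d n = madd C (R n) (R (n + 1))
     (Comp C (R n) (X (n + 1)) (R (n + 1)) (j (n + 1)) (madd C (R n) (X (n + 1)) (Comp C (R n) (X n) (X (n + 1)) (dX n) (\<rho> n))
        (Comp C (R n) (Z n) (X (n + 1)) (?c n) (Comp C (R n) (Z' n) (Z n) (f n) (q n)))))
     (Comp C (R n) (Z' (n + 1)) (R (n + 1)) (\<sigma> (n + 1)) (Comp C (R n) (Z' n) (Z' (n + 1)) (dZ' n) (q n)))" for n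
  have [simp]: "d n \<in> mor C (R n) (R (n + 1))" for n by (simp add: d_def)
  have [simp]: "d (n + 1) \<in> mor C (R (n + 1)) (R (n + 2))" for n by (simp add: d_def)
  have dj: "Comp C (X n) (R n) (R (n + 1)) (d n) (j n) = Comp C (X n) (X (n + 1)) (R (n + 1)) (j (n + 1)) (dX n)" for n
    by (simp add: d_def)
  have qd: "Comp C (R n) (R (n + 1)) (Z' (n + 1)) (q (n + 1)) (d n) = Comp C (R n) (Z' n) (Z' (n + 1)) (dZ' n) (q n)" for n
    by (simp add: d_def)
  define f' where "f' n = madd C (R n) (Y n) (Comp C (R n) (X n) (Y n) (i n) (\<rho> n))
     (Comp C (R n) (Z n) (Y n) (s n) (Comp C (R n) (Z' n) (Z n) (f n) (q n)))" for n
  have [simp]: "f' n \<in> mor C (R n) (Y n)" for n by (simp add: f'_def)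
  have f'd: "Comp C (R n) (R (n + 1)) (Y (n + 1)) (f' (n + 1)) (d n) = Comp C (R n) (Y n) (Y (n + 1)) (dY n) (f' n)" for n
    by (simp add: d_def f'_def madd_ac)
  have pf': "Comp C (R n) (Y n) (Z n) (p n) (f' n) = Comp C (R n) (Z' n) (Z n) (f n) (q n)" for n
    by (simp add: f'_def)
  \<comment> \<open>Dually to the pushout, components in \<open>X\<close> are computed in
    \<open>Y\<close>, so that \<open>d d = 0\<close> follows from the complex
    \<open>Y\<close>.\<close>
  have rf': "\<rho> n = Comp C (R n) (Y n) (X n) (r n) (f' n)" for n by (simp add: f'_def)
  note f'd1 = f'd[of "n + 1" for n, unfolded int_succ_succ] and qd1 = qd[of "n + 1" for n, unfolded int_succ_succ]
  have dd: "Comp C (R n) (R (n + 1)) (R (n + 2)) (d (n + 1)) (d n) = zmor C (R n) (R (n + 2))" for n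
  proof (rule biproduct_eq_toI[OF b[of "n + 2"], where W = "R n"])
    show "Comp C (R n) (R (n + 2)) (Z' (n + 2)) (q (n + 2)) (Comp C (R n) (R (n + 1)) (R (n + 2)) (d (n + 1)) (d n)) =
      Comp C (R n) (R (n + 2)) (Z' (n + 2)) (q (n + 2)) (zmor C (R n) (R (n + 2)))"
      by (simp add: qd1[THEN reassoc] qd)
    show "Comp C (R n) (R (n + 2)) (X (n + 2)) (\<rho> (n + 2)) (Comp C (R n) (R (n + 1)) (R (n + 2)) (d (n + 1)) (d n)) =
      Comp C (R n) (R (n + 2)) (X (n + 2)) (\<rho> (n + 2)) (zmor C (R n) (R (n + 2)))"
      unfolding rf' by (simp add: f'd1[THEN reassoc] f'd)
  qed simp_all
  have R [simp]: "(R, d) \<in> Ob CC" by (simp add: cpx_iff dd)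
  have jc: "j \<in> mor CC (X, dX) (R, d)" by (simp add: chain_iff dj)
  have qc: "q \<in> mor CC (R, d) (Z', dZ')" by (simp add: chain_iff qd)
  have f'c: "f' \<in> mor CC (R, d) (Y, dY)" by (simp add: chain_iff f'd)
  have "eta_splitting X dX j R d q Z' dZ' \<rho> \<sigma> (\<lambda>n. Comp C (Z' n) (Z n) (tw (X (n + 1))) (g n) (f n))"
    unfolding eta_splitting_def by (simp add: jc qc b) (simp add: d_def)
  then have "deflation eta_conflations (R, d) Q' q" unfolding Q'' by (rule eta_deflationI)
  moreover have "is_pullback CC (Y, dY) (Z, dZ) (Z', dZ') (R, d) p f f' q"
    unfolding is_pullback_def
  proof (intro conjI ballI impI)
    show "Comp CC (R, d) (Y, dY) (Z, dZ) p f' = Comp CC (R, d) (Z', dZ') (Z, dZ) f q" by (simp add: pf')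
  next
    fix W a b' assume W: "W \<in> Ob CC" and a: "a \<in> mor CC W (Y, dY)" and b': "b' \<in> mor CC W (Z', dZ')"
      and eq: "Comp CC W (Y, dY) (Z, dZ) p a = Comp CC W (Z', dZ') (Z, dZ) f b'"
    obtain V dV where W': "W = (V, dV)" by (cases W)
    note V = W[unfolded W'] and a = a[unfolded W'] and b' = b'[unfolded W'] and eq = eq[unfolded W', simplified, THEN fun_cong]
    note [simp] = cpxD[OF V] chainD(1)[OF a] chainD(1)[OF b'] eq eq[THEN reassoc]
    define u where "u n = madd C (V n) (R n) (Comp C (V n) (X n) (R n) (j n) (Comp C (V n) (Y n) (X n) (r n) (a n)))
       (Comp C (V n) (Z' n) (R n) (\<sigma> n) (b' n))" for n
    have [simp]: "u n \<in> mor C (V n) (R n)" for n by (simp add: u_def)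
    have f'u: "Comp C (V n) (R n) (Y n) (f' n) (u n) = a n" for n
      by (rule biproduct_eq_toI[OF splittingD(6)[OF h, of n], where W = "V n"]) (simp_all add: u_def f'_def)
    have qu: "Comp C (V n) (R n) (Z' n) (q n) (u n) = b' n" for n by (simp add: u_def)
    have uniq: "v n = u n" if [simp]: "v n \<in> mor C (V n) (R n)" and qv: "Comp C (V n) (R n) (Z' n) (q n) (v n) = b' n"
      and f'v: "Comp C (V n) (R n) (Y n) (f' n) (v n) = a n" for v n
    proof -
      have "Comp C (V n) (R n) (X n) (\<rho> n) (v n) = Comp C (V n) (R n) (X n) (\<rho> n) (u n)"
        unfolding rf' by (simp add: f'v f'u)
      then show ?thesis
        by - (rule biproduct_eq_toI[OF b[of n], where W = "V n"], simp_all add: qu qv)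
    qed
    have "Comp C (V n) (V (n + 1)) (R (n + 1)) (u (n + 1)) (dV n) = Comp C (V n) (R n) (R (n + 1)) (d n) (u n)" for n
    proof (rule biproduct_eq_toI[OF b[of "n + 1"], where W = "V n"])
      show "Comp C (V n) (R (n + 1)) (Z' (n + 1)) (q (n + 1)) (Comp C (V n) (V (n + 1)) (R (n + 1)) (u (n + 1)) (dV n)) =
         Comp C (V n) (R (n + 1)) (Z' (n + 1)) (q (n + 1)) (Comp C (V n) (R n) (R (n + 1)) (d n) (u n))"
        by (simp add: qd[THEN reassoc] qu qu[THEN reassoc] chainD(2)[OF b'])
      show "Comp C (V n) (R (n + 1)) (X (n + 1)) (\<rho> (n + 1)) (Comp C (V n) (V (n + 1)) (R (n + 1)) (u (n + 1)) (dV n)) =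
         Comp C (V n) (R (n + 1)) (X (n + 1)) (\<rho> (n + 1)) (Comp C (V n) (R n) (R (n + 1)) (d n) (u n))"
        unfolding rf'
        by (simp add: f'd[THEN reassoc] f'u f'u[THEN reassoc] chainD(2)[OF a]
            del: splitting_retraction[OF h] splitting_retraction[OF h, THEN reassoc])
    qed simp_all
    then have uc: "u \<in> mor CC (V, dV) (R, d)" by (simp add: chain_iff)
    show "\<exists>!u. u \<in> mor CC W (R, d) \<and> Comp CC W (R, d) (Y, dY) f' u = a \<and> Comp CC W (R, d) (Z', dZ') q u = b'"
      unfolding W'
    proof (rule ex1I[of _ u])
      show "u \<in> mor CC (V, dV) (R, d) \<and> Comp CC (V, dV) (R, d) (Y, dY) f' u = a \<and> Comp CC (V, dV) (R, d) (Z', dZ') q u = b'"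
        using uc f'u qu by simp
      fix v assume v: "v \<in> mor CC (V, dV) (R, d) \<and> Comp CC (V, dV) (R, d) (Y, dY) f' v = a \<and> Comp CC (V, dV) (R, d) (Z', dZ') q v = b'"
      show "v = u"
      proof
        fix n
        show "v n = u n" using v chainD(1)[of v] by (intro uniq) auto
      qed
    qed
  qed (simp_all add: qc f'c)
  ultimately show ?thesis unfolding PQ Q'' by blast
qed

text \<open>The splitting is conjugated degreewise by the isomorphisms and their inverses; by
  naturality the factor of the class is conjugated too, with the twist of \<open>a\<close> on the
  left.\<close>

lemma eta_conflation_iso:
  assumes s: "S \<in> eta_conflations" and t: "T \<in> kernel_cokernel_pairs CC" and st: "seq_iso CC S T"
  shows "T \<in> eta_conflations"
proof -
  obtain X dX i Y dY p Z dZ r s g where S: "S = ((X, dX), i, (Y, dY), p, (Z, dZ))" and h: "eta_splitting X dX i Y dY p Z dZ r s g"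
    using s unfolding eta_conflations_def by blast
  obtain X' dX' i' Y' dY' p' Z' dZ' where T: "T = ((X', dX'), i', (Y', dY'), p', (Z', dZ'))"
    by (metis prod.collapse)
  note t' = CC.kernel_cokernelD(1-5)[OF t[unfolded T]]
  obtain a b c where a: "is_iso CC (X, dX) (X', dX') a" and b: "is_iso CC (Y, dY) (Y', dY') b" and c: "is_iso CC (Z, dZ) (Z', dZ') c"
    and bi: "Comp CC (X, dX) (Y, dY) (Y', dY') b i = Comp CC (X, dX) (X', dX') (Y', dY') i' a"
    and cp: "Comp CC (Y, dY) (Z, dZ) (Z', dZ') c p = Comp CC (Y, dY) (Y', dY') (Z', dZ') p' b"
    using st unfolding S T seq_iso_def by auto
  obtain a' where a': "a \<in> mor CC (X, dX) (X', dX')" "a' \<in> mor CC (X', dX') (X, dX)"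
    "Comp CC (X, dX) (X', dX') (X, dX) a' a = Idn CC (X, dX)" "Comp CC (X', dX') (X, dX) (X', dX') a a' = Idn CC (X', dX')"
    using a by (rule CC.is_isoE)
  obtain b' where b': "b \<in> mor CC (Y, dY) (Y', dY')" "b' \<in> mor CC (Y', dY') (Y, dY)"
    "Comp CC (Y, dY) (Y', dY') (Y, dY) b' b = Idn CC (Y, dY)" "Comp CC (Y', dY') (Y, dY) (Y', dY') b b' = Idn CC (Y', dY')"
    using b by (rule CC.is_isoE)
  obtain c' where c': "c \<in> mor CC (Z, dZ) (Z', dZ')" "c' \<in> mor CC (Z', dZ') (Z, dZ)"
    "Comp CC (Z, dZ) (Z', dZ') (Z, dZ) c' c = Idn CC (Z, dZ)" "Comp CC (Z', dZ') (Z, dZ) (Z', dZ') c c' = Idn CC (Z', dZ')"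
    using c by (rule CC.is_isoE)
  note eqs = a'(3,4)[simplified, THEN fun_cong] b'(3,4)[simplified, THEN fun_cong] c'(3,4)[simplified, THEN fun_cong]
  note [simp] = splitting_simps[OF h] splitting_eqs[OF h] splitting_eqs[OF h, THEN reassoc]
    splitting_section[OF h] splitting_section[OF h, THEN reassoc]
    cpxD(1-3)[OF t'(1)] cpxD(1-3)[OF t'(2)] cpxD(1-3)[OF t'(3)] t'(1-3)
    a'(1,2)[THEN chainD(1)] b'(1,2)[THEN chainD(1)] c'(1,2)[THEN chainD(1)] t'(4,5)[THEN chainD(1)]
    eqs eqs[THEN reassoc]
  have i': "i' n = Comp C (X' n) (Y n) (Y' n) (b n) (Comp C (X' n) (X n) (Y n) (i n) (a' n))" for n
    using bi[simplified, THEN fun_cong, THEN reassoc, of n "X' n" "a' n"] by simp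
  have p': "p' n = Comp C (Y' n) (Z n) (Z' n) (c n) (Comp C (Y' n) (Y n) (Z n) (p n) (b' n))" for n
    using cp[simplified, THEN fun_cong, THEN reassoc, of n "Y' n" "b' n"] by simp
  let ?r = "\<lambda>n. Comp C (Y' n) (X n) (X' n) (a n) (Comp C (Y' n) (Y n) (X n) (r n) (b' n))"
  let ?s = "\<lambda>n. Comp C (Z' n) (Y n) (Y' n) (b n) (Comp C (Z' n) (Z n) (Y n) (s n) (c' n))"
  let ?g = "\<lambda>n. Comp C (Z' n) (tw (X (n + 1))) (tw (X' (n + 1))) (twm (a (n + 1))) (Comp C (Z' n) (Z n) (tw (X (n + 1))) (g n) (c' n))"
  have "is_biproduct C (X' n) (Z' n) (Y' n) (i' n) (?s n) (?r n) (p' n)" for n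
  proof -
    have "Comp C (Y' n) (Y n) (Y' n) (b n) (madd C (Y' n) (Y n) (Comp C (Y' n) (X n) (Y n) (i n) (Comp C (Y' n) (Y n) (X n) (r n) (b' n)))
      (Comp C (Y' n) (Z n) (Y n) (s n) (Comp C (Y' n) (Y n) (Z n) (p n) (b' n)))) = Idn C (Y' n)"
      unfolding biproduct_expand[OF splittingD(6)[OF h, of n] cpxD(1)[OF t'(2)] b'(2)[THEN chainD(1)]] by simp
    then show ?thesis unfolding is_biproduct_def by (simp add: i' p')
  qed
  moreover have "Comp C (Z' n) (Y' (n + 1)) (X' (n + 1)) (?r (n + 1)) (Comp C (Z' n) (Y' n) (Y' (n + 1)) (dY' n) (?s n))
      = Comp C (Z' n) (tw (X' (n + 1))) (X' (n + 1)) (eta (X' (n + 1))) (?g n)" for n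
    by (simp add: chainD(2)[OF b'(1), THEN reassoc] eta_natural[THEN reassoc])
  ultimately have "eta_splitting X' dX' i' Y' dY' p' Z' dZ' ?r ?s ?g"
    unfolding eta_splitting_def using t' by simp
  then show ?thesis unfolding T eta_conflations_def by blast
qed

theorem eta_exact: "exact_structure CC eta_conflations"
proof (intro exact_structure.intro additive_CC exact_structure_axioms.intro)
  show "eta_conflations \<subseteq> kernel_cokernel_pairs CC"
    using splitting_kernel_cokernel by (auto simp: eta_conflations_def)
qed (fact eta_conflation_iso eta_inflation_id eta_deflation_id eta_inflation_comp eta_deflation_comp
    eta_inflation_pushout eta_deflation_pullback)+

end

section \<open>Null-homotopies of eta; injective and projective objects\<close>

lemma int_pred_succ: "(n :: int) - 1 + 1 = n" "(n :: int) - 1 + 2 = n + 1" by simp_all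

context twisted_category
begin

lemma twm_zero [simp]:
  assumes [simp]: "X \<in> Ob C" "Y \<in> Ob C" shows "twm (zmor C X Y) = zmor C (tw X) (tw Y)"
proof -
  have "madd C (tw X) (tw Y) (twm (zmor C X Y)) (twm (zmor C X Y)) = madd C (tw X) (tw Y) (twm (zmor C X Y)) (zmor C (tw X) (tw Y))"
    by (simp flip: twm_add)
  then show ?thesis by (subst (asm) madd_left_cancel) simp_all
qed

text \<open>A null-homotopy of \<open>\<eta>\<close> as a chain map from the twist of
  \<open>X\<close> to \<open>X\<close>, indexed by the degree in which it lands.\<close>

definition eta_homotopy :: "(int \<Rightarrow> 'o) \<Rightarrow> (int \<Rightarrow> 'm) \<Rightarrow> (int \<Rightarrow> 'm) \<Rightarrow> bool" where
  "eta_homotopy X d h \<longleftrightarrow> (\<forall>n. h n \<in> mor C (tw (X (n + 1))) (X n)) \<and>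
     (\<forall>n. madd C (tw (X (n + 1))) (X (n + 1)) (Comp C (tw (X (n + 1))) (X n) (X (n + 1)) (d n) (h n))
       (Comp C (tw (X (n + 1))) (tw (X (n + 2))) (X (n + 1)) (h (n + 1)) (twm (d (n + 1)))) = eta (X (n + 1)))"

lemma eta_homotopyD:
  assumes "eta_homotopy X d h"
  shows "h n \<in> mor C (tw (X (n + 1))) (X n)" "h (n + 1) \<in> mor C (tw (X (n + 2))) (X (n + 1))"
    "madd C (tw (X (n + 1))) (X (n + 1)) (Comp C (tw (X (n + 1))) (X n) (X (n + 1)) (d n) (h n))
       (Comp C (tw (X (n + 1))) (tw (X (n + 2))) (X (n + 1)) (h (n + 1)) (twm (d (n + 1)))) = eta (X (n + 1))"
  using assms spec[of "\<lambda>n. h n \<in> mor C (tw (X (n + 1))) (X n)" "n + 1"] by (simp_all add: eta_homotopy_def)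

lemma eta_homotopy_comp:
  assumes h: "eta_homotopy X d h" and X: "(X, d) \<in> Ob CC" and [simp]: "W \<in> Ob C" "f \<in> mor C W (tw (X (n + 1)))"
  shows "Comp C W (tw (X (n + 1))) (X (n + 1)) (eta (X (n + 1))) f =
     madd C W (X (n + 1)) (Comp C W (X n) (X (n + 1)) (d n) (Comp C W (tw (X (n + 1))) (X n) (h n) f))
       (Comp C W (tw (X (n + 2))) (X (n + 1)) (h (n + 1)) (Comp C W (tw (X (n + 1))) (tw (X (n + 2))) (twm (d (n + 1))) f))"
proof -
  note [simp] = cpxD(1-3)[OF X] eta_homotopyD(1,2)[OF h]
  show ?thesis unfolding eta_homotopyD(3)[OF h, of n, symmetric] by simp
qed

text \<open>The obstruction to extending \<open>f\<close> by \<open>f r\<close> is \<open>f\<close>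
  after the class, which by naturality is \<open>eta\<close> on \<open>J\<close> after the twist of
  \<open>f\<close> and \<open>g\<close>. The homotopy writes it as a boundary, and
  \<open>k p\<close> cancels it.\<close>

lemma homotopy_injective:
  assumes hom: "eta_homotopy J dJ H" and J: "(J, dJ) \<in> Ob CC"
  shows "injective_object CC eta_conflations (J, dJ)"
  unfolding injective_object_def
proof (intro conjI allI impI ballI)
  fix P Q i f assume "inflation eta_conflations P Q i" and f': "f \<in> mor CC P (J, dJ)"
  then obtain X dX Y dY p Z dZ r s g where PQ: "P = (X, dX)" "Q = (Y, dY)" and h: "eta_splitting X dX i Y dY p Z dZ r s g"
    by (auto elim: eta_inflationE)
  note f = f'[unfolded PQ]
  note [simp] = splitting_simps[OF h] splitting_eqs[OF h] splitting_eqs[OF h, THEN reassoc]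
    splitting_section[OF h] splitting_section[OF h, THEN reassoc] splitting_retraction[OF h]
    cpxD[OF J] chainD[OF f] chainD(2,3)[OF f, THEN reassoc] eta_homotopyD(1,2)[OF hom]
  note [simp del] = splitting_eqs(6,7)[OF h] splitting_eqs(6,7)[OF h, THEN reassoc]
  define k where "k n = Comp C (Z n) (tw (J (n + 1))) (J n) (H n) (Comp C (Z n) (tw (X (n + 1))) (tw (J (n + 1))) (twm (f (n + 1))) (g n))" for n
  have [simp]: "k n \<in> mor C (Z n) (J n)" for n by (simp add: k_def)
  have k1: "k (n + 1) = Comp C (Z (n + 1)) (tw (J (n + 2))) (J (n + 1)) (H (n + 1)) (Comp C (Z (n + 1)) (tw (X (n + 2))) (tw (J (n + 2))) (twm (f (n + 2))) (g (n + 1)))" for n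
    by (simp add: k_def)
  have dk: "Comp C (Z n) (J n) (J (n + 1)) (dJ n) (k n) =
     madd C (Z n) (J (n + 1)) (Comp C (Z n) (X (n + 1)) (J (n + 1)) (f (n + 1)) (Comp C (Z n) (tw (X (n + 1))) (X (n + 1)) (eta (X (n + 1))) (g n)))
       (Comp C (Z n) (Z (n + 1)) (J (n + 1)) (k (n + 1)) (dZ n))" for n
  proof -
    let ?G = "Comp C (Z n) (tw (X (n + 1))) (tw (J (n + 1))) (twm (f (n + 1))) (g n)"
    have tf: "Comp C (tw (X (n + 1))) (tw (J (n + 1))) (tw (J (n + 2))) (twm (dJ (n + 1))) (twm (f (n + 1)))
       = Comp C (tw (X (n + 1))) (tw (X (n + 2))) (tw (J (n + 2))) (twm (f (n + 2))) (twm (dX (n + 1)))"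
      using arg_cong[OF chainD(3)[OF f, of n], of twm] by (simp del: chainD(2,3)[OF f])
    \<comment> \<open>The cocycle relation for \<open>g\<close>, carried to \<open>J\<close> by
      \<open>f\<close> and \<open>H\<close>, identifies the second half of the homotopy formula with
      the term in \<open>dZ\<close>.\<close>
    have "Comp C (Z n) (tw (X (n + 2))) (J (n + 1)) (Comp C (tw (X (n + 2))) (tw (J (n + 2))) (J (n + 1)) (H (n + 1)) (twm (f (n + 2))))
       (madd C (Z n) (tw (X (n + 2))) (Comp C (Z n) (tw (X (n + 1))) (tw (X (n + 2))) (twm (dX (n + 1))) (g n))
         (Comp C (Z n) (Z (n + 1)) (tw (X (n + 2))) (g (n + 1)) (dZ n))) = zmor C (Z n) (J (n + 1))"
      unfolding splitting_class[OF h] by simp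
    then have z: "madd C (Z n) (J (n + 1))
       (Comp C (Z n) (tw (J (n + 2))) (J (n + 1)) (H (n + 1)) (Comp C (Z n) (tw (J (n + 1))) (tw (J (n + 2))) (twm (dJ (n + 1))) ?G))
       (Comp C (Z n) (Z (n + 1)) (J (n + 1)) (k (n + 1)) (dZ n)) = zmor C (Z n) (J (n + 1))"
      by (simp add: k1 tf[THEN reassoc])
    have "Comp C (Z n) (X (n + 1)) (J (n + 1)) (f (n + 1)) (Comp C (Z n) (tw (X (n + 1))) (X (n + 1)) (eta (X (n + 1))) (g n))
      = Comp C (Z n) (tw (J (n + 1))) (J (n + 1)) (eta (J (n + 1))) ?G"
      by (simp add: eta_natural[THEN reassoc])
    also have "\<dots> = madd C (Z n) (J (n + 1)) (Comp C (Z n) (J n) (J (n + 1)) (dJ n) (k n))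
       (Comp C (Z n) (tw (J (n + 2))) (J (n + 1)) (H (n + 1)) (Comp C (Z n) (tw (J (n + 1))) (tw (J (n + 2))) (twm (dJ (n + 1))) ?G))"
      unfolding k_def by (rule eta_homotopy_comp[OF hom J]) simp_all
    finally show ?thesis by (simp add: z)
  qed
  define e where "e n = madd C (Y n) (J n) (Comp C (Y n) (X n) (J n) (f n) (r n)) (Comp C (Y n) (Z n) (J n) (k n) (p n))" for n
  have "e \<in> mor CC (Y, dY) (J, dJ)"
    unfolding chain_iff by (simp add: e_def dk dk[THEN reassoc] splitting_eqs(6)[OF h, symmetric])
  moreover have "Comp CC (X, dX) (Y, dY) (J, dJ) e i = f" by (simp add: e_def)
  ultimately show "\<exists>e\<in>mor CC Q (J, dJ). Comp CC P Q (J, dJ) e i = f" unfolding PQ by blast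
qed (rule J)

text \<open>For lifting, \<open>H\<close> acts on the source side and yields a map between twisted
  objects. Fullness of the twist provides an untwisted \<open>k\<close>, and faithfulness allows its
  equation to be verified after twisting.\<close>

lemma homotopy_projective:
  assumes hom: "eta_homotopy P dP H" and P: "(P, dP) \<in> Ob CC"
  shows "projective_object CC eta_conflations (P, dP)"
  unfolding projective_object_def
proof (intro conjI allI impI ballI)
  fix Q R p f assume "deflation eta_conflations Q R p" and f': "f \<in> mor CC (P, dP) R"
  then obtain X dX i Y dY Z dZ r s g where QR: "Q = (Y, dY)" "R = (Z, dZ)" and h: "eta_splitting X dX i Y dY p Z dZ r s g"
    by (auto elim: eta_deflationE)
  note f = f'[unfolded QR]
  note [simp] = splitting_simps[OF h] splitting_eqs[OF h] splitting_eqs[OF h, THEN reassoc]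
    splitting_section[OF h] splitting_section[OF h, THEN reassoc]
    cpxD[OF P] chainD[OF f] chainD(2,3)[OF f, THEN reassoc] eta_homotopyD(1,2)[OF hom]
  define G where "G n = Comp C (P n) (Z n) (tw (X (n + 1))) (g n) (f n)" for n
  have G [simp]: "G n \<in> mor C (P n) (tw (X (n + 1)))" "G (n + 1) \<in> mor C (P (n + 1)) (tw (X (n + 2)))" for n
    by (simp_all add: G_def)
  have Gd: "madd C (P n) (tw (X (n + 2))) (Comp C (P n) (tw (X (n + 1))) (tw (X (n + 2))) (twm (dX (n + 1))) (G n))
      (Comp C (P n) (P (n + 1)) (tw (X (n + 2))) (G (n + 1)) (dP n)) = zmor C (P n) (tw (X (n + 2)))" for n
    using arg_cong[OF splitting_class[OF h, of n], of "\<lambda>x. Comp C (P n) (Z n) (tw (X (n + 2))) x (f n)"] by (simp add: G_def)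
  \<comment> \<open>\<open>H n\<close> starts at the twist of \<open>P (n + 1)\<close> and
    \<open>G n\<close> ends at the twist of \<open>X (n + 1)\<close>; hence the preimage of their
    composite lives in degree \<open>n + 1\<close>.\<close>
  have "\<exists>k\<in>mor C (P (n + 1)) (X (n + 1)). twm k = Comp C (tw (P (n + 1))) (P n) (tw (X (n + 1))) (G n) (H n)" for n
    by (rule twm_full) simp_all
  from this[of "n - 1" for n] have "\<forall>n. \<exists>k\<in>mor C (P n) (X n). twm k = Comp C (tw (P n)) (P (n - 1)) (tw (X n)) (G (n - 1)) (H (n - 1))"
    by simp
  then obtain k where k [simp]: "\<And>n. k n \<in> mor C (P n) (X n)"
    and k': "\<And>n. twm (k n) = Comp C (tw (P n)) (P (n - 1)) (tw (X n)) (G (n - 1)) (H (n - 1))" by metis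
  have k1: "twm (k (n + 1)) = Comp C (tw (P (n + 1))) (P n) (tw (X (n + 1))) (G n) (H n)" for n
    using k'[of "n + 1"] by simp
  have k2: "twm (k (n + 2)) = Comp C (tw (P (n + 2))) (P (n + 1)) (tw (X (n + 2))) (G (n + 1)) (H (n + 1))" for n
    using k1[of "n + 1", unfolded int_succ_succ] .
  let ?c = "\<lambda>n. Comp C (Z n) (tw (X (n + 1))) (X (n + 1)) (eta (X (n + 1))) (g n)"
  have "madd C (P (n + 1)) (X (n + 2)) (Comp C (P (n + 1)) (tw (X (n + 2))) (X (n + 2)) (eta (X (n + 2))) (G (n + 1)))
     (Comp C (P (n + 1)) (X (n + 1)) (X (n + 2)) (dX (n + 1)) (k (n + 1))) = Comp C (P (n + 1)) (P (n + 2)) (X (n + 2)) (k (n + 2)) (dP (n + 1))" for n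
  proof (rule twm_inj[of "P (n + 1)" "X (n + 2)"])
    \<comment> \<open>Naturality at \<open>G\<close>, with \<open>eta\<close> of a twist identified
      with a twisted \<open>eta\<close>, moves \<open>eta\<close> from \<open>X\<close> to
      \<open>P\<close>, where the null-homotopy is available.\<close>
    have 1: "Comp C (tw (P (n + 1))) (tw (tw (X (n + 2)))) (tw (X (n + 2))) (twm (eta (X (n + 2)))) (twm (G (n + 1)))
      = Comp C (tw (P (n + 1))) (P (n + 1)) (tw (X (n + 2))) (G (n + 1)) (eta (P (n + 1)))"
      using eta_natural[of "P (n + 1)" "tw (X (n + 2))" "G (n + 1)"] by (simp add: eta_tw)
    have 2: "madd C (tw (P (n + 1))) (tw (X (n + 2))) (Comp C (tw (P (n + 1))) (P n) (tw (X (n + 2))) (Comp C (P n) (tw (X (n + 1))) (tw (X (n + 2))) (twm (dX (n + 1))) (G n)) (H n))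
      (Comp C (tw (P (n + 1))) (P n) (tw (X (n + 2))) (Comp C (P n) (P (n + 1)) (tw (X (n + 2))) (G (n + 1)) (dP n)) (H n)) = zmor C (tw (P (n + 1))) (tw (X (n + 2)))"
      using arg_cong[OF Gd[of n], of "\<lambda>x. Comp C (tw (P (n + 1))) (P n) (tw (X (n + 2))) x (H n)"] by simp
    have "madd C (tw (P (n + 1))) (tw (X (n + 2)))
       (Comp C (tw (P (n + 1))) (P (n + 1)) (tw (X (n + 2))) (G (n + 1)) (eta (P (n + 1))))
       (Comp C (tw (P (n + 1))) (tw (X (n + 1))) (tw (X (n + 2))) (twm (dX (n + 1))) (twm (k (n + 1))))
      = madd C (tw (P (n + 1))) (tw (X (n + 2)))
         (Comp C (tw (P (n + 1))) (tw (P (n + 2))) (tw (X (n + 2))) (twm (k (n + 2))) (twm (dP (n + 1))))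
         (madd C (tw (P (n + 1))) (tw (X (n + 2))) (Comp C (tw (P (n + 1))) (P n) (tw (X (n + 2))) (Comp C (P n) (tw (X (n + 1))) (tw (X (n + 2))) (twm (dX (n + 1))) (G n)) (H n))
           (Comp C (tw (P (n + 1))) (P n) (tw (X (n + 2))) (Comp C (P n) (P (n + 1)) (tw (X (n + 2))) (G (n + 1)) (dP n)) (H n)))"
      unfolding eta_homotopyD(3)[OF hom, of n, symmetric] k1 k2 by (simp add: madd_ac)
    then show "twm (madd C (P (n + 1)) (X (n + 2)) (Comp C (P (n + 1)) (tw (X (n + 2))) (X (n + 2)) (eta (X (n + 2))) (G (n + 1)))
       (Comp C (P (n + 1)) (X (n + 1)) (X (n + 2)) (dX (n + 1)) (k (n + 1)))) = twm (Comp C (P (n + 1)) (P (n + 2)) (X (n + 2)) (k (n + 2)) (dP (n + 1)))"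
      unfolding 2 by (simp add: 1)
  qed simp_all
  from this[of "n - 1" for n, unfolded int_pred_succ] have K: "madd C (P n) (X (n + 1)) (Comp C (P n) (tw (X (n + 1))) (X (n + 1)) (eta (X (n + 1))) (Comp C (P n) (Z n) (tw (X (n + 1))) (g n) (f n)))
     (Comp C (P n) (X n) (X (n + 1)) (dX n) (k n)) = Comp C (P n) (P (n + 1)) (X (n + 1)) (k (n + 1)) (dP n)" for n
    unfolding G_def .
  define e where "e n = madd C (P n) (Y n) (Comp C (P n) (Z n) (Y n) (s n) (f n)) (Comp C (P n) (X n) (Y n) (i n) (k n))" for n
  have "e \<in> mor CC (P, dP) (Y, dY)"
    unfolding chain_iff by (simp add: e_def K[symmetric] madd_ac)
  moreover have "Comp CC (P, dP) (Y, dY) (Z, dZ) p e = f" by (simp add: e_def)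
  ultimately show "\<exists>e\<in>mor CC (P, dP) Q. Comp CC (P, dP) Q R p e = f" unfolding QR by blast
qed (rule P)

text \<open>The homotopy is conjugated by the retraction and the twisted inclusion; naturality of
  \<open>eta\<close> then reduces the claim to \<open>b a = 1\<close>.\<close>

lemma homotopy_retract:
  assumes hom: "eta_homotopy Q dQ H" and Q: "(Q, dQ) \<in> Ob CC" and P: "(P, dP) \<in> Ob CC"
    and a: "a \<in> mor CC (P, dP) (Q, dQ)" and b: "b \<in> mor CC (Q, dQ) (P, dP)"
    and ba: "Comp CC (P, dP) (Q, dQ) (P, dP) b a = Idn CC (P, dP)"
  shows "\<exists>H. eta_homotopy P dP H"
proof -
  note ba' = ba[simplified, THEN fun_cong]
  note [simp] = cpxD(1-3)[OF P] cpxD(1-3)[OF Q] chainD(1)[OF a] chainD(1)[OF b] eta_homotopyD(1,2)[OF hom] ba' ba'[THEN reassoc]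
  let ?h = "\<lambda>n. Comp C (tw (P (n + 1))) (Q n) (P n) (b n) (Comp C (tw (P (n + 1))) (tw (Q (n + 1))) (Q n) (H n) (twm (a (n + 1))))"
  have tw: "Comp C (tw (P (n + 1))) (tw (P (n + 2))) (tw (Q (n + 2))) (twm (a (n + 2))) (twm (dP (n + 1)))
      = Comp C (tw (P (n + 1))) (tw (Q (n + 1))) (tw (Q (n + 2))) (twm (dQ (n + 1))) (twm (a (n + 1)))" for n
    using arg_cong[OF chainD(3)[OF a, of n], of twm] by simp
  have "madd C (tw (P (n + 1))) (P (n + 1)) (Comp C (tw (P (n + 1))) (P n) (P (n + 1)) (dP n) (?h n))
       (Comp C (tw (P (n + 1))) (tw (P (n + 2))) (P (n + 1)) (?h (n + 1)) (twm (dP (n + 1)))) = eta (P (n + 1))" for n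
  proof -
    have "madd C (tw (P (n + 1))) (P (n + 1)) (Comp C (tw (P (n + 1))) (P n) (P (n + 1)) (dP n) (?h n))
       (Comp C (tw (P (n + 1))) (tw (P (n + 2))) (P (n + 1)) (?h (n + 1)) (twm (dP (n + 1)))) =
       Comp C (tw (P (n + 1))) (Q (n + 1)) (P (n + 1)) (b (n + 1)) (Comp C (tw (P (n + 1))) (tw (Q (n + 1))) (Q (n + 1))
         (madd C (tw (Q (n + 1))) (Q (n + 1)) (Comp C (tw (Q (n + 1))) (Q n) (Q (n + 1)) (dQ n) (H n))
           (Comp C (tw (Q (n + 1))) (tw (Q (n + 2))) (Q (n + 1)) (H (n + 1)) (twm (dQ (n + 1))))) (twm (a (n + 1))))"
      by (simp add: tw chainD(2)[OF b, THEN reassoc])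
    also have "\<dots> = eta (P (n + 1))"
      unfolding eta_homotopyD(3)[OF hom] by (simp add: eta_natural)
    finally show ?thesis .
  qed
  then have "eta_homotopy P dP ?h" unfolding eta_homotopy_def by simp
  then show ?thesis by blast
qed

end

section \<open>Mapping cones and the Frobenius structure on complexes\<close>

lemma int_succ_succ_succ: "(n :: int) + 2 + 1 = n + 3" "(n :: int) + 1 + 2 = n + 3" by simp_all

context preadditive_category
begin

lemma complex_shift_cpx:
  assumes X: "(X, d) \<in> Ob CC"
  shows "(\<lambda>n. X (n + 1), \<lambda>n. mneg C (X (n + 1)) (X (n + 2)) (d (n + 1))) \<in> Ob CC"
proof -
  note [simp] = cpxD[OF X] cpxD(3,4)[OF X, of "n + 1" for n, unfolded int_succ_succ int_succ_succ_succ]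
  show ?thesis unfolding cpx_iff by (simp add: int_succ_succ_succ)
qed

end

context twisted_category
begin

text \<open>In the cone the subobject is \<open>Y\<close> and the quotient is the shift of
  \<open>X\<close>. The off-diagonal entry \<open>f (n + 1)\<close> of the differential is therefore
  the class, with factor \<open>g (n + 1)\<close>.\<close>

lemma cone_splitting:
  assumes X: "(X, dX) \<in> Ob CC" and Y: "(Y, dY) \<in> Ob CC"
    and g: "\<And>n. g n \<in> mor C (X n) (tw (Y n))"
    and gd: "\<And>n. Comp C (X n) (X (n + 1)) (tw (Y (n + 1))) (g (n + 1)) (dX n) = Comp C (X n) (tw (Y n)) (tw (Y (n + 1))) (twm (dY n)) (g n)"
    and b: "\<And>n. is_biproduct C (X (n + 1)) (Y n) (K n) (i1 n) (i2 n) (p1 n) (p2 n)"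
    and f: "\<And>n. f n = Comp C (X n) (tw (Y n)) (Y n) (eta (Y n)) (g n)"
    and dK: "\<And>n. dK n = madd C (K n) (K (n + 1))
           (Comp C (K n) (X (n + 2)) (K (n + 1)) (i1 (n + 1))
              (Comp C (K n) (X (n + 1)) (X (n + 2)) (mneg C (X (n + 1)) (X (n + 2)) (dX (n + 1))) (p1 n)))
           (Comp C (K n) (Y (n + 1)) (K (n + 1)) (i2 (n + 1))
              (madd C (K n) (Y (n + 1)) (Comp C (K n) (X (n + 1)) (Y (n + 1)) (f (n + 1)) (p1 n))
                 (Comp C (K n) (Y n) (Y (n + 1)) (dY n) (p2 n))))"
  shows "eta_splitting Y dY i2 K dK p1 (\<lambda>n. X (n + 1)) (\<lambda>n. mneg C (X (n + 1)) (X (n + 2)) (dX (n + 1))) p2 i1 (\<lambda>n. g (n + 1))"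
proof -
  note b' = biproductD[OF b[of "n + 1" for n], unfolded int_succ_succ]
  note b'' = biproductD[OF b[of "n + 2" for n], unfolded int_succ_succ_succ]
  note cX = cpxD[OF X] cpxD(3,4)[OF X, of "n + 1" for n, unfolded int_succ_succ int_succ_succ_succ]
  note [simp] = cX cX(4,6)[THEN reassoc] cpxD[OF Y] cpxD(4)[OF Y, THEN reassoc] g
    biproductD(1-11)[OF b] biproductD(8-11)[OF b, THEN reassoc]
    b'(1-11) b'(8-11)[THEN reassoc] b''(1-11) b''(8-11)[THEN reassoc] X Y
  have [simp]: "f n \<in> mor C (X n) (Y n)" for n by (simp add: f)
  \<comment> \<open>Since the factor commutes with the differentials, naturality makes
    \<open>f\<close> do so; this is what squares the cone differential to zero.\<close>
  have df: "Comp C (X n) (Y n) (Y (n + 1)) (dY n) (f n) = Comp C (X n) (X (n + 1)) (Y (n + 1)) (f (n + 1)) (dX n)" for n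
    by (simp add: f gd eta_natural[THEN reassoc])
  note df1 = df[of "n + 1" for n, unfolded int_succ_succ]
  have dK1: "dK (n + 1) = madd C (K (n + 1)) (K (n + 2))
           (Comp C (K (n + 1)) (X (n + 3)) (K (n + 2)) (i1 (n + 2))
              (Comp C (K (n + 1)) (X (n + 2)) (X (n + 3)) (mneg C (X (n + 2)) (X (n + 3)) (dX (n + 2))) (p1 (n + 1))))
           (Comp C (K (n + 1)) (Y (n + 2)) (K (n + 2)) (i2 (n + 2))
              (madd C (K (n + 1)) (Y (n + 2)) (Comp C (K (n + 1)) (X (n + 2)) (Y (n + 2)) (f (n + 2)) (p1 (n + 1)))
                 (Comp C (K (n + 1)) (Y (n + 1)) (Y (n + 2)) (dY (n + 1)) (p2 (n + 1)))))" for n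
    using dK[of "n + 1"] unfolding int_succ_succ int_succ_succ_succ .
  have "Comp C (K n) (K (n + 1)) (K (n + 2)) (dK (n + 1)) (dK n) = zmor C (K n) (K (n + 2))" for n
    unfolding dK1 dK[of n]
    by (rule biproduct_eq_fromI[OF b[of n], where W = "K (n + 2)"]) (simp_all add: df1)
  then have [simp]: "(K, dK) \<in> Ob CC"
    unfolding cpx_iff by (simp add: dK)
  show ?thesis unfolding eta_splitting_def
    by (simp add: chain_iff b biproduct_sym[OF b] complex_shift_cpx[OF X]) (simp add: dK f)
qed

text \<open>The mapping cone of \<open>\<eta>\<close>, on which \<open>\<eta>\<close> is contracted by the identity of \<open>Y(1)\<close>.\<close>

lemma eta_cone:
  assumes Y: "(Y, dY) \<in> Ob CC"
  obtains K dK i2 p1 r s g H where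
    "eta_splitting Y dY i2 K dK p1 (\<lambda>n. tw (Y (n + 1))) (\<lambda>n. mneg C (tw (Y (n + 1))) (tw (Y (n + 2))) (twm (dY (n + 1)))) r s g"
    "eta_homotopy K dK H"
proof -
  note [simp] = cpxD[OF Y] cpxD(4)[OF Y, THEN reassoc] Y
  have twY: "(\<lambda>n. tw (Y n), \<lambda>n. twm (dY n)) \<in> Ob CC"
    unfolding cpx_iff by (simp flip: twm_comp)
  obtain K i1 i2 p1 p2 where "\<forall>n. is_biproduct C (tw (Y (n + 1))) (Y n) (K n) (i1 n) (i2 n) (p1 n) (p2 n)"
    using biproduct_family[of "\<lambda>n. tw (Y (n + 1))" Y] by auto
  then have b: "\<And>n. is_biproduct C (tw (Y (n + 1))) (Y n) (K n) (i1 n) (i2 n) (p1 n) (p2 n)" by blast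
  note b' = biproductD[OF b[of "n + 1" for n], unfolded int_succ_succ]
  note b'' = biproductD[OF b[of "n + 2" for n], unfolded int_succ_succ_succ]
  note [simp] = biproductD(1-11)[OF b] biproductD(8-11)[OF b, THEN reassoc] b'(1-11) b'(8-11)[THEN reassoc]
    b''(1-11) b''(8-11)[THEN reassoc]
  define dK where "dK n = madd C (K n) (K (n + 1))
           (Comp C (K n) (tw (Y (n + 2))) (K (n + 1)) (i1 (n + 1))
              (Comp C (K n) (tw (Y (n + 1))) (tw (Y (n + 2))) (mneg C (tw (Y (n + 1))) (tw (Y (n + 2))) (twm (dY (n + 1)))) (p1 n)))
           (Comp C (K n) (Y (n + 1)) (K (n + 1)) (i2 (n + 1))
              (madd C (K n) (Y (n + 1)) (Comp C (K n) (tw (Y (n + 1))) (Y (n + 1)) (eta (Y (n + 1))) (p1 n))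
                 (Comp C (K n) (Y n) (Y (n + 1)) (dY n) (p2 n))))" for n
  have s: "eta_splitting Y dY i2 K dK p1 (\<lambda>n. tw (Y (n + 1))) (\<lambda>n. mneg C (tw (Y (n + 1))) (tw (Y (n + 2))) (twm (dY (n + 1)))) p2 i1 (\<lambda>n. Idn C (tw (Y (n + 1))))"
    by (rule cone_splitting[OF twY Y, where g = "\<lambda>n. Idn C (tw (Y n))" and f = "\<lambda>n. eta (Y n)"]) (simp_all add: dK_def b)
  note [simp] = cpxD(2,3)[OF splittingD(2)[OF s]]
  \<comment> \<open>Project the twisted cone onto the twist of \<open>Y\<close>, then include that
    as the first summand one degree lower.\<close>
  let ?H = "\<lambda>n. Comp C (tw (K (n + 1))) (tw (Y (n + 1))) (K n) (i1 n) (twm (p2 (n + 1)))"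
  have "madd C (tw (K (n + 1))) (K (n + 1)) (Comp C (tw (K (n + 1))) (K n) (K (n + 1)) (dK n) (?H n))
       (Comp C (tw (K (n + 1))) (tw (K (n + 2))) (K (n + 1)) (?H (n + 1)) (twm (dK (n + 1)))) = eta (K (n + 1))" for n
  proof -
    have p2d: "Comp C (K (n + 1)) (K (n + 2)) (Y (n + 2)) (p2 (n + 2)) (dK (n + 1)) =
      madd C (K (n + 1)) (Y (n + 2)) (Comp C (K (n + 1)) (tw (Y (n + 2))) (Y (n + 2)) (eta (Y (n + 2))) (p1 (n + 1)))
        (Comp C (K (n + 1)) (Y (n + 1)) (Y (n + 2)) (dY (n + 1)) (p2 (n + 1)))"
    proof -
      have "dK (n + 1) = madd C (K (n + 1)) (K (n + 2))
           (Comp C (K (n + 1)) (tw (Y (n + 3))) (K (n + 2)) (i1 (n + 2))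
              (Comp C (K (n + 1)) (tw (Y (n + 2))) (tw (Y (n + 3))) (mneg C (tw (Y (n + 2))) (tw (Y (n + 3))) (twm (dY (n + 2)))) (p1 (n + 1))))
           (Comp C (K (n + 1)) (Y (n + 2)) (K (n + 2)) (i2 (n + 2))
              (madd C (K (n + 1)) (Y (n + 2)) (Comp C (K (n + 1)) (tw (Y (n + 2))) (Y (n + 2)) (eta (Y (n + 2))) (p1 (n + 1)))
                 (Comp C (K (n + 1)) (Y (n + 1)) (Y (n + 2)) (dY (n + 1)) (p2 (n + 1)))))"
        using dK_def[of "n + 1"] unfolding int_succ_succ int_succ_succ_succ .
      moreover have "dY (n + 2) \<in> mor C (Y (n + 2)) (Y (n + 3))"
        using cpxD(2)[OF Y, of "n + 2"] unfolding int_succ_succ_succ .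
      ultimately show ?thesis by simp
    qed
    \<comment> \<open>Twisting this row turns its entry \<open>eta\<close> into \<open>eta\<close>
      of a twisted object, which is the value required on the first summand.\<close>
    have tp2d: "Comp C (tw (K (n + 1))) (tw (K (n + 2))) (tw (Y (n + 2))) (twm (p2 (n + 2))) (twm (dK (n + 1))) =
      madd C (tw (K (n + 1))) (tw (Y (n + 2))) (Comp C (tw (K (n + 1))) (tw (tw (Y (n + 2)))) (tw (Y (n + 2))) (eta (tw (Y (n + 2)))) (twm (p1 (n + 1))))
        (Comp C (tw (K (n + 1))) (tw (Y (n + 1))) (tw (Y (n + 2))) (twm (dY (n + 1))) (twm (p2 (n + 1))))"
      using arg_cong[OF p2d, of twm] by (simp add: eta_tw)
    have di1: "Comp C (tw (Y (n + 1))) (K n) (K (n + 1)) (dK n) (i1 n) = madd C (tw (Y (n + 1))) (K (n + 1))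
       (Comp C (tw (Y (n + 1))) (tw (Y (n + 2))) (K (n + 1)) (i1 (n + 1)) (mneg C (tw (Y (n + 1))) (tw (Y (n + 2))) (twm (dY (n + 1)))))
       (Comp C (tw (Y (n + 1))) (Y (n + 1)) (K (n + 1)) (i2 (n + 1)) (eta (Y (n + 1))))"
      by (simp add: dK_def)
    show ?thesis
      using biproduct_expand[OF b[of "n + 1", unfolded int_succ_succ], of "tw (K (n + 1))" "eta (K (n + 1))"]
      by (simp add: di1[THEN reassoc] tp2d eta_natural madd_ac)
  qed
  then have "eta_homotopy K dK ?H" unfolding eta_homotopy_def by simp
  with s show ?thesis by (rule that)
qed

theorem eta_frobenius: "frobenius_exact_structure CC eta_conflations"
proof (intro frobenius_exact_structure.intro eta_exact frobenius_exact_structure_axioms.intro)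
  fix P assume "P \<in> Ob CC"
  then obtain Y dY where P: "P = (Y, dY)" and Y: "(Y, dY) \<in> Ob CC" by (cases P) auto
  obtain K dK i2 p1 r s g H where h: "eta_splitting Y dY i2 K dK p1 (\<lambda>n. tw (Y (n + 1))) (\<lambda>n. mneg C (tw (Y (n + 1))) (tw (Y (n + 2))) (twm (dY (n + 1)))) r s g"
    and H: "eta_homotopy K dK H" using Y by (rule eta_cone)
  have "injective_object CC eta_conflations (K, dK)"
    by (rule homotopy_injective[OF H]) (rule splittingD(2)[OF h])
  then show "\<exists>J i. injective_object CC eta_conflations J \<and> inflation eta_conflations P J i"
    using eta_inflationI[OF h] P by blast
next
  have proj: "\<exists>K dK H p. projective_object CC eta_conflations (K, dK) \<and> (K, dK) \<in> Ob CC \<and> eta_homotopy K dK H \<and>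
    deflation eta_conflations (K, dK) (P, dP) p" if P: "(P, dP) \<in> Ob CC" for P dP
  proof -
    note [simp] = cpxD[OF P]
    \<comment> \<open>To obtain \<open>P\<close> as the quotient of a cone, twist and shift must be
      undone: \<open>?Y\<close> below is \<open>P\<close> untwisted and moved by one degree. Its
      differential is negated in advance, because the shift negates it again.\<close>
    have "\<exists>d\<in>mor C (itw (P n)) (itw (P (n + 1))). twm d = mneg C (P n) (P (n + 1)) (dP n)" for n
      by (rule twm_full) simp_all
    then have "\<forall>n. \<exists>d. d \<in> mor C (itw (P n)) (itw (P (n + 1))) \<and> twm d = mneg C (P n) (P (n + 1)) (dP n)" by blast
    then obtain d where d: "\<And>n. d n \<in> mor C (itw (P n)) (itw (P (n + 1)))"
      and td: "\<And>n. twm (d n) = mneg C (P n) (P (n + 1)) (dP n)" by metis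
    have d1: "d (n + 1) \<in> mor C (itw (P (n + 1))) (itw (P (n + 2)))"
      "twm (d (n + 1)) = mneg C (P (n + 1)) (P (n + 2)) (dP (n + 1))" for n
      using d[of "n + 1"] td[of "n + 1"] by simp_all
    have dd: "Comp C (itw (P n)) (itw (P (n + 1))) (itw (P (n + 2))) (d (n + 1)) (d n) = zmor C (itw (P n)) (itw (P (n + 2)))" for n
      by (rule twm_inj[of "itw (P n)" "itw (P (n + 2))"]) (simp_all add: d d1 td)
    have e: "n - 1 + 1 = n" "n - 1 + 2 = n + 1" "n + 1 - 1 = n" "n + 2 - 1 = n + 1" for n :: int by simp_all
    let ?Y = "\<lambda>n. itw (P (n - 1))" and ?d = "\<lambda>n. d (n - 1)"
    have Y: "(?Y, ?d) \<in> Ob CC"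
      unfolding cpx_iff e using d[of "n - 1" for n, unfolded e] dd[of "n - 1" for n, unfolded e] by simp
    obtain K dK i2 p1 r s g H where h: "eta_splitting ?Y ?d i2 K dK p1 (\<lambda>n. tw (?Y (n + 1))) (\<lambda>n. mneg C (tw (?Y (n + 1))) (tw (?Y (n + 2))) (twm (?d (n + 1)))) r s g"
      and H: "eta_homotopy K dK H" using Y by (rule eta_cone)
    have "(\<lambda>n. tw (?Y (n + 1))) = P" "(\<lambda>n. mneg C (tw (?Y (n + 1))) (tw (?Y (n + 2))) (twm (?d (n + 1)))) = dP"
      unfolding e by (simp_all add: td)
    then have "deflation eta_conflations (K, dK) (P, dP) p1"
      using eta_deflationI[OF h] by simp
    moreover have "projective_object CC eta_conflations (K, dK)"
      by (rule homotopy_projective[OF H]) (rule splittingD(2)[OF h])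
    ultimately show ?thesis using H splittingD(2)[OF h] by blast
  qed
  {
    fix P assume "P \<in> Ob CC"
    then show "\<exists>Q p. projective_object CC eta_conflations Q \<and> deflation eta_conflations Q P p"
      using proj by (cases P) blast
  }
  fix P
  show "projective_object CC eta_conflations P \<longleftrightarrow> injective_object CC eta_conflations P"
  proof
    assume pr: "projective_object CC eta_conflations P"
    obtain X dX where P: "P = (X, dX)" by (cases P)
    have X: "(X, dX) \<in> Ob CC" using pr by (simp add: projective_object_def P)
    obtain K dK H p where K: "(K, dK) \<in> Ob CC" and H: "eta_homotopy K dK H" and p: "deflation eta_conflations (K, dK) (X, dX) p"
      using proj[OF X] by blast
    have "p \<in> mor CC (K, dK) (X, dX)" using p by (auto elim!: eta_deflationE simp: splittingD(5))
    \<comment> \<open>Projectivity splits the deflation, so \<open>X\<close> is a retract of an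
      object on which \<open>\<eta>\<close> is null-homotopic.\<close>
    moreover obtain a where "a \<in> mor CC (X, dX) (K, dK)" "Comp CC (X, dX) (K, dK) (X, dX) p a = Idn CC (X, dX)"
      using pr p CC.id_mor[OF X] unfolding projective_object_def P by blast
    ultimately obtain H' where "eta_homotopy X dX H'" using homotopy_retract[OF H K X] by blast
    then show "injective_object CC eta_conflations P" unfolding P by (rule homotopy_injective[OF _ X])
  next
    assume inj: "injective_object CC eta_conflations P"
    obtain X dX where P: "P = (X, dX)" by (cases P)
    have X: "(X, dX) \<in> Ob CC" using inj by (simp add: injective_object_def P)
    obtain K dK i2 p1 r s g H where h: "eta_splitting X dX i2 K dK p1 (\<lambda>n. tw (X (n + 1))) (\<lambda>n. mneg C (tw (X (n + 1))) (tw (X (n + 2))) (twm (dX (n + 1)))) r s g"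
      and H: "eta_homotopy K dK H" using X by (rule eta_cone)
    obtain a where "a \<in> mor CC (K, dK) (X, dX)" "Comp CC (X, dX) (K, dK) (X, dX) a i2 = Idn CC (X, dX)"
      using inj eta_inflationI[OF h] CC.id_mor[OF X] unfolding injective_object_def P by blast
    then obtain H' where "eta_homotopy X dX H'" using homotopy_retract[OF H splittingD(2)[OF h] X splittingD(4)[OF h]] by blast
    then show "projective_object CC eta_conflations P" unfolding P by (rule homotopy_projective[OF _ X])
  qed
qed

text \<open>Once a splitting is fixed, a conflation is literally a cone sequence: biproducts may be
  realized by any object with the right maps, so \<open>Y\<close> itself serves as the cone of the
  map given by the class on the desuspension of \<open>Z\<close>.\<close>

theorem cone_conflations:
  "{s \<in> kernel_cokernel_pairs CC. \<exists>P\<in>Ob CC. \<exists>Q\<in>Ob CC. \<exists>f\<in>mor CC P Q.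
     (\<exists>g\<in>mor CC P (\<lambda>n. tw (fst Q n), \<lambda>n. twm (snd Q n)).
        f = Comp CC P (\<lambda>n. tw (fst Q n), \<lambda>n. twm (snd Q n)) Q (\<lambda>n. eta (fst Q n)) g) \<and>
     (\<exists>t\<in>cone_sequences C P Q f. seq_iso CC s t)} = eta_conflations" (is "?L = _")
proof (intro equalityI subsetI)
  fix s assume "s \<in> ?L"
  then obtain X dX Y dY f g t where s: "s \<in> kernel_cokernel_pairs CC" and X: "(X, dX) \<in> Ob CC" and Y: "(Y, dY) \<in> Ob CC"
    and g: "g \<in> mor CC (X, dX) (\<lambda>n. tw (Y n), \<lambda>n. twm (dY n))"
    and f: "f = Comp CC (X, dX) (\<lambda>n. tw (Y n), \<lambda>n. twm (dY n)) (Y, dY) (\<lambda>n. eta (Y n)) g"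
    and t: "t \<in> cone_sequences C (X, dX) (Y, dY) f" and st: "seq_iso CC s t" by auto
  obtain K dK i1 i2 p1 p2 where t': "t = ((Y, dY), i2, (K, dK), p1, complex_shift C (X, dX))"
    and b: "\<forall>n. is_biproduct C (X (n + 1)) (Y n) (K n) (i1 n) (i2 n) (p1 n) (p2 n)"
    and dK: "\<forall>n. dK n = madd C (K n) (K (n + 1))
           (Comp C (K n) (X (n + 2)) (K (n + 1)) (i1 (n + 1))
              (Comp C (K n) (X (n + 1)) (X (n + 2)) (mneg C (X (n + 1)) (X (n + 2)) (dX (n + 1))) (p1 n)))
           (Comp C (K n) (Y (n + 1)) (K (n + 1)) (i2 (n + 1))
              (madd C (K n) (Y (n + 1)) (Comp C (K n) (X (n + 1)) (Y (n + 1)) (f (n + 1)) (p1 n))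
                 (Comp C (K n) (Y n) (Y (n + 1)) (dY n) (p2 n))))"
    using t unfolding cone_sequences_def by auto
  have "eta_splitting Y dY i2 K dK p1 (\<lambda>n. X (n + 1)) (\<lambda>n. mneg C (X (n + 1)) (X (n + 2)) (dX (n + 1))) p2 i1 (\<lambda>n. g (n + 1))"
    by (rule cone_splitting[OF X Y, where f = f])
      (use chainD[OF g] b dK in \<open>simp_all add: f\<close>)
  then have te: "t \<in> eta_conflations" unfolding t' complex_shift_def eta_conflations_def by auto
  then have tk: "t \<in> kernel_cokernel_pairs CC"
    using eta_exact exact_structure.conflation_kernel_cokernel by blast
  \<comment> \<open>The isomorphism is given from \<open>s\<close> to the cone sequence, while
    closure under isomorphism is applied in the opposite direction.\<close>
  have "seq_iso CC t s"
    using s tk st by (cases s; cases t) (auto intro!: CC.seq_iso_sym dest: CC.kernel_cokernelD)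
  with te s show "s \<in> eta_conflations" by (rule eta_conflation_iso)
next
  fix s assume s: "s \<in> eta_conflations"
  then obtain X dX i Y dY p Z dZ r s' g where s': "s = ((X, dX), i, (Y, dY), p, (Z, dZ))"
    and h: "eta_splitting X dX i Y dY p Z dZ r s' g" unfolding eta_conflations_def by blast
  note [simp] = splitting_simps[OF h] splitting_eqs[OF h] splitting_eqs[OF h, THEN reassoc]
    splitting_section[OF h]
  have sk: "s \<in> kernel_cokernel_pairs CC" unfolding s' by (rule splitting_kernel_cokernel[OF h])
  have e: "n - 1 + 1 = n" "n - 1 + 2 = n + 1" "n + 1 - 1 = n" "n + 2 - 1 = n + 1" for n :: int by simp_all
  \<comment> \<open>\<open>Z\<close> lowered by one degree with negated differential, so that
    \<open>complex_shift\<close> returns \<open>Z\<close> exactly.\<close>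
  let ?W = "\<lambda>n. Z (n - 1)" and ?d = "\<lambda>n. mneg C (Z (n - 1)) (Z n) (dZ (n - 1))" and ?g = "\<lambda>n. g (n - 1)"
  let ?f = "\<lambda>n. Comp C (Z (n - 1)) (tw (X n)) (X n) (eta (X n)) (g (n - 1))"
  have [simp]: "dZ (n - 1) \<in> mor C (Z (n - 1)) (Z n)" "g (n - 1) \<in> mor C (Z (n - 1)) (tw (X n))" for n
    using splitting_simps(6,15)[OF h, of "n - 1", unfolded e] by simp_all
  have W: "(?W, ?d) \<in> Ob CC"
    unfolding cpx_iff e using splitting_eqs(3)[OF h, of "n - 1" for n, unfolded e] by simp
  have twX: "(\<lambda>n. tw (X n), \<lambda>n. twm (dX n)) \<in> Ob CC"
    unfolding cpx_iff by (simp flip: twm_comp)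
  have gd: "Comp C (Z (n - 1)) (Z n) (tw (X (n + 1))) (g n) (?d n) = Comp C (Z (n - 1)) (tw (X n)) (tw (X (n + 1))) (twm (dX n)) (g (n - 1))" for n
  proof -
    have "madd C (Z (n - 1)) (tw (X (n + 1))) (Comp C (Z (n - 1)) (tw (X n)) (tw (X (n + 1))) (twm (dX n)) (g (n - 1)))
       (Comp C (Z (n - 1)) (Z n) (tw (X (n + 1))) (g n) (dZ (n - 1))) = zmor C (Z (n - 1)) (tw (X (n + 1)))"
      using splitting_class[OF h, of "n - 1", unfolded e] .
    then have "madd C (Z (n - 1)) (tw (X (n + 1))) (Comp C (Z (n - 1)) (Z n) (tw (X (n + 1))) (g n) (dZ (n - 1)))
       (Comp C (Z (n - 1)) (tw (X n)) (tw (X (n + 1))) (twm (dX n)) (g (n - 1))) = zmor C (Z (n - 1)) (tw (X (n + 1)))"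
      by (simp add: madd_commute)
    then show ?thesis by (simp add: mneg_eqI)
  qed
  have g: "?g \<in> mor CC (?W, ?d) (\<lambda>n. tw (X n), \<lambda>n. twm (dX n))"
    unfolding chain_iff e using gd by simp
  have etaX: "(\<lambda>n. eta (X n)) \<in> mor CC (\<lambda>n. tw (X n), \<lambda>n. twm (dX n)) (X, dX)"
    unfolding chain_iff by (simp add: eta_natural)
  have f: "?f \<in> mor CC (?W, ?d) (X, dX)"
    using chain_comp[OF W twX _ g etaX] by simp
  \<comment> \<open>The matrix of \<open>dY\<close> in the chosen splitting; the double negation is
    the shift undoing the sign of \<open>?d\<close>.\<close>
  have "dY n = madd C (Y n) (Y (n + 1))
           (Comp C (Y n) (Z (n + 1)) (Y (n + 1)) (s' (n + 1))
              (Comp C (Y n) (Z n) (Z (n + 1)) (mneg C (Z n) (Z (n + 1)) (mneg C (Z n) (Z (n + 1)) (dZ n))) (p n)))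
           (Comp C (Y n) (X (n + 1)) (Y (n + 1)) (i (n + 1))
              (madd C (Y n) (X (n + 1)) (Comp C (Y n) (Z n) (X (n + 1)) (Comp C (Z n) (tw (X (n + 1))) (X (n + 1)) (eta (X (n + 1))) (g n)) (p n))
                 (Comp C (Y n) (X n) (X (n + 1)) (dX n) (r n))))" for n
    by (rule biproduct_eq_fromI[OF splittingD(6)[OF h, of n], where W = "Y (n + 1)"])
      (simp_all add: madd_ac del: splitting_eqs(6,7)[OF h] splitting_eqs(6,7)[OF h, THEN reassoc])
  then have "((X, dX), i, (Y, dY), p, complex_shift C (?W, ?d)) \<in> cone_sequences C (?W, ?d) (X, dX) ?f"
    unfolding cone_sequences_def split mem_Collect_eq e
    by (intro exI[of _ Y] exI[of _ dY] exI[of _ s'] exI[of _ i] exI[of _ p] exI[of _ r])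
      (simp add: biproduct_sym[OF splittingD(6)[OF h]])
  moreover have "complex_shift C (?W, ?d) = (Z, dZ)"
    unfolding complex_shift_def split e by simp
  ultimately have t: "s \<in> cone_sequences C (?W, ?d) (X, dX) ?f" unfolding s' by simp
  have "seq_iso CC s s"
    unfolding s' seq_iso_def split
    by (intro exI conjI, rule CC.is_iso_id, simp, rule CC.is_iso_id, simp, rule CC.is_iso_id) simp_all
  then show "s \<in> ?L"
    using sk W splittingD(1)[OF h] f g t
    by (intro CollectI conjI bexI[of _ "(?W, ?d)"] bexI[of _ "(X, dX)"] bexI[of _ ?f] bexI[of _ ?g] bexI[of _ s]) simp_all
qed

end

section \<open>The category of graded objects\<close>

context preadditive_category
begin

lemma hom_comm_monoid: "\<lbrakk>X \<in> Ob C; Y \<in> Ob C\<rbrakk> \<Longrightarrow> comm_monoid (Hom C X Y)"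
  using hom_group by (simp add: comm_group_def)

lemma msum_mor [simp]:
  "\<lbrakk>X \<in> Ob C; Y \<in> Ob C; \<And>k. k \<in> K \<Longrightarrow> f k \<in> mor C X Y\<rbrakk> \<Longrightarrow> msum C X Y f K \<in> mor C X Y"
  by (rule comm_monoid.finprod_closed[OF hom_comm_monoid]) auto

lemma msum_atMost_mor [simp]:
  "\<lbrakk>X \<in> Ob C; Y \<in> Ob C; \<And>k. k \<le> n \<Longrightarrow> f k \<in> mor C X Y\<rbrakk> \<Longrightarrow> msum C X Y f {..n} \<in> mor C X Y"
  by (rule msum_mor) auto

lemma msum_cong:
  assumes "X \<in> Ob C" "Y \<in> Ob C" "\<And>k. k \<in> K \<Longrightarrow> g k \<in> mor C X Y" "\<And>k. k \<in> K \<Longrightarrow> f k = g k"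
  shows "msum C X Y f K = msum C X Y g K"
  by (rule comm_monoid.finprod_cong'[OF hom_comm_monoid]) (use assms in auto)

lemma msum_insert:
  "\<lbrakk>X \<in> Ob C; Y \<in> Ob C; finite K; a \<notin> K; \<And>k. k \<in> insert a K \<Longrightarrow> f k \<in> mor C X Y\<rbrakk>
    \<Longrightarrow> msum C X Y f (insert a K) = madd C X Y (f a) (msum C X Y f K)"
  by (rule comm_monoid.finprod_insert[OF hom_comm_monoid]) auto

lemma msum_Suc:
  "\<lbrakk>X \<in> Ob C; Y \<in> Ob C; \<And>k. k \<le> Suc n \<Longrightarrow> f k \<in> mor C X Y\<rbrakk>
    \<Longrightarrow> msum C X Y f {..Suc n} = madd C X Y (f (Suc n)) (msum C X Y f {..n})"
  unfolding atMost_Suc by (rule msum_insert) auto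

lemma msum_empty [simp]: "\<lbrakk>X \<in> Ob C; Y \<in> Ob C\<rbrakk> \<Longrightarrow> msum C X Y f {} = zmor C X Y"
  by (rule comm_monoid.finprod_empty[OF hom_comm_monoid])

lemma msum_add:
  assumes "X \<in> Ob C" "Y \<in> Ob C" "\<And>k. k \<in> K \<Longrightarrow> f k \<in> mor C X Y" "\<And>k. k \<in> K \<Longrightarrow> g k \<in> mor C X Y"
  shows "msum C X Y (\<lambda>k. madd C X Y (f k) (g k)) K = madd C X Y (msum C X Y f K) (msum C X Y g K)"
  by (rule comm_monoid.finprod_multf[OF hom_comm_monoid]) (use assms in auto)

lemma comp_msum_right:
  assumes [simp]: "X \<in> Ob C" "Y \<in> Ob C" "Z \<in> Ob C" "g \<in> mor C Y Z" and "finite K"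
    and "\<And>k. k \<in> K \<Longrightarrow> f k \<in> mor C X Y"
  shows "Comp C X Y Z g (msum C X Y f K) = msum C X Z (\<lambda>k. Comp C X Y Z g (f k)) K"
  using assms(5,6)
proof (induction K rule: finite_induct)
  case (insert a K)
  have [simp]: "f a \<in> mor C X Y" "\<And>k. k \<in> K \<Longrightarrow> f k \<in> mor C X Y" using insert.prems by auto
  have 1: "msum C X Y f (insert a K) = madd C X Y (f a) (msum C X Y f K)"
    by (rule msum_insert) (use insert.hyps in auto)
  have 2: "msum C X Z (\<lambda>k. Comp C X Y Z g (f k)) (insert a K) = madd C X Z (Comp C X Y Z g (f a)) (msum C X Z (\<lambda>k. Comp C X Y Z g (f k)) K)"
    by (rule msum_insert) (use insert.hyps in auto)
  show ?case unfolding 1 2 using insert.IH by simp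
qed simp

lemma comp_msum_left:
  assumes [simp]: "X \<in> Ob C" "Y \<in> Ob C" "Z \<in> Ob C" "f \<in> mor C X Y" and "finite K"
    and "\<And>k. k \<in> K \<Longrightarrow> g k \<in> mor C Y Z"
  shows "Comp C X Y Z (msum C Y Z g K) f = msum C X Z (\<lambda>k. Comp C X Y Z (g k) f) K"
  using assms(5,6)
proof (induction K rule: finite_induct)
  case (insert a K)
  have [simp]: "g a \<in> mor C Y Z" "\<And>k. k \<in> K \<Longrightarrow> g k \<in> mor C Y Z" using insert.prems by auto
  have 1: "msum C Y Z g (insert a K) = madd C Y Z (g a) (msum C Y Z g K)"
    by (rule msum_insert) (use insert.hyps in auto)
  have 2: "msum C X Z (\<lambda>k. Comp C X Y Z (g k) f) (insert a K) = madd C X Z (Comp C X Y Z (g a) f) (msum C X Z (\<lambda>k. Comp C X Y Z (g k) f) K)"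
    by (rule msum_insert) (use insert.hyps in auto)
  show ?case unfolding 1 2 using insert.IH by simp
qed simp

lemma comp_msum_atMost_right:
  "\<lbrakk>X \<in> Ob C; Y \<in> Ob C; Z \<in> Ob C; g \<in> mor C Y Z; \<And>k. k \<le> n \<Longrightarrow> f k \<in> mor C X Y\<rbrakk>
    \<Longrightarrow> Comp C X Y Z g (msum C X Y f {..n}) = msum C X Z (\<lambda>k. Comp C X Y Z g (f k)) {..n}"
  by (rule comp_msum_right) auto

lemma comp_msum_atMost_left:
  "\<lbrakk>X \<in> Ob C; Y \<in> Ob C; Z \<in> Ob C; f \<in> mor C X Y; \<And>k. k \<le> n \<Longrightarrow> g k \<in> mor C Y Z\<rbrakk>
    \<Longrightarrow> Comp C X Y Z (msum C Y Z g {..n}) f = msum C X Z (\<lambda>k. Comp C X Y Z (g k) f) {..n}"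
  by (rule comp_msum_left) auto

lemma msum_zero:
  assumes "X \<in> Ob C" "Y \<in> Ob C" "\<And>k. k \<in> K \<Longrightarrow> f k = zmor C X Y"
  shows "msum C X Y f K = zmor C X Y"
  by (rule comm_monoid.finprod_one_eqI[OF hom_comm_monoid]) (use assms in auto)

text \<open>Composition in \<open>zplus\<close> is a convolution; against identities, degree-zero
  maps and \<open>\<eta>\<close> a single summand survives.\<close>

lemma msum_single:
  assumes [simp]: "X \<in> Ob C" "Y \<in> Ob C" and "finite K" "a \<in> K" "f a = b" "b \<in> mor C X Y"
    and z: "\<And>k. k \<in> K \<Longrightarrow> k \<noteq> a \<Longrightarrow> f k = zmor C X Y"
  shows "msum C X Y f K = b"
proof -
  have K: "K = insert a (K - {a})" using assms(4) by blast
  have "msum C X Y f (insert a (K - {a})) = madd C X Y (f a) (msum C X Y f (K - {a}))"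
  proof (rule msum_insert)
    fix k assume "k \<in> insert a (K - {a})"
    then show "f k \<in> mor C X Y" using z[of k] assms(5,6) by (cases "k = a") auto
  qed (use assms(3) in auto)
  moreover have "msum C X Y f (K - {a}) = zmor C X Y"
    using z by (intro msum_zero) auto
  ultimately show ?thesis using K assms(5,6) by simp
qed

lemma msum_singleton [simp]:
  "\<lbrakk>X \<in> Ob C; Y \<in> Ob C; f a \<in> mor C X Y\<rbrakk> \<Longrightarrow> msum C X Y f {a} = f a"
  by (rule msum_single[where a = a]) auto

text \<open>Pairs l \<le> k are rearranged by their difference m = k - l, which is associativity of
  convolution. Membership is assumed only on the triangle, since a summand with a truncated
  subtraction need not be a morphism.\<close>

lemma msum_triangle:
  assumes [simp]: "X \<in> Ob C" "Y \<in> Ob C" and F: "\<And>l k. l \<le> k \<Longrightarrow> k \<le> n \<Longrightarrow> F l k \<in> mor C X Y"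
  shows "msum C X Y (\<lambda>k. msum C X Y (\<lambda>l. F l k) {..k}) {..n} = msum C X Y (\<lambda>l. msum C X Y (\<lambda>m. F l (l + m)) {..n - l}) {..n}"
  using F
proof (induction n)
  case 0
  then have "F 0 0 \<in> mor C X Y" by simp
  then show ?case by simp
next
  case (Suc n)
  have [simp]: "F l k \<in> mor C X Y" if "l \<le> k" "k \<le> Suc n" for l k using Suc.prems that by simp
  have [simp]: "F l (l + m) \<in> mor C X Y" if "l \<le> n" "m \<le> n - l" for l m using Suc.prems that by simp
  have [simp]: "F l (l + m) \<in> mor C X Y" if "l \<le> Suc n" "m \<le> Suc n - l" for l m
    using Suc.prems that by simp
  \<comment> \<open>Raising the bound by one adds one term to each inner sum on the right; together
    these terms form the new column \<open>k = Suc n\<close> apart from its corner.\<close>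
  have "msum C X Y (\<lambda>m. F l (l + m)) {..Suc n - l} = madd C X Y (F l (Suc n)) (msum C X Y (\<lambda>m. F l (l + m)) {..n - l})"
    if "l \<le> n" for l
    using that by (simp add: Suc_diff_le msum_Suc)
  then have "msum C X Y (\<lambda>l. msum C X Y (\<lambda>m. F l (l + m)) {..Suc n - l}) {..n}
     = msum C X Y (\<lambda>l. madd C X Y (F l (Suc n)) (msum C X Y (\<lambda>m. F l (l + m)) {..n - l})) {..n}"
    by (intro msum_cong) auto
  also have "\<dots> = madd C X Y (msum C X Y (\<lambda>l. F l (Suc n)) {..n}) (msum C X Y (\<lambda>l. msum C X Y (\<lambda>m. F l (l + m)) {..n - l}) {..n})"
    by (rule msum_add) auto
  also have "msum C X Y (\<lambda>l. msum C X Y (\<lambda>m. F l (l + m)) {..n - l}) {..n} = msum C X Y (\<lambda>k. msum C X Y (\<lambda>l. F l k) {..k}) {..n}"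
    using Suc.prems by (intro Suc.IH[symmetric]) simp
  finally have 1: "msum C X Y (\<lambda>l. msum C X Y (\<lambda>m. F l (l + m)) {..Suc n - l}) {..n} =
    madd C X Y (msum C X Y (\<lambda>l. F l (Suc n)) {..n}) (msum C X Y (\<lambda>k. msum C X Y (\<lambda>l. F l k) {..k}) {..n})" .
  have 2: "msum C X Y (\<lambda>m. F (Suc n) (Suc n + m)) {..Suc n - Suc n} = F (Suc n) (Suc n)"
    by simp
  have "msum C X Y (\<lambda>l. msum C X Y (\<lambda>m. F l (l + m)) {..Suc n - l}) {..Suc n} =
    madd C X Y (F (Suc n) (Suc n)) (madd C X Y (msum C X Y (\<lambda>l. F l (Suc n)) {..n}) (msum C X Y (\<lambda>k. msum C X Y (\<lambda>l. F l k) {..k}) {..n}))"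
    by (subst msum_Suc) (simp_all only: 1 2, auto)
  moreover have "msum C X Y (\<lambda>k. msum C X Y (\<lambda>l. F l k) {..k}) {..Suc n} =
    madd C X Y (madd C X Y (F (Suc n) (Suc n)) (msum C X Y (\<lambda>l. F l (Suc n)) {..n})) (msum C X Y (\<lambda>k. msum C X Y (\<lambda>l. F l k) {..k}) {..n})"
    by (simp add: msum_Suc)
  ultimately show ?case by simp
qed

abbreviation "ZC \<equiv> zplus C"

lemma Ob_zplus: "X \<in> Ob ZC \<longleftrightarrow> (\<forall>j. X j \<in> Ob C)"
  by (simp add: zplus_def)

lemma mor_zplus: "f \<in> mor ZC X Y \<longleftrightarrow> (\<forall>n j. f n j \<in> mor C (X j) (Y (j + int n)))"
  by (simp add: zplus_def)

lemma madd_zplus [simp]: "madd ZC X Y f g = (\<lambda>n j. madd C (X j) (Y (j + int n)) (f n j) (g n j))"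
  by (simp add: zplus_def)

lemma zmor_zplus [simp]: "zmor ZC X Y = (\<lambda>n j. zmor C (X j) (Y (j + int n)))"
  by (simp add: zplus_def)

lemma Comp_zplus: "Comp ZC X Y Z g f = (\<lambda>n j. msum C (X j) (Z (j + int n))
        (\<lambda>k. Comp C (X j) (Y (j + int k)) (Z (j + int n)) (g (n - k) (j + int k)) (f k j)) {..n})"
  by (simp add: zplus_def)

lemma Idn_zplus: "Idn ZC X = (\<lambda>n j. if n = 0 then Idn C (X j) else zmor C (X j) (X (j + int n)))"
  by (simp add: zplus_def)

text \<open>For \<open>k \<le> n\<close> the natural subtraction is exact, so degrees
  \<open>k\<close> and \<open>n - k\<close> add up to \<open>n\<close>; the typing of convolution
  summands rests on this.\<close>

lemma zplus_mor_diff: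
  assumes "f \<in> mor ZC X Y" "k \<le> n"
  shows "f (n - k) (j + int k) \<in> mor C (X (j + int k)) (Y (j + int n))"
proof -
  have "f (n - k) (j + int k) \<in> mor C (X (j + int k)) (Y (j + int k + int (n - k)))"
    using assms(1) by (simp add: mor_zplus)
  then show ?thesis using assms(2) by simp
qed

lemma preadditive_zplus: "preadditive_category ZC"
proof (rule preadditive_category.intro)
  fix X Y assume "X \<in> Ob ZC" "Y \<in> Ob ZC"
  then have [simp]: "X j \<in> Ob C" "Y j \<in> Ob C" for j by (auto simp: Ob_zplus)
  show "comm_group (Hom ZC X Y)"
  proof (rule comm_groupI)
    fix f assume f: "f \<in> mor ZC X Y"
    then have "(\<lambda>n j. mneg C (X j) (Y (j + int n)) (f n j)) \<in> mor ZC X Y"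
      "madd ZC X Y (\<lambda>n j. mneg C (X j) (Y (j + int n)) (f n j)) f = zmor ZC X Y"
      by (simp_all add: mor_zplus)
    then show "\<exists>g\<in>mor ZC X Y. madd ZC X Y g f = zmor ZC X Y" by blast
  qed (auto simp: mor_zplus madd_ac)
next
  fix X assume "X \<in> Ob ZC"
  then show "Idn ZC X \<in> mor ZC X X" by (simp add: Ob_zplus Idn_zplus mor_zplus)
next
  fix X Y Z f g assume "X \<in> Ob ZC" "Y \<in> Ob ZC" "Z \<in> Ob ZC" and f: "f \<in> mor ZC X Y" and g: "g \<in> mor ZC Y Z"
  then have [simp]: "X j \<in> Ob C" "Y j \<in> Ob C" "Z j \<in> Ob C" for j by (auto simp: Ob_zplus)
  show "Comp ZC X Y Z g f \<in> mor ZC X Z"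
    unfolding mor_zplus Comp_zplus using f zplus_mor_diff[OF g] by (auto simp: mor_zplus)
next
  fix X Y f assume "X \<in> Ob ZC" "Y \<in> Ob ZC" and f: "f \<in> mor ZC X Y"
  then have [simp]: "X j \<in> Ob C" "Y j \<in> Ob C" for j by (auto simp: Ob_zplus)
  have [simp]: "f n j \<in> mor C (X j) (Y (j + int n))" for n j using f by (simp add: mor_zplus)
  show "Comp ZC X X Y f (Idn ZC X) = f"
  proof (intro ext)
    fix n j
    show "Comp ZC X X Y f (Idn ZC X) n j = f n j" unfolding Comp_zplus Idn_zplus
      by (rule msum_single[where a = 0]) (auto simp: zplus_mor_diff[OF f])
  qed
  show "Comp ZC X Y Y (Idn ZC Y) f = f"
  proof (intro ext)
    fix n j
    show "Comp ZC X Y Y (Idn ZC Y) f n j = f n j" unfolding Comp_zplus Idn_zplus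
      by (rule msum_single[where a = n]) auto
  qed
next
  fix W X Y Z f g h assume "W \<in> Ob ZC" "X \<in> Ob ZC" "Y \<in> Ob ZC" "Z \<in> Ob ZC"
    and f: "f \<in> mor ZC W X" and g: "g \<in> mor ZC X Y" and h: "h \<in> mor ZC Y Z"
  then have [simp]: "W j \<in> Ob C" "X j \<in> Ob C" "Y j \<in> Ob C" "Z j \<in> Ob C" for j by (auto simp: Ob_zplus)
  have [simp]: "f n j \<in> mor C (W j) (X (j + int n))" for n j using f by (simp add: mor_zplus)
  note [simp] = zplus_mor_diff[OF g] zplus_mor_diff[OF h]
  show "Comp ZC W Y Z h (Comp ZC W X Y g f) = Comp ZC W X Z (Comp ZC X Y Z h g) f"
  proof (intro ext)
    fix n j
    \<comment> \<open>The triple composite with degrees \<open>l\<close>, \<open>k - l\<close> and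
      \<open>n - k\<close>; the two bracketings add it up over the same triangle in different
      orders.\<close>
    define F where "F l k = Comp C (W j) (Y (j + int k)) (Z (j + int n)) (h (n - k) (j + int k))
       (Comp C (W j) (X (j + int l)) (Y (j + int k)) (g (k - l) (j + int l)) (f l j))" for l k
    have [simp]: "F l k \<in> mor C (W j) (Z (j + int n))" if "l \<le> k" "k \<le> n" for l k
      unfolding F_def using that by simp
    have "Comp ZC W Y Z h (Comp ZC W X Y g f) n j = msum C (W j) (Z (j + int n)) (\<lambda>k. msum C (W j) (Z (j + int n)) (\<lambda>l. F l k) {..k}) {..n}"
      unfolding Comp_zplus F_def by (rule msum_cong) (auto simp: comp_msum_atMost_right)
    also have "\<dots> = msum C (W j) (Z (j + int n)) (\<lambda>l. msum C (W j) (Z (j + int n)) (\<lambda>m. F l (l + m)) {..n - l}) {..n}"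
      by (rule msum_triangle) auto
    also have "\<dots> = Comp ZC W X Z (Comp ZC X Y Z h g) f n j"
    proof -
      have "msum C (W j) (Z (j + int n)) (\<lambda>m. F l (l + m)) {..n - l} =
         Comp C (W j) (X (j + int l)) (Z (j + int n)) (Comp ZC X Y Z h g (n - l) (j + int l)) (f l j)" if l: "l \<le> n" for l
      proof -
        have e: "j + int l + int (n - l) = j + int n" "j + int l + int m = j + int (l + m)" "n - l - m = n - (l + m)" for m
          using l by auto
        have g': "g m (j + int l) \<in> mor C (X (j + int l)) (Y (j + int (l + m)))" for m
          using g[unfolded mor_zplus, rule_format, of m "j + int l"] unfolding e .
        have h': "h (n - (l + m)) (j + int (l + m)) \<in> mor C (Y (j + int (l + m))) (Z (j + int n))" if "m \<le> n - l" for m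
          using l that by (intro zplus_mor_diff[OF h]) simp
        show ?thesis unfolding Comp_zplus F_def unfolding e(1) unfolding e(2,3)
          by (subst comp_msum_atMost_left) (auto simp: g' h' simp del: of_nat_add intro!: msum_cong)
      qed
      moreover have "Comp ZC X Y Z h g \<in> mor ZC X Z"
        unfolding mor_zplus Comp_zplus using g by (auto simp: mor_zplus)
      ultimately show ?thesis unfolding Comp_zplus[of W X Z]
        by (intro msum_cong) (auto simp: zplus_mor_diff)
    qed
    finally show "Comp ZC W Y Z h (Comp ZC W X Y g f) n j = Comp ZC W X Z (Comp ZC X Y Z h g) f n j" .
  qed
next
  fix X Y Z f f' g assume "X \<in> Ob ZC" "Y \<in> Ob ZC" "Z \<in> Ob ZC" and f: "f \<in> mor ZC X Y" "f' \<in> mor ZC X Y" and g: "g \<in> mor ZC Y Z"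
  then have [simp]: "X j \<in> Ob C" "Y j \<in> Ob C" "Z j \<in> Ob C" for j by (auto simp: Ob_zplus)
  have [simp]: "f n j \<in> mor C (X j) (Y (j + int n))" "f' n j \<in> mor C (X j) (Y (j + int n))" for n j using f by (simp_all add: mor_zplus)
  note [simp] = zplus_mor_diff[OF g]
  show "Comp ZC X Y Z g (madd ZC X Y f f') = madd ZC X Z (Comp ZC X Y Z g f) (Comp ZC X Y Z g f')"
    by (intro ext, simp only: Comp_zplus madd_zplus, subst msum_add[symmetric]) (auto intro!: msum_cong)
next
  fix X Y Z f g g' assume "X \<in> Ob ZC" "Y \<in> Ob ZC" "Z \<in> Ob ZC" and f: "f \<in> mor ZC X Y" and g: "g \<in> mor ZC Y Z" "g' \<in> mor ZC Y Z"
  then have [simp]: "X j \<in> Ob C" "Y j \<in> Ob C" "Z j \<in> Ob C" for j by (auto simp: Ob_zplus)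
  have [simp]: "f n j \<in> mor C (X j) (Y (j + int n))" for n j using f by (simp_all add: mor_zplus)
  note [simp] = zplus_mor_diff[OF g(1)] zplus_mor_diff[OF g(2)]
  show "Comp ZC X Y Z (madd ZC Y Z g g') f = madd ZC X Z (Comp ZC X Y Z g f) (Comp ZC X Y Z g' f)"
    by (intro ext, simp only: Comp_zplus madd_zplus, subst msum_add[symmetric]) (auto intro!: msum_cong)
qed

lemma Comp_zplus_degree_zero:
  assumes X: "\<And>j. X j \<in> Ob C" and Y: "\<And>j. Y j \<in> Ob C" and Z: "\<And>j. Z j \<in> Ob C"
    and g: "g \<in> mor ZC Y Z" and f: "\<And>j. f j \<in> mor C (X j) (Y j)"
  shows "Comp ZC X Y Z g (\<lambda>n j. if n = 0 then f j else zmor C (X j) (Y (j + int n)))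
    = (\<lambda>n j. Comp C (X j) (Y j) (Z (j + int n)) (g n j) (f j))"
proof (intro ext)
  fix n j
  note [simp] = X Y Z f zplus_mor_diff[OF g]
  have [simp]: "g n j \<in> mor C (Y j) (Z (j + int n))" using g by (simp add: mor_zplus)
  show "Comp ZC X Y Z g (\<lambda>n j. if n = 0 then f j else zmor C (X j) (Y (j + int n))) n j
    = Comp C (X j) (Y j) (Z (j + int n)) (g n j) (f j)"
    unfolding Comp_zplus by (rule msum_single[where a = 0]) auto
qed

end

context additive_category
begin

lemma additive_zplus: "additive_category ZC"
proof (intro additive_category.intro preadditive_zplus additive_category_axioms.intro)
  interpret ZC: preadditive_category ZC by (rule preadditive_zplus)
  obtain N where "is_zero_object C N" using ex_zero_object by auto
  then have "N \<in> Ob C" "Idn C N = zmor C N N" by (simp_all add: zero_object_Idn)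
  then have "is_zero_object ZC (\<lambda>j. N)"
    unfolding ZC.zero_object_Idn by (simp add: Ob_zplus Idn_zplus fun_eq_iff)
  then show "\<exists>N. is_zero_object ZC N" by (intro exI[of _ "\<lambda>j. N"])
next
  fix X Y assume X: "X \<in> Ob ZC" and Y: "Y \<in> Ob ZC"
  then have [simp]: "X j \<in> Ob C" "Y j \<in> Ob C" for j by (auto simp: Ob_zplus)
  obtain B i1 i2 p1 p2 where "\<forall>j. is_biproduct C (X j) (Y j) (B j) (i1 j) (i2 j) (p1 j) (p2 j)"
    using biproduct_family[of X Y] by auto
  then have b: "\<And>j. is_biproduct C (X j) (Y j) (B j) (i1 j) (i2 j) (p1 j) (p2 j)" by blast
  note [simp] = biproductD[OF b]
  \<comment> \<open>Families of base maps placed in degree zero compose objectwise, so biproducts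
    can be taken objectwise.\<close>
  let ?c = "\<lambda>P Q f n j. if n = 0 then f j else zmor C (P j) (Q (j + int n))"
  have c: "?c P Q f \<in> mor ZC P Q" if "\<And>j. P j \<in> Ob C" "\<And>j. Q j \<in> Ob C" "\<And>j. f j \<in> mor C (P j) (Q j)" for P Q f
    using that by (simp add: mor_zplus)
  have cc: "Comp ZC P Q R (?c Q R g) (?c P Q f) = ?c P R (\<lambda>j. Comp C (P j) (Q j) (R j) (g j) (f j))"
    if "\<And>j. P j \<in> Ob C" "\<And>j. Q j \<in> Ob C" "\<And>j. R j \<in> Ob C" "\<And>j. f j \<in> mor C (P j) (Q j)" "\<And>j. g j \<in> mor C (Q j) (R j)"
    for P Q R f g
    by (subst Comp_zplus_degree_zero) (use that c[of Q R g] in \<open>auto simp: fun_eq_iff\<close>)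
  have "is_biproduct ZC X Y B (?c X B i1) (?c Y B i2) (?c B X p1) (?c B Y p2)"
    unfolding is_biproduct_def
    by (intro conjI X Y c; (subst cc)?; (subst cc)?) (simp_all add: Idn_zplus Ob_zplus fun_eq_iff)
  then show "\<exists>B i1 i2 p1 p2. is_biproduct ZC X Y B i1 i2 p1 p2" by blast
qed

text \<open>\<open>\<eta>\<close> sits in degree one, so composing with it merely raises degrees by
  one. Its naturality and monicity are read off from this formula and its counterpart on the other
  side.\<close>

lemma Comp_zplus_eta_left:
  assumes X: "X \<in> Ob ZC" and Y: "Y \<in> Ob ZC" and g: "g \<in> mor ZC X (zplus_twist Y)"
  shows "Comp ZC X (zplus_twist Y) Y (zplus_eta C Y) g = (\<lambda>n j. if n = 0 then zmor C (X j) (Y j) else g (n - 1) j)"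
proof (intro ext)
  fix n j
  note [simp] = X[unfolded Ob_zplus, rule_format] Y[unfolded Ob_zplus, rule_format]
  have g' [simp]: "g n j \<in> mor C (X j) (Y (j + int n + 1))" for n j using g by (simp add: mor_zplus zplus_twist_def)
  show "Comp ZC X (zplus_twist Y) Y (zplus_eta C Y) g n j = (if n = 0 then zmor C (X j) (Y j) else g (n - 1) j)"
  proof (cases n)
    case 0
    then show ?thesis using g'[of 0 j] by (simp add: Comp_zplus zplus_eta_def zplus_twist_def)
  next
    case (Suc m)
    have [simp]: "g k j \<in> mor C (X j) (Y (1 + (j + int k)))" for k using g'[of k j] by (simp add: algebra_simps)
    show ?thesis unfolding Comp_zplus zplus_eta_def zplus_twist_def Suc
      by (rule msum_single[where a = m]) (auto simp: algebra_simps)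
  qed
qed

lemma Comp_zplus_eta_right:
  assumes X: "X \<in> Ob ZC" and Y: "Y \<in> Ob ZC" and f: "f \<in> mor ZC X Y"
  shows "Comp ZC (zplus_twist X) X Y f (zplus_eta C X) = (\<lambda>n j. if n = 0 then zmor C (X (j + 1)) (Y j) else f (n - 1) (j + 1))"
proof (intro ext)
  fix n j
  note [simp] = X[unfolded Ob_zplus, rule_format] Y[unfolded Ob_zplus, rule_format]
  have f' [simp]: "f n j \<in> mor C (X j) (Y (j + int n))" for n j using f by (simp add: mor_zplus)
  note [simp] = zplus_mor_diff[OF f]
  show "Comp ZC (zplus_twist X) X Y f (zplus_eta C X) n j = (if n = 0 then zmor C (X (j + 1)) (Y j) else f (n - 1) (j + 1))"
  proof (cases n)
    case 0
    then show ?thesis using f'[of 0 j] by (simp add: Comp_zplus zplus_eta_def zplus_twist_def)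
  next
    case (Suc m)
    have [simp]: "f m (1 + j) \<in> mor C (X (1 + j)) (Y (1 + (j + int m)))" using f'[of m "1 + j"] by (simp add: algebra_simps)
    have [simp]: "f (Suc m - k) (j + int k) \<in> mor C (X (j + int k)) (Y (1 + (j + int m)))" if "k \<le> Suc m" for k
      using zplus_mor_diff[OF f that, of j] by (simp add: algebra_simps)
    show ?thesis unfolding Comp_zplus zplus_eta_def zplus_twist_def Suc
      by (rule msum_single[where a = 1]) (auto simp: algebra_simps)
  qed
qed

lemma zplus_twisted: "twisted_category ZC zplus_twist zplus_twist_mor (\<lambda>X j. X (j - 1)) (zplus_eta C)"
proof (intro twisted_category.intro additive_zplus twisted_category_axioms.intro)
  fix X Y assume X: "X \<in> Ob ZC"
  show "zplus_twist X \<in> Ob ZC" "(\<lambda>j. X (j - 1)) \<in> Ob ZC" "zplus_twist (\<lambda>j. X (j - 1)) = X"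
    using X by (simp_all add: Ob_zplus zplus_twist_def)
  show "zplus_twist_mor (Idn ZC X) = Idn ZC (zplus_twist X)"
    by (simp add: zplus_twist_mor_def zplus_twist_def Idn_zplus fun_eq_iff algebra_simps)
  show "zplus_eta C X \<in> mor ZC (zplus_twist X) X"
    using X by (simp add: mor_zplus zplus_eta_def zplus_twist_def Ob_zplus)
  show "zplus_eta C (zplus_twist X) = zplus_twist_mor (zplus_eta C X)"
    by (simp add: zplus_eta_def zplus_twist_mor_def zplus_twist_def fun_eq_iff algebra_simps)
  assume Y: "Y \<in> Ob ZC"
  {
    fix f assume f: "f \<in> mor ZC X Y"
    show tf: "zplus_twist_mor f \<in> mor ZC (zplus_twist X) (zplus_twist Y)"
      unfolding mor_zplus zplus_twist_mor_def zplus_twist_def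
    proof (intro allI)
      fix n j
      show "f n (j + 1) \<in> mor C (X (j + 1)) (Y (j + int n + 1))"
        using f[unfolded mor_zplus, rule_format, of n "j + 1"] by (simp add: algebra_simps)
    qed
    have twX: "zplus_twist X \<in> Ob ZC" using X by (simp add: Ob_zplus zplus_twist_def)
    show "Comp ZC (zplus_twist X) (zplus_twist Y) Y (zplus_eta C Y) (zplus_twist_mor f) = Comp ZC (zplus_twist X) X Y f (zplus_eta C X)"
      unfolding Comp_zplus_eta_left[OF twX Y tf] Comp_zplus_eta_right[OF X Y f]
      unfolding zplus_twist_def zplus_twist_mor_def by (rule refl)
    fix g assume g: "g \<in> mor ZC X Y"
    show "zplus_twist_mor (madd ZC X Y f g) = madd ZC (zplus_twist X) (zplus_twist Y) (zplus_twist_mor f) (zplus_twist_mor g)"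
      by (simp add: zplus_twist_mor_def zplus_twist_def fun_eq_iff algebra_simps)
    assume "zplus_twist_mor f = zplus_twist_mor g"
    then have "f n (j - 1 + 1) = g n (j - 1 + 1)" for n j unfolding zplus_twist_mor_def fun_eq_iff by blast
    then show "f = g" by (simp add: fun_eq_iff)
  }
  {
    fix g assume g: "g \<in> mor ZC (zplus_twist X) (zplus_twist Y)"
    have "(\<lambda>n j. g n (j - 1)) \<in> mor ZC X Y" unfolding mor_zplus
    proof (intro allI)
      fix n j
      show "g n (j - 1) \<in> mor C (X j) (Y (j + int n))"
        using g[unfolded mor_zplus, rule_format, of n "j - 1"] by (simp add: zplus_twist_def)
    qed
    then show "\<exists>f\<in>mor ZC X Y. zplus_twist_mor f = g"
      by (rule bexI[rotated]) (simp add: zplus_twist_mor_def)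
  }
  {
    fix g g' assume g: "g \<in> mor ZC X (zplus_twist Y)" "g' \<in> mor ZC X (zplus_twist Y)"
      and eq: "Comp ZC X (zplus_twist Y) Y (zplus_eta C Y) g = Comp ZC X (zplus_twist Y) Y (zplus_eta C Y) g'"
    have "g n j = g' n j" for n j
      using fun_cong[OF fun_cong[OF eq[unfolded Comp_zplus_eta_left[OF X Y g(1)] Comp_zplus_eta_left[OF X Y g(2)]], of "Suc n"], of j]
      by simp
    then show "g = g'" by (simp add: fun_eq_iff)
  }
next
  fix X Y Z f g
  show "zplus_twist_mor (Comp ZC X Y Z g f) = Comp ZC (zplus_twist X) (zplus_twist Y) (zplus_twist Z) (zplus_twist_mor g) (zplus_twist_mor f)"
    by (simp add: zplus_twist_mor_def zplus_twist_def Comp_zplus fun_eq_iff algebra_simps)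
qed

lemma E_eta_frobenius: "frobenius_exact_structure (complex_category ZC) (E_eta C)"
proof -
  interpret ZC: twisted_category ZC zplus_twist zplus_twist_mor "\<lambda>X j. X (j - 1)" "zplus_eta C"
    by (rule zplus_twisted)
  have "cpx_twist Q = (\<lambda>n. zplus_twist (fst Q n), \<lambda>n. zplus_twist_mor (snd Q n))" for Q :: "('o, 'm) zcpx"
    by (simp add: cpx_twist_def split_beta)
  moreover have "cpx_eta C Q = (\<lambda>n. zplus_eta C (fst Q n))" for Q :: "('o, 'm) zcpx"
    by (simp add: cpx_eta_def split_beta)
  ultimately have "E_eta C = ZC.eta_conflations"
    unfolding E_eta_def Let_def ZC.cone_conflations[symmetric] by simp
  then show ?thesis using ZC.eta_frobenius by simp
qed

end

section \<open>Transport along a strict isomorphism\<close>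

text \<open>Bijectivity on the whole types lets every quantifier in a categorical notion be replaced
  by one over images, so that transport is plain rewriting. That \<open>\<phi>\<close> does not
  mention source and target reflects the form of \<open>Psi_mor\<close>.\<close>

locale strict_isomorphism =
  fixes C :: "('o, 'm) cat" and D :: "('p, 'n) cat" and F :: "'o \<Rightarrow> 'p" and \<phi> :: "'m \<Rightarrow> 'n"
  assumes bij_F: "bij F" and bij_\<phi>: "bij \<phi>"
    and ob_iff: "F X \<in> Ob D \<longleftrightarrow> X \<in> Ob C"
    and mor_iff: "\<phi> f \<in> mor D (F X) (F Y) \<longleftrightarrow> f \<in> mor C X Y"
    and comp_eq: "Comp D (F X) (F Y) (F Z) (\<phi> g) (\<phi> f) = \<phi> (Comp C X Y Z g f)"
    and id_eq: "Idn D (F X) = \<phi> (Idn C X)"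
    and add_eq: "madd D (F X) (F Y) (\<phi> f) (\<phi> g) = \<phi> (madd C X Y f g)"
    and zero_eq: "zmor D (F X) (F Y) = \<phi> (zmor C X Y)"
begin

lemma all_ob: "(\<forall>X. P X) \<longleftrightarrow> (\<forall>X. P (F X))"
  using bij_F by (metis bij_pointE)

lemma ex_ob: "(\<exists>X. P X) \<longleftrightarrow> (\<exists>X. P (F X))"
  using bij_F by (metis bij_pointE)

lemma all_mor: "(\<forall>f. P f) \<longleftrightarrow> (\<forall>f. P (\<phi> f))"
  using bij_\<phi> by (metis bij_pointE)

lemma ex_mor: "(\<exists>f. P f) \<longleftrightarrow> (\<exists>f. P (\<phi> f))"
  using bij_\<phi> by (metis bij_pointE)

lemma eq_mor: "\<phi> f = \<phi> g \<longleftrightarrow> f = g"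
  using bij_\<phi> by (simp add: bij_is_inj inj_eq)

lemmas transport = Ball_def Bex_def Ex1_def all_ob ex_ob all_mor ex_mor ob_iff mor_iff comp_eq id_eq add_eq zero_eq eq_mor

lemma transport_biproduct:
  "is_biproduct D (F X) (F Y) (F B) (\<phi> i1) (\<phi> i2) (\<phi> p1) (\<phi> p2) \<longleftrightarrow> is_biproduct C X Y B i1 i2 p1 p2"
  unfolding is_biproduct_def transport ..

lemma transport_zero_object: "is_zero_object D (F N) \<longleftrightarrow> is_zero_object C N"
  unfolding is_zero_object_def transport ..

lemma transport_iso: "is_iso D (F X) (F Y) (\<phi> f) \<longleftrightarrow> is_iso C X Y f"
  unfolding is_iso_def transport ..

lemma transport_kernel_cokernel:
  "(F X, \<phi> i, F Y, \<phi> p, F Z) \<in> kernel_cokernel_pairs D \<longleftrightarrow> (X, i, Y, p, Z) \<in> kernel_cokernel_pairs C"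
  unfolding kernel_cokernel_pairs_def is_kernel_def is_cokernel_def mem_Collect_eq split transport ..

lemma transport_seq_iso:
  "seq_iso D (F X, \<phi> i, F Y, \<phi> p, F Z) (F X', \<phi> i', F Y', \<phi> p', F Z') \<longleftrightarrow> seq_iso C (X, i, Y, p, Z) (X', i', Y', p', Z')"
  unfolding seq_iso_def split transport transport_iso ..

lemma transport_pushout:
  "is_pushout D (F X) (F Y) (F X') (F P) (\<phi> i) (\<phi> f) (\<phi> f') (\<phi> i') \<longleftrightarrow> is_pushout C X Y X' P i f f' i'"
  unfolding is_pushout_def transport ..

lemma transport_pullback:
  "is_pullback D (F Y) (F Z) (F Z') (F P) (\<phi> p) (\<phi> f) (\<phi> f') (\<phi> p') \<longleftrightarrow> is_pullback C Y Z Z' P p f f' p'"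
  unfolding is_pullback_def transport ..

lemma preadditive_transport:
  assumes "preadditive_category D" shows "preadditive_category C"
proof -
  interpret D: preadditive_category D by fact
  show ?thesis
  proof (rule preadditive_category.intro)
    fix X Y assume "X \<in> Ob C" "Y \<in> Ob C"
    then have [simp]: "F X \<in> Ob D" "F Y \<in> Ob D" by (simp_all add: ob_iff)
    note \<phi> = mor_iff[THEN iffD2]
    show "comm_group (Hom C X Y)"
    proof (rule comm_groupI)
      show "zmor C X Y \<in> mor C X Y" by (simp flip: mor_iff zero_eq)
    next
      fix f assume f: "f \<in> mor C X Y"
      note [simp] = \<phi>[OF f]
      show "madd C X Y (zmor C X Y) f = f" by (simp flip: eq_mor add_eq zero_eq)
      \<comment> \<open>Negation is not among the transported operations; the inverse is the
        preimage of the one in \<open>D\<close>.\<close>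
      obtain g where g: "\<phi> g = mneg D (F X) (F Y) (\<phi> f)" using bij_\<phi> by (metis bij_pointE)
      have "\<phi> g \<in> mor D (F X) (F Y)" unfolding g by simp
      then have "g \<in> mor C X Y" unfolding mor_iff .
      moreover have "\<phi> (madd C X Y g f) = \<phi> (zmor C X Y)" unfolding add_eq[symmetric] zero_eq[symmetric] g by simp
      then have "madd C X Y g f = zmor C X Y" unfolding eq_mor .
      ultimately show "\<exists>g\<in>mor C X Y. madd C X Y g f = zmor C X Y" by blast
      fix g assume g: "g \<in> mor C X Y"
      note [simp] = \<phi>[OF g]
      show "madd C X Y f g \<in> mor C X Y" by (simp flip: mor_iff add_eq)
      show "madd C X Y f g = madd C X Y g f" by (simp add: D.madd_commute flip: eq_mor add_eq)
      fix h assume h: "h \<in> mor C X Y"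
      note [simp] = \<phi>[OF h]
      show "madd C X Y (madd C X Y f g) h = madd C X Y f (madd C X Y g h)" by (simp flip: eq_mor add_eq)
    qed
  qed (simp_all flip: eq_mor mor_iff ob_iff comp_eq id_eq add_eq)
qed

lemma additive_transport:
  assumes "additive_category D" shows "additive_category C"
proof (intro additive_category.intro preadditive_transport additive_category_axioms.intro)
  interpret D: additive_category D by fact
  show "preadditive_category D" by (rule D.preadditive_category_axioms)
  show "\<exists>N. is_zero_object C N"
    using D.ex_zero_object unfolding ex_ob transport_zero_object .
  fix X Y assume "X \<in> Ob C" "Y \<in> Ob C"
  then have "\<exists>B i1 i2 p1 p2. is_biproduct D (F X) (F Y) B i1 i2 p1 p2"
    by (intro D.ex_biproduct) (simp_all add: ob_iff)
  then show "\<exists>B i1 i2 p1 p2. is_biproduct C X Y B i1 i2 p1 p2"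
    unfolding ex_ob ex_mor transport_biproduct .
qed

lemma strict_category_isomorphism:
  assumes D: "preadditive_category D"
  shows "category_isomorphism C D F (\<lambda>X Y. \<phi>)"
proof -
  interpret D: preadditive_category D by fact
  interpret C: preadditive_category C by (rule preadditive_transport[OF D])
  have F: "F (inv_into UNIV F X) = X" "inv_into UNIV F (F Y) = Y" for X Y
    using bij_F by (simp_all add: bij_is_surj surj_f_inv_f bij_is_inj)
  have \<phi>: "\<phi> (inv_into UNIV \<phi> f) = f" "inv_into UNIV \<phi> (\<phi> g) = g" for f g
    using bij_\<phi> by (simp_all add: bij_is_surj surj_f_inv_f bij_is_inj)
  have 1: "additive_functor C D F (\<lambda>X Y. \<phi>)"
    by unfold_locales (simp_all add: ob_iff mor_iff comp_eq id_eq add_eq)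
  have 2: "additive_functor D C (inv_into UNIV F) (\<lambda>X Y. inv_into UNIV \<phi>)"
    by unfold_locales (simp_all add: F \<phi> flip: eq_mor ob_iff mor_iff comp_eq id_eq add_eq)
  show ?thesis unfolding category_isomorphism_def
    by (intro conjI 1 exI[of _ "inv_into UNIV F"] exI[of _ "\<lambda>X Y. inv_into UNIV \<phi>"] 2) (simp_all add: F \<phi>)
qed

context
  fixes E E'
  assumes E': "\<And>X i Y p Z. (X, i, Y, p, Z) \<in> E' \<longleftrightarrow> (F X, \<phi> i, F Y, \<phi> p, F Z) \<in> E"
begin

lemma transport_inflation: "inflation E (F X) (F Y) (\<phi> i) \<longleftrightarrow> inflation E' X Y i"
  unfolding inflation_def ex_ob ex_mor E' ..

lemma transport_deflation: "deflation E (F Y) (F Z) (\<phi> p) \<longleftrightarrow> deflation E' Y Z p"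
  unfolding deflation_def ex_ob ex_mor E' ..

lemma transport_injective: "injective_object D E (F X) \<longleftrightarrow> injective_object C E' X"
  unfolding injective_object_def transport transport_inflation ..

lemma transport_projective: "projective_object D E (F X) \<longleftrightarrow> projective_object C E' X"
  unfolding projective_object_def transport transport_deflation ..

lemma exact_transport:
  assumes "exact_structure D E" shows "exact_structure C E'"
proof -
  interpret D: exact_structure D E by fact
  show ?thesis
  proof (intro exact_structure.intro additive_transport exact_structure_axioms.intro)
    show "additive_category D" by (rule D.additive_category_axioms)
    show "E' \<subseteq> kernel_cokernel_pairs C"
    proof
      fix s assume s: "s \<in> E'"
      obtain X i Y p Z where s': "s = (X, i, Y, p, Z)" by (cases s) auto
      have "(F X, \<phi> i, F Y, \<phi> p, F Z) \<in> kernel_cokernel_pairs D"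
        using s D.conflation_kernel_cokernel unfolding s' E' by blast
      then show "s \<in> kernel_cokernel_pairs C" unfolding s' transport_kernel_cokernel .
    qed
  next
    fix s t assume s: "s \<in> E'" "t \<in> kernel_cokernel_pairs C" "seq_iso C s t"
    obtain X i Y p Z where s': "s = (X, i, Y, p, Z)" by (cases s) auto
    obtain X' i' Y' p' Z' where t': "t = (X', i', Y', p', Z')" by (cases t) auto
    show "t \<in> E'" unfolding t' E'
      by (rule D.conflation_iso[of "(F X, \<phi> i, F Y, \<phi> p, F Z)"])
        (use s in \<open>simp_all add: s' t' E' transport_kernel_cokernel transport_seq_iso\<close>)
  next
    fix X Y Z i j assume "inflation E' X Y i" "inflation E' Y Z j"
    then show "inflation E' X Z (Comp C X Y Z j i)"
      unfolding transport_inflation[symmetric] comp_eq[symmetric] by (rule D.inflation_comp)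
  next
    fix X Y Z i j assume "deflation E' X Y i" "deflation E' Y Z j"
    then show "deflation E' X Z (Comp C X Y Z j i)"
      unfolding transport_deflation[symmetric] comp_eq[symmetric] by (rule D.deflation_comp)
  next
    fix X Y i X' f assume "inflation E' X Y i" "X' \<in> Ob C" "f \<in> mor C X X'"
    then have "\<exists>P f' i'. is_pushout D (F X) (F Y) (F X') P (\<phi> i) (\<phi> f) f' i' \<and> inflation E (F X') P i'"
      by (intro D.inflation_pushout) (simp_all add: transport_inflation ob_iff mor_iff)
    then show "\<exists>P f' i'. is_pushout C X Y X' P i f f' i' \<and> inflation E' X' P i'"
      unfolding ex_ob ex_mor transport_pushout transport_inflation .
  next
    fix Y Z p Z' f assume "deflation E' Y Z p" "Z' \<in> Ob C" "f \<in> mor C Z' Z"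
    then have "\<exists>P f' p'. is_pullback D (F Y) (F Z) (F Z') P (\<phi> p) (\<phi> f) f' p' \<and> deflation E P (F Z') p'"
      by (intro D.deflation_pullback) (simp_all add: transport_deflation ob_iff mor_iff)
    then show "\<exists>P f' p'. is_pullback C Y Z Z' P p f f' p' \<and> deflation E' P Z' p'"
      unfolding ex_ob ex_mor transport_pullback transport_deflation .
  qed (auto simp: D.inflation_id D.deflation_id ob_iff simp flip: transport_inflation transport_deflation id_eq)
qed

lemma frobenius_transport:
  assumes "frobenius_exact_structure D E" shows "frobenius_exact_structure C E'"
proof -
  interpret D: frobenius_exact_structure D E by fact
  show ?thesis
  proof (intro frobenius_exact_structure.intro exact_transport frobenius_exact_structure_axioms.intro)
    show "exact_structure D E" by (rule D.exact_structure_axioms)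
  next
    fix X assume "X \<in> Ob C"
    then have X: "F X \<in> Ob D" by (simp add: ob_iff)
    show "\<exists>J i. injective_object C E' J \<and> inflation E' X J i"
      using D.enough_injectives[OF X] unfolding ex_ob ex_mor transport_injective transport_inflation .
    show "\<exists>P p. projective_object C E' P \<and> deflation E' P X p"
      using D.enough_projectives[OF X] unfolding ex_ob ex_mor transport_projective transport_deflation .
  next
    fix X show "projective_object C E' X \<longleftrightarrow> injective_object C E' X"
      using D.projective_iff_injective unfolding transport_projective[symmetric] transport_injective[symmetric] .
  qed
qed

end

end

section \<open>Rickard's category\<close>

text \<open>\<open>\<Psi>\<close> replaces the first index by the total degree; conditions on the
  two sides differ by this bijective substitution.\<close>

lemma all_reindex: "(\<forall>n i j. P n i j) \<longleftrightarrow> (\<forall>i n j. P n (i - j) j)" for P :: "nat \<Rightarrow> int \<Rightarrow> int \<Rightarrow> bool"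
  by (metis add_diff_cancel)

lemma all_reindex_ob: "(\<forall>i j. P i j) \<longleftrightarrow> (\<forall>i j. P (i - j) j)" for P :: "int \<Rightarrow> int \<Rightarrow> bool"
  by (metis add_diff_cancel)

lemma index_shift:
  "i - (j + int q) = i - j - int q" "i + 1 - j = i - j + 1" "i + 2 - j = i - j + 2"
  for i j :: int
  by simp_all

lemma bij_Psi_ob: "bij Psi_ob"
  by (rule bij_betw_byWitness[where f' = "\<lambda>(X, d). (\<lambda>i j. X (i + j) j, \<lambda>n i j. d (i + j) n j)"])
    (auto simp: Psi_ob_def)

lemma bij_Psi_mor: "bij Psi_mor"
  by (rule bij_betw_byWitness[where f' = "\<lambda>\<beta> n i j. \<beta> (i + j) n j"]) (auto simp: Psi_mor_def)

context additive_category
begin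

text \<open>A map of degree \<open>(1 - n, n)\<close> raises the total degree by one and
  \<open>j\<close> by \<open>n\<close>. After reindexing, typing and the relation on the
  differentials match clause by clause.\<close>

lemma Psi_ob_iff: "Psi_ob P \<in> Ob (complex_category ZC) \<longleftrightarrow> P \<in> Ob (G_category C)"
proof (cases P)
  case (Pair X d)
  have 1: "(\<forall>i j. X i j \<in> Ob C) \<longleftrightarrow> (\<forall>i. (\<lambda>j. X (i - j) j) \<in> Ob ZC)"
    unfolding Ob_zplus by (rule all_reindex_ob)
  have 2: "(\<forall>n i j. d n i j \<in> mor C (X i j) (X (i + 1 - int n) (j + int n))) \<longleftrightarrow>
    (\<forall>i. (\<lambda>n j. d n (i - j) j) \<in> mor ZC (\<lambda>j. X (i - j) j) (\<lambda>j. X (i + 1 - j) j))"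
    unfolding mor_zplus index_shift by (rule all_reindex)
  have 3: "(\<forall>n i j. msum C (X i j) (X (i + 2 - int n) (j + int n))
           (\<lambda>q. Comp C (X i j) (X (i + 1 - int q) (j + int q)) (X (i + 2 - int n) (j + int n))
              (d (n - q) (i + 1 - int q) (j + int q)) (d q i j)) {..n}
           = zmor C (X i j) (X (i + 2 - int n) (j + int n))) \<longleftrightarrow>
     (\<forall>i. Comp ZC (\<lambda>j. X (i - j) j) (\<lambda>j. X (i + 1 - j) j) (\<lambda>j. X (i + 2 - j) j) (\<lambda>n j. d n (i + 1 - j) j) (\<lambda>n j. d n (i - j) j)
        = zmor ZC (\<lambda>j. X (i - j) j) (\<lambda>j. X (i + 2 - j) j))"
    unfolding Comp_zplus zmor_zplus fun_eq_iff index_shift by (rule all_reindex)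
  show ?thesis
    unfolding Pair Psi_ob_def split cpx_iff G_category_def using 1 2 3
    by (simp add: complex_category_def)
qed

lemma Psi_mor_iff:
  "Psi_mor \<alpha> \<in> mor (complex_category ZC) (Psi_ob P) (Psi_ob Q) \<longleftrightarrow> \<alpha> \<in> mor (G_category C) P Q"
proof (cases P; cases Q)
  fix X dX Y dY assume P: "P = (X, dX)" and Q: "Q = (Y, dY)"
  have 1: "(\<forall>n i j. \<alpha> n i j \<in> mor C (X i j) (Y (i - int n) (j + int n))) \<longleftrightarrow>
    (\<forall>i. (\<lambda>n j. \<alpha> n (i - j) j) \<in> mor ZC (\<lambda>j. X (i - j) j) (\<lambda>j. Y (i - j) j))"
    unfolding mor_zplus index_shift by (rule all_reindex)
  have 2: "(\<forall>n i j. msum C (X i j) (Y (i + 1 - int n) (j + int n))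
               (\<lambda>q. Comp C (X i j) (X (i + 1 - int q) (j + int q)) (Y (i + 1 - int n) (j + int n))
                  (\<alpha> (n - q) (i + 1 - int q) (j + int q)) (dX q i j)) {..n}
           = msum C (X i j) (Y (i + 1 - int n) (j + int n))
               (\<lambda>q. Comp C (X i j) (Y (i - int q) (j + int q)) (Y (i + 1 - int n) (j + int n))
                  (dY (n - q) (i - int q) (j + int q)) (\<alpha> q i j)) {..n}) \<longleftrightarrow>
     (\<forall>i. Comp ZC (\<lambda>j. X (i - j) j) (\<lambda>j. X (i + 1 - j) j) (\<lambda>j. Y (i + 1 - j) j) (\<lambda>n j. \<alpha> n (i + 1 - j) j) (\<lambda>n j. dX n (i - j) j)
        = Comp ZC (\<lambda>j. X (i - j) j) (\<lambda>j. Y (i - j) j) (\<lambda>j. Y (i + 1 - j) j) (\<lambda>n j. dY n (i - j) j) (\<lambda>n j. \<alpha> n (i - j) j))"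
    unfolding Comp_zplus fun_eq_iff index_shift by (rule all_reindex)
  show ?thesis
    unfolding P Q Psi_ob_def Psi_mor_def split G_category_def using 1 2
    by (simp add: complex_category_def)
qed

lemma Psi_strict: "strict_isomorphism (G_category C) (complex_category ZC) Psi_ob Psi_mor"
proof
  fix P Q R f g
  show "Comp (complex_category ZC) (Psi_ob P) (Psi_ob Q) (Psi_ob R) (Psi_mor g) (Psi_mor f) = Psi_mor (Comp (G_category C) P Q R g f)"
    by (cases P; cases Q; cases R)
      (simp add: complex_category_def Psi_ob_def Psi_mor_def G_category_def Comp_zplus index_shift)
  show "Idn (complex_category ZC) (Psi_ob P) = Psi_mor (Idn (G_category C) P)"
    by (cases P) (simp add: complex_category_def Psi_ob_def Psi_mor_def G_category_def Idn_zplus index_shift fun_eq_iff)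
  show "madd (complex_category ZC) (Psi_ob P) (Psi_ob Q) (Psi_mor f) (Psi_mor g) = Psi_mor (madd (G_category C) P Q f g)"
    by (cases P; cases Q) (simp add: complex_category_def Psi_ob_def Psi_mor_def G_category_def index_shift fun_eq_iff)
  show "zmor (complex_category ZC) (Psi_ob P) (Psi_ob Q) = Psi_mor (zmor (G_category C) P Q)"
    by (cases P; cases Q) (simp add: complex_category_def Psi_ob_def Psi_mor_def G_category_def index_shift fun_eq_iff)
qed (rule bij_Psi_ob bij_Psi_mor Psi_ob_iff Psi_mor_iff)+

end

theorem mainTheorem4:
  fixes A :: "('o, 'm) cat"
  assumes "additive_category A"
  shows "category_isomorphism (G_category A) (complex_category (zplus A)) Psi_ob (\<lambda>X Y. Psi_mor) \<and>
    exact_structure (complex_category (zplus A)) (E_eta A) \<and>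
    frobenius_exact_structure (G_category A) (G_conflations A) \<and>
    (\<forall>\<iota> J \<pi> S. cosyzygy_choice (G_category A) (G_conflations A) \<iota> J \<pi> S \<longrightarrow>
       triangulated_category (stable_category (G_category A) (G_conflations A)) S
         (stable_shift (G_category A) (G_conflations A) \<iota> J \<pi> S)
         (stable_triangles (G_category A) (G_conflations A) \<iota> J \<pi> S))"
proof -
  interpret A: additive_category A by fact
  interpret Psi: strict_isomorphism "G_category A" "complex_category (zplus A)" Psi_ob Psi_mor
    by (rule A.Psi_strict)
  interpret CZ: frobenius_exact_structure "complex_category (zplus A)" "E_eta A"
    by (rule A.E_eta_frobenius)
  \<comment> \<open>The typing clauses of \<open>G_conflations\<close> follow from membership in
    \<open>E_eta\<close>, which consists of kernel-cokernel pairs; so the class is exactly the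
    preimage under \<open>\<Psi>\<close>.\<close>
  have "(X, i, Y, p, Z) \<in> G_conflations A \<longleftrightarrow> (Psi_ob X, Psi_mor i, Psi_ob Y, Psi_mor p, Psi_ob Z) \<in> E_eta A" for X i Y p Z
    using CZ.conflationD(1-5)[of "Psi_ob X" "Psi_mor i" "Psi_ob Y" "Psi_mor p" "Psi_ob Z"]
    by (auto simp: G_conflations_def Psi.ob_iff Psi.mor_iff)
  then have G: "frobenius_exact_structure (G_category A) (G_conflations A)"
    by (rule Psi.frobenius_transport) (rule A.E_eta_frobenius)
  show ?thesis
  proof (intro conjI allI impI)
    show "category_isomorphism (G_category A) (complex_category (zplus A)) Psi_ob (\<lambda>X Y. Psi_mor)"
      by (rule Psi.strict_category_isomorphism) (rule CZ.preadditive_category_axioms)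
    show "exact_structure (complex_category (zplus A)) (E_eta A)" by (rule CZ.exact_structure_axioms)
    show "frobenius_exact_structure (G_category A) (G_conflations A)" by (rule G)
  next
    fix \<iota> J \<pi> S assume "cosyzygy_choice (G_category A) (G_conflations A) \<iota> J \<pi> S"
    then show "triangulated_category (stable_category (G_category A) (G_conflations A)) S
         (stable_shift (G_category A) (G_conflations A) \<iota> J \<pi> S)
         (stable_triangles (G_category A) (G_conflations A) \<iota> J \<pi> S)"
      by (intro cosyzygy.stable_triangulated cosyzygy.intro cosyzygy_axioms.intro G)
  qed
qed

end
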